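(* Let $k\ge1$ and $r\ge1$ be integers. Suppose that the rational functions $\sigma,p_1,\dots,p_m$ and the nodes $c_1,\dots,c_m$ satisfy the following four conditions. (i) $|\sigma(\lambda)|<1$ and $|p_i(\lambda)|\le c$ for all $i=1,\dots,m$, uniformly in $\tau$ and $\lambda>0$; moreover the numerator of each $p_i$ is of lower degree than its denominator. (ii) The scheme is accurate of order $k$: $\sigma(\lambda)=e^{-\lambda}+O(\lambda^{k+1})$ as $\lambda\to0$, and for $0\le j\le k$, $\sum_{i=1}^mc_i^jp_i(\lambda)-\frac{j!}{(-\lambda)^{j+1}}\big(e^{-\lambda}-\sum_{\ell=0}^j\frac{(-\lambda)^\ell}{\ell!}\big)=O(\lambda^{k-j})$ as $\lambda\to0$. (iii) The scheme is strictly accurate of order $k$: $\sum_{i=1}^mc_i^jp_i(\lambda)-\frac{j!}{(-\lambda)^{j+1}}\big(\sigma(\lambda)-\sum_{\ell=0}^j\frac{(-\lambda)^\ell}{\ell!}\big)=0$ for all $0\le j\le k-1$. (iv) $|\sigma(\lambda)|\to0$ as $\lambda\to\infty$. Assume that $|u_0|\le\alpha$ and that the maximum principle $|u(x,t)|\le\alpha$ for all $(x,t)\in\Omega\times(0,T]$ holds, and assume that the starting values $u_h^l\in S_h^r$, $l=0,\dots,k-1$, are given and $$|u_h^l(x_j)|\le\alpha,\quad j=0,\dots,Mr,\quad l=0,\dots,k-1.$$ Then the fully discrete solution $u_h^n$ of the cut-off scheme described in the context satisfies $$|u_h^n(x_j)|\le\alpha,\quad j=0,\dots,Mr,\quad n=k,\dots,N,$$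 and for $n=k,\dots,N$ $$\|u(t_n)-u_h^n\|_{L^2(\Omega)}\le C(\tau^k+h^{r+1})+C\sum_{l=0}^{k-1}\|u(t_l)-u_h^l\|_{L^2(\Omega)},$$ provided that $u\in C^{k+1}([0,T];C(\bar\Omega))\cap C^k([0,T];\mathrm{Dom}(\Delta))\cap C^1([0,T];H^{2r+2}(\Omega))$, $f$ is locally Lipschitz continuous, and $f(u)\in C^k([0,T];L^2(\Omega))\cap C([0,T];H^{2r+2}(\Omega))$. Here $C$ is a constant independent of $\tau$ and $h$.
   Context: Allen--Cahn equation: $\Omega=[a,b]$, $T>0$, and $u$ solves $u_t=\Delta u+f(u)$ in $\Omega\times(0,T)$, $u(\cdot,0)=u_0$ in $\Omega$, with homogeneous Neumann condition $\partial_{\mathbf n}u=0$ on $\partial\Omega\times(0,T)$, where $f=-F'$ and $F$ is a double-well potential with two wells at $\pm\alpha$, $\alpha>0$ known. $\mathrm{Dom}(\Delta)$ is the domain of the Neumann Laplacian in $L^2(\Omega)$. Space discretization: $a=x_0<x_1<\dots<x_{Mr}=b$ with uniform mesh size $h=x_{ir}-x_{(i-1)r}=(b-a)/M$, and $I_i=[x_{(i-1)r},x_{ir}]$. $S_h^r=\{v\in H^1(\Omega):v|_{I_i}\in P_r,\ i=1,\dots,M\}$, with $P_r$ the polynomials of degree $\le r$. For each $i$, $x_{(i-1)r+j}$ and $\omega_j$, $j=0,\dots,r$, are the points and weights of the $(r+1)$-point Gauss--Lobatto quadrature on $I_i$, and $(f,g)_h=\sum_{i=1}^M\sum_{j=0}^r\omega_jf(x_{(i-1)r+j})g(x_{(i-1)r+j})$.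 $\Pi_h:C(\overline\Omega)\to S_h^r$ is Lagrange interpolation at the nodes $x_0,\dots,x_{Mr}$. The discrete Laplacian $-\Delta_h:S_h^r\to S_h^r$ is defined by $(-\Delta_hv_h,w_h)_h=(\nabla v_h,\nabla w_h)$ for all $v_h,w_h\in S_h^r$, with $(\cdot,\cdot)$ the $L^2(\Omega)$ inner product. Functions of $-\tau\Delta_h$ are defined spectrally. Time discretization: $\tau=T/N$, $t_n=n\tau$. For given $n\ge k$, $L_j$, $j=1,\dots,k$, are the Lagrange basis polynomials of degree $k-1$ in time with $L_j(t_{n-i})=\delta_{ij}$. $\sigma(\lambda)$, $p_1(\lambda),\dots,p_m(\lambda)$ are rational functions, $c_1,\dots,c_m$ are distinct real numbers in $[0,1]$, $t_{ni}=t_{n-1}+c_i\tau$. Cut-off scheme: for $n\ge k$, given $u_h^{n-k},\dots,u_h^{n-1}\in S_h^r$, $$\hat u_h^n=\sigma(-\tau\Delta_h)u_h^{n-1}+\tau\sum_{i=1}^mp_i(-\tau\Delta_h)\Big(\sum_{j=1}^kL_j(t_{ni})\Pi_hf(u_h^{n-j})\Big),$$ and $u_h^n\in S_h^r$ is defined by $u_h^n(x_j)=\min(\max(\hat u_h^n(x_j),-\alpha),\alpha)$, $j=0,\dots,Mr$. *)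

theory Defs
  imports
    "HOL-Analysis.Analysis"
    "HOL-Library.Landau_Symbols"
    "HOL-Computational_Algebra.Polynomial_Factorial"
    "HOL-Computational_Algebra.Field_as_Ring"
begin

section \<open>Function spaces on the interval \<open>[a, b]\<close>\<close>

text \<open>
  Elements of the spaces below are functions \<open>real \<Rightarrow> real\<close>; only their values on \<open>[a, b]\<close> matter.
\<close>

definition L2_space :: "real \<Rightarrow> real \<Rightarrow> (real \<Rightarrow> real) set" where
  "L2_space a b = {v \<in> borel_measurable (lebesgue_on {a..b}).
     integrable (lebesgue_on {a..b}) (\<lambda>x. (v x)\<^sup>2)}"

definition L2_inner :: "real \<Rightarrow> real \<Rightarrow> (real \<Rightarrow> real) \<Rightarrow> (real \<Rightarrow> real) \<Rightarrow> real" where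
  "L2_inner a b v w = (LINT x|lebesgue_on {a..b}. v x * w x)"

definition L2_norm :: "real \<Rightarrow> real \<Rightarrow> (real \<Rightarrow> real) \<Rightarrow> real" where
  "L2_norm a b v = sqrt (L2_inner a b v v)"

definition test_function :: "real \<Rightarrow> real \<Rightarrow> (real \<Rightarrow> real) \<Rightarrow> bool" where
  "test_function a b \<phi> \<longleftrightarrow>
     (\<forall>n x. (deriv ^^ n) \<phi> differentiable (at x)) \<and>
     (\<exists>a' b'. a < a' \<and> b' < b \<and> (\<forall>x. x \<notin> {a'..b'} \<longrightarrow> \<phi> x = 0))"

definition has_weak_deriv ::
  "real \<Rightarrow> real \<Rightarrow> nat \<Rightarrow> (real \<Rightarrow> real) \<Rightarrow> (real \<Rightarrow> real) \<Rightarrow> bool" where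
  "has_weak_deriv a b n v w \<longleftrightarrow> v \<in> L2_space a b \<and> w \<in> L2_space a b \<and>
     (\<forall>\<phi>. test_function a b \<phi> \<longrightarrow>
        L2_inner a b v ((deriv ^^ n) \<phi>) = (- 1) ^ n * L2_inner a b w \<phi>)"

text \<open>
  Weak derivatives are unique up to null sets. The choice of representative does not affect the
  integrals in which the following constant is used.
\<close>

definition weak_deriv :: "real \<Rightarrow> real \<Rightarrow> nat \<Rightarrow> (real \<Rightarrow> real) \<Rightarrow> real \<Rightarrow> real" where
  "weak_deriv a b n v = (SOME w. has_weak_deriv a b n v w)"

definition H_space :: "real \<Rightarrow> real \<Rightarrow> nat \<Rightarrow> (real \<Rightarrow> real) set" where
  "H_space a b n = {v \<in> L2_space a b. \<forall>i\<le>n. \<exists>w. has_weak_deriv a b i v w}"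

definition H_norm :: "real \<Rightarrow> real \<Rightarrow> nat \<Rightarrow> (real \<Rightarrow> real) \<Rightarrow> real" where
  "H_norm a b n v = sqrt (\<Sum>i\<le>n. (L2_norm a b (weak_deriv a b i v))\<^sup>2)"

definition C_space :: "real \<Rightarrow> real \<Rightarrow> (real \<Rightarrow> real) set" where
  "C_space a b = {v. continuous_on {a..b} v}"

definition C_norm :: "real \<Rightarrow> real \<Rightarrow> (real \<Rightarrow> real) \<Rightarrow> real" where
  "C_norm a b v = (SUP x\<in>{a..b}. \<bar>v x\<bar>)"

text \<open>
  Domain of the Neumann Laplacian in \<open>L\<^sup>2(a, b)\<close>, with the graph norm. The Neumann condition is
  imposed on the continuous representative \<open>w\<close> of the weak derivative.
\<close>

definition Dom_Laplacian :: "real \<Rightarrow> real \<Rightarrow> (real \<Rightarrow> real) set" where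
  "Dom_Laplacian a b = {v \<in> H_space a b 2.
     \<exists>w. has_weak_deriv a b 1 v w \<and> continuous_on {a..b} w \<and> w a = 0 \<and> w b = 0}"

definition Dom_Laplacian_norm :: "real \<Rightarrow> real \<Rightarrow> (real \<Rightarrow> real) \<Rightarrow> real" where
  "Dom_Laplacian_norm a b v = L2_norm a b v + L2_norm a b (weak_deriv a b 2 v)"

text \<open>
  \<open>C_time X nrm n T\<close> is \<open>C\<^sup>n([0, T]; X)\<close> for a space \<open>X\<close> of functions with (semi)norm \<open>nrm\<close>; \<open>V i\<close> is
  the time derivative of order \<open>i\<close> in the sense of \<open>X\<close>, one-sided at \<open>0\<close> and \<open>T\<close>.
\<close>

definition C_time :: "(real \<Rightarrow> real) set \<Rightarrow> ((real \<Rightarrow> real) \<Rightarrow> real) \<Rightarrow> nat \<Rightarrow> real \<Rightarrow>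
    (real \<Rightarrow> real \<Rightarrow> real) set" where
  "C_time X nrm n T = {v. \<exists>V. V 0 = v \<and>
     (\<forall>i\<le>n. \<forall>t\<in>{0..T}. V i t \<in> X \<and>
        ((\<lambda>s. nrm (\<lambda>x. V i s x - V i t x)) \<longlongrightarrow> 0) (at t within {0..T})) \<and>
     (\<forall>i<n. \<forall>t\<in>{0..T}.
        ((\<lambda>s. nrm (\<lambda>x. (V i s x - V i t x) / (s - t) - V (Suc i) t x)) \<longlongrightarrow> 0)
          (at t within {0..T}))}"


section \<open>The Allen--Cahn equation\<close>

text \<open>The wells of \<open>F\<close>, i.e. its local minimum points, are exactly \<open>\<alpha>\<close> and \<open>- \<alpha>\<close>.\<close>

definition double_well :: "(real \<Rightarrow> real) \<Rightarrow> real \<Rightarrow> bool" where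
  "double_well F \<alpha> \<longleftrightarrow> {x. \<forall>\<^sub>F y in nhds x. F x \<le> F y} = {- \<alpha>, \<alpha>}"

text \<open>Here \<open>u t x\<close> is the value at time \<open>t\<close> and position \<open>x\<close>, and \<open>ux\<close> is its spatial derivative.\<close>

definition solves_Allen_Cahn ::
  "real \<Rightarrow> real \<Rightarrow> real \<Rightarrow> (real \<Rightarrow> real) \<Rightarrow> (real \<Rightarrow> real) \<Rightarrow> (real \<Rightarrow> real \<Rightarrow> real) \<Rightarrow> bool" where
  "solves_Allen_Cahn a b T f u0 u \<longleftrightarrow>
     (\<forall>x\<in>{a..b}. u 0 x = u0 x) \<and>
     (\<forall>t\<in>{0<..<T}.
        (\<exists>ux. \<forall>x\<in>{a<..<b}. (u t has_real_derivative ux x) (at x) \<and>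
           (\<exists>uxx. (ux has_real_derivative uxx) (at x) \<and>
              ((\<lambda>s. u s x) has_real_derivative uxx + f (u t x)) (at t))) \<and>
        (u t has_real_derivative 0) (at a within {a..b}) \<and>
        (u t has_real_derivative 0) (at b within {a..b}))"


section \<open>Space discretization\<close>

text \<open>
  \<open>\<xi> 0, \<dots>, \<xi> r\<close> and \<open>\<omega> 0, \<dots>, \<omega> r\<close> are the points and weights of the \<open>(r + 1)\<close>-point Gauss--Lobatto
  rule on \<open>[c, d]\<close>: the rule that contains both end points and is exact for polynomials of degree
  \<open>2 r - 1\<close>, which determines it uniquely.
\<close>

definition gauss_lobatto ::
  "nat \<Rightarrow> real \<Rightarrow> real \<Rightarrow> (nat \<Rightarrow> real) \<Rightarrow> (nat \<Rightarrow> real) \<Rightarrow> bool" where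
  "gauss_lobatto r c d \<xi> \<omega> \<longleftrightarrow>
     strict_mono_on {..r} \<xi> \<and> \<xi> 0 = c \<and> \<xi> r = d \<and>
     (\<forall>p :: real poly. degree p \<le> 2 * r - 1 \<longrightarrow>
        integral {c..d} (poly p) = (\<Sum>j\<le>r. \<omega> j * poly p (\<xi> j)))"

text \<open>
  A mesh is given by \<open>a\<close>, \<open>b\<close>, the number \<open>M\<close> of cells, the degree \<open>r\<close>, the nodes \<open>x 0, \<dots>, x (M * r)\<close>
  and the weights \<open>\<omega> 0, \<dots>, \<omega> r\<close>, which are the same on all cells.
\<close>

definition gl_mesh ::
  "real \<Rightarrow> real \<Rightarrow> nat \<Rightarrow> nat \<Rightarrow> (nat \<Rightarrow> real) \<Rightarrow> (nat \<Rightarrow> real) \<Rightarrow> bool" where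
  "gl_mesh a b M r x \<omega> \<longleftrightarrow> M > 0 \<and>
     (\<forall>i\<le>M. x (i * r) = a + real i * ((b - a) / real M)) \<and>
     (\<forall>i\<in>{1..M}. gauss_lobatto r (x ((i - 1) * r)) (x (i * r)) (\<lambda>j. x ((i - 1) * r + j)) \<omega>)"

text \<open>
  Functions in \<open>S_h\<close> are extended by zero outside \<open>[a, b]\<close>, so that each is represented by exactly one
  function on the real line.
\<close>

definition fem_space :: "real \<Rightarrow> real \<Rightarrow> nat \<Rightarrow> nat \<Rightarrow> (nat \<Rightarrow> real) \<Rightarrow> (real \<Rightarrow> real) set" where
  "fem_space a b M r x = {v \<in> H_space a b 1.
     (\<forall>i\<in>{1..M}. \<exists>p :: real poly. degree p \<le> r \<and>
        (\<forall>y\<in>{x ((i - 1) * r)..x (i * r)}. v y = poly p y)) \<and>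
     (\<forall>y. y \<notin> {a..b} \<longrightarrow> v y = 0)}"

definition quad_inner ::
  "nat \<Rightarrow> nat \<Rightarrow> (nat \<Rightarrow> real) \<Rightarrow> (nat \<Rightarrow> real) \<Rightarrow> (real \<Rightarrow> real) \<Rightarrow> (real \<Rightarrow> real) \<Rightarrow> real" where
  "quad_inner M r x \<omega> v w =
     (\<Sum>i=1..M. \<Sum>j\<le>r. \<omega> j * v (x ((i - 1) * r + j)) * w (x ((i - 1) * r + j)))"

definition lagrange_interp ::
  "real \<Rightarrow> real \<Rightarrow> nat \<Rightarrow> nat \<Rightarrow> (nat \<Rightarrow> real) \<Rightarrow> (real \<Rightarrow> real) \<Rightarrow> real \<Rightarrow> real" where
  "lagrange_interp a b M r x g =
     (THE v. v \<in> fem_space a b M r x \<and> (\<forall>j\<le>M * r. v (x j) = g (x j)))"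

definition neg_disc_Laplacian ::
  "real \<Rightarrow> real \<Rightarrow> nat \<Rightarrow> nat \<Rightarrow> (nat \<Rightarrow> real) \<Rightarrow> (nat \<Rightarrow> real) \<Rightarrow> (real \<Rightarrow> real) \<Rightarrow> real \<Rightarrow> real" where
  "neg_disc_Laplacian a b M r x \<omega> v =
     (THE z. z \<in> fem_space a b M r x \<and>
        (\<forall>w\<in>fem_space a b M r x. quad_inner M r x \<omega> z w =
           L2_inner a b (weak_deriv a b 1 v) (weak_deriv a b 1 w)))"


section \<open>Spectral functional calculus\<close>

text \<open>
  \<open>spectral_fun V ip A g\<close> is \<open>g(A)\<close> for a self-adjoint operator \<open>A\<close> on a finite-dimensional space \<open>V\<close>
  of functions with inner product \<open>ip\<close>: the sum of \<open>g(l)\<close> times the orthogonal projection onto the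
  eigenspace of \<open>l\<close>, over all eigenvalues \<open>l\<close> of \<open>A\<close>.
\<close>

definition eigenspace ::
  "(real \<Rightarrow> real) set \<Rightarrow> ((real \<Rightarrow> real) \<Rightarrow> real \<Rightarrow> real) \<Rightarrow> real \<Rightarrow> (real \<Rightarrow> real) set" where
  "eigenspace V A l = {v \<in> V. A v = (\<lambda>y. l * v y)}"

definition eigenvalues ::
  "(real \<Rightarrow> real) set \<Rightarrow> ((real \<Rightarrow> real) \<Rightarrow> real \<Rightarrow> real) \<Rightarrow> real set" where
  "eigenvalues V A = {l. \<exists>v\<in>eigenspace V A l. v \<noteq> (\<lambda>y. 0)}"

definition orth_proj ::
  "((real \<Rightarrow> real) \<Rightarrow> (real \<Rightarrow> real) \<Rightarrow> real) \<Rightarrow> (real \<Rightarrow> real) set \<Rightarrow> (real \<Rightarrow> real) \<Rightarrow> real \<Rightarrow> real" where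
  "orth_proj ip E v = (THE w. w \<in> E \<and> (\<forall>z\<in>E. ip (\<lambda>y. v y - w y) z = 0))"

definition spectral_fun ::
  "(real \<Rightarrow> real) set \<Rightarrow> ((real \<Rightarrow> real) \<Rightarrow> (real \<Rightarrow> real) \<Rightarrow> real) \<Rightarrow>
   ((real \<Rightarrow> real) \<Rightarrow> real \<Rightarrow> real) \<Rightarrow> (real \<Rightarrow> real) \<Rightarrow> (real \<Rightarrow> real) \<Rightarrow> real \<Rightarrow> real" where
  "spectral_fun V ip A g v =
     (\<lambda>y. \<Sum>l\<in>eigenvalues V A. g l * orth_proj ip (eigenspace V A l) v y)"


section \<open>Time discretization and the cut-off scheme\<close>

text \<open>
  Rational functions are evaluated through their fraction in lowest terms, so removable singularities
  carry the continuous value. At a genuine pole the value is \<open>0\<close>, but a function that is bounded on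
  \<open>{0<..}\<close> has no pole there or at \<open>0\<close>.
\<close>

definition rat_num :: "real poly fract \<Rightarrow> real poly" where
  "rat_num R = fst (quot_of_fract R)"

definition rat_den :: "real poly fract \<Rightarrow> real poly" where
  "rat_den R = snd (quot_of_fract R)"

definition rat_eval :: "real poly fract \<Rightarrow> real \<Rightarrow> real" where
  "rat_eval R l = poly (rat_num R) l / poly (rat_den R) l"

text \<open>
  The common shape of the accuracy conditions: \<open>g\<close> is \<open>exp (- l)\<close> for accuracy and the value of
  \<open>\<sigma>\<close> at \<open>l\<close> for strict accuracy.
\<close>

definition order_quotient :: "nat \<Rightarrow> real \<Rightarrow> real \<Rightarrow> real" where
  "order_quotient j l g =
     fact j / (- l) ^ (j + 1) * (g - (\<Sum>i\<le>j. (- l) ^ i / fact i))"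

text \<open>\<open>L\<^sub>j\<close> for the step from \<open>t\<^sub>n\<^sub>-\<^sub>1\<close> to \<open>t\<^sub>n\<close>, with time nodes \<open>t\<^sub>n\<^sub>-\<^sub>i = (n - i) \<tau>\<close>, \<open>i = 1, \<dots>, k\<close>.\<close>

definition time_lagrange :: "real \<Rightarrow> nat \<Rightarrow> nat \<Rightarrow> nat \<Rightarrow> real \<Rightarrow> real" where
  "time_lagrange \<tau> k n j t =
     (\<Prod>i\<in>{1..k} - {j}. (t - real (n - i) * \<tau>) / (real (n - j) * \<tau> - real (n - i) * \<tau>))"

definition provisional_step ::
  "real \<Rightarrow> real \<Rightarrow> nat \<Rightarrow> nat \<Rightarrow> (nat \<Rightarrow> real) \<Rightarrow> (nat \<Rightarrow> real) \<Rightarrow> (real \<Rightarrow> real) \<Rightarrow> real \<Rightarrow> nat \<Rightarrow>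
   nat \<Rightarrow> (real \<Rightarrow> real) \<Rightarrow> (nat \<Rightarrow> real \<Rightarrow> real) \<Rightarrow> (nat \<Rightarrow> real) \<Rightarrow> (nat \<Rightarrow> real \<Rightarrow> real) \<Rightarrow> nat \<Rightarrow>
   real \<Rightarrow> real" where
  "provisional_step a b M r x \<omega> f \<tau> k m \<sigma> p c U n =
     (let fun_of = spectral_fun (fem_space a b M r x) (quad_inner M r x \<omega>)
                     (\<lambda>v y. \<tau> * neg_disc_Laplacian a b M r x \<omega> v y)
      in (\<lambda>y. fun_of \<sigma> (U (n - 1)) y +
            \<tau> * (\<Sum>i=1..m. fun_of (p i)
                  (\<lambda>z. \<Sum>j=1..k. time_lagrange \<tau> k n j (real (n - 1) * \<tau> + c i * \<tau>) *
                     lagrange_interp a b M r x (\<lambda>w. f (U (n - j) w)) z) y)))"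

definition cutoff_solution ::
  "real \<Rightarrow> real \<Rightarrow> nat \<Rightarrow> nat \<Rightarrow> (nat \<Rightarrow> real) \<Rightarrow> (nat \<Rightarrow> real) \<Rightarrow> (real \<Rightarrow> real) \<Rightarrow> real \<Rightarrow> real \<Rightarrow>
   nat \<Rightarrow> nat \<Rightarrow> nat \<Rightarrow> (real \<Rightarrow> real) \<Rightarrow> (nat \<Rightarrow> real \<Rightarrow> real) \<Rightarrow> (nat \<Rightarrow> real) \<Rightarrow>
   (nat \<Rightarrow> real \<Rightarrow> real) \<Rightarrow> bool" where
  "cutoff_solution a b M r x \<omega> f \<alpha> \<tau> N k m \<sigma> p c U \<longleftrightarrow>
     (\<forall>n\<in>{k..N}. U n \<in> fem_space a b M r x \<and>
        (\<forall>j\<le>M * r. U n (x j) =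
           min (max (provisional_step a b M r x \<omega> f \<tau> k m \<sigma> p c U n (x j)) (- \<alpha>)) \<alpha>))"

end

theory Submission
  imports Defs "HOL-Computational_Algebra.Fundamental_Theorem_Algebra"
begin

text \<open>
  Since \<open>\<bar>u\<bar> \<le> \<alpha>\<close>, the cut-off does not increase the nodal error, so the error need only be followed
  through one uncut step. In the norm of the quadrature inner product the eigenfunctions of the
  discrete Laplacian diagonalise this step. Inserting the Taylor expansion of \<open>u\<close> in time, strict
  accuracy cancels all terms of order below \<open>k\<close>; the one of order \<open>k\<close> carries the factor
  \<open>min \<lambda> 1\<close> and, like the consistency error of the space discretization in the dual energy norm, is
  absorbed by the damping \<open>\<sigma>\<^sup>2 \<le> 1 - c\<^sub>0 min \<lambda> 1\<close>. The quadrature is exact up to degree \<open>2 r - 1\<close>, which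
  gives the order \<open>r + 1\<close> for the consistency error. The nonlinearity enters only through its
  values in \<open>[-\<alpha>, \<alpha>]\<close>, where it is Lipschitz, and a discrete Gronwall inequality closes the argument.
\<close>

subsection \<open>Square integrable functions\<close>

text \<open>The error is followed in the quadrature norm because clamping nodal values is a
  contraction only for a norm that is a positively weighted sum over the nodes. This norm makes
  sense for every function, so the exact solution enters it directly; it is compared with the L2
  norm only at the start and at the end, at the price of terms of size \<open>h ^ (r + 1)\<close>.

  Two contributions of a step are too large for a plain triangle inequality, which over
  \<open>N\<close> steps would lose powers of \<tau>: the Taylor term of order \<open>k\<close>, of
  size \<open>\<tau> ^ k * min l 1\<close>, and the spatial residual, which is of order
  \<open>r + 1\<close> only against the energy norm. In both cases the square is divided by the gap
  \<open>\<tau> + c0 * min l 1\<close>. For the first this leaves a factor \<open>l\<close>, and the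
  sum of \<open>l * y\<^sup>2\<close> is \<tau> times an energy: this supplies the missing \<tau>,
  and it is where regularity in the domain of the Laplacian enters. For the second it produces the
  weight \<open>1 / (1 + l / \<tau>)\<close> of the dual energy norm.

  Mesh and step size are never coupled; every constant is fixed before either is chosen.\<close>

lemma L2_space_measurable: "v \<in> L2_space a b \<Longrightarrow> v \<in> borel_measurable (lebesgue_on {a..b})"
  by (simp add: L2_space_def)

lemma L2_space_integrable_mult:
  assumes "v \<in> L2_space a b" "w \<in> L2_space a b"
  shows "integrable (lebesgue_on {a..b}) (\<lambda>x. v x * w x)"
proof (rule Bochner_Integration.integrable_bound)
  show "integrable (lebesgue_on {a..b}) (\<lambda>x. (v x)\<^sup>2 + (w x)\<^sup>2)"
    using assms by (auto simp: L2_space_def)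
  show "(\<lambda>x. v x * w x) \<in> borel_measurable (lebesgue_on {a..b})"
    using assms by (auto simp: L2_space_def)
  have "\<bar>p * q\<bar> \<le> p\<^sup>2 + q\<^sup>2" for p q :: real
  proof -
    have "0 \<le> (\<bar>p\<bar> - \<bar>q\<bar>)\<^sup>2" by simp
    then have "2 * (\<bar>p\<bar> * \<bar>q\<bar>) \<le> p\<^sup>2 + q\<^sup>2" by (simp add: power2_diff)
    moreover have "0 \<le> \<bar>p\<bar> * \<bar>q\<bar>" by simp
    ultimately show ?thesis unfolding abs_mult by linarith
  qed
  then show "AE x in lebesgue_on {a..b}. norm (v x * w x) \<le> norm ((v x)\<^sup>2 + (w x)\<^sup>2)"
    by (intro AE_I2) (metis abs_of_nonneg real_norm_def sum_power2_ge_zero)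
qed

lemma continuous_L2_space [intro]:
  assumes "continuous_on {a..b} v"
  shows "v \<in> L2_space a b"
proof -
  have "integrable (lebesgue_on {a..b}) (\<lambda>x. (v x)\<^sup>2)"
    by (rule continuous_imp_integrable_real) (intro continuous_intros assms)
  then show ?thesis
    using assms by (simp add: L2_space_def continuous_imp_measurable_on_sets_lebesgue)
qed

lemma L2_space_add [intro]:
  assumes "v \<in> L2_space a b" "w \<in> L2_space a b"
  shows "(\<lambda>x. v x + w x) \<in> L2_space a b"
proof -
  have "integrable (lebesgue_on {a..b}) (\<lambda>x. (v x)\<^sup>2 + (w x)\<^sup>2 + 2 * (v x * w x))"
    using assms L2_space_integrable_mult[OF assms] by (auto simp: L2_space_def)
  then show ?thesis
    using assms by (auto simp: L2_space_def power2_sum algebra_simps)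
qed

lemma L2_space_scale [intro]:
  assumes "v \<in> L2_space a b"
  shows "(\<lambda>x. c * v x) \<in> L2_space a b"
  using assms by (auto simp: L2_space_def power_mult_distrib)

lemma L2_space_diff [intro]:
  assumes "v \<in> L2_space a b" "w \<in> L2_space a b"
  shows "(\<lambda>x. v x - w x) \<in> L2_space a b"
  using L2_space_add[OF assms(1) L2_space_scale[OF assms(2), of "-1"]] by simp

lemma L2_space_sum [intro]:
  assumes "\<And>i. i \<in> I \<Longrightarrow> v i \<in> L2_space a b"
  shows "(\<lambda>x. \<Sum>i\<in>I. v i x) \<in> L2_space a b"
  using assms by (induction I rule: infinite_finite_induct) auto

lemma L2_space_integrable:
  assumes "v \<in> L2_space a b"
  shows "integrable (lebesgue_on {a..b}) v"
  using L2_space_integrable_mult[OF assms continuous_L2_space[of a b "\<lambda>_. 1"]] by simp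

lemma L2_space_subinterval:
  assumes "v \<in> L2_space a b" "{c..d} \<subseteq> {a..b}"
  shows "v \<in> L2_space c d"
proof -
  have "v \<in> borel_measurable (lebesgue_on {c..d})"
    by (rule measurable_restrict_mono[OF L2_space_measurable[OF assms(1)] assms(2)])
  moreover have "integrable (lebesgue_on {c..d}) (\<lambda>x. (v x)\<^sup>2)"
    by (rule integrable_subinterval[OF _ assms(2)]) (use assms(1) in \<open>simp add: L2_space_def\<close>)
  ultimately show ?thesis by (simp add: L2_space_def)
qed

lemma L2_inner_integral:
  assumes "v \<in> L2_space a b" "w \<in> L2_space a b"
  shows "L2_inner a b v w = integral {a..b} (\<lambda>x. v x * w x)"
  unfolding L2_inner_def
  by (rule lebesgue_integral_eq_integral[OF L2_space_integrable_mult[OF assms]]) simp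

lemma L2_space_integrable_on:
  assumes "v \<in> L2_space a b" "w \<in> L2_space a b" "{c..d} \<subseteq> {a..b}"
  shows "(\<lambda>x. v x * w x) integrable_on {c..d}"
  by (rule integrable_on_lebesgue_on[OF L2_space_integrable_mult])
    (use assms L2_space_subinterval in auto)

lemma L2_inner_commute: "L2_inner a b v w = L2_inner a b w v"
  by (simp add: L2_inner_def mult.commute)

lemma L2_inner_add:
  assumes "v \<in> L2_space a b" "v' \<in> L2_space a b" "w \<in> L2_space a b"
  shows "L2_inner a b (\<lambda>x. v x + v' x) w = L2_inner a b v w + L2_inner a b v' w"
  using L2_space_integrable_mult[OF assms(1,3)] L2_space_integrable_mult[OF assms(2,3)]
  by (simp add: L2_inner_def distrib_right)

lemma L2_inner_scale: "L2_inner a b (\<lambda>x. c * v x) w = c * L2_inner a b v w"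
  by (simp add: L2_inner_def mult.assoc)

lemma L2_inner_diff:
  assumes "v \<in> L2_space a b" "v' \<in> L2_space a b" "w \<in> L2_space a b"
  shows "L2_inner a b (\<lambda>x. v x - v' x) w = L2_inner a b v w - L2_inner a b v' w"
  using L2_space_integrable_mult[OF assms(1,3)] L2_space_integrable_mult[OF assms(2,3)]
  by (simp add: L2_inner_def left_diff_distrib)

lemma L2_inner_sum:
  assumes "\<And>i. i \<in> I \<Longrightarrow> v i \<in> L2_space a b" "w \<in> L2_space a b"
  shows "L2_inner a b (\<lambda>x. \<Sum>i\<in>I. v i x) w = (\<Sum>i\<in>I. L2_inner a b (v i) w)"
  using assms
proof (induction I rule: infinite_finite_induct)
  case (insert i I)
  have "L2_inner a b (\<lambda>x. v i x + (\<Sum>i\<in>I. v i x)) w = L2_inner a b (v i) w + L2_inner a b (\<lambda>x. \<Sum>i\<in>I. v i x) w"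
    using insert by (intro L2_inner_add L2_space_sum) auto
  then show ?case using insert by simp
qed (auto simp: L2_inner_def)

lemma L2_inner_nonneg: "0 \<le> L2_inner a b v v"
  by (simp add: L2_inner_def)

lemma L2_norm_nonneg [simp]: "0 \<le> L2_norm a b v"
  by (simp add: L2_norm_def L2_inner_nonneg)

lemma L2_norm_sq: "(L2_norm a b v)\<^sup>2 = L2_inner a b v v"
  by (simp add: L2_norm_def L2_inner_nonneg)

lemma L2_norm_sq_integral:
  assumes "v \<in> L2_space a b"
  shows "(L2_norm a b v)\<^sup>2 = integral {a..b} (\<lambda>x. (v x)\<^sup>2)"
  unfolding L2_norm_sq L2_inner_integral[OF assms assms] by (simp add: power2_eq_square)

text \<open>Needed because \<open>weak_deriv\<close> is an arbitrary choice: different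
  representatives may be exchanged inside inner products.\<close>

lemma L2_inner_AE_cong:
  assumes "AE x in lebesgue_on {a..b}. v x = v' x" "AE x in lebesgue_on {a..b}. w x = w' x"
    and "v \<in> L2_space a b" "v' \<in> L2_space a b" "w \<in> L2_space a b" "w' \<in> L2_space a b"
  shows "L2_inner a b v w = L2_inner a b v' w'"
  unfolding L2_inner_def
  using assms by (intro integral_cong_AE) (auto intro!: borel_measurable_times dest: L2_space_measurable)

text \<open>Discriminant argument for the quadratic in \<open>t\<close>. The form is only
  semidefinite on functions, so the degenerate case \<open>q = 0\<close> is treated
  separately.\<close>

lemma L2_Cauchy_Schwarz:
  assumes "v \<in> L2_space a b" "w \<in> L2_space a b"
  shows "\<bar>L2_inner a b v w\<bar> \<le> L2_norm a b v * L2_norm a b w"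
proof -
  define p q s where "p = L2_inner a b v v" and "q = L2_inner a b w w" and "s = L2_inner a b v w"
  have nn: "p \<ge> 0" "q \<ge> 0" by (auto simp: p_def q_def L2_inner_nonneg)
  have "0 \<le> p - 2 * t * s + t\<^sup>2 * q" for t
  proof -
    have w: "(\<lambda>x. t * w x) \<in> L2_space a b" and d: "(\<lambda>x. v x - t * w x) \<in> L2_space a b" using assms by auto
    have "0 \<le> L2_inner a b (\<lambda>x. v x - t * w x) (\<lambda>x. v x - t * w x)" by (rule L2_inner_nonneg)
    also have "\<dots> = L2_inner a b v (\<lambda>x. v x - t * w x) - t * L2_inner a b w (\<lambda>x. v x - t * w x)"
      by (subst L2_inner_diff[OF assms(1) w d]) (simp add: L2_inner_scale)
    also have "\<dots> = (p - t * s) - t * (s - t * q)"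
      unfolding L2_inner_commute[of a b v "\<lambda>x. v x - t * w x"] L2_inner_commute[of a b w "\<lambda>x. v x - t * w x"]
      by (subst L2_inner_diff[OF assms(1) w assms(1)], subst L2_inner_diff[OF assms(1) w assms(2)])
        (simp add: L2_inner_scale p_def q_def s_def L2_inner_commute)
    finally show ?thesis by (simp add: algebra_simps power2_eq_square)
  qed
  note quad = this
  have "s\<^sup>2 \<le> p * q"
  proof (cases "q = 0")
    case True
    have "s = 0"
    proof (rule ccontr)
      assume "s \<noteq> 0"
      \<comment> \<open>With \<open>q = 0\<close> the quadratic is linear in \<open>t\<close>, and
        this value of \<open>t\<close> makes it -1.\<close>
      then show False using quad[of "(p + 1) / (2 * s)"] True by simp
    qed
    then show ?thesis using nn by simp
  next
    case False
    then have "q > 0" using nn by simp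
    have "p - 2 * (s / q) * s + (s / q)\<^sup>2 * q = p - s\<^sup>2 / q"
      using \<open>q > 0\<close> by (simp add: field_simps power2_eq_square)
    then have "0 \<le> p - s\<^sup>2 / q" using quad[of "s / q"] by simp
    then show ?thesis using \<open>q > 0\<close> by (simp add: field_simps)
  qed
  then have "sqrt (s\<^sup>2) \<le> sqrt (p * q)" by (rule real_sqrt_le_mono)
  then show ?thesis by (simp add: L2_norm_def p_def q_def s_def real_sqrt_mult)
qed

lemma L2_norm_scale: "L2_norm a b (\<lambda>x. c * v x) = \<bar>c\<bar> * L2_norm a b v"
proof -
  have "L2_inner a b (\<lambda>x. c * v x) (\<lambda>x. c * v x) = c\<^sup>2 * L2_inner a b v v"
    by (simp add: L2_inner_def algebra_simps power2_eq_square flip: integral_mult_right_zero)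
  then show ?thesis by (simp add: L2_norm_def real_sqrt_mult)
qed

lemma L2_norm_triangle:
  assumes "v \<in> L2_space a b" "w \<in> L2_space a b"
  shows "L2_norm a b (\<lambda>x. v x + w x) \<le> L2_norm a b v + L2_norm a b w"
proof -
  have s: "(\<lambda>x. v x + w x) \<in> L2_space a b" using assms by auto
  have "(L2_norm a b (\<lambda>x. v x + w x))\<^sup>2 =
      L2_inner a b v (\<lambda>x. v x + w x) + L2_inner a b w (\<lambda>x. v x + w x)"
    unfolding L2_norm_sq by (rule L2_inner_add[OF assms s])
  also have "\<dots> \<le> L2_norm a b v * L2_norm a b (\<lambda>x. v x + w x) + L2_norm a b w * L2_norm a b (\<lambda>x. v x + w x)"
    using L2_Cauchy_Schwarz[OF assms(1) s] L2_Cauchy_Schwarz[OF assms(2) s] by linarith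
  finally have "L2_norm a b (\<lambda>x. v x + w x) * L2_norm a b (\<lambda>x. v x + w x) \<le> (L2_norm a b v + L2_norm a b w) * L2_norm a b (\<lambda>x. v x + w x)"
    by (simp add: power2_eq_square algebra_simps)
  then show ?thesis
    using L2_norm_nonneg[of a b "\<lambda>x. v x + w x"] L2_norm_nonneg[of a b v] L2_norm_nonneg[of a b w]
    by (cases "L2_norm a b (\<lambda>x. v x + w x) = 0") (auto simp: mult_le_cancel_right simp del: L2_norm_nonneg)
qed

lemma L2_norm_triangle_diff:
  assumes "v \<in> L2_space a b" "w \<in> L2_space a b"
  shows "L2_norm a b (\<lambda>x. v x - w x) \<le> L2_norm a b v + L2_norm a b w"
  using L2_norm_triangle[OF assms(1) L2_space_scale[OF assms(2), of "-1"]] L2_norm_scale[of a b "-1" w] by simp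

lemma L2_norm_eq_0_AE:
  assumes "v \<in> L2_space a b" "L2_norm a b v = 0"
  shows "AE x in lebesgue_on {a..b}. v x = 0"
proof -
  have "integral\<^sup>L (lebesgue_on {a..b}) (\<lambda>x. (v x)\<^sup>2) = 0"
    using assms(2) by (simp add: L2_norm_def L2_inner_def power2_eq_square)
  moreover have "integrable (lebesgue_on {a..b}) (\<lambda>x. (v x)\<^sup>2)" using assms by (simp add: L2_space_def)
  ultimately have "AE x in lebesgue_on {a..b}. (v x)\<^sup>2 = 0"
    by (subst (asm) integral_nonneg_eq_0_iff_AE) auto
  then show ?thesis by auto
qed

lemma L2_norm_AE_cong:
  assumes "AE x in lebesgue_on {a..b}. v x = v' x" "v \<in> L2_space a b" "v' \<in> L2_space a b"
  shows "L2_norm a b v = L2_norm a b v'"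
  unfolding L2_norm_def using L2_inner_AE_cong[OF assms(1,1)] assms by simp

lemma L2_norm_le_sup:
  assumes "a \<le> b" "v \<in> L2_space a b" "\<And>x. x \<in> {a..b} \<Longrightarrow> \<bar>v x\<bar> \<le> K"
  shows "(L2_norm a b v)\<^sup>2 \<le> (b - a) * K\<^sup>2"
proof -
  have "(\<lambda>x. v x * v x) integrable_on {a..b}" using L2_space_integrable_on[OF assms(2,2)] by simp
  then have "(\<lambda>x. (v x)\<^sup>2) integrable_on {a..b}" by (simp add: power2_eq_square)
  then have "integral {a..b} (\<lambda>x. (v x)\<^sup>2) \<le> integral {a..b} (\<lambda>x. K\<^sup>2)"
    by (intro integral_le) (auto intro!: power2_le_iff_abs_le[THEN iffD2] assms(3) order.trans[OF abs_ge_zero assms(3)])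
  then show ?thesis using assms by (simp add: L2_norm_sq_integral)
qed

text \<open>Cauchy-Schwarz against the constant 1. The factor \<open>sqrt (d - c)\<close> later
  supplies the half powers of \<open>h\<close> that turn sup bounds on a cell back into sums of
  squared L2 norms.\<close>

lemma L2_integral_bound:
  assumes "w \<in> L2_space c d" "c \<le> x" "x \<le> y" "y \<le> d"
  shows "\<bar>integral {x..y} w\<bar> \<le> sqrt (d - c) * L2_norm c d w"
proof -
  have w: "w \<in> L2_space x y" using L2_space_subinterval[OF assms(1)] assms by auto
  have o: "(\<lambda>_. 1) \<in> L2_space x y" by auto
  have "integral {x..y} w = L2_inner x y (\<lambda>_. 1) w" using L2_inner_integral[OF o w] by simp
  then have "\<bar>integral {x..y} w\<bar> \<le> L2_norm x y (\<lambda>_. 1) * L2_norm x y w" using L2_Cauchy_Schwarz[OF o w] by simp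
  also have "\<dots> \<le> sqrt (d - c) * L2_norm c d w"
  proof (rule mult_mono)
    have "(L2_norm x y (\<lambda>_. 1))\<^sup>2 = y - x" using assms by (simp add: L2_norm_sq_integral[OF o])
    then show "L2_norm x y (\<lambda>_. 1) \<le> sqrt (d - c)"
      using assms by (intro real_le_rsqrt) simp
    have i: "(\<lambda>x. (w x)\<^sup>2) integrable_on {c..d}" using L2_space_integrable_on[OF assms(1,1)] by (simp add: power2_eq_square)
    have "(L2_norm x y w)\<^sup>2 \<le> (L2_norm c d w)\<^sup>2"
      unfolding L2_norm_sq_integral[OF w] L2_norm_sq_integral[OF assms(1)]
      using assms by (intro integral_subset_le integrable_on_subinterval[OF i] i) auto
    then show "L2_norm x y w \<le> L2_norm c d w" by (simp add: power2_le_iff_abs_le)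
  qed (use assms in auto)
  finally show ?thesis .
qed

subsection \<open>Functions with vanishing integrals over intervals\<close>

text \<open>By Henstock's lemma the Riemann sums of the absolute value also tend to zero.\<close>

lemma vanishing_integrals_imp_AE_zero:
  fixes w :: "real \<Rightarrow> real"
  assumes w: "integrable (lebesgue_on {a..b}) w"
    and z: "\<And>x y. a \<le> x \<Longrightarrow> x \<le> y \<Longrightarrow> y \<le> b \<Longrightarrow> integral {x..y} w = 0"
  shows "AE x in lebesgue_on {a..b}. w x = 0"
proof -
  have wi: "w integrable_on cbox a b" using integrable_on_lebesgue_on[OF w] by simp
  have "((\<lambda>x. \<bar>w x\<bar>) has_integral 0) (cbox a b)"
    unfolding has_integral
  proof (intro allI impI)
    fix e :: real assume "e > 0"
    from Henstock_lemma[OF wi this] obtain \<gamma> where g: "gauge \<gamma>"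
      and le: "\<And>p. p tagged_partial_division_of (cbox a b) \<Longrightarrow> \<gamma> fine p \<Longrightarrow>
        sum (\<lambda>(x,k). norm (measure lborel k *\<^sub>R w x - integral k w)) p < e" by blast
    have "norm ((\<Sum>(x, k)\<in>p. measure lborel k *\<^sub>R \<bar>w x\<bar>) - 0) < e"
      if p: "p tagged_division_of cbox a b" "\<gamma> fine p" for p
    proof -
      have "(\<Sum>(x, k)\<in>p. measure lborel k *\<^sub>R \<bar>w x\<bar>) = (\<Sum>(x,k)\<in>p. norm (measure lborel k *\<^sub>R w x - integral k w))"
      proof (rule sum.cong, simp, clarify)
        fix x k assume "(x, k) \<in> p"
        then obtain c d where k: "k = cbox c d" "k \<subseteq> cbox a b" "x \<in> k"
          using p(1) by (metis tagged_division_ofD(2-4))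
        then have "integral k w = 0" using z[of c d] by auto
        then show "measure lborel k *\<^sub>R \<bar>w x\<bar> = norm (measure lborel k *\<^sub>R w x - integral k w)"
          by (simp add: abs_mult)
      qed
      also have "\<dots> < e" using le[of p] p by (auto simp: tagged_division_of_def)
      finally show ?thesis by (simp add: sum_nonneg case_prod_beta)
    qed
    then show "\<exists>\<gamma>. gauge \<gamma> \<and> (\<forall>\<D>. \<D> tagged_division_of cbox a b \<and> \<gamma> fine \<D> \<longrightarrow>
        norm ((\<Sum>(x, k)\<in>\<D>. measure lborel k *\<^sub>R \<bar>w x\<bar>) - 0) < e)"
      using g by blast
  qed
  then have "integral {a..b} (\<lambda>x. \<bar>w x\<bar>) = 0" by (simp add: integral_unique)
  then have "integral\<^sup>L (lebesgue_on {a..b}) (\<lambda>x. \<bar>w x\<bar>) = 0"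
    using lebesgue_integral_eq_integral[of "{a..b}" "\<lambda>x. \<bar>w x\<bar>"] w by auto
  then have "AE x in lebesgue_on {a..b}. \<bar>w x\<bar> = 0"
    using w by (subst (asm) integral_nonneg_eq_0_iff_AE) auto
  then show ?thesis by auto
qed

subsection \<open>Test functions\<close>

definition smooth :: "(real \<Rightarrow> real) \<Rightarrow> bool" where
  "smooth f \<longleftrightarrow> (\<forall>n x. (deriv ^^ n) f differentiable (at x))"

text \<open>A set that is closed under differentiation contains all iterated derivatives of its
  members, so smoothness follows without a formula for the \<open>n\<close>-th derivative.\<close>

lemma smooth_coinduct:
  assumes "f \<in> S" "\<And>g. g \<in> S \<Longrightarrow> \<exists>g'\<in>S. \<forall>x. (g has_real_derivative g' x) (at x)"
  shows "smooth f"
proof -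
  have mem: "(deriv ^^ n) f \<in> S" for n
  proof (induction n)
    case (Suc n)
    then obtain g' where g': "g' \<in> S" "\<forall>x. ((deriv ^^ n) f has_real_derivative g' x) (at x)"
      using assms(2) by blast
    then have "deriv ((deriv ^^ n) f) = g'" by (auto intro: DERIV_imp_deriv)
    then show ?case using g' by simp
  qed (simp add: assms)
  show ?thesis unfolding smooth_def
    using assms(2)[OF mem] real_differentiable_def by blast
qed

lemma smooth_deriv: "smooth f \<Longrightarrow> smooth (deriv f)"
  unfolding smooth_def
proof (intro allI)
  fix n x
  assume "\<forall>n x. (deriv ^^ n) f differentiable (at x)"
  then have "(deriv ^^ Suc n) f differentiable (at x)" by blast
  then show "(deriv ^^ n) (deriv f) differentiable (at x)" by (simp only: funpow_Suc_right o_apply)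
qed

lemma smooth_DERIV: "smooth f \<Longrightarrow> (f has_real_derivative deriv f x) (at x)"
  unfolding smooth_def
  by (drule spec[of _ 0]) (simp add: DERIV_deriv_iff_real_differentiable)

lemma smooth_continuous: "smooth f \<Longrightarrow> continuous_on S f"
  by (intro continuous_at_imp_continuous_on ballI DERIV_isCont[OF smooth_DERIV])

lemma smooth_antideriv:
  assumes "smooth g" "\<And>x. (f has_real_derivative g x) (at x)"
  shows "smooth f"
  unfolding smooth_def
proof (intro allI)
  fix n x
  have d: "deriv f = g" using assms(2) by (auto intro: DERIV_imp_deriv)
  show "(deriv ^^ n) f differentiable (at x)"
  proof (cases n)
    case 0 then show ?thesis using assms(2) real_differentiable_def by auto
  next
    case (Suc m)
    then have "(deriv ^^ n) f = (deriv ^^ m) g" by (simp only: funpow_Suc_right o_apply d)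
    then show ?thesis using assms(1) by (simp add: smooth_def)
  qed
qed

lemma smooth_lincomb:
  assumes "smooth f" "smooth g"
  shows "smooth (\<lambda>x. c * f x + d * g x)"
proof (rule smooth_coinduct[where S = "{\<lambda>x. c * f x + d * g x |f g. smooth f \<and> smooth g}"])
  show "(\<lambda>x. c * f x + d * g x) \<in> {\<lambda>x. c * f x + d * g x |f g. smooth f \<and> smooth g}"
    using assms by blast
next
  fix h assume "h \<in> {\<lambda>x. c * f x + d * g x |f g. smooth f \<and> smooth g}"
  then obtain f g where h: "h = (\<lambda>x. c * f x + d * g x)" "smooth f" "smooth g" by blast
  have "\<forall>x. (h has_real_derivative c * deriv f x + d * deriv g x) (at x)"
    using smooth_DERIV[OF h(2)] smooth_DERIV[OF h(3)] unfolding h(1)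
    by (auto intro!: derivative_eq_intros)
  moreover have "(\<lambda>x. c * deriv f x + d * deriv g x) \<in> {\<lambda>x. c * f x + d * g x |f g. smooth f \<and> smooth g}"
    using smooth_deriv h by blast
  ultimately show "\<exists>g'\<in>{\<lambda>x. c * f x + d * g x |f g. smooth f \<and> smooth g}. \<forall>x. (h has_real_derivative g' x) (at x)"
    by (intro bexI[of _ "\<lambda>x. c * deriv f x + d * deriv g x"])
qed

text \<open>For \<open>P = 1\<close> this is the standard flat function exp(-c/x), extended by zero.
  The polynomial in 1/x makes the family closed under differentiation; letting \<open>c\<close> tend
  to 0 then recovers the indicator of the positive half line.\<close>

definition exp_bump :: "real \<Rightarrow> real poly \<Rightarrow> real \<Rightarrow> real" where
  "exp_bump c P x = (if x > 0 then poly P (1 / x) * exp (- c / x) else 0)"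

lemma poly_div_exp_tendsto_0:
  fixes P :: "real poly"
  assumes "c > 0"
  shows "((\<lambda>y. poly P y / exp (c * y)) \<longlongrightarrow> 0) at_top"
proof -
  have "((\<lambda>y. (y ^ i / exp (c * y))) \<longlongrightarrow> 0) at_top" for i
  proof -
    have "((\<lambda>y. (1 / c ^ i) * ((c * y) ^ i / exp (c * y))) \<longlongrightarrow> (1 / c ^ i) * 0) at_top"
      by (intro tendsto_mult tendsto_const filterlim_compose[OF tendsto_power_div_exp_0]
          filterlim_tendsto_pos_mult_at_top[OF tendsto_const assms] filterlim_ident)
    then show ?thesis using assms by (simp add: power_mult_distrib)
  qed
  then have "((\<lambda>y. \<Sum>i\<le>degree P. coeff P i * (y ^ i / exp (c * y))) \<longlongrightarrow> (\<Sum>i\<le>degree P. coeff P i * 0)) at_top"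
    by (intro tendsto_sum tendsto_mult tendsto_const)
  then show ?thesis by (simp add: poly_altdef sum_divide_distrib)
qed

text \<open>Away from 0 this is the product rule, with \<open>[:0, 0, 1:]\<close> evaluated at 1/x
  as the inner derivative; at 0 exponential decay beats every polynomial in 1/x.\<close>

lemma exp_bump_DERIV:
  assumes "c > 0"
  shows "(exp_bump c P has_real_derivative exp_bump c ([:0, 0, 1:] * (smult c P - pderiv P)) x) (at x)"
proof -
  let ?Q = "[:0, 0, 1:] * (smult c P - pderiv P)"
  consider "x > 0" | "x < 0" | "x = 0" by linarith
  then show ?thesis
  proof cases
    case 1
    have "((\<lambda>x. poly P (1 / x) * exp (- c / x)) has_real_derivative
        exp_bump c ?Q x) (at x)"
      using 1 by (auto intro!: derivative_eq_intros simp: exp_bump_def field_simps power2_eq_square)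
    moreover have "\<forall>\<^sub>F y in nhds x. y > 0" using 1 eventually_nhds_in_open[of "{0<..}" x] by auto
    ultimately show ?thesis
      by (subst DERIV_cong_ev[where g = "\<lambda>x. poly P (1 / x) * exp (- c / x)", OF refl _ refl])
        (auto elim!: eventually_mono simp: exp_bump_def)
  next
    case 2
    have "((\<lambda>x. 0) has_real_derivative exp_bump c ?Q x) (at x)" using 2 by (simp add: exp_bump_def)
    moreover have "\<forall>\<^sub>F y in nhds x. y < 0" using 2 eventually_nhds_in_open[of "{..<0}" x] by auto
    ultimately show ?thesis
      by (subst DERIV_cong_ev[where g = "\<lambda>x. 0", OF refl _ refl])
        (auto elim!: eventually_mono simp: exp_bump_def)
  next
    case 3
    have "((\<lambda>y. exp_bump c P y / y) \<longlongrightarrow> 0) (at_right 0)"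
    proof -
      have "((\<lambda>y. poly ([:0, 1:] * P) (inverse y) / exp (c * inverse y)) \<longlongrightarrow> 0) (at_right 0)"
        by (rule filterlim_compose[OF poly_div_exp_tendsto_0[OF assms] filterlim_inverse_at_top_right])
      moreover have "\<forall>\<^sub>F y in at_right 0. poly ([:0, 1:] * P) (inverse y) / exp (c * inverse y) = exp_bump c P y / y"
        using eventually_at_right_less[of "0::real"]
        by (rule eventually_mono) (simp add: exp_bump_def divide_inverse exp_minus)
      ultimately show ?thesis by (rule Lim_transform_eventually)
    qed
    moreover have "((\<lambda>y. exp_bump c P y / y) \<longlongrightarrow> 0) (at_left 0)"
    proof (rule tendsto_eventually)
      show "\<forall>\<^sub>F y in at_left 0. exp_bump c P y / y = 0"
        unfolding eventually_at_filter by (rule always_eventually) (simp add: exp_bump_def)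
    qed
    ultimately have "((\<lambda>y. exp_bump c P y / y) \<longlongrightarrow> 0) (at 0)"
      by (intro filterlim_split_at)
    then show ?thesis unfolding has_field_derivative_iff using 3 by (simp add: exp_bump_def)
  qed
qed

definition bump :: "real \<Rightarrow> real \<Rightarrow> real \<Rightarrow> real \<Rightarrow> real" where
  "bump c p q x = exp_bump c 1 (x - p) * exp_bump c 1 (q - x)"

lemma smooth_bump:
  assumes "c > 0"
  shows "smooth (bump c p q)"
proof -
  \<comment> \<open>Finite sums of products of a left and a right flank are closed under
    differentiation by the product rule. Lists of polynomial pairs index them, so
    \<open>range s\<close> serves as the set for \<open>smooth_coinduct\<close>.\<close>
  define s where "s L = (\<lambda>x. \<Sum>(P,Q)\<leftarrow>L. exp_bump c P (x - p) * exp_bump c Q (q - x))" for L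
  have s_Cons: "s ((P, Q) # L) x = exp_bump c P (x - p) * exp_bump c Q (q - x) + s L x" for P Q L x
    by (simp add: s_def)
  let ?D = "\<lambda>P. [:0, 0, 1:] * (smult c P - pderiv P)"
  have "\<exists>L'. \<forall>x. (s L has_real_derivative s L' x) (at x)" for L
  proof (induction L)
    case Nil show ?case by (rule exI[of _ "[]"]) (simp add: s_def)
  next
    case (Cons a L)
    obtain P Q where a: "a = (P, Q)" by force
    from Cons obtain L' where L': "\<forall>x. (s L has_real_derivative s L' x) (at x)" by blast
    have 1: "((\<lambda>x. exp_bump c P (x - p)) has_real_derivative exp_bump c (?D P) (x - p)) (at x)" for x
    proof -
      have "((\<lambda>x. exp_bump c P (x - p)) has_real_derivative exp_bump c (?D P) (x - p) * 1) (at x)"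
        by (rule DERIV_chain2[where g = "\<lambda>x. x - p", OF exp_bump_DERIV[OF assms]]) (auto intro!: derivative_eq_intros)
      then show ?thesis by simp
    qed
    \<comment> \<open>The right flank has inner derivative -1, which is absorbed into the sign of
      the polynomial.\<close>
    have 2: "((\<lambda>x. exp_bump c Q (q - x)) has_real_derivative exp_bump c (- ?D Q) (q - x)) (at x)" for x
    proof -
      have "((\<lambda>x. exp_bump c Q (q - x)) has_real_derivative exp_bump c (?D Q) (q - x) * (-1)) (at x)"
        by (rule DERIV_chain2[where g = "\<lambda>x. q - x", OF exp_bump_DERIV[OF assms]]) (auto intro!: derivative_eq_intros)
      moreover have "exp_bump c (- R) y = exp_bump c R y * (-1)" for R y by (simp add: exp_bump_def)
      ultimately show ?thesis by metis
    qed
    have "(s (a # L) has_real_derivative s ((?D P, Q) # (P, - ?D Q) # L') x) (at x)" for x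
    proof -
      have e: "s (a # L) = (\<lambda>x. exp_bump c P (x - p) * exp_bump c Q (q - x) + s L x)"
        by (rule ext) (simp only: a s_Cons)
      have "s ((?D P, Q) # (P, - ?D Q) # L') x =
          exp_bump c (?D P) (x - p) * exp_bump c Q (q - x) + exp_bump c (- ?D Q) (q - x) * exp_bump c P (x - p) + s L' x"
        by (simp only: s_Cons mult.commute add.assoc)
      then show ?thesis unfolding e by (simp only:) (rule DERIV_add[OF DERIV_mult[OF 1 2] L'[rule_format]])
    qed
    then show ?case by blast
  qed
  then have "smooth (s L)" for L
    by (intro smooth_coinduct[where S = "range s"]) auto
  from this[of "[(1, 1)]"] show ?thesis by (simp add: s_def bump_def[abs_def])
qed

lemma bump_outside: "x \<notin> {p<..<q} \<Longrightarrow> bump c p q x = 0"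
  by (auto simp: bump_def exp_bump_def)

lemma bump_bounds: "c > 0 \<Longrightarrow> 0 \<le> bump c p q x \<and> bump c p q x \<le> 1"
  by (auto simp: bump_def exp_bump_def intro!: mult_le_one)

lemma bump_pos: "x \<in> {p<..<q} \<Longrightarrow> bump c p q x > 0"
  by (auto simp: bump_def exp_bump_def)

text \<open>Supplies test functions converging pointwise to the indicator of an open interval, for
  use with dominated convergence.\<close>

lemma bump_tendsto:
  assumes "x \<in> {p<..<q}"
  shows "(\<lambda>n. bump (1 / (real n + 1)) p q x) \<longlonglongrightarrow> 1"
proof -
  have z: "(\<lambda>n. 1 / (real n + 1)) \<longlonglongrightarrow> 0"
    using LIMSEQ_inverse_real_of_nat by (simp add: inverse_eq_divide add.commute)
  have "(\<lambda>n. exp (- (1 / (real n + 1)) / (x - p)) * exp (- (1 / (real n + 1)) / (q - x))) \<longlonglongrightarrow> exp (- 0 / (x - p)) * exp (- 0 / (q - x))"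
    by (intro tendsto_mult tendsto_exp tendsto_divide tendsto_minus z tendsto_const) (use assms in auto)
  then show ?thesis using assms by (simp add: bump_def exp_bump_def)
qed

lemma test_function_bump:
  assumes "c > 0" "a < p" "q < b"
  shows "test_function a b (bump c p q)"
  unfolding test_function_def
proof
  show "\<forall>n x. (deriv ^^ n) (bump c p q) differentiable at x"
    using smooth_bump[OF assms(1)] by (simp add: smooth_def)
  show "\<exists>a' b'. a < a' \<and> b' < b \<and> (\<forall>x. x \<notin> {a'..b'} \<longrightarrow> bump c p q x = 0)"
  proof (intro exI conjI allI impI)
    show "bump c p q x = 0" if "x \<notin> {p..q}" for x
      by (rule bump_outside) (use that in auto)
  qed (use assms in auto)
qed

lemma test_function_smooth: "test_function a b \<phi> \<Longrightarrow> smooth \<phi>"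
  by (simp add: test_function_def smooth_def)

lemma test_function_ends: "test_function a b \<phi> \<Longrightarrow> \<phi> a = 0 \<and> \<phi> b = 0"
  by (auto simp: test_function_def)

lemma test_function_L2: "test_function a b \<phi> \<Longrightarrow> \<phi> \<in> L2_space a b"
  using smooth_continuous test_function_smooth by blast

lemma test_function_deriv:
  assumes "test_function a b \<phi>"
  shows "test_function a b (deriv \<phi>)"
proof -
  obtain a' b' where ab: "a < a'" "b' < b" "\<forall>x. x \<notin> {a'..b'} \<longrightarrow> \<phi> x = 0"
    using assms by (auto simp: test_function_def)
  have "deriv \<phi> x = 0" if "x \<notin> {a'..b'}" for x
  proof (rule DERIV_imp_deriv)
    have "\<forall>\<^sub>F y in nhds x. y \<in> - {a'..b'}"
      using that by (intro eventually_nhds_in_open) auto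
    then have ev: "\<forall>\<^sub>F y in nhds x. \<phi> y = 0"
      by (rule eventually_mono) (use ab in auto)
    show "(\<phi> has_real_derivative 0) (at x)"
      by (subst DERIV_cong_ev[OF refl ev refl]) simp
  qed
  moreover have "smooth (deriv \<phi>)" using assms test_function_smooth smooth_deriv by blast
  ultimately show ?thesis using ab unfolding test_function_def smooth_def by blast
qed

lemma test_function_funpow_deriv: "test_function a b \<phi> \<Longrightarrow> test_function a b ((deriv ^^ n) \<phi>)"
  by (induction n) (auto intro: test_function_deriv)

text \<open>Bumps tend to the indicator of an interior interval, so \<open>w\<close> has zero
  integral over each of these; continuity of the primitive carries this to intervals touching
  \<open>a\<close> or \<open>b\<close>.\<close>

lemma fundamental_lemma_variations:
  assumes w: "w \<in> L2_space a b"
    and z: "\<And>\<phi>. test_function a b \<phi> \<Longrightarrow> L2_inner a b w \<phi> = 0"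
  shows "AE x in lebesgue_on {a..b}. w x = 0"
proof (cases "a < b")
  case False
  have "integral {x..y} w = 0" if "a \<le> x" "x \<le> y" "y \<le> b" for x y
    using that False by (cases "x = y") auto
  then show ?thesis using vanishing_integrals_imp_AE_zero[OF L2_space_integrable[OF w]] by blast
next
  case True
  have wi: "integrable (lebesgue_on {a..b}) w" by (rule L2_space_integrable[OF w])
  have wi': "w integrable_on {a..b}" by (rule integrable_on_lebesgue_on[OF wi]) simp
  have inner: "integral {p..q} w = 0" if pq: "a < p" "p \<le> q" "q < b" for p q
  proof -
    define f where "f n = (\<lambda>x. w x * bump (1 / (real n + 1)) p q x)" for n
    have t: "test_function a b (bump (1 / (real n + 1)) p q)" for n
      using pq by (intro test_function_bump) auto
    have "(\<lambda>n. integral\<^sup>L (lebesgue_on {a..b}) (f n)) \<longlonglongrightarrow>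
        integral\<^sup>L (lebesgue_on {a..b}) (\<lambda>x. w x * indicator {p<..<q} x)"
    proof (rule integral_dominated_convergence[where w = "\<lambda>x. \<bar>w x\<bar>"])
      show "(\<lambda>x. w x * indicat_real {p<..<q} x) \<in> borel_measurable (lebesgue_on {a..b})"
      proof -
        have "indicat_real {p<..<q} \<in> borel_measurable (lebesgue_on {a..b})"
          by (intro measurable_restrict_space1 borel_measurable_indicator) auto
        then show ?thesis using L2_space_measurable[OF w] by (intro borel_measurable_times)
      qed
      show "f n \<in> borel_measurable (lebesgue_on {a..b})" for n
        unfolding f_def using test_function_L2[OF t] L2_space_measurable w
        by (intro borel_measurable_times) blast+
      show "integrable (lebesgue_on {a..b}) (\<lambda>x. \<bar>w x\<bar>)" using wi by auto
      show "AE x in lebesgue_on {a..b}. (\<lambda>n. f n x) \<longlonglongrightarrow> w x * indicat_real {p<..<q} x"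
      proof (rule AE_I2)
        fix x
        show "(\<lambda>n. f n x) \<longlonglongrightarrow> w x * indicat_real {p<..<q} x"
        proof (cases "x \<in> {p<..<q}")
          case True
          then show ?thesis unfolding f_def using tendsto_mult[OF tendsto_const bump_tendsto[OF True], of "w x"] by simp
        next
          case False
          then show ?thesis unfolding f_def by (simp add: bump_outside)
        qed
      qed
      show "AE x in lebesgue_on {a..b}. norm (f n x) \<le> \<bar>w x\<bar>" for n
        using bump_bounds[of "1 / (real n + 1)" p q]
        by (intro AE_I2) (auto simp: f_def abs_mult intro!: mult_left_le)
    qed
    moreover have "integral\<^sup>L (lebesgue_on {a..b}) (f n) = 0" for n
      using z[OF t] by (simp add: f_def L2_inner_def)
    ultimately have 0: "integral\<^sup>L (lebesgue_on {a..b}) (\<lambda>x. w x * indicat_real {p<..<q} x) = 0"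
      by (simp add: LIMSEQ_const_iff)
    have ii: "integrable (lebesgue_on {a..b}) (\<lambda>x. w x * indicat_real {p<..<q} x)"
      using wi pq by (intro integrable_real_mult_indicator) (auto simp: sets_restrict_space_iff)
    have "integral {a..b} (\<lambda>x. w x * indicat_real {p<..<q} x) = 0"
      using 0 lebesgue_integral_eq_integral[OF ii] by simp
    moreover have "integral {a..b} (\<lambda>x. w x * indicat_real {p<..<q} x) = integral {a..b} (\<lambda>x. if x \<in> {p<..<q} then w x else 0)"
      by (rule Henstock_Kurzweil_Integration.integral_cong) auto
    moreover have "\<dots> = integral {p<..<q} w"
      using pq by (subst integral_restrict_Int) (auto intro!: arg_cong[of _ _ "\<lambda>S. integral S w"])
    moreover have "\<dots> = integral {p..q} w"
      using integral_open_interval_real[of p q w] by simp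
    ultimately show ?thesis by simp
  qed
  \<comment> \<open>By \<open>inner\<close> this primitive is constant on the open interval, and by
    continuity on all of \<open>{a..b}\<close>.\<close>
  define G where "G t = integral {a..t} w" for t
  have Gc: "continuous_on {a..b} G" unfolding G_def by (rule indefinite_integral_continuous_1[OF wi'])
  have Gd: "integral {x..y} w = G y - G x" if "a \<le> x" "x \<le> y" "y \<le> b" for x y
    using Henstock_Kurzweil_Integration.integral_combine[of a x y w] integrable_on_subinterval[OF wi', of a y] that
    by (auto simp: G_def)
  have const: "G x = G ((a + b) / 2)" if "x \<in> {a<..<b}" for x
  proof (cases "x \<le> (a + b) / 2")
    case True
    then show ?thesis using inner[of x "(a+b)/2"] Gd[of x "(a+b)/2"] that \<open>a < b\<close> by auto
  next
    case False
    then show ?thesis using inner[of "(a+b)/2" x] Gd[of "(a+b)/2" x] that \<open>a < b\<close> by auto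
  qed
  have "G x = G ((a + b) / 2)" if "x \<in> {a..b}" for x
  proof (rule continuous_constant_on_closure[of "{a<..<b}" G])
    show "continuous_on (closure {a<..<b}) G" using Gc True by simp
    show "x \<in> closure {a<..<b}" using that True by simp
  qed (rule const)
  note Gk = this
  have "integral {x..y} w = 0" if "a \<le> x" "x \<le> y" "y \<le> b" for x y
  proof -
    have "x \<in> {a..b}" "y \<in> {a..b}" using that by auto
    from Gk[OF this(1)] Gk[OF this(2)] show ?thesis unfolding Gd[OF that] by linarith
  qed
  then show ?thesis using vanishing_integrals_imp_AE_zero[OF wi] by blast
qed

subsection \<open>Weak derivatives\<close>

lemma has_weak_derivD:
  assumes "has_weak_deriv a b n v w"
  shows "v \<in> L2_space a b" "w \<in> L2_space a b"
    "test_function a b \<phi> \<Longrightarrow> L2_inner a b v ((deriv ^^ n) \<phi>) = (- 1) ^ n * L2_inner a b w \<phi>"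
  using assms by (auto simp: has_weak_deriv_def)

lemma has_weak_deriv_unique:
  assumes "has_weak_deriv a b n v w" "has_weak_deriv a b n v w'"
  shows "AE x in lebesgue_on {a..b}. w x = w' x"
proof -
  have "AE x in lebesgue_on {a..b}. w x - w' x = 0"
  proof (rule fundamental_lemma_variations)
    show "(\<lambda>x. w x - w' x) \<in> L2_space a b" using assms has_weak_derivD by blast
    fix \<phi> assume t: "test_function a b \<phi>"
    have "(- 1) ^ n * L2_inner a b w \<phi> = (- 1) ^ n * L2_inner a b w' \<phi>"
      using has_weak_derivD(3)[OF assms(1) t] has_weak_derivD(3)[OF assms(2) t] by simp
    then have "L2_inner a b w \<phi> = L2_inner a b w' \<phi>" by simp
    then show "L2_inner a b (\<lambda>x. w x - w' x) \<phi> = 0"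
      using L2_inner_diff[OF has_weak_derivD(2)[OF assms(1)] has_weak_derivD(2)[OF assms(2)] test_function_L2[OF t]] by simp
  qed
  then show ?thesis by auto
qed

lemma has_weak_deriv_weak_deriv:
  "has_weak_deriv a b n v w \<Longrightarrow> has_weak_deriv a b n v (weak_deriv a b n v)"
  unfolding weak_deriv_def by (rule someI[of "has_weak_deriv a b n v"])

lemma H_space_weak_deriv:
  "v \<in> H_space a b n \<Longrightarrow> i \<le> n \<Longrightarrow> has_weak_deriv a b i v (weak_deriv a b i v)"
  by (auto simp: H_space_def intro: has_weak_deriv_weak_deriv)

lemma has_weak_deriv_0: "v \<in> L2_space a b \<Longrightarrow> has_weak_deriv a b 0 v v"
  by (simp add: has_weak_deriv_def)

lemma has_weak_deriv_add:
  assumes "has_weak_deriv a b n v w" "has_weak_deriv a b n v' w'"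
  shows "has_weak_deriv a b n (\<lambda>x. v x + v' x) (\<lambda>x. w x + w' x)"
  using has_weak_derivD[OF assms(1)] has_weak_derivD[OF assms(2)] 
    test_function_L2[OF test_function_funpow_deriv, of a b _ n] test_function_L2[of a b]
  by (auto simp: has_weak_deriv_def L2_inner_add distrib_left)

lemma has_weak_deriv_scale:
  assumes "has_weak_deriv a b n v w"
  shows "has_weak_deriv a b n (\<lambda>x. c * v x) (\<lambda>x. c * w x)"
  using has_weak_derivD[OF assms] by (auto simp: has_weak_deriv_def L2_inner_scale)

lemma has_weak_deriv_diff:
  assumes "has_weak_deriv a b n v w" "has_weak_deriv a b n v' w'"
  shows "has_weak_deriv a b n (\<lambda>x. v x - v' x) (\<lambda>x. w x - w' x)"
  using has_weak_deriv_add[OF assms(1) has_weak_deriv_scale[OF assms(2), of "-1"]] by simp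

lemma has_weak_deriv_sum:
  assumes "\<And>i. i \<in> I \<Longrightarrow> has_weak_deriv a b n (v i) (w i)"
  shows "has_weak_deriv a b n (\<lambda>x. \<Sum>i\<in>I. v i x) (\<lambda>x. \<Sum>i\<in>I. w i x)"
  using assms
proof (induction I rule: infinite_finite_induct)
  case (insert i I)
  then show ?case using has_weak_deriv_add[of a b n "v i" "w i"] by simp
qed (auto simp: has_weak_deriv_def L2_inner_def)

text \<open>The relation of order \<open>i\<close> tested with \<open>deriv \<phi>\<close> and that
  of order \<open>Suc i\<close> tested with \<phi> have the same left side. Higher weak derivatives
  thus form a chain that can be integrated one step at a time.\<close>

lemma has_weak_deriv_Suc:
  assumes "has_weak_deriv a b i v w" "has_weak_deriv a b (Suc i) v w'"
  shows "has_weak_deriv a b 1 w w'"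
  unfolding has_weak_deriv_def
proof (intro conjI allI impI)
  fix \<phi> assume t: "test_function a b \<phi>"
  have "(- 1) ^ i * L2_inner a b w (deriv \<phi>) = L2_inner a b v ((deriv ^^ i) (deriv \<phi>))"
    using has_weak_derivD(3)[OF assms(1) test_function_deriv[OF t]] by simp
  also have "\<dots> = L2_inner a b v ((deriv ^^ Suc i) \<phi>)" by (simp only: funpow_Suc_right o_apply)
  also have "\<dots> = (- 1) ^ Suc i * L2_inner a b w' \<phi>" using has_weak_derivD(3)[OF assms(2) t] by simp
  finally have "(- 1) ^ i * L2_inner a b w (deriv \<phi>) = (- 1) ^ i * (- L2_inner a b w' \<phi>)" by simp
  then have "L2_inner a b w (deriv \<phi>) = - L2_inner a b w' \<phi>" by (subst (asm) mult_cancel_left) simp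
  then show "L2_inner a b w ((deriv ^^ 1) \<phi>) = (- 1) ^ 1 * L2_inner a b w' \<phi>" by simp
qed (use has_weak_derivD assms in blast)+

lemma integral_abs_bound:
  fixes f :: "real \<Rightarrow> real"
  assumes "f integrable_on S" "g integrable_on S" "\<And>x. x \<in> S \<Longrightarrow> \<bar>f x\<bar> \<le> g x"
  shows "\<bar>integral S f\<bar> \<le> integral S g"
  using Henstock_Kurzweil_Integration.integral_norm_bound_integral[of f S g] assms by simp

text \<open>The bound on increments of \<open>H\<close> is of higher than first order, so \<open>H\<close> has derivative zero.\<close>

lemma indefinite_integral_by_parts:
  assumes w: "w \<in> L2_space a b" and t: "test_function a b \<phi>" and "a < b"
  shows "L2_inner a b (\<lambda>x. integral {a..x} w) (deriv \<phi>) = - L2_inner a b w \<phi>"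
proof -
  define G where "G x = integral {a..x} w" for x
  have wi: "w integrable_on {a..b}" and ai: "(\<lambda>x. \<bar>w x\<bar>) integrable_on {a..b}"
    using L2_space_integrable[OF w] by (auto intro!: integrable_on_lebesgue_on)
  have wi': "w integrable_on {x..y}" and ai': "(\<lambda>x. \<bar>w x\<bar>) integrable_on {x..y}" if "a \<le> x" "y \<le> b" for x y
    using integrable_on_subinterval[OF wi] integrable_on_subinterval[OF ai] that by auto
  have Gc: "continuous_on {a..b} G" unfolding G_def by (rule indefinite_integral_continuous_1[OF wi])
  have GL: "G \<in> L2_space a b" using Gc by auto
  have sm: "smooth \<phi>" "smooth (deriv \<phi>)" using t test_function_smooth smooth_deriv by blast+
  have pc: "continuous_on S \<phi>" "continuous_on S (deriv \<phi>)" for S using sm smooth_continuous by auto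
  have "bounded (deriv \<phi> ` {a..b})" by (intro compact_imp_bounded compact_continuous_image pc) auto
  then obtain B where "\<forall>y\<in>deriv \<phi> ` {a..b}. norm y \<le> B" unfolding bounded_iff by blast
  then have B: "\<bar>deriv \<phi> x\<bar> \<le> B" if "x \<in> {a..b}" for x using that by auto
  have B0: "B \<ge> 0" using B[of a] \<open>a < b\<close> by auto
  define A where "A x = integral {a..x} (\<lambda>x. \<bar>w x\<bar>)" for x
  have Ac: "continuous_on {a..b} A" unfolding A_def by (rule indefinite_integral_continuous_1[OF ai])
  have i1: "(\<lambda>s. G s * deriv \<phi> s) integrable_on {x..y}" if "a \<le> x" "y \<le> b" for x y
    by (intro integrable_continuous_real continuous_intros pc continuous_on_subset[OF Gc]) (use that in auto)
  have i2: "(\<lambda>s. w s * \<phi> s) integrable_on {x..y}" if "a \<le> x" "y \<le> b" for x y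
    using L2_space_integrable_on[OF w test_function_L2[OF t]] that by auto
  define H where "H x = G x * \<phi> x - integral {a..x} (\<lambda>s. G s * deriv \<phi> s) - integral {a..x} (\<lambda>s. w s * \<phi> s)" for x
  have Hle: "\<bar>H y - H x\<bar> \<le> 2 * B * (y - x) * (A y - A x)" if xy: "a \<le> x" "x \<le> y" "y \<le> b" for x y
  proof -
    note comb = Henstock_Kurzweil_Integration.integral_combine[of a x y, OF xy(1,2), symmetric]
    have e1: "G y - G x = integral {x..y} w" using comb[OF wi'] xy by (simp add: G_def)
    have e2: "A y - A x = integral {x..y} (\<lambda>x. \<bar>w x\<bar>)" using comb[OF ai'] xy by (simp add: A_def)
    have A0: "integral {x..z} (\<lambda>x. \<bar>w x\<bar>) \<le> A y - A x" if "x \<le> z" "z \<le> y" for z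
      unfolding e2 by (rule integral_subset_le) (use that xy ai' in auto)
    have AA: "0 \<le> A y - A x" unfolding e2 by (rule Henstock_Kurzweil_Integration.integral_nonneg) (use xy ai' in auto)
    have ftc: "(deriv \<phi> has_integral \<phi> y - \<phi> x) {x..y}"
      by (rule fundamental_theorem_of_calculus)
        (use xy smooth_DERIV[OF sm(1)] in \<open>auto simp: has_real_derivative_iff_has_vector_derivative[symmetric] intro: has_field_derivative_at_within\<close>)
    have e3: "integral {x..y} (\<lambda>r. w r * (\<phi> y - \<phi> r)) = (G y - G x) * \<phi> y - integral {x..y} (\<lambda>s. w s * \<phi> s)"
      using i2[OF xy(1,3)] wi'[OF xy(1,3)] by (simp add: right_diff_distrib Henstock_Kurzweil_Integration.integral_diff e1 integrable_on_mult_left)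
    have e4: "integral {x..y} (\<lambda>r. (G x - G r) * deriv \<phi> r) = G x * (\<phi> y - \<phi> x) - integral {x..y} (\<lambda>s. G s * deriv \<phi> s)"
      using i1[OF xy(1,3)] ftc by (simp add: left_diff_distrib Henstock_Kurzweil_Integration.integral_diff integral_unique integrable_on_mult_right has_integral_integrable)
    \<comment> \<open>Each integrand keeps a factor that is small for \<open>y\<close> near
      \<open>x\<close>: an increment of \<phi>, of size \<open>y - x\<close>, or an increment of
      \<open>G\<close>, bounded by that of \<open>A\<close>.\<close>
    have "H y - H x = integral {x..y} (\<lambda>r. w r * (\<phi> y - \<phi> r)) + integral {x..y} (\<lambda>r. (G x - G r) * deriv \<phi> r)"
      unfolding e3 e4 H_def comb[OF i1[OF order.refl xy(3)]] comb[OF i2[OF order.refl xy(3)]] by (simp add: algebra_simps)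
    moreover have "\<bar>integral {x..y} (\<lambda>r. w r * (\<phi> y - \<phi> r))\<bar> \<le> integral {x..y} (\<lambda>r. B * (y - x) * \<bar>w r\<bar>)"
    proof (rule integral_abs_bound)
      show "(\<lambda>r. w r * (\<phi> y - \<phi> r)) integrable_on {x..y}"
        using i2[OF xy(1,3)] wi'[OF xy(1,3)] by (auto simp: right_diff_distrib intro!: integrable_diff integrable_on_mult_left)
      show "(\<lambda>r. B * (y - x) * \<bar>w r\<bar>) integrable_on {x..y}" using ai'[OF xy(1,3)] by (rule integrable_on_mult_right)
      fix r assume r: "r \<in> {x..y}"
      have "norm (\<phi> y - \<phi> r) \<le> B * norm (y - r)"
        by (rule field_differentiable_bound[of "{x..y}" \<phi> "deriv \<phi>"])
          (use r xy B smooth_DERIV[OF sm(1)] in \<open>auto intro: has_field_derivative_at_within\<close>)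
      also have "\<dots> \<le> B * (y - x)" using r B0 by (intro mult_left_mono) auto
      finally show "\<bar>w r * (\<phi> y - \<phi> r)\<bar> \<le> B * (y - x) * \<bar>w r\<bar>"
        by (simp add: abs_mult mult.commute[of _ "\<bar>w r\<bar>"] mult_left_mono)
    qed
    moreover have "integral {x..y} (\<lambda>r. B * (y - x) * \<bar>w r\<bar>) = B * (y - x) * (A y - A x)" by (simp add: e2)
    moreover have "\<bar>integral {x..y} (\<lambda>r. (G x - G r) * deriv \<phi> r)\<bar> \<le> integral {x..y} (\<lambda>r. B * (A y - A x))"
    proof (rule integral_abs_bound)
      show "(\<lambda>r. (G x - G r) * deriv \<phi> r) integrable_on {x..y}"
        by (intro integrable_continuous_real continuous_intros pc continuous_on_subset[OF Gc]) (use xy in auto)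
      fix r assume r: "r \<in> {x..y}"
      have "G r - G x = integral {x..r} w"
        using Henstock_Kurzweil_Integration.integral_combine[of a x r w] wi'[of a r] xy r by (simp add: G_def)
      moreover have "\<bar>integral {x..r} w\<bar> \<le> integral {x..r} (\<lambda>x. \<bar>w x\<bar>)"
        by (rule integral_abs_bound) (use wi' ai' xy r in auto)
      ultimately have "\<bar>G x - G r\<bar> \<le> A y - A x" using A0[of r] r by auto
      then show "\<bar>(G x - G r) * deriv \<phi> r\<bar> \<le> B * (A y - A x)"
        unfolding abs_mult using B[of r] r xy AA by (subst mult.commute) (intro mult_mono, auto)
    qed auto
    moreover have "integral {x..y} (\<lambda>r. B * (A y - A x)) = B * (y - x) * (A y - A x)" using xy by simp
    ultimately show ?thesis by linarith
  qed
  have "(H has_real_derivative 0) (at x within {a..b})" if x: "x \<in> {a..b}" for x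
    unfolding has_field_derivative_iff
  proof (rule Lim_null_comparison)
    have "((\<lambda>y. A y - A x) \<longlongrightarrow> A x - A x) (at x within {a..b})"
      using Ac x by (intro tendsto_diff) (auto simp: continuous_on_def)
    then show "((\<lambda>y. 2 * B * \<bar>A y - A x\<bar>) \<longlongrightarrow> 0) (at x within {a..b})"
      by (auto intro!: tendsto_mult_right_zero tendsto_rabs_zero)
    have "norm ((H y - H x) / (y - x) - 0) \<le> 2 * B * \<bar>A y - A x\<bar>" if y: "y \<in> {a..b}" "y \<noteq> x" for y
    proof -
      have "\<bar>H y - H x\<bar> \<le> 2 * B * \<bar>y - x\<bar> * \<bar>A y - A x\<bar>"
      proof (cases "x \<le> y")
        case True
        have "2 * B * (y - x) * (A y - A x) \<le> 2 * B * \<bar>y - x\<bar> * \<bar>A y - A x\<bar>"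
          using True B0 by (simp add: mult_left_mono)
        then show ?thesis using Hle[of x y] x y True by auto
      next
        case False
        have "2 * B * (x - y) * (A x - A y) \<le> 2 * B * \<bar>y - x\<bar> * \<bar>A y - A x\<bar>"
          using False B0 by (simp add: mult_left_mono abs_minus_commute[of y x] abs_minus_commute[of "A y" "A x"])
        then show ?thesis using Hle[of y x] x y False by auto
      qed
      then show ?thesis using y by (simp add: abs_divide divide_le_eq algebra_simps)
    qed
    then show "\<forall>\<^sub>F y in at x within {a..b}. norm ((H y - H x) / (y - x)) \<le> 2 * B * \<bar>A y - A x\<bar>"
      by (auto simp: eventually_at_filter)
  qed
  then have "\<exists>k. \<forall>x\<in>{a..b}. H x = k"
    by (intro has_field_derivative_zero_constant) auto
  then have "H a = H b" using \<open>a < b\<close> by auto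
  then have "integral {a..b} (\<lambda>s. G s * deriv \<phi> s) = - integral {a..b} (\<lambda>s. w s * \<phi> s)"
    using test_function_ends[OF t] by (simp add: H_def)
  then show ?thesis
    using L2_inner_integral[OF GL test_function_L2[OF test_function_deriv[OF t]]] L2_inner_integral[OF w test_function_L2[OF t]]
    by (simp add: G_def[abs_def])
qed

lemma smooth_antiderivative_exists:
  assumes "smooth g"
  obtains F where "\<And>x. (F has_real_derivative g x) (at x)"
proof -
  have "\<exists>F. \<forall>x. - \<infinity> < ereal x \<longrightarrow> ereal x < \<infinity> \<longrightarrow> (F has_vector_derivative g x) (at x)"
    by (rule einterval_antiderivative) (use smooth_DERIV[OF assms] DERIV_isCont in auto)
  then show ?thesis using that by (auto simp: has_real_derivative_iff_has_vector_derivative)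
qed

text \<open>An antiderivative is constant on either side of the support; mean zero makes the two
  constants equal, so subtracting one of them leaves compact support.\<close>

lemma test_function_antiderivative:
  assumes g: "test_function a b g" and z: "integral {a..b} g = 0" and "a < b"
  obtains \<phi> where "test_function a b \<phi>" "deriv \<phi> = g"
proof -
  obtain a' b' where ab: "a < a'" "b' < b" "\<And>x. x \<notin> {a'..b'} \<Longrightarrow> g x = 0"
    using g by (auto simp: test_function_def)
  \<comment> \<open>The interval given by \<open>test_function\<close> may be empty; including the
    midpoint ensures \<open>p \<le> q\<close>.\<close>
  define p where "p = min a' ((a + b) / 2)"
  define q where "q = max b' ((a + b) / 2)"
  have pq: "a < p" "p \<le> q" "q < b" and gz: "\<And>x. x < p \<or> q < x \<Longrightarrow> g x = 0"
    using ab \<open>a < b\<close> by (auto simp: p_def q_def)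
  obtain F where F: "\<And>x. (F has_real_derivative g x) (at x)"
    using smooth_antiderivative_exists[OF test_function_smooth[OF g]] by blast
  have FT: "(g has_integral F y - F x) {x..y}" if "x \<le> y" for x y
    by (rule fundamental_theorem_of_calculus[OF that])
      (use F in \<open>auto simp: has_real_derivative_iff_has_vector_derivative[symmetric] intro: has_field_derivative_at_within\<close>)
  have Fab: "F b = F a" using FT[of a b] \<open>a < b\<close> z by (auto dest: integral_unique)
  have low: "F x = F a" if "x < p" for x
  proof -
    have "F y = F x" if "x \<le> y" "y < p" for x y
    proof -
      have "(g has_integral 0) {x..y}" using gz that by (intro has_integral_is_0) auto
      then show ?thesis using FT[OF that(1)] by (auto dest: has_integral_unique)
    qed
    then show ?thesis using that pq by (metis linorder_linear)
  qed
  have high: "F x = F a" if "x > q" for x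
  proof -
    have "F y = F x" if "x \<le> y" "q < x" for x y
    proof -
      have "(g has_integral 0) {x..y}" using gz that by (intro has_integral_is_0) auto
      then show ?thesis using FT[OF that(1)] by (auto dest: has_integral_unique)
    qed
    then show ?thesis using that pq Fab by (metis linorder_linear)
  qed
  define \<phi> where "\<phi> x = F x - F a" for x
  have d: "(\<phi> has_real_derivative g x) (at x)" for x
    unfolding \<phi>_def using F[of x] by (auto intro!: derivative_eq_intros)
  have "smooth \<phi>" by (rule smooth_antideriv[OF test_function_smooth[OF g] d])
  moreover have "\<phi> x = 0" if "x \<notin> {p..q}" for x using that low high by (auto simp: \<phi>_def not_le)
  ultimately have "test_function a b \<phi>" using pq by (auto simp: test_function_def smooth_def)
  moreover have "deriv \<phi> = g" using d by (auto intro: DERIV_imp_deriv)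
  ultimately show ?thesis using that by blast
qed

lemma test_function_lincomb:
  assumes "test_function a b f" "test_function a b g"
  shows "test_function a b (\<lambda>x. c * f x + d * g x)"
proof -
  obtain a1 b1 where 1: "a < a1" "b1 < b" "\<And>x. x \<notin> {a1..b1} \<Longrightarrow> f x = 0"
    using assms(1) by (auto simp: test_function_def)
  obtain a2 b2 where 2: "a < a2" "b2 < b" "\<And>x. x \<notin> {a2..b2} \<Longrightarrow> g x = 0"
    using assms(2) by (auto simp: test_function_def)
  have "smooth (\<lambda>x. c * f x + d * g x)" using assms test_function_smooth smooth_lincomb by blast
  moreover have "c * f x + d * g x = 0" if "x \<notin> {min a1 a2..max b1 b2}" for x
  proof -
    have "x \<notin> {a1..b1}" "x \<notin> {a2..b2}" using that by auto
    then show ?thesis using 1(3) 2(3) by simp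
  qed
  ultimately show ?thesis using 1 2 unfolding test_function_def smooth_def
    by (intro conjI exI[of _ "min a1 a2"] exI[of _ "max b1 b2"]) auto
qed

text \<open>Lemma of du Bois-Reymond: \<open>v\<close> minus the primitive of \<open>w\<close> is
  orthogonal to all derivatives of test functions, that is to all test functions of mean zero, and
  is therefore constant almost everywhere.\<close>

lemma weak_deriv_imp_indefinite_integral:
  assumes vw: "has_weak_deriv a b 1 v w" and "a < b"
  obtains C where "AE x in lebesgue_on {a..b}. v x = C + integral {a..x} w"
proof -
  note L = has_weak_derivD[OF vw]
  define G where "G x = integral {a..x} w" for x
  have wi: "w integrable_on {a..b}" using L2_space_integrable[OF L(2)] by (auto intro!: integrable_on_lebesgue_on)
  have GL: "G \<in> L2_space a b" unfolding G_def[abs_def] by (intro continuous_L2_space indefinite_integral_continuous_1[OF wi])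
  \<comment> \<open>A fixed test function of nonzero mean: subtracting a multiple of it gives any
    test function mean zero.\<close>
  define \<eta>0 where "\<eta>0 = bump 1 ((2 * a + b) / 3) ((a + 2 * b) / 3)"
  have t0: "test_function a b \<eta>0" unfolding \<eta>0_def by (rule test_function_bump) (use \<open>a < b\<close> in auto)
  define I where "I = integral {a..b} \<eta>0"
  have "I \<noteq> 0"
  proof
    assume "I = 0"
    then have "\<forall>x\<in>{a..b}. \<eta>0 x = 0" unfolding I_def
      by (subst (asm) integral_eq_0_iff) (use \<open>a < b\<close> smooth_continuous[OF test_function_smooth[OF t0]] bump_bounds[of 1] in \<open>auto simp: \<eta>0_def\<close>)
    then have "\<eta>0 ((a + b) / 2) = 0" using \<open>a < b\<close> by auto
    moreover have "\<eta>0 ((a + b) / 2) > 0" unfolding \<eta>0_def by (rule bump_pos) (use \<open>a < b\<close> in auto)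
    ultimately show False by simp
  qed
  define D where "D x = v x - G x" for x
  have DL: "D \<in> L2_space a b" unfolding D_def[abs_def] using L GL by auto
  define K where "K = L2_inner a b D \<eta>0 / I"
  have oneL: "(\<lambda>_. K) \<in> L2_space a b" by auto
  have "AE x in lebesgue_on {a..b}. D x - K = 0"
  proof (rule fundamental_lemma_variations)
    show DK: "(\<lambda>x. D x - K) \<in> L2_space a b" using DL oneL by auto
    fix \<psi> assume t: "test_function a b \<psi>"
    define c where "c = integral {a..b} \<psi> / I"
    define g where "g x = 1 * \<psi> x + (- c) * \<eta>0 x" for x
    have tg: "test_function a b g" unfolding g_def[abs_def] by (rule test_function_lincomb[OF t t0])
    have ii: "\<psi> integrable_on {a..b}" "\<eta>0 integrable_on {a..b}"
      using t t0 test_function_smooth smooth_continuous by (blast intro: integrable_continuous_real)+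
    have "integral {a..b} g = 0"
      unfolding g_def using ii \<open>I \<noteq> 0\<close>
      by (simp add: Henstock_Kurzweil_Integration.integral_diff integrable_on_mult_right c_def flip: I_def)
    then obtain \<phi> where p: "test_function a b \<phi>" "deriv \<phi> = g"
      using test_function_antiderivative[OF tg _ \<open>a < b\<close>] by blast
    have "L2_inner a b v g = - L2_inner a b w \<phi>" using L(3)[OF p(1)] p(2) by simp
    also have "\<dots> = L2_inner a b G g"
      using indefinite_integral_by_parts[OF L(2) p(1) \<open>a < b\<close>] p(2) by (simp add: G_def[abs_def])
    finally have "L2_inner a b D g = 0"
      unfolding D_def using L2_inner_diff[OF L(1) GL test_function_L2[OF tg]] by simp
    moreover have "L2_inner a b D g = L2_inner a b D \<psi> - c * L2_inner a b D \<eta>0"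
    proof -
      have "L2_inner a b (\<lambda>x. \<psi> x - c * \<eta>0 x) D = L2_inner a b \<psi> D - c * L2_inner a b \<eta>0 D"
        using L2_inner_diff[OF test_function_L2[OF t] L2_space_scale[OF test_function_L2[OF t0], of c] DL] by (simp add: L2_inner_scale)
      moreover have "g = (\<lambda>x. \<psi> x - c * \<eta>0 x)" by (auto simp: g_def)
      ultimately show ?thesis by (simp add: L2_inner_commute[of a b D])
    qed
    ultimately have "L2_inner a b D \<psi> = c * L2_inner a b D \<eta>0" by simp
    moreover have "L2_inner a b (\<lambda>_. K) \<psi> = K * integral {a..b} \<psi>"
      using L2_inner_integral[OF oneL test_function_L2[OF t]] by simp
    ultimately show "L2_inner a b (\<lambda>x. D x - K) \<psi> = 0"
      using L2_inner_diff[OF DL oneL test_function_L2[OF t]] by (simp add: K_def c_def)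
  qed
  then have "AE x in lebesgue_on {a..b}. v x = K + integral {a..x} w"
    by (rule eventually_mono) (auto simp: D_def G_def)
  then show ?thesis using that by blast
qed

section \<open>Continuous representatives of weak derivatives\<close>

lemma continuous_AE_zero:
  fixes g :: "real \<Rightarrow> real"
  assumes "continuous_on {a..b} g" "a < b" "AE x in lebesgue_on {a..b}. g x = 0" "x \<in> {a..b}"
  shows "g x = 0"
proof -
  have gL: "g \<in> L2_space a b" using assms by auto
  have "L2_norm a b g = L2_norm a b (\<lambda>_. 0)" by (rule L2_norm_AE_cong) (use assms gL in auto)
  then have "integral {a..b} (\<lambda>x. (g x)\<^sup>2) = 0" using L2_norm_sq_integral[OF gL] by (simp add: L2_norm_def L2_inner_def)
  then have "\<forall>x\<in>{a..b}. (g x)\<^sup>2 = 0"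
    by (subst (asm) integral_eq_0_iff) (use assms in \<open>auto intro!: continuous_intros\<close>)
  then show ?thesis using assms by auto
qed

lemma integral_AE_cong:
  assumes "f \<in> L2_space a b" "g \<in> L2_space a b" "AE x in lebesgue_on {a..b}. f x = g x"
    "a \<le> x" "x \<le> y" "y \<le> b"
  shows "integral {x..y} f = integral {x..y} g"
proof -
  have h: "(\<lambda>x. f x - g x) \<in> L2_space a b" using assms by auto
  have "L2_norm a b (\<lambda>x. f x - g x) = L2_norm a b (\<lambda>x. 0)"
    by (rule L2_norm_AE_cong) (use assms h in auto)
  then have "L2_norm a b (\<lambda>x. f x - g x) = 0" by (simp add: L2_norm_def L2_inner_def)
  then have "integral {x..y} (\<lambda>x. f x - g x) = 0" using L2_integral_bound[OF h assms(4-6)] by simp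
  moreover have "f integrable_on {x..y}" "g integrable_on {x..y}"
    using L2_space_subinterval[OF assms(1), of x y] L2_space_subinterval[OF assms(2), of x y] assms(4-6)
    by (auto intro!: integrable_on_lebesgue_on L2_space_integrable)
  ultimately show ?thesis by (simp add: Henstock_Kurzweil_Integration.integral_diff)
qed

text \<open>Each weak derivative of order below \<open>n\<close> is almost everywhere the primitive
  of the next one. The functions \<open>D j\<close> give meaning to point values of derivatives, at
  nodes and at the boundary, which \<open>weak_deriv\<close> cannot.\<close>

lemma H_space_representatives:
  assumes v: "continuous_on {a..b} v" and H: "v \<in> H_space a b n" and "a < b"
  obtains D where "D 0 = v" "\<And>j. j < n \<Longrightarrow> continuous_on {a..b} (D j)"
    "\<And>j. j < n \<Longrightarrow> AE x in lebesgue_on {a..b}. D j x = weak_deriv a b j v x"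
    "\<And>j x y. j < n \<Longrightarrow> a \<le> x \<Longrightarrow> x \<le> y \<Longrightarrow> y \<le> b \<Longrightarrow> D j y - D j x = integral {x..y} (weak_deriv a b (Suc j) v)"
    "\<And>j x. Suc j < n \<Longrightarrow> x \<in> {a..b} \<Longrightarrow> (D j has_real_derivative D (Suc j) x) (at x within {a..b})"
proof -
  define w where "w j = weak_deriv a b j v" for j
  have ww: "has_weak_deriv a b j v (w j)" if "j \<le> n" for j
    using H_space_weak_deriv[OF H that] by (simp add: w_def)
  have wL: "w j \<in> L2_space a b" if "j \<le> n" for j using has_weak_derivD(2)[OF ww[OF that]] .
  have wi: "w j integrable_on {a..b}" if "j \<le> n" for j
    using L2_space_integrable[OF wL[OF that]] by (auto intro!: integrable_on_lebesgue_on)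
  have "\<exists>C. AE x in lebesgue_on {a..b}. w j x = C + integral {a..x} (w (Suc j))" if "j < n" for j
  proof -
    have "has_weak_deriv a b 1 (w j) (w (Suc j))"
      by (rule has_weak_deriv_Suc[OF ww ww]) (use that in auto)
    from weak_deriv_imp_indefinite_integral[OF this \<open>a < b\<close>] show ?thesis by blast
  qed
  then obtain C where C: "\<And>j. j < n \<Longrightarrow> AE x in lebesgue_on {a..b}. w j x = C j + integral {a..x} (w (Suc j))"
    by metis
  \<comment> \<open>At order 0 the given continuous \<open>v\<close> is kept, so that no nodal value
    changes; by continuity it agrees with the primitive everywhere (\<open>D0\<close>).\<close>
  define D where "D j = (if j = 0 then v else (\<lambda>x. C j + integral {a..x} (w (Suc j))))" for j
  have Ec: "continuous_on {a..b} (\<lambda>x. C j + integral {a..x} (w (Suc j)))" if "j < n" for j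
    using that by (intro continuous_intros indefinite_integral_continuous_1 wi) auto
  have D0: "v x = C 0 + integral {a..x} (w (Suc 0))" if "0 < n" "x \<in> {a..b}" for x
  proof -
    have vw: "AE x in lebesgue_on {a..b}. v x = w 0 x"
      using has_weak_deriv_unique[OF has_weak_deriv_0[of v a b] ww[of 0]] v by auto
    have "v x - (C 0 + integral {a..x} (w (Suc 0))) = 0"
    proof (rule continuous_AE_zero[OF _ \<open>a < b\<close> _ that(2)])
      show "continuous_on {a..b} (\<lambda>x. v x - (C 0 + integral {a..x} (w (Suc 0))))"
        by (intro continuous_on_diff v Ec that)
      show "AE x in lebesgue_on {a..b}. v x - (C 0 + integral {a..x} (w (Suc 0))) = 0"
        using vw C[OF that(1)] by eventually_elim simp
    qed
    then show ?thesis by simp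
  qed
  have DE: "D j x = C j + integral {a..x} (w (Suc j))" if "j < n" "x \<in> {a..b}" for j x
    using D0[of x] that by (auto simp: D_def)
  have Dc: "continuous_on {a..b} (D j)" if "j < n" for j
    using Ec[OF that] DE[OF that] by (subst continuous_on_cong[OF refl]) auto
  have Dw: "AE x in lebesgue_on {a..b}. D j x = w j x" if "j < n" for j
  proof -
    have "AE x in lebesgue_on {a..b}. x \<in> {a..b}" by (rule AE_I2) simp
    with C[OF that] show ?thesis by eventually_elim (use DE that in auto)
  qed
  have Di: "D j y - D j x = integral {x..y} (w (Suc j))" if "j < n" "a \<le> x" "x \<le> y" "y \<le> b" for j x y
    using DE[OF that(1)] that Henstock_Kurzweil_Integration.integral_combine[of a x y "w (Suc j)"]
      integrable_on_subinterval[OF wi[of "Suc j"], of a y] by auto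
  have Dd: "(D j has_real_derivative D (Suc j) x) (at x within {a..b})" if "Suc j < n" "x \<in> {a..b}" for j x
  proof -
    have e: "D j y = D j a + integral {a..y} (D (Suc j))" if "y \<in> {a..b}" for y
    proof -
      have "integral {a..y} (D (Suc j)) = integral {a..y} (w (Suc j))"
        using Dc[of "Suc j"] wL[of "Suc j"] Dw[of "Suc j"] \<open>Suc j < n\<close> that by (intro integral_AE_cong) auto
      then show ?thesis using Di[of j a y] \<open>Suc j < n\<close> that by auto
    qed
    have "((\<lambda>y. D j a + integral {a..y} (D (Suc j))) has_real_derivative D (Suc j) x) (at x within {a..b})"
      using integral_has_real_derivative[OF Dc[OF that(1)] that(2)] by (auto intro!: derivative_eq_intros)
    then show ?thesis
      by (rule has_field_derivative_transform_within[OF _ zero_less_one that(2)]) (rule e[symmetric])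
  qed
  show ?thesis by (rule that[of D]) (use Dc Dw Di Dd in \<open>auto simp: w_def D_def\<close>)
qed

subsection \<open>Local polynomial approximation\<close>

lemma pderiv_surj:
  fixes p :: "real poly"
  obtains q where "pderiv q = p" "degree q \<le> Suc (degree p)"
proof
  let ?q = "\<Sum>i\<le>degree p. monom (coeff p i / real (Suc i)) (Suc i)"
  have "pderiv ?q = (\<Sum>i\<le>degree p. monom (coeff p i) i)"
  proof -
    have "pderiv (sum f A) = (\<Sum>x\<in>A. pderiv (f x))" for f :: "nat \<Rightarrow> real poly" and A
      using higher_pderiv_sum[of 1 f A] by simp
    then show ?thesis by (simp add: pderiv_monom del: of_nat_Suc)
  qed
  then show "pderiv ?q = p" by (simp add: poly_as_sum_of_monoms)
  show "degree ?q \<le> Suc (degree p)"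
    by (intro degree_sum_le) (auto intro!: order.trans[OF degree_monom_le])
qed

text \<open>Built from the top derivative downwards: a constant approximates \<open>D m\<close>, and
  each antiderivative matched at \<open>c\<close> gains a factor \<open>d - c\<close>. Only
  increments of \<open>D m\<close> enter, which are later bounded by the L2 norm of one further weak
  derivative.\<close>

lemma taylor_poly_exists:
  fixes D :: "nat \<Rightarrow> real \<Rightarrow> real"
  assumes "c < d" "\<And>i x. i < m \<Longrightarrow> x \<in> {c..d} \<Longrightarrow> (D i has_real_derivative D (Suc i) x) (at x within {c..d})"
    and "\<And>x. x \<in> {c..d} \<Longrightarrow> \<bar>D m x - D m c\<bar> \<le> e"
  shows "\<exists>P. degree P \<le> m \<and> (\<forall>i\<le>m. \<forall>x\<in>{c..d}. \<bar>D i x - poly ((pderiv ^^ i) P) x\<bar> \<le> (d - c) ^ (m - i) * e)"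
  using assms
proof (induction m arbitrary: D)
  case 0
  then show ?case by (intro exI[of _ "[:D 0 c:]"]) auto
next
  case (Suc m)
  have "\<exists>P. degree P \<le> m \<and> (\<forall>i\<le>m. \<forall>x\<in>{c..d}. \<bar>D (Suc i) x - poly ((pderiv ^^ i) P) x\<bar> \<le> (d - c) ^ (m - i) * e)"
    by (rule Suc.IH[of "\<lambda>i. D (Suc i)"]) (use Suc.prems in auto)
  then obtain Q where Q: "degree Q \<le> m"
    "\<And>i x. i \<le> m \<Longrightarrow> x \<in> {c..d} \<Longrightarrow> \<bar>D (Suc i) x - poly ((pderiv ^^ i) Q) x\<bar> \<le> (d - c) ^ (m - i) * e"
    by blast
  obtain R where R: "pderiv R = Q" "degree R \<le> Suc (degree Q)" by (rule pderiv_surj)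
  define P where "P = R + [:D 0 c - poly R c:]"
  have P: "pderiv P = Q" "poly P c = D 0 c" by (auto simp: P_def R pderiv_add pderiv_pCons)
  have dP: "degree P \<le> Suc m" unfolding P_def using R(2) Q(1) by (intro degree_add_le) auto
  have "\<bar>D i x - poly ((pderiv ^^ i) P) x\<bar> \<le> (d - c) ^ (Suc m - i) * e" if i: "i \<le> Suc m" and x: "x \<in> {c..d}" for i x
  proof (cases i)
    case (Suc j)
    then have "(pderiv ^^ i) P = (pderiv ^^ j) Q" by (simp only: funpow_Suc_right o_apply P)
    then show ?thesis using Q(2)[of j x] Suc i x by simp
  next
    case 0
    have "norm ((D 0 x - poly P x) - (D 0 c - poly P c)) \<le> ((d - c) ^ m * e) * norm (x - c)"
    proof (rule field_differentiable_bound[of "{c..d}"])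
      fix z assume z: "z \<in> {c..d}"
      show "((\<lambda>x. D 0 x - poly P x) has_field_derivative (D (Suc 0) z - poly Q z)) (at z within {c..d})"
        using Suc.prems(2)[of 0 z] z poly_DERIV[of P z] P(1)
        by (auto intro!: DERIV_diff intro: has_field_derivative_at_within)
      show "norm (D (Suc 0) z - poly Q z) \<le> (d - c) ^ m * e" using Q(2)[of 0 z] z by simp
    qed (use x in auto)
    also have "\<dots> \<le> ((d - c) ^ m * e) * (d - c)"
    proof (rule mult_left_mono)
      have "0 \<le> e" using Suc.prems(3)[of c] \<open>c < d\<close> by auto
      then show "0 \<le> (d - c) ^ m * e" using \<open>c < d\<close> by simp
    qed (use x in auto)
    finally show ?thesis using P(2) 0 by (simp add: algebra_simps)
  qed
  then show ?case using dP by blast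
qed

subsection \<open>Polynomials on intervals\<close>

lemma poly_L2_space [simp, intro]: "poly P \<in> L2_space a b"
  by (intro continuous_L2_space continuous_intros)

lemma integral_affine_01:
  fixes f :: "real \<Rightarrow> real"
  assumes "c < d" "continuous_on {c..d} f"
  shows "integral {c..d} f = (d - c) * integral {0..1} (\<lambda>t. f (c + (d - c) * t))"
proof -
  have "(f has_integral integral {c..d} f) (cbox c d)"
    using assms(2) by (simp add: integrable_continuous_real integrable_integral)
  then have "((\<lambda>x. f ((d - c) *\<^sub>R x + c)) has_integral (1 / (\<bar>d - c\<bar> ^ DIM(real))) *\<^sub>R integral {c..d} f)
      ((\<lambda>x. (1 / (d - c)) *\<^sub>R x + - ((1 / (d - c)) *\<^sub>R c)) ` cbox c d)"
    by (rule has_integral_affinity) (use assms in auto)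
  moreover have "(\<lambda>x. (1 / (d - c)) *\<^sub>R x + - ((1 / (d - c)) *\<^sub>R c)) ` cbox c d = {0..1}"
  proof -
    have "(1 / (d - c)) *\<^sub>R d + - ((1 / (d - c)) *\<^sub>R c) = (1 / (d - c)) * (d - c)"
      by (metis real_scaleR_def right_diff_distrib diff_conv_add_uminus)
    moreover have "(1 / (d - c)) * (d - c) = 1" using assms(1) by simp
    ultimately have "(1 / (d - c)) *\<^sub>R d + - ((1 / (d - c)) *\<^sub>R c) = 1" by (rule trans)
    then show ?thesis using assms(1) by (subst image_affinity_cbox) simp
  qed
  ultimately have "((\<lambda>x. f ((d - c) *\<^sub>R x + c)) has_integral (1 / (d - c)) * integral {c..d} f) {0..1}"
    using assms(1) by simp
  then have "integral {0..1} (\<lambda>t. f (c + (d - c) * t)) = (1 / (d - c)) * integral {c..d} f"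
    by (intro integral_unique) (simp add: add.commute)
  then show ?thesis using assms(1) by simp
qed

lemma poly_altdef_le: "degree (P :: real poly) \<le> n \<Longrightarrow> poly P x = (\<Sum>i\<le>n. coeff P i * x ^ i)"
  unfolding poly_altdef by (intro sum.mono_neutral_left) (auto simp: coeff_eq_0)

lemma L2_norm_poly_scale:
  assumes "c < d"
  shows "(L2_norm c d (poly P))\<^sup>2 = (d - c) * (L2_norm 0 1 (poly (pcompose P [:c, d - c:])))\<^sup>2"
  unfolding L2_norm_sq_integral[OF poly_L2_space]
  using integral_affine_01[OF assms, of "\<lambda>x. (poly P x)\<^sup>2"]
  by (simp add: poly_pcompose continuous_intros mult.commute)

text \<open>Subtracting \<open>2\<^sup>n P(x/2)\<close> eliminates the coefficient of \<open>x\<^sup>n\<close>.\<close>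

lemma poly_coeff_bound:
  "\<exists>C\<ge>0. \<forall>P :: real poly. degree P \<le> r \<longrightarrow> (\<forall>i. \<bar>coeff P i\<bar> \<le> C * L2_norm 0 1 (poly P))"
proof (induction r)
  case 0
  have "\<bar>coeff P i\<bar> \<le> 1 * L2_norm 0 1 (poly P)" if deg: "degree P \<le> 0" for P :: "real poly" and i
  proof -
    obtain p where p: "P = [:p:]" using deg degree_eq_zeroE[of P] by blast
    have "(L2_norm 0 1 (poly P))\<^sup>2 = p\<^sup>2" using L2_norm_sq_integral[OF poly_L2_space, of 0 1 P] by (simp add: p)
    then have "L2_norm 0 1 (poly P) = \<bar>p\<bar>" by (metis L2_norm_nonneg abs_of_nonneg power2_eq_iff real_sqrt_abs)
    then show ?thesis by (cases i) (auto simp: p)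
  qed
  then show ?case by (intro exI[of _ 1]) auto
next
  case (Suc r)
  then obtain C where C: "C \<ge> 0" "\<And>P i. degree P \<le> r \<Longrightarrow> \<bar>coeff P i\<bar> \<le> C * L2_norm 0 1 (poly P)" by blast
  define K where "K = L2_norm 0 1 (\<lambda>x. x ^ Suc r)"
  have mL: "(\<lambda>x. c * x ^ i) \<in> L2_space 0 1" for c i by (intro continuous_L2_space continuous_intros)
  have Kpos: "K > 0"
  proof -
    have "K\<^sup>2 = integral {0..1} (\<lambda>x::real. x ^ (2 * Suc r))"
      unfolding K_def using L2_norm_sq_integral[OF mL[of 1 "Suc r"]] by (simp add: mult.commute del: power_Suc flip: power_mult)
    note KK = this
    have "K \<noteq> 0"
    proof
      assume "K = 0"
      then have "integral {0..1} (\<lambda>x::real. x ^ (2 * Suc r)) = 0" using KK by (simp del: power_Suc)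
      then have "\<forall>x\<in>{0..1::real}. x ^ (2 * Suc r) = 0"
        by (subst (asm) integral_eq_0_iff) (auto intro!: continuous_intros simp del: power_Suc mult_Suc_right)
      then show False by (auto dest: bspec[of _ _ 1])
    qed
    then show ?thesis using L2_norm_nonneg[of 0 1 "\<lambda>x. x ^ Suc r"] unfolding K_def by linarith
  qed
  \<comment> \<open>\<open>C1\<close> bounds the coefficients of \<open>Q\<close>, and through them
    the lower ones of \<open>P\<close>; \<open>C2\<close> adds the top coefficient, obtained from
    the norm of what remains of \<open>P\<close> divided by the norm \<open>K\<close> of the top
    monomial.\<close>
  define C1 where "C1 = C * (1 + 2 ^ Suc r * 2)"
  define C2 where "C2 = C1 + (1 + (real (Suc r)) * C1) / K"
  have C10: "C1 \<ge> 0" using C by (simp add: C1_def)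
  have K1: "L2_norm 0 1 (\<lambda>x. x ^ i) \<le> 1" for i
  proof -
    have "(L2_norm 0 1 (\<lambda>x. x ^ i))\<^sup>2 \<le> (1 - 0) * 1\<^sup>2"
      using mL[of 1 i] by (intro L2_norm_le_sup) (auto simp: power_le_one)
    then show ?thesis by (simp add: power_le_one_iff abs_le_square_iff)
  qed
  have main: "\<bar>coeff P i\<bar> \<le> C2 * L2_norm 0 1 (poly P)" if deg: "degree P \<le> Suc r" for P :: "real poly" and i
  proof -
    define N where "N = L2_norm 0 1 (poly P)"
    have N0: "N \<ge> 0" by (simp add: N_def)
    define H where "H = pcompose P [:0, 1 / 2:]"
    define Q where "Q = P - smult (2 ^ Suc r) H"
    have cH: "coeff H i = (1 / 2) ^ i * coeff P i" for i unfolding H_def by (rule coeff_pcompose_linear)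
    \<comment> \<open>Rescaling turns the norm of \<open>H\<close> on the unit interval into that of
      \<open>P\<close> on its left half.\<close>
    have "(L2_norm 0 1 (poly H))\<^sup>2 = 2 * (L2_norm 0 (1/2) (poly P))\<^sup>2"
      using L2_norm_poly_scale[of 0 "1/2" P] by (simp add: H_def)
    also have "\<dots> \<le> 2 * N\<^sup>2"
    proof -
      have i: "(\<lambda>x. (poly P x)\<^sup>2) integrable_on S" if "S = {x..y}" for x y S
        unfolding that by (intro integrable_continuous_real continuous_intros)
      have "(L2_norm 0 (1/2) (poly P))\<^sup>2 \<le> N\<^sup>2"
        unfolding N_def L2_norm_sq_integral[OF poly_L2_space] by (intro integral_subset_le i[OF refl]) auto
      then show ?thesis by simp
    qed
    also have "\<dots> \<le> (2 * N)\<^sup>2" by (simp add: power_mult_distrib)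
    finally have NH: "L2_norm 0 1 (poly H) \<le> 2 * N" by (rule power2_le_imp_le) (use N0 in simp)
    have "L2_norm 0 1 (poly Q) \<le> L2_norm 0 1 (poly P) + L2_norm 0 1 (\<lambda>x. 2 ^ Suc r * poly H x)"
    proof -
      have "poly Q = (\<lambda>x. poly P x - 2 ^ Suc r * poly H x)" by (simp add: Q_def fun_eq_iff)
      then show ?thesis
        using L2_norm_triangle_diff[OF poly_L2_space L2_space_scale[OF poly_L2_space], of 0 1 P "2 ^ Suc r" H] by (simp only:)
    qed
    also have "\<dots> \<le> N + 2 ^ Suc r * (2 * N)"
      unfolding L2_norm_scale using NH by (simp add: N_def)
    finally have NQ: "L2_norm 0 1 (poly Q) \<le> (1 + 2 ^ Suc r * 2) * N" by (simp add: algebra_simps)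
    have cQ: "coeff Q i = (1 - 2 ^ Suc r * (1 / 2) ^ i) * coeff P i" for i
      by (simp add: Q_def cH algebra_simps)
    have "degree Q \<le> r"
    proof (rule degree_le, intro allI impI)
      fix i assume "i > r"
      then consider "i = Suc r" | "i > Suc r" by linarith
      then show "coeff Q i = 0"
      proof cases
        case 1 then show ?thesis by (simp add: cQ flip: power_mult_distrib)
      next
        case 2 then show ?thesis using deg by (simp add: cQ coeff_eq_0)
      qed
    qed
    then have "\<bar>coeff Q i\<bar> \<le> C * L2_norm 0 1 (poly Q)" for i by (rule C(2))
    also have "\<dots> \<le> C1 * N" unfolding C1_def mult.assoc by (intro mult_left_mono NQ C(1))
    finally have bQ: "\<bar>coeff Q i\<bar> \<le> C1 * N" for i .
    \<comment> \<open>The multiplier \<open>1 - 2 ^ (Suc r - i)\<close> between the coefficients of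
      \<open>P\<close> and those of \<open>Q\<close> has modulus at least 1 for
      \<open>i \<le> r\<close>, so nothing is lost in passing back.\<close>
    have low: "\<bar>coeff P i\<bar> \<le> C1 * N" if "i \<le> r" for i
    proof -
      have "(2::real) ^ Suc r * (1 / 2) ^ i = 2 ^ (Suc r - i)"
        using that by (simp add: power_divide power_diff)
      moreover have "(2::real) ^ (Suc r - i) \<ge> 2 ^ 1" using that by (intro power_increasing) auto
      ultimately have z: "(2::real) \<le> 2 ^ Suc r * (1 / 2) ^ i" by (simp only: power_one_right)
      have "1 \<le> \<bar>1 - t\<bar>" if "2 \<le> t" for t :: real using that by simp
      from this[OF z] have "1 \<le> \<bar>1 - 2 ^ Suc r * (1 / 2) ^ i :: real\<bar>" .
      then have "\<bar>coeff P i\<bar> \<le> \<bar>1 - 2 ^ Suc r * (1 / 2) ^ i\<bar> * \<bar>coeff P i\<bar>"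
        using mult_right_mono[of 1 "\<bar>1 - 2 ^ Suc r * (1 / 2) ^ i :: real\<bar>" "\<bar>coeff P i\<bar>"] by simp
      also have "\<dots> = \<bar>coeff Q i\<bar>" by (simp add: cQ abs_mult)
      finally show ?thesis using bQ[of i] by linarith
    qed
    have top: "\<bar>coeff P (Suc r)\<bar> \<le> (1 + real (Suc r) * C1) / K * N"
    proof -
      have pd: "poly P x = (\<Sum>i\<le>r. coeff P i * x ^ i) + coeff P (Suc r) * x ^ Suc r" for x
      proof -
        have "poly P x = (\<Sum>i\<le>Suc r. coeff P i * x ^ i)"
          using poly_altdef_le[OF deg] by simp
        then show ?thesis by simp
      qed
      have sL: "(\<lambda>x. \<Sum>i\<in>I. coeff P i * x ^ i) \<in> L2_space 0 1" for I
        by (intro continuous_L2_space continuous_intros)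
      have sN: "L2_norm 0 1 (\<lambda>x. \<Sum>i\<in>I. coeff P i * x ^ i) \<le> (\<Sum>i\<in>I. \<bar>coeff P i\<bar>)" if "finite I" for I
        using that
      proof (induction I rule: finite_induct)
        case empty then show ?case by (simp add: L2_norm_def L2_inner_def)
      next
        case (insert j I)
        have "L2_norm 0 1 (\<lambda>x. coeff P j * x ^ j + (\<Sum>i\<in>I. coeff P i * x ^ i)) \<le> L2_norm 0 1 (\<lambda>x. coeff P j * x ^ j) + L2_norm 0 1 (\<lambda>x. \<Sum>i\<in>I. coeff P i * x ^ i)"
          by (rule L2_norm_triangle[OF mL sL])
        also have "\<dots> \<le> \<bar>coeff P j\<bar> * 1 + (\<Sum>i\<in>I. \<bar>coeff P i\<bar>)"
          unfolding L2_norm_scale by (intro add_mono mult_left_mono K1 insert.IH) auto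
        finally show ?case using insert by simp
      qed
      have "\<bar>coeff P (Suc r)\<bar> * K = L2_norm 0 1 (\<lambda>x. poly P x - (\<Sum>i\<le>r. coeff P i * x ^ i))"
        unfolding K_def L2_norm_scale[symmetric] by (simp add: pd)
      also have "\<dots> \<le> N + L2_norm 0 1 (\<lambda>x. \<Sum>i\<le>r. coeff P i * x ^ i)"
        unfolding N_def by (rule L2_norm_triangle_diff[OF poly_L2_space sL])
      also have "\<dots> \<le> N + (\<Sum>i\<le>r. \<bar>coeff P i\<bar>)" using sN by simp
      also have "\<dots> \<le> N + (\<Sum>i\<le>r. C1 * N)" using low by (intro add_left_mono sum_mono) auto
      also have "\<dots> = (1 + real (Suc r) * C1) * N" by (simp add: algebra_simps)
      finally show ?thesis using Kpos by (simp add: field_simps)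
    qed
    have a: "C1 * N \<le> C2 * N"
      unfolding C2_def using C10 Kpos N0 by (intro mult_right_mono) (auto intro!: divide_nonneg_pos add_nonneg_nonneg mult_nonneg_nonneg)
    have b: "(1 + real (Suc r) * C1) / K * N \<le> C2 * N"
      unfolding C2_def using C10 N0 by (intro mult_right_mono) auto
    have c: "0 \<le> C2 * N" using mult_nonneg_nonneg[OF C10 N0] a by linarith
    consider "i \<le> r" | "i = Suc r" | "i > Suc r" by linarith
    then show ?thesis unfolding N_def[symmetric]
    proof cases
      case 1 then show "\<bar>coeff P i\<bar> \<le> C2 * N" using low[of i] a by linarith
    next
      case 2 then show "\<bar>coeff P i\<bar> \<le> C2 * N" using top b by simp
    next
      case 3 then show "\<bar>coeff P i\<bar> \<le> C2 * N" using deg c by (simp add: coeff_eq_0)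
    qed
  qed
  have "C2 \<ge> 0" unfolding C2_def using C10 Kpos by (auto intro!: divide_nonneg_pos add_nonneg_nonneg mult_nonneg_nonneg)
  then show ?case using main by blast
qed

text \<open>On the unit interval the L2 norm controls the coefficients; the affine substitution
  produces the power of \<open>d - c\<close>, two more for the derivative. One constant depending on
  \<open>r\<close> alone serves all cells of all meshes.\<close>

lemma poly_inverse_inequality:
  obtains C where "C \<ge> 0"
    "\<And>(P :: real poly) c d x. degree P \<le> r \<Longrightarrow> c < d \<Longrightarrow> x \<in> {c..d} \<Longrightarrow>
       (d - c) * (poly P x)\<^sup>2 \<le> C * integral {c..d} (\<lambda>x. (poly P x)\<^sup>2)"
    "\<And>(P :: real poly) c d x. degree P \<le> r \<Longrightarrow> c < d \<Longrightarrow> x \<in> {c..d} \<Longrightarrow>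
       (d - c) ^ 3 * (poly (pderiv P) x)\<^sup>2 \<le> C * integral {c..d} (\<lambda>x. (poly P x)\<^sup>2)"
proof -
  obtain C0 where C0: "C0 \<ge> 0" "\<And>P i. degree P \<le> r \<Longrightarrow> \<bar>coeff P i\<bar> \<le> C0 * L2_norm 0 1 (poly P)"
    using poly_coeff_bound[of r] by blast
  define K where "K = (real r + 1) * (real r + 1) * C0"
  have K0: "K \<ge> 0" using C0 by (simp add: K_def)
  have sup: "\<bar>poly P t\<bar> \<le> (real r + 1) * B"
    if "degree P \<le> r" "t \<in> {0..1}" "\<And>i. \<bar>coeff P i\<bar> \<le> B" for P :: "real poly" and t B
  proof -
    have "\<bar>poly P t\<bar> = \<bar>\<Sum>i\<le>r. coeff P i * t ^ i\<bar>" using poly_altdef_le[OF that(1)] by simp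
    also have "\<dots> \<le> (\<Sum>i\<le>r. \<bar>coeff P i * t ^ i\<bar>)" by (rule sum_abs)
    also have "\<dots> \<le> (\<Sum>i\<le>r. B * 1)"
      unfolding abs_mult using that by (intro sum_mono mult_mono) (auto simp: power_le_one power_abs intro: order.trans[OF abs_ge_zero])
    finally show ?thesis by (simp add: algebra_simps)
  qed
  have both: "(d - c) * (poly P x)\<^sup>2 \<le> K\<^sup>2 * integral {c..d} (\<lambda>x. (poly P x)\<^sup>2) \<and>
      (d - c) ^ 3 * (poly (pderiv P) x)\<^sup>2 \<le> K\<^sup>2 * integral {c..d} (\<lambda>x. (poly P x)\<^sup>2)"
    if deg: "degree P \<le> r" and cd: "c < d" and x: "x \<in> {c..d}" for P :: "real poly" and c d x
  proof -
    define Q where "Q = pcompose P [:c, d - c:]"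
    define N where "N = L2_norm 0 1 (poly Q)"
    have N0: "N \<ge> 0" by (simp add: N_def)
    have NN: "integral {c..d} (\<lambda>x. (poly P x)\<^sup>2) = (d - c) * N\<^sup>2"
      using L2_norm_poly_scale[OF cd, of P] by (simp add: Q_def N_def L2_norm_sq_integral[OF poly_L2_space, of c d])
    have dQ: "degree Q \<le> r" using deg cd by (simp add: Q_def degree_pcompose)
    define t where "t = (x - c) / (d - c)"
    have t: "t \<in> {0..1}" "c + (d - c) * t = x" using x cd by (auto simp: t_def field_simps)
    have Pt: "poly P x = poly Q t" using t(2) by (simp add: Q_def poly_pcompose mult.commute)
    have cQ: "\<bar>coeff Q i\<bar> \<le> C0 * N" for i unfolding N_def by (rule C0(2)[OF dQ])
    have b1: "\<bar>poly Q t\<bar> \<le> K * N"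
    proof -
      have "\<bar>poly Q t\<bar> \<le> (real r + 1) * (C0 * N)" by (rule sup[OF dQ t(1) cQ])
      also have "\<dots> \<le> (real r + 1) * ((real r + 1) * (C0 * N))"
        using C0(1) N0 mult_right_mono[of 1 "real r + 1" "C0 * N"] by (intro mult_left_mono) auto
      finally show ?thesis by (simp add: K_def mult.assoc)
    qed
    have b2: "\<bar>poly (pderiv Q) t\<bar> \<le> K * N"
    proof -
      have "\<bar>coeff (pderiv Q) i\<bar> \<le> (real r + 1) * (C0 * N)" for i
      proof (cases "Suc i \<le> r")
        case True
        then show ?thesis unfolding coeff_pderiv abs_mult by (intro mult_mono cQ) auto
      next
        case False
        then have "coeff Q (Suc i) = 0" using dQ by (intro coeff_eq_0) auto
        then show ?thesis using C0(1) N0 by (simp add: coeff_pderiv)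
      qed
      moreover have "degree (pderiv Q) \<le> r" using dQ by (simp add: degree_pderiv)
      ultimately have "\<bar>poly (pderiv Q) t\<bar> \<le> (real r + 1) * ((real r + 1) * (C0 * N))" using sup t(1) by blast
      then show ?thesis by (simp add: K_def mult.assoc)
    qed
    have dP: "poly (pderiv Q) t = (d - c) * poly (pderiv P) x"
    proof -
      have "pderiv Q = pcompose (pderiv P) [:c, d - c:] * pderiv [:c, d - c:]" unfolding Q_def by (rule pderiv_pcompose)
      then show ?thesis using t(2) by (simp add: poly_pcompose pderiv_pCons mult.commute)
    qed
    have "(poly Q t)\<^sup>2 \<le> (K * N)\<^sup>2" using b1 by (metis abs_ge_zero power2_abs power_mono)
    then have "(d - c) * (poly P x)\<^sup>2 \<le> (d - c) * (K * N)\<^sup>2" unfolding Pt using cd by (intro mult_left_mono) auto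
    moreover have "(poly (pderiv Q) t)\<^sup>2 \<le> (K * N)\<^sup>2" using b2 by (metis abs_ge_zero power2_abs power_mono)
    then have "(d - c) * ((d - c) * poly (pderiv P) x)\<^sup>2 \<le> (d - c) * (K * N)\<^sup>2" unfolding dP using cd by (intro mult_left_mono) auto
    ultimately show ?thesis unfolding NN by (simp add: power_mult_distrib algebra_simps power2_eq_square power3_eq_cube)
  qed
  show ?thesis by (rule that[of "K\<^sup>2"]) (use both in auto)
qed

section \<open>Polynomial interpolation at distinct nodes\<close>

lemma poly_interpolation_exists:
  fixes \<xi> y :: "nat \<Rightarrow> real"
  assumes "inj_on \<xi> {..n}"
  shows "\<exists>P. degree P \<le> n \<and> (\<forall>j\<le>n. poly P (\<xi> j) = y j)"
  using assms
proof (induction n)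
  case 0
  show ?case by (intro exI[of _ "[:y 0:]"]) auto
next
  case (Suc n)
  have "inj_on \<xi> {..n}" using Suc.prems by (rule inj_on_subset) auto
  then obtain P where P: "degree P \<le> n" "\<And>j. j \<le> n \<Longrightarrow> poly P (\<xi> j) = y j" using Suc.IH by blast
  define W where "W = (\<Prod>i\<le>n. [:- \<xi> i, 1:])"
  have dW: "degree W \<le> Suc n"
    unfolding W_def by (rule order.trans[OF degree_prod_sum_le]) auto
  have W0: "poly W (\<xi> j) = 0" if "j \<le> n" for j using that by (auto simp: W_def poly_prod)
  have W1: "poly W (\<xi> (Suc n)) \<noteq> 0"
  proof
    assume "poly W (\<xi> (Suc n)) = 0"
    then obtain i where "i \<le> n" "\<xi> (Suc n) = \<xi> i" by (auto simp: W_def poly_prod)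
    then show False using inj_onD[OF Suc.prems, of "Suc n" i] by auto
  qed
  define R where "R = P + smult ((y (Suc n) - poly P (\<xi> (Suc n))) / poly W (\<xi> (Suc n))) W"
  have "degree R \<le> Suc n" unfolding R_def
    using P(1) dW by (intro degree_add_le order.trans[OF degree_smult_le]) auto
  moreover have "\<forall>j\<le>Suc n. poly R (\<xi> j) = y j"
    using P(2) W0 W1 by (auto simp: R_def le_Suc_eq)
  ultimately show ?case by blast
qed

lemma poly_interpolation_unique:
  fixes \<xi> :: "nat \<Rightarrow> real"
  assumes "inj_on \<xi> {..n}" "degree P \<le> n" "degree Q \<le> n" "\<And>j. j \<le> n \<Longrightarrow> poly P (\<xi> j) = poly Q (\<xi> j)"
  shows "P = Q"
  by (rule poly_eqI_degree[of "\<xi> ` {..n}"]) (use assms in \<open>auto simp: card_image\<close>)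

subsection \<open>Gauss--Lobatto quadrature\<close>

context
  fixes r c d \<xi> \<omega>
  assumes gl: "gauss_lobatto r c d \<xi> \<omega>" and r: "r \<ge> 1"
begin

lemma gauss_lobatto_nodes:
  shows "c < d" "inj_on \<xi> {..r}" "\<And>j. j \<le> r \<Longrightarrow> \<xi> j \<in> {c..d}" "\<And>j. 0 < j \<Longrightarrow> j < r \<Longrightarrow> \<xi> j \<in> {c<..<d}"
    "\<xi> 0 = c" "\<xi> r = d"
proof -
  have m: "strict_mono_on {..r} \<xi>" and e: "\<xi> 0 = c" "\<xi> r = d" using gl by (auto simp: gauss_lobatto_def)
  show "\<xi> 0 = c" "\<xi> r = d" by (fact e)+
  show cd: "c < d" using strict_mono_onD[OF m, of 0 r] e r by auto
  show "inj_on \<xi> {..r}" using m by (rule strict_mono_on_imp_inj_on)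
  show int: "\<xi> j \<in> {c<..<d}" if "0 < j" "j < r" for j
    using strict_mono_onD[OF m, of 0 j] strict_mono_onD[OF m, of j r] e that by auto
  show "\<xi> j \<in> {c..d}" if "j \<le> r" for j
    using int[of j] e cd that by (cases "j = 0"; cases "j = r") auto
qed

lemma gauss_lobatto_exact:
  "degree p \<le> 2 * r - 1 \<Longrightarrow> integral {c..d} (poly p) = (\<Sum>j\<le>r. \<omega> j * poly p (\<xi> j))"
  using gl by (auto simp: gauss_lobatto_def)

lemma gauss_lobatto_sum_weights: "(\<Sum>j\<le>r. \<omega> j) = d - c"
proof -
  have "poly [:1:] = (\<lambda>x::real. 1)" by auto
  then show ?thesis using gauss_lobatto_exact[of "[:1:]"] gauss_lobatto_nodes(1) by simp
qed

text \<open>Exactness is applied to a polynomial that is nonnegative on the interval and vanishes at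
  every node but the \<open>j\<close>-th. Interior nodes need squared factors, the end points only
  simple ones, because a sign change there lies outside.\<close>

lemma gauss_lobatto_weight_pos:
  assumes j: "j \<le> r"
  shows "\<omega> j > 0"
proof -
  note nodes = gauss_lobatto_nodes
  define A where "A = (\<Prod>i\<in>{0<..<r} - {j}. [:- \<xi> i, 1:]\<^sup>2)"
  define E where "E = (if j = 0 then 1 else [:- c, 1:]) * (if j = r then 1 else [:d, - 1:])"
  define q where "q = E * A"
  have "degree A \<le> (\<Sum>i\<in>{0<..<r} - {j}. degree ([:- \<xi> i, 1:]\<^sup>2))"
    unfolding A_def using degree_prod_sum_le[of "{0<..<r} - {j}" "\<lambda>i. [:- \<xi> i, 1:]\<^sup>2"] by (simp add: o_def)
  also have "\<dots> \<le> (\<Sum>i\<in>{0<..<r} - {j}. 2)" by (intro sum_mono) (simp add: degree_power_eq)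
  also have "\<dots> = 2 * card ({0<..<r} - {j})" by simp
  finally have dA: "degree A \<le> 2 * card ({0<..<r} - {j})" .
  have dE: "degree E \<le> (if j = 0 then 0 else 1) + (if j = r then 0 else 1)"
    unfolding E_def by (rule order.trans[OF degree_mult_le]) (intro add_mono, auto)
  have card: "card ({0<..<r} - {j}) = (if j = 0 \<or> j = r then r - 1 else r - 2)"
    using j by auto
  \<comment> \<open>Here the simple end factors matter: for an end node the count is
    \<open>1 + 2 * (r - 1)\<close>, exactly the degree of exactness, and for an interior node it is
    \<open>2 + 2 * (r - 2)\<close>.\<close>
  have dq: "degree q \<le> 2 * r - 1"
    unfolding q_def using degree_mult_le[of E A] dA dE j r by (auto simp: card split: if_splits)
  have pq: "poly q x = (if j = 0 then 1 else x - c) * (if j = r then 1 else d - x) * (\<Prod>i\<in>{0<..<r} - {j}. (x - \<xi> i)\<^sup>2)" for x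
    by (simp add: q_def E_def A_def poly_prod)
  have nn: "0 \<le> poly q x" if "x \<in> {c..d}" for x
    unfolding pq using that by (intro mult_nonneg_nonneg prod_nonneg) auto
  have pos: "poly q (\<xi> j) > 0"
  proof -
    have "(\<Prod>i\<in>{0<..<r} - {j}. (\<xi> j - \<xi> i)\<^sup>2) > 0"
    proof (rule prod_pos)
      fix i assume "i \<in> {0<..<r} - {j}"
      then have "\<xi> j \<noteq> \<xi> i" using nodes(2) j by (auto simp: inj_on_def)
      then show "(\<xi> j - \<xi> i)\<^sup>2 > 0" by simp
    qed
    moreover have "(if j = 0 then 1 else \<xi> j - c) > 0 \<and> (if j = r then 1 else d - \<xi> j) > 0"
    proof -
      consider "j = 0" | "j = r" | "0 < j" "j < r" using j by linarith
      then show ?thesis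
      proof cases
        case 3 then show ?thesis using nodes(4)[of j] by simp
      qed (use nodes(1,5,6) r in simp_all)
    qed
    ultimately show ?thesis unfolding pq by (intro mult_pos_pos) blast+
  qed
  have zero: "poly q (\<xi> i) = 0" if i: "i \<le> r" "i \<noteq> j" for i
  proof (cases "i = 0 \<or> i = r")
    case True
    then show ?thesis using i nodes(5,6) by (auto simp: pq)
  next
    case False
    then have "i \<in> {0<..<r} - {j}" using i by auto
    then show ?thesis by (auto simp: pq intro!: prod_zero)
  qed
  have "integral {c..d} (poly q) \<noteq> 0"
  proof
    assume "integral {c..d} (poly q) = 0"
    then have "\<forall>x\<in>{c..d}. poly q x = 0"
      by (subst (asm) integral_eq_0_iff) (use nn nodes(1) in \<open>auto intro!: continuous_intros\<close>)
    then show False using pos nodes(3)[OF j] by force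
  qed
  moreover have "0 \<le> integral {c..d} (poly q)"
    by (intro Henstock_Kurzweil_Integration.integral_nonneg integrable_continuous_real continuous_intros nn)
  ultimately have "0 < integral {c..d} (poly q)" by linarith
  also have "integral {c..d} (poly q) = (\<Sum>i\<le>r. \<omega> i * poly q (\<xi> i))" by (rule gauss_lobatto_exact[OF dq])
  also have "\<dots> = \<omega> j * poly q (\<xi> j)"
    using j zero by (subst sum.remove[of _ j]) (auto intro!: sum.neutral)
  finally show ?thesis using pos by (simp add: zero_less_mult_iff)
qed

text \<open>
  The square minus its leading coefficient times \<open>(x - c) (x - d) \<Prod> (x - \<xi>\<^sub>i)\<^sup>2\<close>, which vanishes at the
  nodes and is nonpositive on the interval, is integrated exactly.
\<close>

lemma gauss_lobatto_square_ge:
  assumes P: "degree P \<le> r"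
  shows "integral {c..d} (\<lambda>x. (poly P x)\<^sup>2) \<le> (\<Sum>j\<le>r. \<omega> j * (poly P (\<xi> j))\<^sup>2)"
proof -
  note nodes = gauss_lobatto_nodes
  define A where "A = (\<Prod>i\<in>{0<..<r}. [:- \<xi> i, 1:])"
  define W where "W = [:- c, 1:] * [:- d, 1:] * A\<^sup>2"
  have dA: "degree A = r - 1" "lead_coeff A = 1"
  proof -
    show "degree A = r - 1" unfolding A_def by (subst degree_prod_eq_sum_degree) auto
    have "lead_coeff A = (\<Prod>i\<in>{0<..<r}. lead_coeff [:- \<xi> i, 1:])" unfolding A_def by (rule lead_coeff_prod)
    then show "lead_coeff A = 1" by simp
  qed
  have A0: "A \<noteq> 0" using dA(2) by auto
  have dW: "degree W = 2 * r" and lW: "lead_coeff W = 1"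
  proof -
    have "degree W = 2 + 2 * degree A"
    proof -
      have "[:- c, 1:] * [:- d, 1:] \<noteq> 0" "degree ([:- c, 1:] * [:- d, 1:]) = 2" by auto
      then show ?thesis unfolding W_def using A0 by (subst degree_mult_eq) (auto simp: degree_power_eq)
    qed
    then show "degree W = 2 * r" using dA r by simp
    show "lead_coeff W = 1" unfolding W_def lead_coeff_mult lead_coeff_power dA(2) by simp
  qed
  define a where "a = coeff P r"
  define S where "S = P\<^sup>2 - smult (a\<^sup>2) W"
  have "degree S \<le> 2 * r - 1"
  proof (rule degree_le, intro allI impI)
    fix i assume i: "i > 2 * r - 1"
    have dP2: "degree (P\<^sup>2) \<le> 2 * r"
      using P degree_mult_le[of P P] by (simp add: power2_eq_square)
    show "coeff S i = 0"
    proof (cases "i = 2 * r")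
      case True
      have "coeff (P\<^sup>2) (r + r) = a * a"
        unfolding power2_eq_square a_def
      proof (cases "degree P = r")
        case True then show "coeff (P * P) (r + r) = coeff P r * coeff P r" using coeff_mult_degree_sum[of P P] by simp
      next
        case False
        then have "degree P < r" using P by simp
        then show "coeff (P * P) (r + r) = coeff P r * coeff P r"
          using degree_mult_le[of P P] by (simp add: coeff_eq_0)
      qed
      moreover have "coeff W (2 * r) = 1" using dW lW by simp
      ultimately show ?thesis unfolding S_def True by (simp add: power2_eq_square mult_2)
    next
      case False
      then have "i > 2 * r" using i by simp
      then show ?thesis unfolding S_def using dP2 dW by (simp add: coeff_eq_0)
    qed
  qed
  then have ex: "integral {c..d} (poly S) = (\<Sum>j\<le>r. \<omega> j * poly S (\<xi> j))" by (rule gauss_lobatto_exact)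
  have pW: "poly W x = (x - c) * (x - d) * (poly A x)\<^sup>2" for x by (simp add: W_def algebra_simps)
  have W0: "poly W (\<xi> j) = 0" if "j \<le> r" for j
  proof (cases "j = 0 \<or> j = r")
    case True then show ?thesis using nodes(5,6) by (auto simp: pW)
  next
    case False
    then have "poly A (\<xi> j) = 0" using that unfolding A_def poly_prod by (intro prod_zero) auto
    then show ?thesis by (simp add: pW)
  qed
  have "integral {c..d} (\<lambda>x. (poly P x)\<^sup>2) \<le> integral {c..d} (poly S)"
  proof (rule integral_le)
    show "(\<lambda>x. (poly P x)\<^sup>2) integrable_on {c..d}" "poly S integrable_on {c..d}"
      by (intro integrable_continuous_real continuous_intros)+
    fix x assume x: "x \<in> {c..d}"
    then have "poly W x \<le> 0" unfolding pW by (intro mult_nonpos_nonneg mult_nonneg_nonpos) auto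
    then have "a\<^sup>2 * poly W x \<le> 0" by (intro mult_nonneg_nonpos) auto
    then show "(poly P x)\<^sup>2 \<le> poly S x" by (simp add: S_def)
  qed
  also have "\<dots> = (\<Sum>j\<le>r. \<omega> j * (poly P (\<xi> j))\<^sup>2)"
    unfolding ex by (intro sum.cong refl) (simp add: S_def W0)
  finally show ?thesis .
qed

end

subsection \<open>Diagonalisation of symmetric operators\<close>

lemma sum_mult_delta:
  fixes f :: "'i \<Rightarrow> real"
  assumes "finite S" "j \<in> S"
  shows "(\<Sum>i\<in>S. f i * (if i = j then 1 else 0)) = f j"
proof -
  have "(\<Sum>i\<in>S. f i * (if i = j then 1 else 0)) = (\<Sum>i\<in>S. if i = j then f i else 0)" by (intro sum.cong) auto
  then show ?thesis using assms by simp
qed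

text \<open>Gaussian elimination on \<open>d\<close> equations in \<open>d + 1\<close> unknowns: an
  unknown \<open>p\<close> with nonzero coefficient in the last equation is eliminated, and
  \<open>R\<close> is the reduced system.\<close>

lemma nontrivial_solution:
  fixes M :: "nat \<Rightarrow> nat \<Rightarrow> real"
  shows "\<exists>a. (\<exists>i\<le>d. a i \<noteq> 0) \<and> (\<forall>l<d. (\<Sum>i\<le>d. a i * M i l) = 0)"
proof (induction d arbitrary: M)
  case 0
  show ?case by (rule exI[of _ "\<lambda>_. 1"]) auto
next
  case (Suc d)
  show ?case
  proof (cases "\<forall>i\<le>Suc d. M i d = 0")
    case True
    obtain a where a: "\<exists>i\<le>d. a i \<noteq> 0" "\<forall>l<d. (\<Sum>i\<le>d. a i * M i l) = 0" using Suc.IH[of M] by blast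
    define b where "b i = (if i \<le> d then a i else 0)" for i
    have "(\<Sum>i\<le>Suc d. b i * M i l) = (\<Sum>i\<le>d. a i * M i l)" for l
      by (simp add: b_def)
    then have "\<forall>l<Suc d. (\<Sum>i\<le>Suc d. b i * M i l) = 0"
      using a(2) True by (auto simp: less_Suc_eq intro!: sum.neutral)
    moreover have "\<exists>i\<le>Suc d. b i \<noteq> 0" using a(1) by (auto simp: b_def intro: le_SucI)
    ultimately show ?thesis by blast
  next
    case False
    then obtain p where p: "p \<le> Suc d" "M p d \<noteq> 0" by blast
    \<comment> \<open>Enumerates the unknowns other than the pivot \<open>p\<close> by
      \<open>{..d}\<close>.\<close>
    define s where "s i = (if i < p then i else Suc i)" for i
    define R where "R i l = M (s i) l - M (s i) d / M p d * M p l" for i l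
    obtain a where a: "\<exists>i\<le>d. a i \<noteq> 0" "\<forall>l<d. (\<Sum>i\<le>d. a i * R i l) = 0" using Suc.IH[of R] by blast
    have inj: "inj_on s {..d}" by (auto simp: s_def inj_on_def split: if_splits)
    have img: "s ` {..d} = {..Suc d} - {p}"
    proof
      show "s ` {..d} \<subseteq> {..Suc d} - {p}" using p by (auto simp: s_def)
      show "{..Suc d} - {p} \<subseteq> s ` {..d}"
      proof
        fix x assume x: "x \<in> {..Suc d} - {p}"
        show "x \<in> s ` {..d}"
        proof (cases "x < p")
          case True then show ?thesis using p by (intro image_eqI[of _ _ x]) (auto simp: s_def)
        next
          case False then show ?thesis using x by (intro image_eqI[of _ _ "x - 1"]) (auto simp: s_def)
        qed
      qed
    qed
    define t where "t = inv_into {..d} s"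
    have ts: "t (s i) = i" if "i \<le> d" for i using that inj by (simp add: t_def inv_into_f_f)
    define b where "b j = (if j = p then - (\<Sum>i\<le>d. a i * M (s i) d) / M p d else a (t j))" for j
    have sp: "s i \<noteq> p" for i by (auto simp: s_def)
    have sum_b: "(\<Sum>j\<le>Suc d. b j * M j l) = b p * M p l + (\<Sum>i\<le>d. a i * M (s i) l)" for l
    proof -
      have "(\<Sum>j\<le>Suc d. b j * M j l) = b p * M p l + (\<Sum>j\<in>s ` {..d}. b j * M j l)"
        unfolding img using p by (subst sum.remove[of _ p]) auto
      also have "(\<Sum>j\<in>s ` {..d}. b j * M j l) = (\<Sum>i\<le>d. b (s i) * M (s i) l)"
        by (subst sum.reindex[OF inj]) simp
      also have "\<dots> = (\<Sum>i\<le>d. a i * M (s i) l)" by (intro sum.cong) (auto simp: b_def sp ts)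
      finally show ?thesis .
    qed
    have "(\<Sum>j\<le>Suc d. b j * M j l) = 0" if "l < Suc d" for l
    proof (cases "l = d")
      case True then show ?thesis unfolding sum_b using p by (simp add: b_def)
    next
      case False
      then have "(\<Sum>i\<le>d. a i * R i l) = 0" using a(2) that by auto
      moreover have "(\<Sum>i\<le>d. a i * R i l) = (\<Sum>i\<le>d. a i * M (s i) l) - (\<Sum>i\<le>d. a i * M (s i) d) / M p d * M p l"
        by (simp add: R_def right_diff_distrib sum_subtractf sum_divide_distrib sum_distrib_right mult.assoc)
      ultimately show ?thesis unfolding sum_b by (simp add: b_def)
    qed
    moreover have "\<exists>j\<le>Suc d. b j \<noteq> 0"
    proof -
      obtain i where "i \<le> d" "a i \<noteq> 0" using a(1) by blast
      moreover have "s i \<le> Suc d" using \<open>i \<le> d\<close> img by auto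
      ultimately show ?thesis by (intro exI[of _ "s i"]) (auto simp: b_def sp ts)
    qed
    ultimately show ?thesis by blast
  qed
qed

text \<open>The quadrature form is bilinear on all functions but definite only on \<open>V\<close>,
  so among the laws of \<open>ip\<close> positivity alone is restricted to \<open>V\<close>. Finite
  dimension is expressed by dependence of any \<open>d + 1\<close> elements, so no basis has to be
  supplied.\<close>

locale symmetric_operator =
  fixes V :: "(real \<Rightarrow> real) set" and ip :: "(real \<Rightarrow> real) \<Rightarrow> (real \<Rightarrow> real) \<Rightarrow> real"
    and A :: "(real \<Rightarrow> real) \<Rightarrow> real \<Rightarrow> real" and d :: nat
  assumes V_zero: "(\<lambda>y. 0) \<in> V"
    and V_add: "v \<in> V \<Longrightarrow> w \<in> V \<Longrightarrow> (\<lambda>y. v y + w y) \<in> V"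
    and V_scale: "v \<in> V \<Longrightarrow> (\<lambda>y. c * v y) \<in> V"
    and ip_sym: "ip v w = ip w v"
    and ip_add: "ip (\<lambda>y. v y + w y) z = ip v z + ip w z"
    and ip_scale: "ip (\<lambda>y. c * v y) z = c * ip v z"
    and ip_pos: "v \<in> V \<Longrightarrow> v \<noteq> (\<lambda>y. 0) \<Longrightarrow> 0 < ip v v"
    and A_closed: "v \<in> V \<Longrightarrow> A v \<in> V"
    and A_add: "v \<in> V \<Longrightarrow> w \<in> V \<Longrightarrow> A (\<lambda>y. v y + w y) = (\<lambda>y. A v y + A w y)"
    and A_scale: "v \<in> V \<Longrightarrow> A (\<lambda>y. c * v y) = (\<lambda>y. c * A v y)"
    and A_sym: "v \<in> V \<Longrightarrow> w \<in> V \<Longrightarrow> ip (A v) w = ip v (A w)"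
    and dim: "(\<And>i. i \<le> d \<Longrightarrow> vs i \<in> V) \<Longrightarrow> \<exists>a. (\<exists>i\<le>d. a i \<noteq> 0) \<and> (\<lambda>y. \<Sum>i\<le>d. a i * vs i y) = (\<lambda>y. 0)"
begin

lemma V_sum: "(\<And>i. i \<in> I \<Longrightarrow> vs i \<in> V) \<Longrightarrow> (\<lambda>y. \<Sum>i\<in>I. c i * vs i y) \<in> V"
proof (induction I rule: infinite_finite_induct)
  case (insert i I)
  then have "(\<lambda>y. c i * vs i y + (\<Sum>i\<in>I. c i * vs i y)) \<in> V" by (intro V_add V_scale) auto
  then show ?case using insert by simp
qed (use V_zero in auto)

lemma V_diff: "v \<in> V \<Longrightarrow> w \<in> V \<Longrightarrow> (\<lambda>y. v y - w y) \<in> V"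
  using V_add[of v "\<lambda>y. (-1) * w y"] V_scale[of w "-1"] by simp

lemma ip_zero: "ip (\<lambda>y. 0) z = 0"
  using ip_scale[of 0 "\<lambda>y. 0" z] by simp

lemma ip_diff: "ip (\<lambda>y. v y - w y) z = ip v z - ip w z"
  using ip_add[of v "\<lambda>y. (-1) * w y" z] ip_scale[of "-1" w z] by simp

lemma ip_sum: "ip (\<lambda>y. \<Sum>i\<in>I. c i * vs i y) z = (\<Sum>i\<in>I. c i * ip (vs i) z)"
proof (induction I rule: infinite_finite_induct)
  case (insert i I)
  then show ?case using ip_add[of "\<lambda>y. c i * vs i y" "\<lambda>y. \<Sum>i\<in>I. c i * vs i y" z] by (simp add: ip_scale)
qed (auto simp: ip_zero)

lemma ip_eq_0: "v \<in> V \<Longrightarrow> ip v v = 0 \<Longrightarrow> v = (\<lambda>y. 0)"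
  using ip_pos by force

lemma ip_nonneg: "v \<in> V \<Longrightarrow> 0 \<le> ip v v"
  using ip_pos[of v] ip_zero[of v] by (cases "v = (\<lambda>y. 0)") auto

lemma A_zero: "A (\<lambda>y. 0) = (\<lambda>y. 0)"
  using A_scale[OF V_zero, of 0] by simp

lemma A_diff: "v \<in> V \<Longrightarrow> w \<in> V \<Longrightarrow> A (\<lambda>y. v y - w y) = (\<lambda>y. A v y - A w y)"
  using A_add[of v "\<lambda>y. (-1) * w y"] V_scale[of w "-1"] A_scale[of w "-1"] by simp

lemma A_sum: "(\<And>i. i \<in> I \<Longrightarrow> vs i \<in> V) \<Longrightarrow> A (\<lambda>y. \<Sum>i\<in>I. c i * vs i y) = (\<lambda>y. \<Sum>i\<in>I. c i * A (vs i) y)"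
proof (induction I rule: infinite_finite_induct)
  case (insert i I)
  then show ?case using A_add[OF V_scale V_sum, of "vs i" I vs "c i" c] by (simp add: A_scale)
qed (auto simp: A_zero)

fun pow :: "nat \<Rightarrow> (real \<Rightarrow> real) \<Rightarrow> real \<Rightarrow> real" where
  "pow 0 v = v"
| "pow (Suc n) v = A (pow n v)"

lemma pow_closed: "v \<in> V \<Longrightarrow> pow n v \<in> V"
  by (induction n) (auto intro: A_closed)

text \<open>This is p(A) v. With \<open>papp_mult\<close>, factorisations of polynomials become
  factorisations of operators.\<close>

definition papp :: "real poly \<Rightarrow> (real \<Rightarrow> real) \<Rightarrow> real \<Rightarrow> real" where
  "papp p v = (\<lambda>y. \<Sum>i\<le>degree p. coeff p i * pow i v y)"

lemma papp_closed: "v \<in> V \<Longrightarrow> papp p v \<in> V"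
  unfolding papp_def by (intro V_sum pow_closed)

lemma papp_le: "degree p \<le> n \<Longrightarrow> papp p v = (\<lambda>y. \<Sum>i\<le>n. coeff p i * pow i v y)"
  unfolding papp_def by (intro ext sum.mono_neutral_left) (auto simp: coeff_eq_0)

lemma papp_pCons: "v \<in> V \<Longrightarrow> papp (pCons c p) v = (\<lambda>y. c * v y + A (papp p v) y)"
proof -
  assume v: "v \<in> V"
  have "papp (pCons c p) v = (\<lambda>y. \<Sum>i\<le>Suc (degree p). coeff (pCons c p) i * pow i v y)"
    by (rule papp_le) (simp add: degree_pCons_le)
  also have "\<dots> = (\<lambda>y. c * v y + (\<Sum>i\<le>degree p. coeff p i * A (pow i v) y))"
    by (simp add: sum.atMost_Suc_shift del: sum.atMost_Suc)
  also have "(\<lambda>y. \<Sum>i\<le>degree p. coeff p i * A (pow i v) y) = A (papp p v)"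
    unfolding papp_def using A_sum[of "{..degree p}" "\<lambda>i. pow i v" "coeff p"] pow_closed[OF v] by simp
  then have "(\<Sum>i\<le>degree p. coeff p i * A (pow i v) y) = A (papp p v) y" for y by (rule fun_cong)
  then have "(\<lambda>y. c * v y + (\<Sum>i\<le>degree p. coeff p i * A (pow i v) y)) = (\<lambda>y. c * v y + A (papp p v) y)" by simp
  finally show ?thesis .
qed

lemma papp_0: "papp 0 v = (\<lambda>y. 0)"
  by (simp add: papp_def)

lemma papp_add: "papp (p + q) v = (\<lambda>y. papp p v y + papp q v y)"
proof -
  let ?n = "max (degree p) (degree q)"
  have "papp (p + q) v = (\<lambda>y. \<Sum>i\<le>?n. coeff (p + q) i * pow i v y)" by (rule papp_le) (rule degree_add_le_max)
  also have "\<dots> = (\<lambda>y. papp p v y + papp q v y)"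
    unfolding papp_le[of p ?n v, OF max.cobounded1] papp_le[of q ?n v, OF max.cobounded2]
    by (simp add: distrib_right sum.distrib)
  finally show ?thesis .
qed

lemma papp_smult: "papp (smult c p) v = (\<lambda>y. c * papp p v y)"
  using papp_le[of "smult c p" "degree p" v] by (simp add: papp_def sum_distrib_left mult.assoc degree_smult_le)

lemma papp_mult: "v \<in> V \<Longrightarrow> papp (p * q) v = papp p (papp q v)"
proof (induction p)
  case 0 show ?case by (simp add: papp_0)
next
  case (pCons c p)
  have "papp (pCons c p * q) v = (\<lambda>y. papp (smult c q) v y + papp (pCons 0 (p * q)) v y)"
    by (simp add: mult_pCons_left papp_add)
  also have "\<dots> = (\<lambda>y. c * papp q v y + A (papp p (papp q v)) y)"
    using pCons by (simp add: papp_smult papp_pCons)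
  also have "\<dots> = papp (pCons c p) (papp q v)"
    using papp_pCons[OF papp_closed[OF pCons.prems]] by simp
  finally show ?case .
qed

text \<open>
  A polynomial of minimal degree annihilating \<open>v\<close> has no irreducible quadratic factor
  \<open>(X - s)\<^sup>2 + t\<^sup>2\<close>, since \<open>\<parallel>(A - s) y\<parallel>\<^sup>2 + t\<^sup>2 \<parallel>y\<parallel>\<^sup>2 = 0\<close> forces \<open>y = 0\<close>.
\<close>

lemma eigenvector_exists:
  assumes v: "v \<in> V" "v \<noteq> (\<lambda>y. 0)"
  obtains p l where "papp p v \<noteq> (\<lambda>y. 0)" "A (papp p v) = (\<lambda>y. l * papp p v y)"
proof -
  define Z where "Z p \<longleftrightarrow> p \<noteq> 0 \<and> papp p v = (\<lambda>y. 0)" for p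
  obtain a where a: "\<exists>i\<le>d. a i \<noteq> 0" "(\<lambda>y. \<Sum>i\<le>d. a i * pow i v y) = (\<lambda>y. 0)"
    using dim[of "\<lambda>i. pow i v"] pow_closed[OF v(1)] by blast
  define q where "q = (\<Sum>i\<le>d. monom (a i) i)"
  have cq: "coeff q i = (if i \<le> d then a i else 0)" for i
    by (simp add: q_def coeff_sum)
  have "Z q" unfolding Z_def
  proof
    show "q \<noteq> 0" using a(1) cq by (metis coeff_0)
    have "degree q \<le> d" by (rule degree_le) (simp add: cq)
    then show "papp q v = (\<lambda>y. 0)" using a(2) by (subst papp_le) (auto simp: cq)
  qed
  then obtain p where p: "Z p" "\<And>q. Z q \<Longrightarrow> degree p \<le> degree q"
    using ex_has_least_nat[of Z q degree] by blast
  have "degree p \<noteq> 0"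
  proof
    assume "degree p = 0"
    then obtain c where "p = [:c:]" using degree_eq_zeroE by blast
    then have "c \<noteq> 0" and z: "(\<lambda>y. c * v y) = (\<lambda>y. 0)" using p(1) by (auto simp: Z_def papp_def)
    then have "v y = 0" for y using fun_cong[OF z, of y] by simp
    then show False using v(2) by auto
  qed
  define pc where "pc = map_poly complex_of_real p"
  have dpc: "degree pc = degree p" unfolding pc_def by (rule degree_map_poly) simp
  then have "\<not> constant (poly pc)" using \<open>degree p \<noteq> 0\<close> by (simp add: constant_degree)
  then obtain z where z: "poly pc z = 0" using fundamental_theorem_of_algebra by blast
  define s t where "s = Re z" and "t = Im z"
  have "poly (map_poly complex_of_real q) (of_real x) = of_real (poly q x)" for q x
    by (induction q) (auto simp: map_poly_pCons)
  then have pr: "poly pc (of_real x) = of_real (poly p x)" for x by (simp add: pc_def)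
  show ?thesis
  proof (cases "t = 0")
    case True
    then have "z = of_real s" by (simp add: s_def t_def complex_eq_iff)
    then have "poly p s = 0" using z pr[of s] by simp
    \<comment> \<open>By minimality q(A) v is nonzero, while A - s maps it to p(A) v = 0, so it is
      an eigenvector.\<close>
    then obtain q where q: "p = [:- s, 1:] * q" using poly_eq_0_iff_dvd by (metis dvdE)
    have "q \<noteq> 0" using q p(1) by (auto simp: Z_def)
    then have "degree q < degree p" unfolding q by (subst degree_mult_eq) auto
    then have "\<not> Z q" using p(2) by force
    then have nz: "papp q v \<noteq> (\<lambda>y. 0)" using \<open>q \<noteq> 0\<close> by (simp add: Z_def)
    have "papp [:- s, 1:] (papp q v) = papp p v" unfolding q by (rule papp_mult[OF v(1), symmetric])
    then have "papp [:- s, 1:] (papp q v) = (\<lambda>y. 0)" using p(1) by (simp add: Z_def)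
    then have "(\<lambda>y. - s * papp q v y + A (papp q v) y) = (\<lambda>y. 0)"
      using papp_closed[OF v(1)] by (simp add: papp_pCons papp_0 A_zero)
    then have "A (papp q v) = (\<lambda>y. s * papp q v y)" by (auto simp: fun_eq_iff dest: spec)
    then show ?thesis using that nz by blast
  next
    case False
    define Q where "Q = [:s\<^sup>2 + t\<^sup>2, - 2 * s, 1:]"
    obtain k R where kR: "p = Q * k + R" "degree R < 2"
    proof
      show "p = Q * (p div Q) + p mod Q" by simp
      show "degree (p mod Q) < 2" using degree_mod_less[of Q p] by (auto simp: Q_def)
    qed
    have zz: "z\<^sup>2 - 2 * of_real s * z + of_real (s\<^sup>2 + t\<^sup>2) = 0"
      by (simp add: complex_eq_iff s_def t_def power2_eq_square)
    obtain r0 r1 where R: "R = [:r0, r1:]"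
    proof -
      have "R = [:coeff R 0, coeff R 1:]"
        using kR(2) by (intro poly_eqI) (auto simp: coeff_pCons coeff_eq_0 split: nat.splits)
      then show ?thesis using that by blast
    qed
    have "pc = map_poly of_real Q * map_poly of_real k + map_poly of_real R"
      unfolding pc_def kR(1)
      by (rule poly_eqI) (simp add: coeff_map_poly coeff_mult)
    then have "poly (map_poly of_real Q) z * poly (map_poly of_real k) z + poly (map_poly of_real R) z = 0"
      using z by simp
    moreover have "poly (map_poly of_real Q) z = z\<^sup>2 - 2 * of_real s * z + of_real (s\<^sup>2 + t\<^sup>2)"
      by (simp add: Q_def map_poly_pCons algebra_simps power2_eq_square)
    \<comment> \<open>The linear remainder vanishes at the nonreal number \<open>z\<close>, so both
      of its real coefficients are zero.\<close>
    ultimately have "of_real r0 + z * of_real r1 = 0" using zz by (simp add: R map_poly_pCons)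
    then have "r1 * t = 0" "r0 + s * r1 = 0" by (auto simp: complex_eq_iff s_def t_def)
    then have "r1 = 0" "r0 = 0" using False by auto
    then have pq: "p = Q * k" using kR(1) R by simp
    have "k \<noteq> 0" using pq p(1) by (auto simp: Z_def)
    then have "degree k < degree p" unfolding pq by (subst degree_mult_eq) (auto simp: Q_def)
    then have "\<not> Z k" using p(2) by force
    then have nz: "papp k v \<noteq> (\<lambda>y. 0)" using \<open>k \<noteq> 0\<close> by (simp add: Z_def)
    define y where "y = papp k v"
    have yV: "y \<in> V" unfolding y_def by (rule papp_closed[OF v(1)])
    define w where "w = (\<lambda>x. A y x - s * y x)"
    have wV: "w \<in> V" unfolding w_def by (intro V_diff A_closed V_scale yV)
    have "papp Q y = (\<lambda>y. 0)" using p(1) papp_mult[OF v(1)] pq by (simp add: Z_def y_def)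
    then have Qy: "(\<lambda>x. (s\<^sup>2 + t\<^sup>2) * y x + A (\<lambda>x. (- 2 * s) * y x + A y x) x) = (\<lambda>y. 0)"
      using yV by (simp add: Q_def papp_pCons papp_0 A_zero)
    have Aw: "A w x - s * w x = - t\<^sup>2 * y x" for x
    proof -
      have "A (\<lambda>x. (- 2 * s) * y x + A y x) = (\<lambda>x. (- 2 * s) * A y x + A (A y) x)"
        using A_add[OF V_scale[OF yV] A_closed[OF yV], of "- 2 * s"] A_scale[OF yV, of "- 2 * s"] by simp
      moreover have "A w = (\<lambda>x. A (A y) x - s * A y x)"
        unfolding w_def using A_diff[OF A_closed[OF yV] V_scale[OF yV], of s] A_scale[OF yV, of s] by simp
      moreover have "(s\<^sup>2 + t\<^sup>2) * y x + A (\<lambda>x. (- 2 * s) * y x + A y x) x = 0" using fun_cong[OF Qy, of x] by simp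
      ultimately have "(s\<^sup>2 + t\<^sup>2) * y x + ((- 2 * s) * A y x + A (A y) x) = 0" "A w x = A (A y) x - s * A y x" by simp_all
      then show ?thesis by (simp add: w_def algebra_simps power2_eq_square)
    qed
    have "ip w w = ip (\<lambda>x. A w x - s * w x) y"
    proof -
      have "ip w w = ip (A y) w - ip (\<lambda>x. s * y x) w" unfolding w_def[symmetric] by (subst (1) w_def) (rule ip_diff)
      also have "\<dots> = ip y (A w) - s * ip y w" using A_sym[OF yV wV] by (simp add: ip_scale)
      also have "\<dots> = ip (A w) y - ip (\<lambda>x. s * w x) y" by (simp add: ip_sym[of y] ip_scale)
      finally show ?thesis by (simp add: ip_diff)
    qed
    also have "\<dots> = - t\<^sup>2 * ip y y" unfolding Aw by (rule ip_scale)
    finally have "ip w w + t\<^sup>2 * ip y y = 0" by simp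
    moreover have "ip y y > 0" using ip_pos[OF yV] nz by (simp add: y_def)
    moreover have "t\<^sup>2 > 0" using False by simp
    ultimately show ?thesis using ip_nonneg[OF wV] by (smt (verit) mult_pos_pos)
  qed
qed

section \<open>Orthonormal eigenbasis and functional calculus\<close>

definition eigensystem :: "nat \<Rightarrow> (nat \<Rightarrow> real \<Rightarrow> real) \<Rightarrow> (nat \<Rightarrow> real) \<Rightarrow> bool" where
  "eigensystem n e l \<longleftrightarrow> (\<forall>i<n. e i \<in> V \<and> A (e i) = (\<lambda>y. l i * e i y)) \<and>
     (\<forall>i<n. \<forall>j<n. ip (e i) (e j) = (if i = j then 1 else 0))"

lemma eigensystem_le: "eigensystem n e l \<Longrightarrow> n \<le> d"
proof (rule ccontr)
  assume e: "eigensystem n e l" and "\<not> n \<le> d"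
  then have n: "d < n" by simp
  then obtain a where a: "\<exists>i\<le>d. a i \<noteq> 0" "(\<lambda>y. \<Sum>i\<le>d. a i * e i y) = (\<lambda>y. 0)"
    using dim[of e] e by (auto simp: eigensystem_def)
  then obtain j where j: "j \<le> d" "a j \<noteq> 0" by blast
  have "0 = ip (\<lambda>y. \<Sum>i\<le>d. a i * e i y) (e j)" unfolding a(2) by (simp add: ip_zero)
  also have "\<dots> = (\<Sum>i\<le>d. a i * (if i = j then 1 else 0))"
    unfolding ip_sum using e n j by (intro sum.cong) (auto simp: eigensystem_def)
  also have "\<dots> = a j" by (rule sum_mult_delta) (use j in auto)
  finally show False using j by simp
qed

text \<open>An orthonormal family of eigenvectors of maximal size is a basis. A nonzero residual
  \<open>w\<close> is orthogonal to the family, and by symmetry so is every p(A) w;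
  \<open>eigenvector_exists\<close> returns an eigenvector of just this form, which would enlarge
  the family.\<close>

lemma eigenbasis_exists:
  obtains n e l where "eigensystem n e l" "\<And>v. v \<in> V \<Longrightarrow> v = (\<lambda>y. \<Sum>i<n. ip v (e i) * e i y)"
proof -
  have "\<exists>n. (\<exists>e l. eigensystem n e l) \<and> (\<forall>m. (\<exists>e l. eigensystem m e l) \<longrightarrow> m \<le> n)"
  proof (rule ex_has_greatest_nat[of _ 0 "\<lambda>n. n" "Suc d", simplified])
    show "\<exists>e l. eigensystem 0 e l" by (simp add: eigensystem_def)
    show "\<forall>y. (\<exists>e l. eigensystem y e l) \<longrightarrow> y < Suc d" using eigensystem_le by fastforce
  qed
  then obtain n e l where e: "eigensystem n e l" and max: "\<And>m e l. eigensystem m e l \<Longrightarrow> m \<le> n" by blast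
  have eV: "e i \<in> V" "A (e i) = (\<lambda>y. l i * e i y)" if "i < n" for i using e that by (auto simp: eigensystem_def)
  have "v = (\<lambda>y. \<Sum>i<n. ip v (e i) * e i y)" if v: "v \<in> V" for v
  proof (rule ccontr)
    assume ne: "v \<noteq> (\<lambda>y. \<Sum>i<n. ip v (e i) * e i y)"
    define w where "w = (\<lambda>y. v y - (\<Sum>i<n. ip v (e i) * e i y))"
    have wV: "w \<in> V" unfolding w_def by (intro V_diff v V_sum) (use eV in auto)
    have w0: "w \<noteq> (\<lambda>y. 0)" using ne by (auto simp: w_def fun_eq_iff)
    have orth: "ip w (e j) = 0" if j: "j < n" for j
    proof -
      have "ip w (e j) = ip v (e j) - (\<Sum>i<n. ip v (e i) * ip (e i) (e j))"
        unfolding w_def by (simp only: ip_diff ip_sum)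
      also have "(\<Sum>i<n. ip v (e i) * ip (e i) (e j)) = (\<Sum>i<n. ip v (e i) * (if i = j then 1 else 0))"
        using e j by (intro sum.cong) (auto simp: eigensystem_def)
      also have "\<dots> = ip v (e j)" by (rule sum_mult_delta) (use j in auto)
      finally show ?thesis by simp
    qed
    have pow_orth: "ip (pow i w) (e j) = 0" if j: "j < n" for i j
    proof (induction i)
      case 0 then show ?case using orth[OF j] by simp
    next
      case (Suc i)
      have "ip (pow (Suc i) w) (e j) = ip (pow i w) (A (e j))"
        using A_sym[OF pow_closed[OF wV] eV(1)[OF j]] by simp
      also have "\<dots> = l j * ip (pow i w) (e j)"
        unfolding eV(2)[OF j] by (simp add: ip_sym[of "pow i w"] ip_scale)
      finally show ?case using Suc by simp
    qed
    obtain p c where p: "papp p w \<noteq> (\<lambda>y. 0)" "A (papp p w) = (\<lambda>y. c * papp p w y)"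
      using eigenvector_exists[OF wV w0] by blast
    define x where "x = papp p w"
    have xV: "x \<in> V" unfolding x_def by (rule papp_closed[OF wV])
    have xo: "ip x (e j) = 0" if "j < n" for j
      unfolding x_def papp_def ip_sum by (simp add: pow_orth[OF that])
    define N where "N = sqrt (ip x x)"
    have Npos: "N > 0" "N * N = ip x x" using ip_pos[OF xV] p(1) by (auto simp: N_def x_def)
    define e' where "e' i = (if i < n then e i else (\<lambda>y. (1 / N) * x y))" for i
    define l' where "l' i = (if i < n then l i else c)" for i
    have "eigensystem (Suc n) e' l'"
      unfolding eigensystem_def
    proof (intro conjI allI impI)
      fix i assume i: "i < Suc n"
      show "e' i \<in> V" using eV V_scale[OF xV, of "1 / N"] by (simp add: e'_def)
      show "A (e' i) = (\<lambda>y. l' i * e' i y)"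
      proof (cases "i < n")
        case False
        have "A (\<lambda>y. (1 / N) * x y) = (\<lambda>y. (1 / N) * (c * x y))" unfolding A_scale[OF xV, of "1 / N"] using p(2) by (simp add: x_def)
        then show ?thesis using False by (simp add: e'_def l'_def fun_eq_iff)
      qed (use eV in \<open>auto simp: e'_def l'_def\<close>)
    next
      fix i j assume ij: "i < Suc n" "j < Suc n"
      have nn: "ip (\<lambda>y. (1 / N) * x y) (\<lambda>y. (1 / N) * x y) = 1"
      proof -
        have "ip (\<lambda>y. (1 / N) * x y) (\<lambda>y. (1 / N) * x y) = (1 / N) * ((1 / N) * ip x x)"
          by (simp only: ip_scale ip_sym[of x "\<lambda>y. (1 / N) * x y"])
        also have "\<dots> = 1" unfolding Npos(2)[symmetric] using Npos(1) by simp
        finally show ?thesis .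
      qed
      have nx: "ip (\<lambda>y. (1 / N) * x y) (e k) = 0" "ip (e k) (\<lambda>y. (1 / N) * x y) = 0" if "k < n" for k
        using ip_scale[of "1 / N" x "e k"] xo[OF that] ip_sym by simp_all
      show "ip (e' i) (e' j) = (if i = j then 1 else 0)"
        using ij nn nx e by (auto simp: e'_def eigensystem_def less_Suc_eq)
    qed
    then show False using max by fastforce
  qed
  then show ?thesis using that e by blast
qed

text \<open>Reconciles the definition by eigenspaces, where each eigenvalue counts once, with the
  eigenbasis, where it may be repeated: the projection onto an eigenspace is the partial sum over
  the indices with that eigenvalue.\<close>

lemma spectral_fun_eigenbasis:
  assumes e: "eigensystem n e l" and basis: "\<And>v. v \<in> V \<Longrightarrow> v = (\<lambda>y. \<Sum>i<n. ip v (e i) * e i y)" and v: "v \<in> V"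
  shows "spectral_fun V ip A g v = (\<lambda>y. \<Sum>i<n. g (l i) * ip v (e i) * e i y)"
proof -
  have eV: "e i \<in> V" "A (e i) = (\<lambda>y. l i * e i y)" if "i < n" for i using e that by (auto simp: eigensystem_def)
  have ee: "ip (e i) (e j) = (if i = j then 1 else 0)" if "i < n" "j < n" for i j using e that by (auto simp: eigensystem_def)
  have e0: "e i \<noteq> (\<lambda>y. 0)" if "i < n" for i using ee[OF that that] ip_zero by auto
  \<comment> \<open>Eigenvectors for different eigenvalues are orthogonal.\<close>
  have coord: "m = l i \<or> ip w (e i) = 0" if w: "w \<in> eigenspace V A m" and i: "i < n" for w m i
  proof -
    have wV: "w \<in> V" "A w = (\<lambda>y. m * w y)" using w by (auto simp: eigenspace_def)
    have "m * ip w (e i) = ip (A w) (e i)" by (simp add: wV(2) ip_scale)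
    also have "\<dots> = ip w (A (e i))" by (rule A_sym[OF wV(1) eV(1)[OF i]])
    also have "\<dots> = l i * ip w (e i)" unfolding eV(2)[OF i] by (simp add: ip_sym[of w] ip_scale)
    finally show ?thesis by auto
  qed
  have ev: "eigenvalues V A = l ` {..<n}"
  proof
    show "l ` {..<n} \<subseteq> eigenvalues V A" using eV e0 by (auto simp: eigenvalues_def eigenspace_def)
    show "eigenvalues V A \<subseteq> l ` {..<n}"
    proof
      fix m assume "m \<in> eigenvalues V A"
      then obtain w where w: "w \<in> eigenspace V A m" "w \<noteq> (\<lambda>y. 0)" by (auto simp: eigenvalues_def)
      show "m \<in> l ` {..<n}"
      proof (rule ccontr)
        assume "m \<notin> l ` {..<n}"
        then have "ip w (e i) = 0" if "i < n" for i using coord[OF w(1) that] that by auto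
        then have "w = (\<lambda>y. 0)" using basis[of w] w(1) by (simp add: eigenspace_def)
        then show False using w(2) by simp
      qed
    qed
  qed
  have proj: "orth_proj ip (eigenspace V A m) v = (\<lambda>y. \<Sum>i\<in>{i. i < n \<and> l i = m}. ip v (e i) * e i y)" for m
    unfolding orth_proj_def
  proof (rule the_equality)
    let ?w = "\<lambda>y. \<Sum>i\<in>{i. i < n \<and> l i = m}. ip v (e i) * e i y"
    have wV: "?w \<in> V" by (rule V_sum) (use eV in auto)
    have "A ?w = (\<lambda>y. \<Sum>i\<in>{i. i < n \<and> l i = m}. ip v (e i) * A (e i) y)" by (rule A_sum) (use eV in auto)
    also have "\<dots> = (\<lambda>y. m * ?w y)"
      unfolding sum_distrib_left by (intro ext sum.cong) (use eV in auto)
    finally have wE: "?w \<in> eigenspace V A m" using wV by (simp add: eigenspace_def)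
    have orth: "ip (\<lambda>y. v y - ?w y) z = 0" if z: "z \<in> eigenspace V A m" for z
    proof -
      have "ip v z = ip (\<lambda>y. \<Sum>i<n. ip v (e i) * e i y) z" using basis[OF v] by simp
      also have "\<dots> = (\<Sum>i<n. ip v (e i) * ip (e i) z)" by (rule ip_sum)
      also have "\<dots> = (\<Sum>i\<in>{i. i < n \<and> l i = m}. ip v (e i) * ip (e i) z)"
        by (rule sum.mono_neutral_right) (use coord[OF z] ip_sym in auto)
      finally show ?thesis by (simp only: ip_diff ip_sum)
    qed
    show "?w \<in> eigenspace V A m \<and> (\<forall>z\<in>eigenspace V A m. ip (\<lambda>y. v y - ?w y) z = 0)" using wE orth by blast
    fix w assume w: "w \<in> eigenspace V A m \<and> (\<forall>z\<in>eigenspace V A m. ip (\<lambda>y. v y - w y) z = 0)"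
    define x where "x = (\<lambda>y. w y - ?w y)"
    have xV: "x \<in> V" unfolding x_def using w wV by (intro V_diff) (auto simp: eigenspace_def)
    have "A x = (\<lambda>y. A w y - A ?w y)" unfolding x_def using w wV by (intro A_diff) (auto simp: eigenspace_def)
    then have "A x = (\<lambda>y. m * x y)" using w wE by (simp add: eigenspace_def x_def right_diff_distrib)
    then have xE: "x \<in> eigenspace V A m" using xV by (simp add: eigenspace_def)
    have "ip x x = ip (\<lambda>y. v y - ?w y) x - ip (\<lambda>y. v y - w y) x"
      by (simp only: ip_diff[symmetric]) (simp add: x_def)
    then have "ip x x = 0" using orth[OF xE] w xE by simp
    then have "x = (\<lambda>y. 0)" using ip_eq_0[OF xV] by simp
    then show "w = ?w" by (simp add: x_def fun_eq_iff)
  qed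
  have "spectral_fun V ip A g v y = (\<Sum>i<n. g (l i) * ip v (e i) * e i y)" for y
  proof -
    have "spectral_fun V ip A g v y = (\<Sum>m\<in>l ` {..<n}. \<Sum>i\<in>{i \<in> {..<n}. l i = m}. g (l i) * ip v (e i) * e i y)"
      unfolding spectral_fun_def ev proj sum_distrib_left by (intro sum.cong) (auto simp: mult.assoc)
    also have "\<dots> = (\<Sum>i<n. g (l i) * ip v (e i) * e i y)"
      by (rule sum.image_gen[symmetric]) simp
    finally show ?thesis .
  qed
  then show ?thesis by blast
qed

end

subsection \<open>The finite element space\<close>

lemma L2_space_indicator:
  assumes "v \<in> L2_space a b" "S \<in> sets borel"
  shows "(\<lambda>y. indicat_real S y * v y) \<in> L2_space a b"
proof -
  have i: "indicat_real S \<in> borel_measurable (lebesgue_on {a..b})"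
    using assms(2) by (intro measurable_restrict_space1 borel_measurable_indicator) (auto intro: sets_completionI_sets)
  then have m: "(\<lambda>y. indicat_real S y * v y) \<in> borel_measurable (lebesgue_on {a..b})"
    using assms(1) by (auto dest: L2_space_measurable intro!: borel_measurable_times)
  have "integrable (lebesgue_on {a..b}) (\<lambda>y. (indicat_real S y * v y)\<^sup>2)"
  proof (rule Bochner_Integration.integrable_bound)
    show "integrable (lebesgue_on {a..b}) (\<lambda>y. (v y)\<^sup>2)" using assms(1) by (simp add: L2_space_def)
    show "(\<lambda>y. (indicat_real S y * v y)\<^sup>2) \<in> borel_measurable (lebesgue_on {a..b})" using m by (rule borel_measurable_power)
    show "AE y in lebesgue_on {a..b}. norm ((indicat_real S y * v y)\<^sup>2) \<le> norm ((v y)\<^sup>2)"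
      by (intro AE_I2) (auto simp: indicator_def)
  qed
  then show ?thesis using m by (simp add: L2_space_def)
qed

lemma integral_partition:
  fixes X :: "nat \<Rightarrow> real" and f :: "real \<Rightarrow> real"
  assumes "\<And>i. i < m \<Longrightarrow> X i \<le> X (Suc i)" "f integrable_on {X 0..X m}"
  shows "integral {X 0..X m} f = (\<Sum>i=1..m. integral {X (i - 1)..X i} f)"
  using assms
proof (induction m)
  case (Suc m)
  have "X 0 \<le> X j" if "j \<le> m" for j
    using that by (induction j) (use Suc.prems(1) in \<open>auto intro: order.trans\<close>)
  then have le: "X 0 \<le> X m" by blast
  have i: "f integrable_on {X 0..X m}" by (rule integrable_on_subinterval[OF Suc.prems(2)]) (use Suc.prems(1)[of m] in auto)
  have "integral {X 0..X (Suc m)} f = integral {X 0..X m} f + integral {X m..X (Suc m)} f"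
    by (rule Henstock_Kurzweil_Integration.integral_combine[symmetric]) (use le Suc.prems in auto)
  also have "integral {X 0..X m} f = (\<Sum>i=1..m. integral {X (i - 1)..X i} f)" by (rule Suc.IH) (use Suc.prems i in auto)
  finally show ?case by simp
qed simp

locale mesh =
  fixes a b :: real and M r :: nat and x \<omega> :: "nat \<Rightarrow> real"
  assumes ab: "a < b" and r: "r \<ge> 1" and gl: "gl_mesh a b M r x \<omega>"
begin

definition h :: real where "h = (b - a) / real M"
definition X :: "nat \<Rightarrow> real" where "X i = x (i * r)"
definition nd :: "nat \<Rightarrow> nat \<Rightarrow> real" where "nd i j = x ((i - 1) * r + j)"

abbreviation "V \<equiv> fem_space a b M r x"
abbreviation "ip \<equiv> quad_inner M r x \<omega>"
abbreviation "N2 v \<equiv> ip v v"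

definition E :: "(real \<Rightarrow> real) \<Rightarrow> (real \<Rightarrow> real) \<Rightarrow> real" where
  "E v w = L2_inner a b (weak_deriv a b 1 v) (weak_deriv a b 1 w)"

lemma M_pos: "M > 0" using gl by (simp add: gl_mesh_def)

lemma h_pos: "h > 0" using ab M_pos by (simp add: h_def)

lemma h_le: "h \<le> b - a"
proof -
  have "(b - a) / real M \<le> (b - a) / 1" using M_pos ab by (intro divide_left_mono) auto
  then show ?thesis by (simp add: h_def)
qed

lemma Mh: "real M * h = b - a" using M_pos by (simp add: h_def)

lemma X_eq: "i \<le> M \<Longrightarrow> X i = a + real i * h"
  using gl by (simp add: gl_mesh_def X_def h_def)

lemma X_ends: "X 0 = a" "X M = b"
  using X_eq[of 0] X_eq[of M] Mh by auto

lemma X_diff: "i \<in> {1..M} \<Longrightarrow> X i - X (i - 1) = h"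
  using X_eq[of i] X_eq[of "i - 1"] by (auto simp: of_nat_diff algebra_simps)

lemma X_less: "i \<in> {1..M} \<Longrightarrow> X (i - 1) < X i"
  using X_diff h_pos by fastforce

lemma X_mono: "i \<le> j \<Longrightarrow> j \<le> M \<Longrightarrow> X i \<le> X j"
  using h_pos by (simp add: X_eq mult_right_mono)

lemma cell_subset: "i \<in> {1..M} \<Longrightarrow> {X (i - 1)..X i} \<subseteq> {a..b}"
  using X_mono[of 0 "i - 1"] X_mono[of i M] by (auto simp: X_ends)

lemma gl_cell: "i \<in> {1..M} \<Longrightarrow> gauss_lobatto r (X (i - 1)) (X i) (nd i) \<omega>"
  using gl unfolding gl_mesh_def X_def nd_def[abs_def] by blast

lemma cell_cover:
  assumes "y \<in> {a..b}"
  obtains i where "i \<in> {1..M}" "y \<in> {X (i - 1)..X i}"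
proof -
  have "\<exists>i\<in>{1..m}. y \<in> {X (i - 1)..X i}" if "0 < m" "m \<le> M" "y \<le> X m" for m
    using that
  proof (induction m)
    case (Suc m)
    show ?case
    proof (cases "m = 0 \<or> y > X m")
      case True
      then show ?thesis using Suc.prems assms X_ends by (intro bexI[of _ "Suc m"]) auto
    next
      case False
      then obtain i where "i \<in> {1..m}" "y \<in> {X (i - 1)..X i}" using Suc by auto
      then show ?thesis by (intro bexI[of _ i]) auto
    qed
  qed simp
  from this[of M] show ?thesis using that assms M_pos X_ends by auto
qed

lemma weight_pos: "j \<le> r \<Longrightarrow> \<omega> j > 0"
  using gauss_lobatto_weight_pos[OF gl_cell[of 1] r] M_pos by simp

lemma weight_sum: "(\<Sum>j\<le>r. \<omega> j) = h"
  using gauss_lobatto_sum_weights[OF gl_cell[of 1] r] X_diff[of 1] M_pos by simp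

lemma nd_in: "i \<in> {1..M} \<Longrightarrow> j \<le> r \<Longrightarrow> nd i j \<in> {X (i - 1)..X i}"
  by (rule gauss_lobatto_nodes(3)[OF gl_cell r])

lemma nd_inj: "i \<in> {1..M} \<Longrightarrow> inj_on (nd i) {..r}"
  by (rule gauss_lobatto_nodes(2)[OF gl_cell r])

lemma nd_ends: "nd i 0 = X (i - 1)" "i \<ge> 1 \<Longrightarrow> nd i r = X i"
proof -
  assume "i \<ge> 1"
  then have "(i - 1) * r + r = i * r" by (cases i) auto
  then show "nd i r = X i" by (simp add: nd_def X_def)
qed (simp add: nd_def X_def)

lemma node_index: "i \<in> {1..M} \<Longrightarrow> j \<le> r \<Longrightarrow> (i - 1) * r + j \<le> M * r"
proof -
  assume "i \<in> {1..M}" "j \<le> r"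
  then have "(i - 1) * r + j \<le> (i - 1) * r + r" by simp
  also have "\<dots> = i * r" using \<open>i \<in> {1..M}\<close> by (cases i) auto
  also have "\<dots> \<le> M * r" using \<open>i \<in> {1..M}\<close> by simp
  finally show ?thesis .
qed

lemma node_cover:
  assumes "J \<le> M * r"
  obtains i j where "i \<in> {1..M}" "j \<le> r" "J = (i - 1) * r + j"
proof (cases "J = M * r")
  case True
  then show ?thesis using that[of M r] M_pos by (cases M) auto
next
  case False
  then have "J < M * r" using assms by simp
  then have "J div r < M" using r by (simp add: less_mult_imp_div_less)
  moreover have "J mod r \<le> r" using r by (simp add: less_imp_le)
  ultimately show ?thesis using that[of "Suc (J div r)" "J mod r"] by simp
qed

lemma node_in: "J \<le> M * r \<Longrightarrow> x J \<in> {a..b}"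
  using node_cover[of J] nd_in cell_subset by (metis nd_def subsetD)

lemma ip_nd: "ip v w = (\<Sum>i=1..M. \<Sum>j\<le>r. \<omega> j * (v (nd i j) * w (nd i j)))"
  by (simp add: quad_inner_def nd_def mult.assoc)

text \<open>The form sees nodal values only. This lets the exact solution, which is not in
  \<open>V\<close>, be inserted without being interpolated.\<close>

lemma ip_cong:
  assumes "\<And>J. J \<le> M * r \<Longrightarrow> v (x J) = v' (x J)" "\<And>J. J \<le> M * r \<Longrightarrow> w (x J) = w' (x J)"
  shows "ip v w = ip v' w'"
  unfolding ip_nd nd_def using assms node_index by (intro sum.cong) auto

lemma ip_sym: "ip v w = ip w v"
  by (simp add: ip_nd mult.commute)

lemma ip_add: "ip (\<lambda>y. v y + w y) z = ip v z + ip w z"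
  by (simp add: ip_nd distrib_left distrib_right sum.distrib)

lemma ip_scale: "ip (\<lambda>y. c * v y) z = c * ip v z"
  by (simp add: ip_nd sum_distrib_left mult.assoc mult.left_commute)

lemma ip_diff: "ip (\<lambda>y. v y - w y) z = ip v z - ip w z"
  using ip_add[of v "\<lambda>y. (-1) * w y" z] ip_scale[of "-1" w z] by simp

lemma N2_nonneg: "N2 v \<ge> 0"
  unfolding ip_nd using weight_pos by (intro sum_nonneg mult_nonneg_nonneg[OF _ zero_le_square]) (auto intro: less_imp_le)

text \<open>Rests on the positivity of the weights; it is the property of the quadrature norm that
  makes the cut-off harmless.\<close>

lemma N2_le_nodes:
  assumes "\<And>J. J \<le> M * r \<Longrightarrow> \<bar>v (x J)\<bar> \<le> \<bar>w (x J)\<bar>"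
  shows "N2 v \<le> N2 w"
  unfolding ip_nd
proof (intro sum_mono mult_left_mono)
  fix i j assume "i \<in> {1..M}" "j \<in> {..r}"
  then have "\<bar>v (nd i j)\<bar> \<le> \<bar>w (nd i j)\<bar>" using assms node_index by (simp add: nd_def)
  then show "v (nd i j) * v (nd i j) \<le> w (nd i j) * w (nd i j)" by (simp add: abs_le_square_iff flip: power2_eq_square)
qed (use weight_pos in \<open>auto intro: less_imp_le\<close>)

lemma N2_const: "N2 (\<lambda>_. K) = (b - a) * K\<^sup>2"
  by (simp add: ip_nd weight_sum Mh[symmetric] power2_eq_square mult.assoc flip: sum_distrib_right)

lemma N2_bound:
  assumes "\<And>J. J \<le> M * r \<Longrightarrow> \<bar>v (x J)\<bar> \<le> K"
  shows "N2 v \<le> (b - a) * K\<^sup>2"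
  unfolding N2_const[symmetric] by (rule N2_le_nodes) (use assms in force)

text \<open>Continuity is built into the requirement that the polynomials of neighbouring cells both agree with
  the function at the common end point.\<close>

definition pieces :: "(real \<Rightarrow> real) \<Rightarrow> (nat \<Rightarrow> real poly) \<Rightarrow> bool" where
  "pieces v P \<longleftrightarrow> (\<forall>i\<in>{1..M}. degree (P i) \<le> r \<and> (\<forall>y\<in>{X (i - 1)..X i}. v y = poly (P i) y))"

lemma piecesD: "pieces v P \<Longrightarrow> i \<in> {1..M} \<Longrightarrow> degree (P i) \<le> r"
  "pieces v P \<Longrightarrow> i \<in> {1..M} \<Longrightarrow> y \<in> {X (i - 1)..X i} \<Longrightarrow> v y = poly (P i) y"
  by (auto simp: pieces_def)

lemma pieces_nd: "pieces v P \<Longrightarrow> i \<in> {1..M} \<Longrightarrow> j \<le> r \<Longrightarrow> v (nd i j) = poly (P i) (nd i j)"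
  by (rule piecesD(2)[OF _ _ nd_in])

text \<open>The piecewise derivative. Open cells avoid double counting at mesh points, where the
  value 0 is a convention without influence on integrals.\<close>

definition pd :: "(nat \<Rightarrow> real poly) \<Rightarrow> real \<Rightarrow> real" where
  "pd P y = (\<Sum>i=1..M. indicat_real {X (i - 1)<..<X i} y * poly (pderiv (P i)) y)"

lemma pd_cell:
  assumes "i \<in> {1..M}" "y \<in> {X (i - 1)<..<X i}"
  shows "pd P y = poly (pderiv (P i)) y"
proof -
  have "indicat_real {X (k - 1)<..<X k} y = (if k = i then 1 else 0)" if "k \<in> {1..M}" for k
  proof (cases k i rule: linorder_cases)
    case less
    then have "X k \<le> X (i - 1)" using assms(1) by (intro X_mono) auto
    then show ?thesis using assms(2) less by auto
  next
    case greater
    then have "X i \<le> X (k - 1)" using that by (intro X_mono) auto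
    then show ?thesis using assms(2) greater by auto
  qed (use assms in auto)
  then have "pd P y = (\<Sum>k=1..M. if k = i then poly (pderiv (P i)) y else 0)"
    unfolding pd_def by (intro sum.cong) auto
  then show ?thesis using assms(1) by simp
qed

lemma pd_L2: "pd P \<in> L2_space a b"
  unfolding pd_def[abs_def] by (intro L2_space_sum L2_space_indicator) auto

lemma pieces_continuous:
  assumes "pieces v P"
  shows "continuous_on {a..b} v"
proof -
  have "continuous_on (\<Union>i\<in>{1..M}. {X (i - 1)..X i}) v"
  proof (rule continuous_on_closed_Union)
    fix i assume "i \<in> {1..M}"
    then show "continuous_on {X (i - 1)..X i} v"
      using piecesD(2)[OF assms] by (subst continuous_on_cong[OF refl, of _ _ "poly (P i)"]) (auto intro!: continuous_intros)
  qed auto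
  moreover have "(\<Union>i\<in>{1..M}. {X (i - 1)..X i}) = {a..b}"
    using cell_subset cell_cover by blast
  ultimately show ?thesis by simp
qed

lemma integral_cells:
  fixes f :: "real \<Rightarrow> real"
  assumes "f integrable_on {a..b}"
  shows "integral {a..b} f = (\<Sum>i=1..M. integral {X (i - 1)..X i} f)"
  using integral_partition[of M X f] assms X_less[of "Suc _"] by (simp add: X_ends less_imp_le)

text \<open>The fundamental theorem of calculus applies to the continuous product of
  \<open>v\<close> and a test function in spite of the finitely many mesh points where it may fail
  to be differentiable.\<close>

lemma pieces_weak_deriv:
  assumes v: "pieces v P"
  shows "has_weak_deriv a b 1 v (pd P)"
  unfolding has_weak_deriv_def
proof (intro conjI allI impI)
  note cont = pieces_continuous[OF v]
  show vL: "v \<in> L2_space a b" using cont by auto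
  show pL: "pd P \<in> L2_space a b" by (rule pd_L2)
  fix \<phi> assume t: "test_function a b \<phi>"
  have sm: "smooth \<phi>" using t by (rule test_function_smooth)
  have tL: "\<phi> \<in> L2_space a b" "deriv \<phi> \<in> L2_space a b" using t test_function_deriv test_function_L2 by blast+
  have "((\<lambda>y. pd P y * \<phi> y + v y * deriv \<phi> y) has_integral (v b * \<phi> b - v a * \<phi> a)) {a..b}"
  proof (rule fundamental_theorem_of_calculus_interior_strong[of "X ` {0..M}"])
    show "continuous_on {a..b} (\<lambda>y. v y * \<phi> y)" by (intro continuous_intros cont smooth_continuous sm)
    fix y assume y: "y \<in> {a<..<b} - X ` {0..M}"
    then obtain i where i: "i \<in> {1..M}" "y \<in> {X (i - 1)..X i}" using cell_cover[of y] by force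
    then have "y \<noteq> X i" "y \<noteq> X (i - 1)" using y by auto
    then have iy: "y \<in> {X (i - 1)<..<X i}" using i by auto
    have ev: "\<forall>\<^sub>F z in nhds y. v z = poly (P i) z"
      using eventually_nhds_in_open[OF open_greaterThanLessThan iy]
      by (rule eventually_mono) (use piecesD(2)[OF v i(1)] in auto)
    have "(v has_real_derivative pd P y) (at y)"
      unfolding pd_cell[OF i(1) iy] by (subst DERIV_cong_ev[OF refl ev refl]) (rule poly_DERIV)
    then have "((\<lambda>y. v y * \<phi> y) has_real_derivative (pd P y * \<phi> y + deriv \<phi> y * v y)) (at y)"
      by (rule DERIV_mult[OF _ smooth_DERIV[OF sm]])
    then show "((\<lambda>y. v y * \<phi> y) has_vector_derivative (pd P y * \<phi> y + v y * deriv \<phi> y)) (at y)"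
      by (simp add: has_real_derivative_iff_has_vector_derivative mult.commute)
  qed (use ab in auto)
  then have "integral {a..b} (\<lambda>y. pd P y * \<phi> y + v y * deriv \<phi> y) = 0"
    using test_function_ends[OF t] by (simp add: integral_unique)
  then have "L2_inner a b (pd P) \<phi> + L2_inner a b v (deriv \<phi>) = 0"
    using L2_inner_integral[OF pL tL(1)] L2_inner_integral[OF vL tL(2)]
      L2_space_integrable_on[OF pL tL(1)] L2_space_integrable_on[OF vL tL(2)]
    by (simp add: Henstock_Kurzweil_Integration.integral_add)
  then show "L2_inner a b v ((deriv ^^ 1) \<phi>) = (- 1) ^ 1 * L2_inner a b (pd P) \<phi>" by simp
qed

text \<open>Continuous piecewise polynomials have a square integrable weak derivative, which turns
  membership in \<open>V\<close> into an algebraic condition on the pieces.\<close>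

lemma V_iff: "v \<in> V \<longleftrightarrow> (\<exists>P. pieces v P) \<and> (\<forall>y. y \<notin> {a..b} \<longrightarrow> v y = 0)"
proof
  assume v: "v \<in> V"
  then have "\<forall>i\<in>{1..M}. \<exists>p. degree p \<le> r \<and> (\<forall>y\<in>{X (i - 1)..X i}. v y = poly p y)"
    by (simp add: fem_space_def X_def)
  then obtain P where "\<forall>i\<in>{1..M}. degree (P i) \<le> r \<and> (\<forall>y\<in>{X (i - 1)..X i}. v y = poly (P i) y)" by metis
  then show "(\<exists>P. pieces v P) \<and> (\<forall>y. y \<notin> {a..b} \<longrightarrow> v y = 0)" using v by (auto simp: pieces_def fem_space_def)
next
  assume v: "(\<exists>P. pieces v P) \<and> (\<forall>y. y \<notin> {a..b} \<longrightarrow> v y = 0)"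
  then obtain P where P: "pieces v P" by blast
  have vL: "v \<in> L2_space a b" using pieces_continuous[OF P] by auto
  have "\<exists>w. has_weak_deriv a b i v w" if "i \<le> 1" for i
  proof (cases "i = 0")
    case True then show ?thesis using has_weak_deriv_0[OF vL] by auto
  next
    case False then have "i = 1" using that by simp
    then show ?thesis using pieces_weak_deriv[OF P] by auto
  qed
  then have "v \<in> H_space a b 1" using vL by (simp add: H_space_def)
  then show "v \<in> V" using v P by (auto simp: fem_space_def pieces_def X_def)
qed

lemma V_pieces: "v \<in> V \<Longrightarrow> \<exists>P. pieces v P" by (simp add: V_iff)

lemma V_outside: "v \<in> V \<Longrightarrow> y \<notin> {a..b} \<Longrightarrow> v y = 0" by (simp add: V_iff)

lemma V_zero: "(\<lambda>y. 0) \<in> V"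
  unfolding V_iff pieces_def by (auto intro!: exI[of _ "\<lambda>_. 0"])

lemma V_add: assumes "v \<in> V" "w \<in> V" shows "(\<lambda>y. v y + w y) \<in> V"
proof -
  obtain P Q where "pieces v P" "pieces w Q" using assms V_iff by blast
  then have "pieces (\<lambda>y. v y + w y) (\<lambda>i. P i + Q i)" by (auto simp: pieces_def intro: degree_add_le)
  then show ?thesis unfolding V_iff using V_outside[OF assms(1)] V_outside[OF assms(2)] by (auto simp del: atLeastAtMost_iff)
qed

lemma V_scale: assumes "v \<in> V" shows "(\<lambda>y. c * v y) \<in> V"
proof -
  obtain P where "pieces v P" using assms V_iff by blast
  then have "pieces (\<lambda>y. c * v y) (\<lambda>i. smult c (P i))" by (auto simp: pieces_def intro: order.trans[OF degree_smult_le])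
  then show ?thesis unfolding V_iff using V_outside[OF assms] by (auto simp del: atLeastAtMost_iff)
qed

lemma V_eqI:
  assumes "v \<in> V" "w \<in> V" "\<And>J. J \<le> M * r \<Longrightarrow> v (x J) = w (x J)"
  shows "v = w"
proof
  fix y
  obtain P Q where P: "pieces v P" and Q: "pieces w Q" using assms V_iff by blast
  show "v y = w y"
  proof (cases "y \<in> {a..b}")
    case True
    then obtain i where i: "i \<in> {1..M}" "y \<in> {X (i - 1)..X i}" using cell_cover by blast
    have "P i = Q i"
    proof (rule poly_interpolation_unique[OF nd_inj[OF i(1)] piecesD(1)[OF P i(1)] piecesD(1)[OF Q i(1)]])
      fix j assume "j \<le> r"
      then show "poly (P i) (nd i j) = poly (Q i) (nd i j)"
        using pieces_nd[OF P i(1)] pieces_nd[OF Q i(1)] assms(3)[OF node_index[OF i(1)]] by (simp add: nd_def)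
    qed
    then show ?thesis using piecesD(2)[OF P i] piecesD(2)[OF Q i] by simp
  qed (simp add: V_outside[OF assms(1)] V_outside[OF assms(2)])
qed

section \<open>Lagrange interpolation in the finite element space\<close>

lemma V_interpolant:
  obtains v where "v \<in> V" "\<And>J. J \<le> M * r \<Longrightarrow> v (x J) = g J"
proof -
  define P where "P i = (SOME p. degree p \<le> r \<and> (\<forall>j\<le>r. poly p (nd i j) = g ((i - 1) * r + j)))" for i
  have "degree (P i) \<le> r \<and> (\<forall>j\<le>r. poly (P i) (nd i j) = g ((i - 1) * r + j))" if "i \<in> {1..M}" for i
    unfolding P_def
    by (rule someI_ex, rule poly_interpolation_exists[of "nd i" r "\<lambda>j. g ((i - 1) * r + j)", OF nd_inj[OF that]])
  then have P: "\<And>i. i \<in> {1..M} \<Longrightarrow> degree (P i) \<le> r"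
    "\<And>i j. i \<in> {1..M} \<Longrightarrow> j \<le> r \<Longrightarrow> poly (P i) (nd i j) = g ((i - 1) * r + j)" by blast+
  \<comment> \<open>A mesh point is assigned to the cell on its left; the case distinction below
    shows that the polynomial of the right cell gives the same value.\<close>
  define k where "k y = (LEAST i. 1 \<le> i \<and> y \<le> X i)" for y
  define v where "v y = (if y \<in> {a..b} then poly (P (k y)) y else 0)" for y
  have v: "v y = poly (P i) y" if i: "i \<in> {1..M}" and y: "y \<in> {X (i - 1)..X i}" for i y
  proof -
    have yab: "y \<in> {a..b}" using cell_subset[OF i] y by auto
    show ?thesis
    proof (cases "y = X (i - 1) \<and> i \<noteq> 1")
      case False
      have "k y = i" unfolding k_def
      proof (rule Least_equality)
        fix q assume q: "1 \<le> q \<and> y \<le> X q"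
        show "i \<le> q"
        proof (rule ccontr)
          assume "\<not> i \<le> q"
          then have "X q \<le> X (i - 1)" using i by (intro X_mono) auto
          then have "y = X (i - 1)" using q y by auto
          moreover have "i \<noteq> 1" using q \<open>\<not> i \<le> q\<close> by auto
          ultimately show False using False by simp
        qed
      qed (use i y in auto)
      then show ?thesis using yab by (simp add: v_def)
    next
      case True
      have i1: "i - 1 \<in> {1..M}" using True i by auto
      have "k y = i - 1" unfolding k_def
      proof (rule Least_equality)
        fix q assume q: "1 \<le> q \<and> y \<le> X q"
        show "i - 1 \<le> q"
        proof (rule ccontr)
          assume "\<not> i - 1 \<le> q"
          then have "X q \<le> X (i - 1 - 1)" using i by (intro X_mono) auto
          then show False using X_less[OF i1] True q by auto
        qed
      qed (use i1 True in auto)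
      then have "v y = poly (P (i - 1)) (nd (i - 1) r)" using yab True nd_ends(2)[of "i - 1"] i1 by (simp add: v_def)
      also have "\<dots> = g ((i - 1 - 1) * r + r)" by (rule P(2)[OF i1 order.refl])
      \<comment> \<open>The last node of a cell and the first node of the next share one global
        index, so both polynomials interpolate the same datum.\<close>
      also have "(i - 1 - 1) * r + r = (i - 1) * r + 0" using i1 by (cases "i - 1") auto
      also have "g ((i - 1) * r + 0) = poly (P i) (nd i 0)" using P(2)[OF i, of 0] by simp
      finally show ?thesis using True nd_ends(1) by simp
    qed
  qed
  have "pieces v P" using P(1) v by (simp add: pieces_def)
  then have "v \<in> V" unfolding V_iff by (auto simp: v_def)
  moreover have "v (x J) = g J" if J: "J \<le> M * r" for J
  proof -
    obtain i j where ij: "i \<in> {1..M}" "j \<le> r" "J = (i - 1) * r + j" using node_cover[OF J] by blast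
    then show ?thesis using v[OF ij(1) nd_in[OF ij(1,2)]] P(2)[OF ij(1,2)] by (simp add: nd_def)
  qed
  ultimately show ?thesis using that by blast
qed

definition interp :: "(real \<Rightarrow> real) \<Rightarrow> real \<Rightarrow> real" where
  "interp g = lagrange_interp a b M r x g"

lemma interp: "interp g \<in> V" "J \<le> M * r \<Longrightarrow> interp g (x J) = g (x J)"
proof -
  obtain v where v: "v \<in> V" "\<forall>J\<le>M * r. v (x J) = g (x J)" using V_interpolant[of "\<lambda>J. g (x J)"] by blast
  have "\<exists>!v. v \<in> V \<and> (\<forall>J\<le>M * r. v (x J) = g (x J))"
  proof (rule ex1I[of _ v])
    fix w assume w: "w \<in> V \<and> (\<forall>J\<le>M * r. w (x J) = g (x J))"
    show "w = v" by (rule V_eqI) (use w v in auto)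
  qed (use v in blast)
  then have "interp g \<in> V \<and> (\<forall>J\<le>M * r. interp g (x J) = g (x J))"
    unfolding interp_def lagrange_interp_def by (rule theI')
  then show "interp g \<in> V" "J \<le> M * r \<Longrightarrow> interp g (x J) = g (x J)" by auto
qed

lemma ip_interp: "ip (interp g) w = ip g w" "ip w (interp g) = ip w g"
  by (rule ip_cong; simp add: interp(2))+

lemma V_zero_iff: "v \<in> V \<Longrightarrow> N2 v = 0 \<Longrightarrow> v = (\<lambda>y. 0)"
proof (rule V_eqI[OF _ V_zero])
  fix J assume v: "v \<in> V" "N2 v = 0" and J: "J \<le> M * r"
  obtain i j where ij: "i \<in> {1..M}" "j \<le> r" "J = (i - 1) * r + j" using node_cover[OF J] by blast
  have nn: "0 \<le> \<omega> j * (v (nd i j) * v (nd i j))" if "j \<le> r" for i j using weight_pos[OF that] by simp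
  have "(\<Sum>j\<le>r. \<omega> j * (v (nd i j) * v (nd i j))) = 0"
    using v(2) unfolding ip_nd using ij(1) by (subst (asm) sum_nonneg_eq_0_iff) (auto intro!: sum_nonneg nn)
  then have "\<omega> j * (v (nd i j) * v (nd i j)) = 0"
    using ij(2) by (subst (asm) sum_nonneg_eq_0_iff) (auto intro!: nn)
  then show "v (x J) = 0" using weight_pos[OF ij(2)] ij(3) by (simp add: nd_def)
qed simp

lemma ip_pos: "v \<in> V \<Longrightarrow> v \<noteq> (\<lambda>y. 0) \<Longrightarrow> 0 < ip v v"
  using V_zero_iff N2_nonneg[of v] by fastforce

section \<open>The energy form\<close>

lemma weak_deriv_V: "v \<in> V \<Longrightarrow> has_weak_deriv a b 1 v (weak_deriv a b 1 v)"
  using V_pieces pieces_weak_deriv has_weak_deriv_weak_deriv by blast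

lemma E_sym: "E v w = E w v" by (simp add: E_def L2_inner_commute)

text \<open>\<open>weak_deriv\<close> is a choice and hence additive only almost everywhere, so the
  proof goes through uniqueness of weak derivatives.\<close>

lemma E_add: assumes "v \<in> V" "w \<in> V" "z \<in> V" shows "E (\<lambda>y. v y + w y) z = E v z + E w z"
proof -
  note W = weak_deriv_V[OF assms(1)] weak_deriv_V[OF assms(2)] weak_deriv_V[OF assms(3)] weak_deriv_V[OF V_add[OF assms(1,2)]]
  note L = has_weak_derivD(2)[OF W(1)] has_weak_derivD(2)[OF W(2)] has_weak_derivD(2)[OF W(3)] has_weak_derivD(2)[OF W(4)]
  have "E (\<lambda>y. v y + w y) z = L2_inner a b (\<lambda>y. weak_deriv a b 1 v y + weak_deriv a b 1 w y) (weak_deriv a b 1 z)"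
    unfolding E_def by (rule L2_inner_AE_cong[OF has_weak_deriv_unique[OF W(4) has_weak_deriv_add[OF W(1,2)]]])
      (use L in auto)
  also have "\<dots> = E v z + E w z" unfolding E_def by (rule L2_inner_add[OF L(1-3)])
  finally show ?thesis .
qed

lemma E_scale: assumes "v \<in> V" "z \<in> V" shows "E (\<lambda>y. c * v y) z = c * E v z"
proof -
  note W = weak_deriv_V[OF assms(1)] weak_deriv_V[OF assms(2)] weak_deriv_V[OF V_scale[OF assms(1)], of c]
  note L = has_weak_derivD(2)[OF W(1)] has_weak_derivD(2)[OF W(2)] has_weak_derivD(2)[OF W(3)]
  have "E (\<lambda>y. c * v y) z = L2_inner a b (\<lambda>y. c * weak_deriv a b 1 v y) (weak_deriv a b 1 z)"
    unfolding E_def by (rule L2_inner_AE_cong[OF has_weak_deriv_unique[OF W(3) has_weak_deriv_scale[OF W(1)]]])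
      (use L in auto)
  then show ?thesis unfolding E_def by (simp add: L2_inner_scale)
qed

lemma E_cells:
  assumes "pieces v P" "pieces w Q"
  shows "E v w = (\<Sum>i=1..M. integral {X (i - 1)..X i} (\<lambda>y. poly (pderiv (P i)) y * poly (pderiv (Q i)) y))"
proof -
  note W = pieces_weak_deriv[OF assms(1)] pieces_weak_deriv[OF assms(2)]
  note W' = has_weak_deriv_weak_deriv[OF W(1)] has_weak_deriv_weak_deriv[OF W(2)]
  have "E v w = L2_inner a b (pd P) (pd Q)"
    unfolding E_def by (rule L2_inner_AE_cong[OF has_weak_deriv_unique[OF W'(1) W(1)] has_weak_deriv_unique[OF W'(2) W(2)]])
      (use W W' has_weak_derivD(2) in blast)+
  also have "\<dots> = integral {a..b} (\<lambda>y. pd P y * pd Q y)" by (rule L2_inner_integral[OF pd_L2 pd_L2])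
  also have "\<dots> = (\<Sum>i=1..M. integral {X (i - 1)..X i} (\<lambda>y. pd P y * pd Q y))"
    by (rule integral_cells) (use L2_space_integrable_on[OF pd_L2 pd_L2] in simp)
  also have "\<dots> = (\<Sum>i=1..M. integral {X (i - 1)..X i} (\<lambda>y. poly (pderiv (P i)) y * poly (pderiv (Q i)) y))"
  proof (rule sum.cong[OF refl])
    fix i assume i: "i \<in> {1..M}"
    show "integral {X (i - 1)..X i} (\<lambda>y. pd P y * pd Q y) = integral {X (i - 1)..X i} (\<lambda>y. poly (pderiv (P i)) y * poly (pderiv (Q i)) y)"
      by (rule integral_spike[of "{X (i - 1), X i}"]) (use pd_cell[OF i] in \<open>auto simp: negligible_insert\<close>)
  qed
  finally show ?thesis .
qed

lemma E_nonneg: "0 \<le> E v v" by (simp add: E_def L2_inner_nonneg)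

end

context mesh
begin

subsection \<open>The discrete Laplacian\<close>

lemma V_sum: "(\<And>i. i \<in> I \<Longrightarrow> vs i \<in> V) \<Longrightarrow> (\<lambda>y. \<Sum>i\<in>I. c i * vs i y) \<in> V"
proof (induction I rule: infinite_finite_induct)
  case (insert i I)
  then have "(\<lambda>y. c i * vs i y + (\<Sum>i\<in>I. c i * vs i y)) \<in> V" by (intro V_add V_scale) auto
  then show ?case using insert by simp
qed (use V_zero in auto)

lemma ip_zero: "ip (\<lambda>y. 0) z = 0"
  using ip_scale[of 0 "\<lambda>y. 0" z] by simp

lemma ip_sum: "ip (\<lambda>y. \<Sum>i\<in>I. c i * vs i y) z = (\<Sum>i\<in>I. c i * ip (vs i) z)"
proof (induction I rule: infinite_finite_induct)
  case (insert i I)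
  then show ?case using ip_add[of "\<lambda>y. c i * vs i y" "\<lambda>y. \<Sum>i\<in>I. c i * vs i y" z] by (simp add: ip_scale)
qed (auto simp: ip_zero)

lemma E_sum:
  assumes "\<And>i. i \<in> I \<Longrightarrow> vs i \<in> V" "z \<in> V"
  shows "E (\<lambda>y. \<Sum>i\<in>I. c i * vs i y) z = (\<Sum>i\<in>I. c i * E (vs i) z)"
  using assms(1)
proof (induction I rule: infinite_finite_induct)
  case (insert i I)
  then have "E (\<lambda>y. c i * vs i y + (\<Sum>i\<in>I. c i * vs i y)) z = c i * E (vs i) z + E (\<lambda>y. \<Sum>i\<in>I. c i * vs i y) z"
    using E_add[OF V_scale V_sum assms(2), of "vs i" I vs "c i" c] E_scale[OF _ assms(2), of "vs i" "c i"] by simp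
  then show ?case using insert by simp
qed (use E_scale[OF V_zero assms(2), of 0] in auto)

lemma V_ip_eqI:
  assumes "v \<in> V" "w \<in> V" "\<And>z. z \<in> V \<Longrightarrow> ip v z = ip w z"
  shows "v = w"
proof -
  have d: "(\<lambda>y. v y - w y) \<in> V" using V_add[OF assms(1) V_scale[OF assms(2), of "-1"]] by simp
  have "ip (\<lambda>y. v y - w y) (\<lambda>y. v y - w y) = 0" using assms(3)[OF d] by (simp add: ip_diff)
  then have "(\<lambda>y. v y - w y) = (\<lambda>y. 0)" by (rule V_zero_iff[OF d])
  then show ?thesis by (simp add: fun_eq_iff)
qed

text \<open>The nodal basis is orthogonal for the quadrature form (mass lumping), so the Riesz
  representative can be written down directly.\<close>

lemma disc_Laplacian_exists:
  assumes v: "v \<in> V"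
  obtains z where "z \<in> V" "\<And>w. w \<in> V \<Longrightarrow> ip z w = E v w"
proof -
  have "\<forall>K. \<exists>p. p \<in> V \<and> (\<forall>J\<le>M * r. p (x J) = (if J = K then 1 else 0))"
  proof
    fix K
    obtain p where "p \<in> V" "\<And>L. L \<le> M * r \<Longrightarrow> p (x L) = (if L = K then 1 else 0)"
      using V_interpolant[of "\<lambda>L. if L = K then 1 else 0"] by blast
    then show "\<exists>p. p \<in> V \<and> (\<forall>J\<le>M * r. p (x J) = (if J = K then 1 else 0))" by blast
  qed
  then obtain p where p: "\<And>K. p K \<in> V" "\<And>J K. J \<le> M * r \<Longrightarrow> p K (x J) = (if J = K then 1 else 0)" by metis
  have pos: "ip (p K) (p K) > 0" if "K \<le> M * r" for K
    by (rule ip_pos[OF p(1)]) (use p(2)[OF that, of K] in auto)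
  have orth: "ip (p K) (p L) = 0" if "K \<noteq> L" for K L
  proof -
    have "p K (nd i j) * p L (nd i j) = 0" if "i \<in> {1..M}" "j \<le> r" for i j
      using p(2)[OF node_index[OF that]] \<open>K \<noteq> L\<close> by (simp add: nd_def)
    then show ?thesis unfolding ip_nd by (intro sum.neutral ballI) auto
  qed
  define z where "z = (\<lambda>y. \<Sum>K\<le>M * r. (E v (p K) / ip (p K) (p K)) * p K y)"
  have zV: "z \<in> V" unfolding z_def by (rule V_sum) (rule p(1))
  have zp: "ip z (p L) = E v (p L)" if "L \<le> M * r" for L
  proof -
    have "ip z (p L) = (\<Sum>K\<le>M * r. (E v (p K) / ip (p K) (p K)) * ip (p K) (p L))" unfolding z_def by (rule ip_sum)
    also have "\<dots> = (\<Sum>K\<le>M * r. if K = L then E v (p L) else 0)"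
      by (intro sum.cong refl) (use orth pos[OF that] in auto)
    finally show ?thesis using that by simp
  qed
  have "ip z w = E v w" if w: "w \<in> V" for w
  proof -
    have we: "w = (\<lambda>y. \<Sum>K\<le>M * r. w (x K) * p K y)"
    proof (rule V_eqI[OF w])
      show "(\<lambda>y. \<Sum>K\<le>M * r. w (x K) * p K y) \<in> V" by (rule V_sum) (rule p(1))
      fix J assume J: "J \<le> M * r"
      have "(\<Sum>K\<le>M * r. w (x K) * p K (x J)) = (\<Sum>K\<le>M * r. if K = J then w (x J) else 0)"
        by (intro sum.cong refl) (use p(2)[OF J] in auto)
      then show "w (x J) = (\<Sum>K\<le>M * r. w (x K) * p K (x J))" using J by simp
    qed
    have "ip z w = ip (\<lambda>y. \<Sum>K\<le>M * r. w (x K) * p K y) z" using we ip_sym[of z w] by simp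
    also have "\<dots> = (\<Sum>K\<le>M * r. w (x K) * E v (p K))"
      unfolding ip_sum by (intro sum.cong refl) (use zp ip_sym in auto)
    also have "\<dots> = E (\<lambda>y. \<Sum>K\<le>M * r. w (x K) * p K y) v"
      using E_sum[of "{..M * r}" p v "\<lambda>K. w (x K)"] p(1) v E_sym by simp
    finally show ?thesis using we E_sym[of v w] by simp
  qed
  then show ?thesis using that zV by blast
qed

definition A :: "(real \<Rightarrow> real) \<Rightarrow> real \<Rightarrow> real" where
  "A v = neg_disc_Laplacian a b M r x \<omega> v"

lemma A: "v \<in> V \<Longrightarrow> A v \<in> V" "v \<in> V \<Longrightarrow> w \<in> V \<Longrightarrow> ip (A v) w = E v w"
proof -
  have "A v \<in> V \<and> (\<forall>w\<in>V. ip (A v) w = E v w)" if v: "v \<in> V" for v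
  proof -
    obtain z where z: "z \<in> V" "\<And>w. w \<in> V \<Longrightarrow> ip z w = E v w" using disc_Laplacian_exists[OF v] by blast
    have "\<exists>!z. z \<in> V \<and> (\<forall>w\<in>V. ip z w = E v w)"
    proof (rule ex1I[of _ z])
      fix y assume y: "y \<in> V \<and> (\<forall>w\<in>V. ip y w = E v w)"
      show "y = z" by (rule V_ip_eqI) (use y z in auto)
    qed (use z in blast)
    then show ?thesis unfolding A_def neg_disc_Laplacian_def E_def by (rule theI')
  qed
  then show "v \<in> V \<Longrightarrow> A v \<in> V" "v \<in> V \<Longrightarrow> w \<in> V \<Longrightarrow> ip (A v) w = E v w" by auto
qed

text \<open>The step size is built into the operator, so its eigenvalues are already the arguments
  of the rational functions. The dimension bound counts the \<open>M * r + 1\<close> nodal values,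
  which determine an element of \<open>V\<close>.\<close>

lemma symmetric_operator: "symmetric_operator V ip (\<lambda>v y. \<tau> * A v y) (Suc (M * r))"
proof
  show "(\<lambda>y. 0) \<in> V" by (rule V_zero)
  fix v w z :: "real \<Rightarrow> real" and c :: real
  show "ip v w = ip w v" by (rule ip_sym)
  show "ip (\<lambda>y. v y + w y) z = ip v z + ip w z" by (rule ip_add)
  show "ip (\<lambda>y. c * v y) z = c * ip v z" by (rule ip_scale)
  assume v: "v \<in> V"
  show "(\<lambda>y. c * v y) \<in> V" by (rule V_scale[OF v])
  show "0 < ip v v" if "v \<noteq> (\<lambda>y. 0)" by (rule ip_pos[OF v that])
  show "(\<lambda>y. \<tau> * A v y) \<in> V" by (rule V_scale[OF A(1)[OF v]])
  show "(\<lambda>y. \<tau> * A (\<lambda>y. c * v y) y) = (\<lambda>y. c * (\<tau> * A v y))"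
  proof -
    have "A (\<lambda>y. c * v y) = (\<lambda>y. c * A v y)"
      by (rule V_ip_eqI) (use v V_scale A E_scale in \<open>auto simp: ip_scale\<close>)
    then show ?thesis by (simp add: mult.left_commute)
  qed
  assume w: "w \<in> V"
  show "(\<lambda>y. v y + w y) \<in> V" by (rule V_add[OF v w])
  show "(\<lambda>y. \<tau> * A (\<lambda>y. v y + w y) y) = (\<lambda>y. \<tau> * A v y + \<tau> * A w y)"
  proof -
    have "A (\<lambda>y. v y + w y) = (\<lambda>y. A v y + A w y)"
      by (rule V_ip_eqI) (use v w V_add A E_add in \<open>auto simp: ip_add\<close>)
    then show ?thesis by (simp add: distrib_left)
  qed
  show "ip (\<lambda>y. \<tau> * A v y) w = ip v (\<lambda>y. \<tau> * A w y)"
    using A(2)[OF v w] A(2)[OF w v] by (simp add: ip_scale ip_sym[of v] E_sym)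
next
  fix vs assume vs: "\<And>i. i \<le> Suc (M * r) \<Longrightarrow> vs i \<in> V"
  \<comment> \<open>One function more than there are nodal values, hence a combination vanishing at
    all nodes.\<close>
  obtain c where c: "\<exists>i\<le>Suc (M * r). c i \<noteq> 0" "\<forall>l<Suc (M * r). (\<Sum>i\<le>Suc (M * r). c i * vs i (x l)) = 0"
    using nontrivial_solution[of "Suc (M * r)" "\<lambda>i l. vs i (x l)"] by blast
  have "(\<lambda>y. \<Sum>i\<le>Suc (M * r). c i * vs i y) = (\<lambda>y. 0)"
    by (rule V_eqI[OF V_sum V_zero]) (use vs c(2) in \<open>auto simp del: sum.atMost_Suc\<close>)
  then show "\<exists>a. (\<exists>i\<le>Suc (M * r). a i \<noteq> 0) \<and> (\<lambda>y. \<Sum>i\<le>Suc (M * r). a i * vs i y) = (\<lambda>y. 0)"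
    using c(1) by blast
qed

text \<open>What the error analysis uses of the eigenbasis. Parseval's identity is stated for all
  functions, not only for those in \<open>V\<close>; the \<open>l i\<close> are eigenvalues of
  \<tau> times the discrete operator, whence the factor \<tau> in front of \<open>E\<close>.\<close>

definition spectral_basis :: "real \<Rightarrow> nat \<Rightarrow> (nat \<Rightarrow> real \<Rightarrow> real) \<Rightarrow> (nat \<Rightarrow> real) \<Rightarrow> bool" where
  "spectral_basis \<tau> n e l \<longleftrightarrow>
     (\<forall>i<n. e i \<in> V \<and> 0 \<le> l i) \<and>
     (\<forall>v. N2 v = (\<Sum>i<n. (ip v (e i))\<^sup>2)) \<and>
     (\<forall>v\<in>V. \<forall>i<n. \<tau> * E v (e i) = l i * ip v (e i)) \<and>
     (\<forall>v\<in>V. \<tau> * E v v = (\<Sum>i<n. l i * (ip v (e i))\<^sup>2)) \<and>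
     (\<forall>s. \<forall>i<n. ip (\<lambda>y. \<Sum>j<n. s j * e j y) (e i) = s i) \<and>
     (\<forall>v\<in>V. \<forall>g. \<forall>i<n. ip (spectral_fun V ip (\<lambda>v y. \<tau> * A v y) g v) (e i) = g (l i) * ip v (e i))"

lemma spectral_basis_exists:
  assumes "\<tau> > 0"
  obtains n e l where "spectral_basis \<tau> n e l"
proof -
  interpret S: symmetric_operator V ip "\<lambda>v y. \<tau> * A v y" "Suc (M * r)" by (rule symmetric_operator)
  obtain n e l where es: "S.eigensystem n e l" and basis: "\<And>v. v \<in> V \<Longrightarrow> v = (\<lambda>y. \<Sum>i<n. ip v (e i) * e i y)"
    using S.eigenbasis_exists by blast
  have eV: "e i \<in> V" and eA: "(\<lambda>y. \<tau> * A (e i) y) = (\<lambda>y. l i * e i y)" if "i < n" for i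
    using es that by (auto simp: S.eigensystem_def)
  have ee: "ip (e i) (e j) = (if i = j then 1 else 0)" if "i < n" "j < n" for i j
    using es that by (auto simp: S.eigensystem_def)
  have coord: "ip (\<lambda>y. \<Sum>j<n. s j * e j y) (e i) = s i" if "i < n" for s i
  proof -
    have "ip (\<lambda>y. \<Sum>j<n. s j * e j y) (e i) = (\<Sum>j<n. s j * (if j = i then 1 else 0))"
      unfolding ip_sum by (intro sum.cong refl) (use ee that in auto)
    also have "\<dots> = s i" by (rule sum_mult_delta) (use that in auto)
    finally show ?thesis .
  qed
  have Ee: "\<tau> * E v (e i) = l i * ip v (e i)" if v: "v \<in> V" and i: "i < n" for v i
  proof -
    have "\<tau> * E v (e i) = ip (\<lambda>y. \<tau> * A (e i) y) v" using A(2)[OF eV[OF i] v] by (simp add: ip_scale E_sym)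
    also have "\<dots> = l i * ip v (e i)" unfolding eA[OF i] by (simp add: ip_scale ip_sym)
    finally show ?thesis .
  qed
  \<comment> \<open>For \<open>v\<close> outside \<open>V\<close> the interpolant has the same
    coordinates and the same quadrature norm.\<close>
  have parseval: "N2 v = (\<Sum>i<n. (ip v (e i))\<^sup>2)" for v
  proof -
    have "N2 v = ip (interp v) v" by (simp add: ip_interp)
    also have "\<dots> = ip (\<lambda>y. \<Sum>i<n. ip (interp v) (e i) * e i y) v" using basis[OF interp(1)[of v]] by simp
    also have "\<dots> = (\<Sum>i<n. (ip v (e i))\<^sup>2)"
      unfolding ip_sum by (simp add: ip_interp ip_sym[of "e _"] power2_eq_square)
    finally show ?thesis .
  qed
  have Evv: "\<tau> * E v v = (\<Sum>i<n. l i * (ip v (e i))\<^sup>2)" if v: "v \<in> V" for v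
  proof -
    have "E v v = E (\<lambda>y. \<Sum>i<n. ip v (e i) * e i y) v" using basis[OF v] by simp
    also have "\<dots> = (\<Sum>i<n. ip v (e i) * E v (e i))"
      using E_sum[of "{..<n}" e v "\<lambda>i. ip v (e i)"] eV v E_sym by simp
    finally have "\<tau> * E v v = (\<Sum>i<n. ip v (e i) * (\<tau> * E v (e i)))"
      by (simp add: sum_distrib_left mult.left_commute)
    then show ?thesis using Ee[OF v] by (simp add: power2_eq_square mult.assoc mult.left_commute)
  qed
  have l0: "0 \<le> l i" if "i < n" for i
  proof -
    have "l i = \<tau> * E (e i) (e i)" using Ee[OF eV[OF that] that] ee[OF that that] by simp
    then show ?thesis using E_nonneg assms by simp
  qed
  have sf: "ip (spectral_fun V ip (\<lambda>v y. \<tau> * A v y) g v) (e i) = g (l i) * ip v (e i)"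
    if v: "v \<in> V" and i: "i < n" for g v i
  proof -
    have "spectral_fun V ip (\<lambda>v y. \<tau> * A v y) g v = (\<lambda>y. \<Sum>i<n. g (l i) * ip v (e i) * e i y)"
      using es basis v by (rule S.spectral_fun_eigenbasis)
    then show ?thesis using coord[OF i, of "\<lambda>i. g (l i) * ip v (e i)"] by simp
  qed
  show ?thesis
    by (rule that[of n e l]) (unfold spectral_basis_def, use eV l0 parseval Ee Evv coord sf in blast)
qed

end

subsection \<open>The rational functions of the scheme\<close>

lemma rat_den_nonzero [simp]: "rat_den R \<noteq> 0"
  by (simp add: rat_den_def)

lemma rat_num_den_common_root:
  assumes "poly (rat_num R) x = 0" "poly (rat_den R) x = 0"
  shows False
proof -
  have "[:- x, 1:] dvd rat_num R" "[:- x, 1:] dvd rat_den R" using assms by (simp_all add: poly_eq_0_iff_dvd)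
  then have "is_unit [:- x, 1:]"
    using coprime_quot_of_fract[of R] unfolding rat_num_def rat_den_def by (rule coprime_common_divisor[rotated])
  then show False by (simp add: is_unit_poly_iff)
qed

lemma eventually_poly_nonzero:
  fixes p :: "real poly"
  assumes "p \<noteq> 0"
  shows "\<forall>\<^sub>F y in at x. poly p y \<noteq> 0"
proof -
  have f: "finite ({y. poly p y = 0} - {x})" using poly_roots_finite[OF assms] by simp
  have "open (- ({y. poly p y = 0} - {x}))" using finite_imp_closed[OF f] by (rule open_Compl)
  then have "\<forall>\<^sub>F y in nhds x. y \<in> - ({y. poly p y = 0} - {x})"
    by (rule eventually_nhds_in_open) simp
  then show ?thesis by (auto simp: eventually_at_filter elim: eventually_mono)
qed

text \<open>At a root of the denominator boundedness forces the numerator to vanish too, against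
  lowest terms. Approaching from the right includes the point 0, where the bound itself is not
  assumed.\<close>

lemma bounded_rat_eval_no_pole:
  assumes B: "\<And>l. l > 0 \<Longrightarrow> \<bar>rat_eval R l\<bar> \<le> B" and x: "x \<ge> 0"
  shows "poly (rat_den R) x \<noteq> 0"
proof
  assume z: "poly (rat_den R) x = 0"
  have ev: "\<forall>\<^sub>F y in at_right x. norm (poly (rat_num R) y) \<le> B * \<bar>poly (rat_den R) y\<bar>"
  proof -
    have "\<forall>\<^sub>F y in at_right x. poly (rat_den R) y \<noteq> 0"
      using eventually_poly_nonzero[of "rat_den R" x] by (simp add: eventually_at_split)
    moreover have "\<forall>\<^sub>F y in at_right x. x < y" by (rule eventually_at_right_less)
    ultimately show ?thesis
    proof eventually_elim
      case (elim y)
      then have "\<bar>rat_eval R y\<bar> \<le> B" using B x by simp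
      then show ?case using elim by (simp add: rat_eval_def abs_divide field_simps)
    qed
  qed
  have "((\<lambda>y. poly (rat_num R) y) \<longlongrightarrow> 0) (at_right x)"
  proof (rule Lim_null_comparison[OF ev])
    have "((\<lambda>y. B * \<bar>poly (rat_den R) y\<bar>) \<longlongrightarrow> B * \<bar>poly (rat_den R) x\<bar>) (at_right x)"
      by (intro tendsto_intros)
    then show "((\<lambda>y. B * \<bar>poly (rat_den R) y\<bar>) \<longlongrightarrow> 0) (at_right x)" using z by simp
  qed
  moreover have "((\<lambda>y. poly (rat_num R) y) \<longlongrightarrow> poly (rat_num R) x) (at_right x)" by (intro tendsto_intros)
  ultimately have "poly (rat_num R) x = 0" using tendsto_unique trivial_limit_at_right_real by blast
  then show False using rat_num_den_common_root z by blast
qed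

lemma rat_eval_continuous:
  assumes "\<And>l. l > 0 \<Longrightarrow> \<bar>rat_eval R l\<bar> \<le> B"
  shows "continuous_on {0..} (rat_eval R)"
  unfolding rat_eval_def[abs_def] using bounded_rat_eval_no_pole[OF assms]
  by (intro continuous_intros) auto

text \<open>The conditions on the scheme concern positive arguments, but constants are
  eigenfunctions for the eigenvalue 0; continuity closes the gap.\<close>

lemma bounded_extends_to_0:
  fixes g :: "real \<Rightarrow> real"
  assumes "continuous_on {0..} g" "\<And>l. l > 0 \<Longrightarrow> \<bar>g l\<bar> \<le> B" "l \<ge> 0"
  shows "\<bar>g l\<bar> \<le> B"
proof (cases "l = 0")
  case True
  have "(g \<longlongrightarrow> g 0) (at 0 within {0..})" using assms(1) by (simp add: continuous_on_def)
  then have "(g \<longlongrightarrow> g 0) (at_right 0)" by (rule tendsto_within_subset) auto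
  then have "((\<lambda>l. \<bar>g l\<bar>) \<longlongrightarrow> \<bar>g 0\<bar>) (at_right 0)" by (rule tendsto_rabs)
  then have "\<bar>g 0\<bar> \<le> B"
    by (rule tendsto_upperbound) (use assms(2) eventually_at_right_less[of "0::real"] in \<open>auto elim: eventually_mono\<close>)
  then show ?thesis using True by simp
qed (use assms in auto)

text \<open>The degree gap gives \<open>l * rat_eval R l\<close> a finite limit at infinity. This
  bound later pays for the factor \<open>l\<close> in front of the Taylor remainders at the stages,
  which are controlled in the quadrature norm only.\<close>

lemma rat_eval_times_bounded:
  assumes B: "\<And>l. l > 0 \<Longrightarrow> \<bar>rat_eval R l\<bar> \<le> B" and deg: "R = 0 \<or> degree (rat_num R) < degree (rat_den R)"
  obtains K where "\<And>l. l \<ge> 0 \<Longrightarrow> \<bar>l * rat_eval R l\<bar> \<le> K"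
proof -
  define P where "P = pCons 0 (rat_num R)"
  define Q where "Q = rat_den R"
  have e: "l * rat_eval R l = poly P l / poly Q l" for l by (simp add: P_def Q_def rat_eval_def)
  have "\<exists>c. ((\<lambda>l. poly P l / poly Q l) \<longlongrightarrow> c) at_infinity"
  proof (cases "R = 0")
    case True
    then show ?thesis by (auto simp: P_def rat_num_def intro!: exI[of _ 0])
  next
    case False
    then have "rat_num R \<noteq> 0" by (simp add: rat_num_def)
    then have dP: "degree P \<le> degree Q" using deg False by (simp add: P_def Q_def)
    show ?thesis
    proof (cases "degree P < degree Q")
      case True
      then show ?thesis by (intro exI) (rule poly_divide_tendsto_0_at_infinity)
    next
      case False
      then have eq: "degree P = degree Q" using dP by simp
      have "((\<lambda>l. (poly P l / l ^ degree P) / (poly Q l / l ^ degree Q)) \<longlongrightarrow> lead_coeff P / lead_coeff Q) at_infinity"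
        by (intro tendsto_divide poly_divide_tendsto_aux) (simp add: Q_def)
      moreover have "\<forall>\<^sub>F l in at_infinity. (poly P l / l ^ degree P) / (poly Q l / l ^ degree Q) = poly P l / poly Q l"
        using eventually_not_equal_at_infinity[of 0] by eventually_elim (simp add: eq)
      ultimately show ?thesis by (intro exI) (rule Lim_transform_eventually)
    qed
  qed
  then obtain c where "((\<lambda>l. poly P l / poly Q l) \<longlongrightarrow> c) at_infinity" by blast
  then have "((\<lambda>l. \<bar>poly P l / poly Q l\<bar>) \<longlongrightarrow> \<bar>c\<bar>) at_top"
    using at_top_le_at_infinity tendsto_mono tendsto_rabs by blast
  then have "\<forall>\<^sub>F l in at_top. \<bar>poly P l / poly Q l\<bar> < \<bar>c\<bar> + 1" by (rule order_tendstoD(2)) simp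
  then obtain N where N: "\<And>l. l \<ge> N \<Longrightarrow> \<bar>l * rat_eval R l\<bar> \<le> \<bar>c\<bar> + 1"
    unfolding e eventually_at_top_linorder by (meson less_imp_le)
  show ?thesis
  proof (rule that[of "max (\<bar>c\<bar> + 1) (\<bar>N\<bar> * B)"])
    fix l :: real assume l: "l \<ge> 0"
    show "\<bar>l * rat_eval R l\<bar> \<le> max (\<bar>c\<bar> + 1) (\<bar>N\<bar> * B)"
    proof (cases "l \<ge> N")
      case False
      have "\<bar>rat_eval R l\<bar> \<le> B" by (rule bounded_extends_to_0[OF rat_eval_continuous[OF B] B l])
      then have "\<bar>l * rat_eval R l\<bar> \<le> \<bar>N\<bar> * B" unfolding abs_mult using False l by (intro mult_mono) auto
      then show ?thesis by simp
    qed (use N in force)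
  qed
qed

text \<open>
  The one-step error of the scheme for \<open>u' + \<lambda> u = g\<close> with exact solution \<open>u(t) = t\<^sup>j / j!\<close>.
\<close>

definition defect :: "(real \<Rightarrow> real) \<Rightarrow> (nat \<Rightarrow> real \<Rightarrow> real) \<Rightarrow> nat \<Rightarrow> (nat \<Rightarrow> real) \<Rightarrow> nat \<Rightarrow> real \<Rightarrow> real" where
  "defect s q m c j l = 1 / fact j - (if j = 0 then s l else (\<Sum>i=1..m. q i l * c i ^ (j - 1)) / fact (j - 1)) -
     l * (\<Sum>i=1..m. q i l * c i ^ j) / fact j"

text \<open>Strict accuracy of orders \<open>j - 1\<close> and \<open>j\<close> reduces the two
  stage sums to a difference of exponential partial sums, the single term
  \<open>(- l) ^ j / fact j\<close>, which after division cancels \<open>1 / fact j\<close>.\<close>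

lemma defect_zero_pos:
  assumes "\<And>j l. j \<le> k - 1 \<Longrightarrow> l > 0 \<Longrightarrow> (\<Sum>i=1..m. c i ^ j * q i l) - order_quotient j l (s l) = 0"
    and "j < k" "l > 0"
  shows "defect s q m c j l = 0"
proof -
  have S: "(\<Sum>i=1..m. q i l * c i ^ j') = order_quotient j' l (s l)" if "j' \<le> k - 1" for j'
    using assms(1)[OF that assms(3)] by (simp add: mult.commute)
  define X where "X n = (\<Sum>i\<le>n. (- l) ^ i / fact i)" for n
  have oq: "order_quotient j' l (s l) = fact j' / (- l) ^ (j' + 1) * (s l - X j')" for j'
    by (simp add: order_quotient_def X_def)
  have l0: "(- l) ^ n \<noteq> 0" for n using assms(3) by simp
  have A: "l * (\<Sum>i=1..m. q i l * c i ^ j) / fact j = - ((s l - X j) / (- l) ^ j)"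
    using S[of j] oq[of j] assms(2,3) l0[of j] by (simp add: field_simps)
  show ?thesis
  proof (cases j)
    case 0
    then show ?thesis using A by (simp add: defect_def X_def)
  next
    case (Suc n)
    have "(\<Sum>i=1..m. q i l * c i ^ (j - 1)) / fact (j - 1) = (s l - X n) / (- l) ^ j"
      using S[of n] oq[of n] assms(2) Suc by simp
    moreover have "X j = X n + (- l) ^ j / fact j" by (simp add: X_def Suc)
    moreover have "(s l - X n) / (- l) ^ j - (s l - X j) / (- l) ^ j = (X j - X n) / (- l) ^ j"
      by (simp add: diff_divide_distrib)
    ultimately show ?thesis using A l0[of j] Suc by (simp add: defect_def)
  qed
qed

text \<open>At order \<open>k\<close> only the sum of order \<open>k - 1\<close> is known exactly.
  Replacing \<open>s l\<close> by the exponential costs \<open>C * l\<close> after division by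
  \<open>l ^ k\<close>, the Taylor remainder at most \<open>3 * l\<close>, and the stage sum of
  order \<open>k\<close> carries its own factor \<open>l\<close>.\<close>

lemma defect_order_pos:
  assumes "\<And>j l. j \<le> k - 1 \<Longrightarrow> l > 0 \<Longrightarrow> (\<Sum>i=1..m. c i ^ j * q i l) - order_quotient j l (s l) = 0"
    and "k \<ge> 1" "l > 0" "l \<le> 1" and s: "\<bar>s l - exp (- l)\<bar> \<le> C * l ^ (k + 1)"
    and q: "\<bar>\<Sum>i=1..m. q i l * c i ^ k\<bar> \<le> B"
  shows "\<bar>defect s q m c k l\<bar> \<le> (C + 3 + B) * l"
proof -
  define X where "X n = (\<Sum>i\<le>n. (- l) ^ i / fact i)" for n
  have l0: "(- l) ^ n \<noteq> 0" for n using assms(3) by simp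
  obtain n where k: "k = Suc n" using assms(2) by (cases k) auto
  have "(\<Sum>i=1..m. q i l * c i ^ n) = order_quotient n l (s l)"
    using assms(1)[of n l] assms(3) k by (simp add: mult.commute)
  then have S: "(\<Sum>i=1..m. q i l * c i ^ n) / fact n = (s l - X n) / (- l) ^ k"
    by (simp add: order_quotient_def X_def k)
  obtain t where t: "\<bar>t\<bar> \<le> \<bar>- l\<bar>" "exp (- l) = (\<Sum>i<Suc k. ((- l) ^ i) / fact i) + (exp t / fact (Suc k)) * (- l) ^ Suc k"
    using Maclaurin_exp_le[of "- l" "Suc k"] by blast
  have Xk: "(\<Sum>i<Suc k. ((- l) ^ i) / fact i) = X n + (- l) ^ k / fact k"
    by (simp only: lessThan_Suc_atMost) (simp add: X_def k)
  define \<theta> where "\<theta> = (exp t / fact (Suc k) :: real)"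
  have th: "\<bar>\<theta>\<bar> \<le> 3"
  proof -
    have "exp t \<le> exp 1" using t(1) assms(3,4) by simp
    also have "exp 1 \<le> (3::real)" by (rule exp_le)
    finally have "exp t / fact (Suc k) \<le> 3 / 1" by (intro frac_le fact_ge_1) auto
    then show ?thesis by (simp add: \<theta>_def)
  qed
  have "s l - X n = (s l - exp (- l)) + (- l) ^ k / fact k + \<theta> * (- l) ^ Suc k"
    using t(2) unfolding Xk \<theta>_def by simp
  then have e: "s l - X n = (s l - exp (- l)) + (- l) ^ k / fact k + (- \<theta> * l) * (- l) ^ k" by simp
  have "(D + z / fact k + (- \<theta> * l) * z) / z = D / z + 1 / fact k - \<theta> * l" if "z \<noteq> 0" for D z :: real
    using that by (simp add: add_divide_distrib diff_divide_distrib)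
  from this[OF l0[of k], of "s l - exp (- l)"]
  have "(s l - X n) / (- l) ^ k = (s l - exp (- l)) / (- l) ^ k + 1 / fact k - \<theta> * l" unfolding e[symmetric] .
  then have e1: "defect s q m c k l = - ((s l - exp (- l)) / (- l) ^ k) + \<theta> * l - l * (\<Sum>i=1..m. q i l * c i ^ k) / fact k"
    unfolding defect_def using S k by simp
  have b1: "\<bar>(s l - exp (- l)) / (- l) ^ k\<bar> \<le> C * l"
  proof -
    have "\<bar>(s l - exp (- l)) / (- l) ^ k\<bar> = \<bar>s l - exp (- l)\<bar> / l ^ k" using assms(3) by (simp add: abs_divide power_abs)
    also have "\<dots> \<le> C * l ^ (k + 1) / l ^ k" using s assms(3) by (intro divide_right_mono) auto
    finally show ?thesis using assms(3) by simp
  qed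
  have b2: "\<bar>\<theta> * l\<bar> \<le> 3 * l" unfolding abs_mult using th assms(3) by (intro mult_mono) auto
  have b3: "\<bar>l * (\<Sum>i=1..m. q i l * c i ^ k) / fact k\<bar> \<le> B * l"
  proof -
    have "\<bar>l * (\<Sum>i=1..m. q i l * c i ^ k) / fact k\<bar> = l * \<bar>\<Sum>i=1..m. q i l * c i ^ k\<bar> / fact k"
      using assms(3) by (simp add: abs_mult)
    also have "\<dots> \<le> l * B / 1"
      using q assms(3) by (intro frac_le mult_left_mono mult_nonneg_nonneg fact_ge_1) auto
    finally show ?thesis by (simp add: mult.commute)
  qed
  have tri: "\<bar>u\<bar> \<le> K1 + K2 + K3" if "u = - u1 + u2 - u3" "\<bar>u1\<bar> \<le> K1" "\<bar>u2\<bar> \<le> K2" "\<bar>u3\<bar> \<le> K3" for u u1 u2 u3 K1 K2 K3 :: real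
    using that by linarith
  have "C * l + 3 * l + B * l = (C + 3 + B) * l" by (simp add: distrib_right)
  then show ?thesis using tri[OF e1 b1 b2 b3] by (simp only:)
qed

text \<open>Three ranges: near 0 the exponential gives decay linear in \<open>l\<close>, on a
  compact middle range the strict bound has a maximum below 1, and near infinity the limit takes
  over.\<close>

lemma stability_function_decay:
  fixes s :: "real \<Rightarrow> real" and C \<delta> :: real
  assumes cont: "continuous_on {0..} s" and lt: "\<And>l. l > 0 \<Longrightarrow> \<bar>s l\<bar> < 1"
    and \<delta>: "\<delta> > 0" "\<And>l. 0 < l \<Longrightarrow> l \<le> \<delta> \<Longrightarrow> \<bar>s l - exp (- l)\<bar> \<le> C * l\<^sup>2"
    and lim: "((\<lambda>l. \<bar>s l\<bar>) \<longlongrightarrow> 0) at_top"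
  obtains c0 where "c0 > 0" "\<And>l. l \<ge> 0 \<Longrightarrow> (s l)\<^sup>2 \<le> 1 - c0 * min l 1"
proof -
  \<comment> \<open>The last entry makes all quadratic errors together at most \<open>l / 2\<close>,
    which leaves \<open>1 - l / 2\<close>.\<close>
  define d where "d = min \<delta> (min 1 (1 / (2 * (\<bar>C\<bar> + 1))))"
  have d: "0 < d" "d \<le> \<delta>" "d \<le> 1" "d \<le> 1 / (2 * (\<bar>C\<bar> + 1))"
    unfolding d_def using \<delta>(1) by (simp_all only: min.coboundedI1 min.coboundedI2 min.cobounded1 order.refl min_less_iff_conj zero_less_one) (simp add: add_nonneg_pos)
  have le1: "\<bar>s l\<bar> \<le> 1" if "l \<ge> 0" for l by (rule bounded_extends_to_0[OF cont _ that]) (use lt in \<open>auto intro: less_imp_le\<close>)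
  have small: "\<bar>s l\<bar> \<le> 1 - l / 2" if l: "0 < l" "l \<le> d" for l
  proof -
    have "exp (- l) \<le> 1 - l + l\<^sup>2"
    proof -
      have "1 + l \<le> exp l" by simp
      then have "exp (- l) \<le> 1 / (1 + l)" using l by (simp add: exp_minus inverse_eq_divide frac_le)
      also have "\<dots> \<le> 1 - l + l\<^sup>2"
      proof -
        have "1 \<le> (1 - l + l\<^sup>2) * (1 + l)" using l by (simp add: algebra_simps power2_eq_square)
        then show ?thesis using l by (simp add: divide_le_eq)
      qed
      finally show ?thesis .
    qed
    moreover have "\<bar>s l - exp (- l)\<bar> \<le> \<bar>C\<bar> * l\<^sup>2"
    proof -
      have "\<bar>s l - exp (- l)\<bar> \<le> C * l\<^sup>2" using \<delta>(2)[of l] l d(2) by linarith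
      also have "\<dots> \<le> \<bar>C\<bar> * l\<^sup>2" by (intro mult_right_mono) auto
      finally show ?thesis .
    qed
    moreover have "(\<bar>C\<bar> + 1) * l\<^sup>2 \<le> l / 2"
    proof -
      have "(\<bar>C\<bar> + 1) * l \<le> (\<bar>C\<bar> + 1) * (1 / (2 * (\<bar>C\<bar> + 1)))" using l d by (intro mult_left_mono) auto
      also have "\<dots> = 1 / 2" by simp
      finally have "(\<bar>C\<bar> + 1) * l * l \<le> 1 / 2 * l" using l by (intro mult_right_mono) auto
      then show ?thesis by (simp add: power2_eq_square mult.assoc)
    qed
    moreover have "exp (- l) > 0" by simp
    moreover have "(\<bar>C\<bar> + 1) * l\<^sup>2 = \<bar>C\<bar> * l\<^sup>2 + l\<^sup>2" by (simp add: distrib_right)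
    ultimately show ?thesis by linarith
  qed
  obtain N0 where N0: "\<And>l. l \<ge> N0 \<Longrightarrow> \<bar>s l\<bar> < 1 / 2"
    using order_tendstoD(2)[OF lim, of "1/2"] by (auto simp: eventually_at_top_linorder)
  define N where "N = max N0 (d + 1)"
  have "\<exists>z\<in>{d..N}. \<forall>y\<in>{d..N}. \<bar>s y\<bar> \<le> \<bar>s z\<bar>"
    by (rule continuous_attains_sup) (use d in \<open>auto simp: N_def intro!: continuous_intros continuous_on_subset[OF cont]\<close>)
  then obtain z where z: "z \<in> {d..N}" "\<And>y. y \<in> {d..N} \<Longrightarrow> \<bar>s y\<bar> \<le> \<bar>s z\<bar>" by blast
  \<comment> \<open>The entry \<open>1 / 2\<close> serves the range near 0 and the range
    \<open>l \<ge> N\<close>, the other one the middle range.\<close>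
  define c0 where "c0 = min (1 / 2) (1 - \<bar>s z\<bar>)"
  have c0: "0 < c0" "c0 \<le> 1 / 2" "c0 \<le> 1 - \<bar>s z\<bar>"
    unfolding c0_def using lt[of z] z(1) d(1) by (simp_all only: min.cobounded1 min.cobounded2 min_less_iff_conj) simp
  have "(s l)\<^sup>2 \<le> 1 - c0 * min l 1" if l: "l \<ge> 0" for l
  proof -
    have sq: "(s l)\<^sup>2 \<le> \<bar>s l\<bar>"
      using le1[OF l] mult_left_mono[OF le1[OF l], of "\<bar>s l\<bar>"] by (simp add: power2_eq_square flip: abs_mult)
    have cm: "c0 * min l 1 \<le> c0" using c0 by (intro mult_left_le) auto
    consider "l = 0" | "0 < l" "l \<le> d" | "l \<in> {d..N}" | "l \<ge> N" using l by force
    then show ?thesis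
    proof cases
      case 1 then show ?thesis using le1[of 0] sq by simp
    next
      case 2
      have "c0 * l \<le> 1 / 2 * l" using c0 2 by (intro mult_right_mono) auto
      moreover have "min l 1 = l" using 2 d by simp
      ultimately show ?thesis using small[OF 2] sq by (simp only:)
    next
      case 3 then show ?thesis using z(2)[OF 3] sq c0 cm by linarith
    next
      case 4 then show ?thesis using N0[of l] sq c0(2) cm unfolding N_def by linarith
    qed
  qed
  then show ?thesis using that c0 by blast
qed

text \<open>The interface between scheme and error analysis, uniform in nonnegative
  \<open>l\<close>: the error recursion refers to these bounds and no longer to rational
  functions.\<close>

definition stable_scheme :: "nat \<Rightarrow> nat \<Rightarrow> (nat \<Rightarrow> real) \<Rightarrow> (real \<Rightarrow> real) \<Rightarrow> (nat \<Rightarrow> real \<Rightarrow> real) \<Rightarrow> real \<Rightarrow> real \<Rightarrow> bool" where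
  "stable_scheme k m c s q c0 B \<longleftrightarrow> c0 > 0 \<and> B \<ge> 0 \<and>
     (\<forall>l\<ge>0. (s l)\<^sup>2 \<le> 1 - c0 * min l 1) \<and>
     (\<forall>i\<in>{1..m}. \<forall>l\<ge>0. \<bar>q i l\<bar> \<le> B \<and> \<bar>l * q i l\<bar> \<le> B) \<and>
     (\<forall>j<k. \<forall>l\<ge>0. defect s q m c j l = 0) \<and>
     (\<forall>l\<ge>0. \<bar>defect s q m c k l\<bar> \<le> B * min l 1)"

lemma stable_scheme_exists:
  fixes \<sigma> :: "real poly fract" and p :: "nat \<Rightarrow> real poly fract"
  assumes k: "k \<ge> 1" and c01: "\<And>i. i \<in> {1..m} \<Longrightarrow> c i \<in> {0..1}"
    and i1: "\<And>l. l > 0 \<Longrightarrow> \<bar>rat_eval \<sigma> l\<bar> < 1"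
    and i2: "\<exists>B. \<forall>i\<in>{1..m}. \<forall>l>0. \<bar>rat_eval (p i) l\<bar> \<le> B"
    and i3: "\<And>i. i \<in> {1..m} \<Longrightarrow> p i = 0 \<or> degree (rat_num (p i)) < degree (rat_den (p i))"
    and ii: "(\<lambda>l. rat_eval \<sigma> l - exp (- l)) \<in> O[at 0](\<lambda>l. l ^ (k + 1))"
    and iii: "\<And>j l. j \<le> k - 1 \<Longrightarrow> l > 0 \<Longrightarrow>
         (\<Sum>i=1..m. c i ^ j * rat_eval (p i) l) - order_quotient j l (rat_eval \<sigma> l) = 0"
    and iv: "((\<lambda>l. \<bar>rat_eval \<sigma> l\<bar>) \<longlongrightarrow> 0) at_top"
  obtains c0 B where "stable_scheme k m c (rat_eval \<sigma>) (\<lambda>i. rat_eval (p i)) c0 B"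
proof -
  let ?s = "rat_eval \<sigma>" and ?q = "\<lambda>i. rat_eval (p i)"
  obtain B1 where B1: "\<And>i l. i \<in> {1..m} \<Longrightarrow> l > 0 \<Longrightarrow> \<bar>?q i l\<bar> \<le> B1" using i2 by blast
  have sc: "continuous_on {0..} ?s" by (rule rat_eval_continuous[of _ 1]) (use i1 in \<open>auto intro: less_imp_le\<close>)
  have qc: "continuous_on {0..} (?q i)" if "i \<in> {1..m}" for i by (rule rat_eval_continuous[OF B1[OF that]])
  have qB1: "\<bar>?q i l\<bar> \<le> B1" if "i \<in> {1..m}" "l \<ge> 0" for i l
    by (rule bounded_extends_to_0[OF qc[OF that(1)] B1[OF that(1)] that(2)])
  have "\<exists>K. \<forall>l\<ge>0. \<bar>l * ?q i l\<bar> \<le> K" if "i \<in> {1..m}" for i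
    using rat_eval_times_bounded[OF B1[OF that] i3[OF that]] by metis
  then obtain K where K: "\<And>i l. i \<in> {1..m} \<Longrightarrow> l \<ge> 0 \<Longrightarrow> \<bar>l * ?q i l\<bar> \<le> K i" by metis
  define B2 where "B2 = \<bar>B1\<bar> + (\<Sum>i=1..m. \<bar>K i\<bar>)"
  have B20: "B2 \<ge> 0" by (auto simp: B2_def intro!: add_nonneg_nonneg sum_nonneg)
  have q1: "\<bar>?q i l\<bar> \<le> B2" if "i \<in> {1..m}" "l \<ge> 0" for i l
  proof -
    have "0 \<le> (\<Sum>i=1..m. \<bar>K i\<bar>)" by (intro sum_nonneg) auto
    then show ?thesis using qB1[OF that] unfolding B2_def by linarith
  qed
  have q2: "\<bar>l * ?q i l\<bar> \<le> B2" if "i \<in> {1..m}" "l \<ge> 0" for i l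
  proof -
    have "\<bar>K i\<bar> \<le> (\<Sum>i=1..m. \<bar>K i\<bar>)" by (rule member_le_sum) (use that in auto)
    then show ?thesis using K[OF that] unfolding B2_def by linarith
  qed
  obtain C \<delta>0 where C: "\<delta>0 > 0" "\<And>l. l \<noteq> 0 \<Longrightarrow> \<bar>l\<bar> < \<delta>0 \<Longrightarrow> \<bar>?s l - exp (- l)\<bar> \<le> C * \<bar>l ^ (k + 1)\<bar>"
  proof -
    obtain C where "\<forall>\<^sub>F l in at 0. norm (?s l - exp (- l)) \<le> C * norm (l ^ (k + 1))"
      using landau_o.bigE[OF ii] by blast
    then obtain d where "d > 0" "\<forall>l. l \<noteq> 0 \<and> dist l 0 < d \<longrightarrow> norm (?s l - exp (- l)) \<le> C * norm (l ^ (k + 1))"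
      unfolding eventually_at by blast
    then show ?thesis by (intro that[of d C]) (simp_all add: dist_real_def)
  qed
  have C0: "C \<ge> 0"
  proof -
    have "0 \<le> C * \<bar>(\<delta>0 / 2) ^ (k + 1)\<bar>" using C(2)[of "\<delta>0 / 2"] C(1) by linarith
    moreover have "0 < \<bar>(\<delta>0 / 2) ^ (k + 1)\<bar>" using C(1) by simp
    ultimately show ?thesis using zero_le_mult_iff[of C "\<bar>(\<delta>0 / 2) ^ (k + 1)\<bar>"] by linarith
  qed
  define \<delta> where "\<delta> = min (\<delta>0 / 2) 1"
  have \<delta>: "0 < \<delta>" "\<delta> \<le> 1" "\<delta> < \<delta>0" using C(1) by (auto simp: \<delta>_def)
  have near: "\<bar>?s l - exp (- l)\<bar> \<le> C * l ^ (k + 1)" if "0 < l" "l \<le> \<delta>" for l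
    using C(2)[of l] that \<delta> by simp
  have near2: "\<bar>?s l - exp (- l)\<bar> \<le> C * l\<^sup>2" if "0 < l" "l \<le> \<delta>" for l
  proof -
    have "l ^ (k + 1) \<le> l ^ 2" using that \<delta> k by (intro power_decreasing) auto
    then show ?thesis using near[OF that] mult_left_mono[OF _ C0] by fastforce
  qed
  obtain c0 where c0: "c0 > 0" "\<And>l. l \<ge> 0 \<Longrightarrow> (?s l)\<^sup>2 \<le> 1 - c0 * min l 1"
    using stability_function_decay[OF sc i1 \<delta>(1) near2 iv] by blast
  have dc: "continuous_on {0..} (defect ?s ?q m c j)" for j
    unfolding defect_def[abs_def] by (cases "j = 0") (auto intro!: continuous_intros sc qc)
  have d0: "defect ?s ?q m c j l = 0" if "j < k" "l \<ge> 0" for j l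
    using bounded_extends_to_0[OF dc[of j], of 0 l] defect_zero_pos[OF iii that(1)] that(2) by simp
  have bq: "\<bar>\<Sum>i=1..m. ?q i l * c i ^ j\<bar> \<le> real m * B2" if "l \<ge> 0" for l j
  proof -
    have "\<bar>\<Sum>i=1..m. ?q i l * c i ^ j\<bar> \<le> (\<Sum>i=1..m. \<bar>?q i l * c i ^ j\<bar>)" by (rule sum_abs)
    also have "\<dots> \<le> (\<Sum>i=1..m. B2 * 1)"
      unfolding abs_mult using c01 q1 that B20 by (intro sum_mono mult_mono) (auto simp: power_le_one power_abs)
    finally show ?thesis by simp
  qed
  have blq: "\<bar>l * (\<Sum>i=1..m. ?q i l * c i ^ j)\<bar> \<le> real m * B2" if "l \<ge> 0" for l j
  proof -
    have "\<bar>l * (\<Sum>i=1..m. ?q i l * c i ^ j)\<bar> = \<bar>\<Sum>i=1..m. (l * ?q i l) * c i ^ j\<bar>"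
      by (simp add: sum_distrib_left mult.assoc)
    also have "\<dots> \<le> (\<Sum>i=1..m. \<bar>(l * ?q i l) * c i ^ j\<bar>)" by (rule sum_abs)
    also have "\<dots> \<le> (\<Sum>i=1..m. B2 * 1)"
      unfolding abs_mult[of "_ * _" "_ ^ _"] using c01 q2 that B20 by (intro sum_mono mult_mono) (auto simp: power_le_one power_abs)
    finally show ?thesis by simp
  qed
  have frac: "\<bar>y / fact n\<bar> \<le> \<bar>y\<bar>" for y :: real and n
  proof -
    have "\<bar>y\<bar> / fact n \<le> \<bar>y\<bar> / 1" by (intro divide_left_mono fact_ge_1) auto
    then show ?thesis by (simp add: abs_divide)
  qed
  define D where "D = 1 + 2 * (real m * B2)"
  have dk_far: "\<bar>defect ?s ?q m c k l\<bar> \<le> D" if "l \<ge> 0" for l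
  proof -
    have "defect ?s ?q m c k l = 1 / fact k - (\<Sum>i=1..m. ?q i l * c i ^ (k - 1)) / fact (k - 1) - l * (\<Sum>i=1..m. ?q i l * c i ^ k) / fact k"
      using k by (simp add: defect_def)
    moreover have "\<bar>1 / fact k\<bar> \<le> (1::real)" using frac[of 1 k] by simp
    ultimately show ?thesis
      using order.trans[OF frac bq[OF that], of "k - 1" "k - 1"] order.trans[OF frac blq[OF that], of k k] unfolding D_def by linarith
  qed
  have dk_near: "\<bar>defect ?s ?q m c k l\<bar> \<le> (C + 3 + real m * B2) * l" if "0 < l" "l \<le> \<delta>" for l
    by (rule defect_order_pos[OF iii k]) (use that \<delta> near bq in auto)
  \<comment> \<open>The summand \<open>D / \<delta>\<close> turns the crude bound \<open>D\<close>
    away from 0 into a multiple of \<open>min l 1\<close>, which is at least \<delta> there.\<close>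
  define B where "B = B2 + (C + 3 + real m * B2) + D / \<delta>"
  have D0: "D \<ge> 0" using B20 by (simp add: D_def)
  have parts: "B2 \<le> B" "C + 3 + real m * B2 \<le> B" "D / \<delta> \<le> B"
    using B20 C0 D0 \<delta> by (auto simp: B_def)
  have dk_pos: "\<bar>defect ?s ?q m c k l\<bar> \<le> B * min l 1" if l: "l > 0" for l
  proof (cases "l \<le> \<delta>")
    case True
    have "(C + 3 + real m * B2) * l \<le> B * l" using parts l by (intro mult_right_mono) auto
    then show ?thesis using dk_near[OF l True] True \<delta> by simp
  next
    case False
    have "D = D / \<delta> * \<delta>" using \<delta> by simp
    also have "\<dots> \<le> B * min l 1" using parts False \<delta> D0 B20 C0 by (intro mult_mono) (auto simp: B_def)
    finally show ?thesis using dk_far[of l] l by simp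
  qed
  have dk: "\<bar>defect ?s ?q m c k l\<bar> \<le> B * min l 1" if l: "l \<ge> 0" for l
  proof (cases "l = 0")
    case True
    \<comment> \<open>The excess over the bound is a continuous function that vanishes for positive
      \<open>l\<close>, hence also at 0.\<close>
    have "continuous_on {0..} (\<lambda>l. max (\<bar>defect ?s ?q m c k l\<bar> - B * min l 1) 0)" by (intro continuous_intros dc)
    from bounded_extends_to_0[OF this, of 0 0] show ?thesis using dk_pos True by simp
  qed (use dk_pos l in simp)
  show ?thesis
  proof (rule that[of c0 B])
    show "stable_scheme k m c ?s ?q c0 B"
      unfolding stable_scheme_def using c0 parts(1) B20 d0 dk q1 q2 by (meson order.trans)
  qed
qed

subsection \<open>Approximation estimates\<close>

text \<open>One family \<open>D\<close> with Taylor polynomials of every order up to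
  \<open>n\<close> on every subinterval: the consistency estimate compares the same derivatives with
  polynomials of two different degrees.\<close>

definition taylor_reps :: "real \<Rightarrow> real \<Rightarrow> nat \<Rightarrow> (real \<Rightarrow> real) \<Rightarrow> (nat \<Rightarrow> real \<Rightarrow> real) \<Rightarrow> bool" where
  "taylor_reps a b n v D \<longleftrightarrow> D 0 = v \<and> (\<forall>j<n. continuous_on {a..b} (D j)) \<and>
     (\<forall>j x. Suc j < n \<longrightarrow> x \<in> {a..b} \<longrightarrow> (D j has_real_derivative D (Suc j) x) (at x within {a..b})) \<and>
     (\<forall>n' c d. 1 \<le> n' \<longrightarrow> n' \<le> n \<longrightarrow> a \<le> c \<longrightarrow> c < d \<longrightarrow> d \<le> b \<longrightarrow>
       (\<exists>P. degree P < n' \<and> (\<forall>j<n'. \<forall>x\<in>{c..d}. \<bar>D j x - poly ((pderiv ^^ j) P) x\<bar>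
          \<le> (d - c) ^ (n' - 1 - j) * (sqrt (d - c) * L2_norm c d (weak_deriv a b n' v)))))"

lemma taylor_reps_exist:
  assumes v: "continuous_on {a..b} v" and H: "v \<in> H_space a b n" and "a < b"
  shows "\<exists>D. taylor_reps a b n v D"
proof (rule H_space_representatives[OF assms])
  fix D
  assume D: "D 0 = v" "\<And>j. j < n \<Longrightarrow> continuous_on {a..b} (D j)"
    "\<And>j x y. j < n \<Longrightarrow> a \<le> x \<Longrightarrow> x \<le> y \<Longrightarrow> y \<le> b \<Longrightarrow> D j y - D j x = integral {x..y} (weak_deriv a b (Suc j) v)"
    "\<And>j x. Suc j < n \<Longrightarrow> x \<in> {a..b} \<Longrightarrow> (D j has_real_derivative D (Suc j) x) (at x within {a..b})"
  have T: "\<exists>P. degree P < n' \<and> (\<forall>j<n'. \<forall>x\<in>{c..d}. \<bar>D j x - poly ((pderiv ^^ j) P) x\<bar>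
          \<le> (d - c) ^ (n' - 1 - j) * (sqrt (d - c) * L2_norm c d (weak_deriv a b n' v)))"
    if n': "1 \<le> n'" "n' \<le> n" and cd: "a \<le> c" "c < d" "d \<le> b" for n' c d
  proof -
    obtain m where m: "n' = Suc m" using n' by (cases n') auto
    have wL: "weak_deriv a b n' v \<in> L2_space c d"
      by (rule L2_space_subinterval[OF has_weak_derivD(2)[OF H_space_weak_deriv[OF H n'(2)]]]) (use cd in auto)
    have "\<exists>P. degree P \<le> m \<and> (\<forall>i\<le>m. \<forall>x\<in>{c..d}. \<bar>D i x - poly ((pderiv ^^ i) P) x\<bar>
        \<le> (d - c) ^ (m - i) * (sqrt (d - c) * L2_norm c d (weak_deriv a b n' v)))"
    proof (rule taylor_poly_exists[OF cd(2)])
      fix i x assume i: "i < m" "x \<in> {c..d}"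
      have "(D i has_real_derivative D (Suc i) x) (at x within {a..b})" by (rule D(4)) (use i cd n' m in auto)
      then show "(D i has_real_derivative D (Suc i) x) (at x within {c..d})"
        by (rule DERIV_subset) (use cd in auto)
    next
      fix x assume x: "x \<in> {c..d}"
      have "D m x - D m c = integral {c..x} (weak_deriv a b n' v)" using D(3)[of m c x] x cd n' m by simp
      then show "\<bar>D m x - D m c\<bar> \<le> sqrt (d - c) * L2_norm c d (weak_deriv a b n' v)"
        using L2_integral_bound[OF wL, of c x] x by simp
    qed
    then show ?thesis unfolding m by (auto simp: less_Suc_eq_le)
  qed
  show ?thesis unfolding taylor_reps_def using D(1,2,4) T by (intro exI[of _ D]) simp
qed

lemma taylor_repsD:
  assumes "taylor_reps a b n v D"
  shows "D 0 = v" "j < n \<Longrightarrow> continuous_on {a..b} (D j)"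
    "Suc j < n \<Longrightarrow> x \<in> {a..b} \<Longrightarrow> (D j has_real_derivative D (Suc j) x) (at x within {a..b})"
  using assms by (simp_all add: taylor_reps_def)

lemma taylor_reps_poly:
  assumes "taylor_reps a b n v D" "1 \<le> n'" "n' \<le> n" "a \<le> c" "c < d" "d \<le> b"
  obtains P where "degree P < n'"
    "\<And>j x. j < n' \<Longrightarrow> x \<in> {c..d} \<Longrightarrow> \<bar>D j x - poly ((pderiv ^^ j) P) x\<bar>
          \<le> (d - c) ^ (n' - 1 - j) * (sqrt (d - c) * L2_norm c d (weak_deriv a b n' v))"
proof -
  have "\<exists>P. degree P < n' \<and> (\<forall>j<n'. \<forall>x\<in>{c..d}. \<bar>D j x - poly ((pderiv ^^ j) P) x\<bar>
          \<le> (d - c) ^ (n' - 1 - j) * (sqrt (d - c) * L2_norm c d (weak_deriv a b n' v)))"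
    using assms unfolding taylor_reps_def by simp
  then show ?thesis using that by blast
qed

lemma sum_Cauchy_Schwarz:
  fixes f g :: "'i \<Rightarrow> real"
  shows "(\<Sum>i\<in>S. f i * g i) \<le> sqrt (\<Sum>i\<in>S. (f i)\<^sup>2) * sqrt (\<Sum>i\<in>S. (g i)\<^sup>2)"
proof -
  have "(\<Sum>i\<in>S. f i * g i) \<le> (\<Sum>i\<in>S. \<bar>f i\<bar> * \<bar>g i\<bar>)" by (intro sum_mono) (simp flip: abs_mult)
  also have "\<dots> \<le> L2_set f S * L2_set g S" by (rule L2_set_mult_ineq)
  finally show ?thesis by (simp add: L2_set_def)
qed

lemma square_sum_le: "(x + y)\<^sup>2 \<le> 2 * x\<^sup>2 + 2 * (y::real)\<^sup>2"
proof -
  have "0 \<le> (x - y)\<^sup>2" by simp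
  then show ?thesis by (simp add: power2_sum power2_diff)
qed

lemma poly_integral_deriv:
  fixes P :: "real poly"
  assumes "c \<le> d"
  shows "integral {c..d} (poly (pderiv P)) = poly P d - poly P c"
  by (intro integral_unique fundamental_theorem_of_calculus assms)
    (auto simp: has_real_derivative_iff_has_vector_derivative[symmetric] intro: has_field_derivative_at_within)

lemma poly_integral_by_parts:
  fixes P Q :: "real poly"
  assumes "c \<le> d"
  shows "integral {c..d} (\<lambda>x. poly (pderiv P) x * poly Q x) = poly P d * poly Q d - poly P c * poly Q c - integral {c..d} (\<lambda>x. poly P x * poly (pderiv Q) x)"
proof -
  have i: "(\<lambda>x. poly P x * poly Q x) integrable_on {c..d}" for P Q :: "real poly"
    by (intro integrable_continuous_real continuous_intros)
  have e: "poly (pderiv (P * Q)) = (\<lambda>x. poly (pderiv P) x * poly Q x + poly P x * poly (pderiv Q) x)"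
    by (simp add: fun_eq_iff pderiv_mult algebra_simps)
  have "integral {c..d} (poly (pderiv (P * Q))) = poly (P * Q) d - poly (P * Q) c" by (rule poly_integral_deriv[OF assms])
  moreover have "integral {c..d} (poly (pderiv (P * Q))) = integral {c..d} (\<lambda>x. poly (pderiv P) x * poly Q x) + integral {c..d} (\<lambda>x. poly P x * poly (pderiv Q) x)"
    unfolding e by (rule Henstock_Kurzweil_Integration.integral_add[OF i i])
  ultimately show ?thesis by simp
qed

text \<open>Names the constant of the inverse inequality, so that a single value, depending only on
  \<open>r\<close>, can be fixed before any mesh.\<close>

definition inverse_const :: "nat \<Rightarrow> real \<Rightarrow> bool" where
  "inverse_const r C \<longleftrightarrow> C \<ge> 0 \<and> (\<forall>(P :: real poly) c d x. degree P \<le> r \<longrightarrow> c < d \<longrightarrow> x \<in> {c..d} \<longrightarrow>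
     (d - c) * (poly P x)\<^sup>2 \<le> C * integral {c..d} (\<lambda>x. (poly P x)\<^sup>2) \<and>
     (d - c) ^ 3 * (poly (pderiv P) x)\<^sup>2 \<le> C * integral {c..d} (\<lambda>x. (poly P x)\<^sup>2))"

lemma inverse_const_exists: "\<exists>C. inverse_const r C"
  unfolding inverse_const_def using poly_inverse_inequality[of r] by metis

context mesh
begin

lemma cell_le: "i \<in> {1..M} \<Longrightarrow> X (i - 1) \<le> X i" using X_less[of i] by simp

lemma cell_bounds: "i \<in> {1..M} \<Longrightarrow> a \<le> X (i - 1)" "i \<in> {1..M} \<Longrightarrow> X i \<le> b"
  using X_mono[of 0 "i - 1"] X_mono[of i M] by (auto simp: X_ends)

lemma L2_norm_cells:
  assumes "w \<in> L2_space a b"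
  shows "(\<Sum>i=1..M. (L2_norm (X (i - 1)) (X i) w)\<^sup>2) = (L2_norm a b w)\<^sup>2"
proof -
  have "(L2_norm a b w)\<^sup>2 = (\<Sum>i=1..M. integral {X (i - 1)..X i} (\<lambda>y. (w y)\<^sup>2))"
    unfolding L2_norm_sq_integral[OF assms]
    by (rule integral_cells) (use L2_space_integrable_on[OF assms assms] in \<open>simp add: power2_eq_square\<close>)
  also have "\<dots> = (\<Sum>i=1..M. (L2_norm (X (i - 1)) (X i) w)\<^sup>2)"
    by (intro sum.cong refl L2_norm_sq_integral[symmetric] L2_space_subinterval[OF assms] cell_subset)
  finally show ?thesis by simp
qed

section \<open>Quadrature and L2 norms on single cells\<close>

definition cell_N2 :: "nat \<Rightarrow> (real \<Rightarrow> real) \<Rightarrow> real" where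
  "cell_N2 i v = (\<Sum>j\<le>r. \<omega> j * (v (nd i j))\<^sup>2)"

lemma N2_cells: "N2 v = (\<Sum>i=1..M. cell_N2 i v)"
  by (simp add: ip_nd cell_N2_def power2_eq_square)

lemma cell_N2_nonneg: "cell_N2 i v \<ge> 0"
  unfolding cell_N2_def using weight_pos by (intro sum_nonneg mult_nonneg_nonneg) (auto intro: less_imp_le)

lemma cell_N2_add: "cell_N2 i (\<lambda>y. v y + w y) \<le> 2 * cell_N2 i v + 2 * cell_N2 i w"
proof -
  have "cell_N2 i (\<lambda>y. v y + w y) \<le> (\<Sum>j\<le>r. \<omega> j * (2 * (v (nd i j))\<^sup>2 + 2 * (w (nd i j))\<^sup>2))"
    unfolding cell_N2_def using weight_pos by (intro sum_mono mult_left_mono square_sum_le) (auto intro: less_imp_le)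
  also have "\<dots> = 2 * cell_N2 i v + 2 * cell_N2 i w"
    by (simp add: cell_N2_def distrib_left sum.distrib sum_distrib_left mult.left_commute)
  finally show ?thesis .
qed

lemma weighted_sum_bound:
  assumes "\<And>j. j \<le> r \<Longrightarrow> \<bar>v j\<bar> \<le> K"
  shows "\<bar>\<Sum>j\<le>r. \<omega> j * v j\<bar> \<le> h * K"
proof -
  have "\<bar>\<Sum>j\<le>r. \<omega> j * v j\<bar> \<le> (\<Sum>j\<le>r. \<bar>\<omega> j * v j\<bar>)" by (rule sum_abs)
  also have "\<dots> \<le> (\<Sum>j\<le>r. \<omega> j * K)"
    unfolding abs_mult using assms weight_pos by (intro sum_mono mult_mono) (auto intro: less_imp_le simp: less_imp_le)
  also have "\<dots> = h * K" by (simp add: weight_sum flip: sum_distrib_right)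
  finally show ?thesis .
qed

lemma cell_N2_bound:
  assumes "i \<in> {1..M}" "\<And>y. y \<in> {X (i - 1)..X i} \<Longrightarrow> \<bar>v y\<bar> \<le> K"
  shows "cell_N2 i v \<le> h * K\<^sup>2"
proof -
  have "\<bar>\<Sum>j\<le>r. \<omega> j * (v (nd i j))\<^sup>2\<bar> \<le> h * K\<^sup>2"
  proof (rule weighted_sum_bound)
    fix j assume "j \<le> r"
    then have "\<bar>v (nd i j)\<bar> \<le> \<bar>K\<bar>" using assms(2)[OF nd_in[OF assms(1)], of j] by simp
    then show "\<bar>(v (nd i j))\<^sup>2\<bar> \<le> K\<^sup>2" by (simp add: abs_le_square_iff)
  qed
  then show ?thesis unfolding cell_N2_def by linarith
qed

lemma poly_L2_le_cell_N2:
  assumes "i \<in> {1..M}" "degree P \<le> r"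
  shows "integral {X (i - 1)..X i} (\<lambda>y. (poly P y)\<^sup>2) \<le> cell_N2 i (poly P)"
  unfolding cell_N2_def by (rule gauss_lobatto_square_ge[OF gl_cell[OF assms(1)] r assms(2)])

lemma cell_N2_le_poly_L2:
  assumes C: "inverse_const r C" and i: "i \<in> {1..M}" and P: "degree P \<le> r"
  shows "cell_N2 i (poly P) \<le> C * integral {X (i - 1)..X i} (\<lambda>y. (poly P y)\<^sup>2)"
proof -
  let ?I = "integral {X (i - 1)..X i} (\<lambda>y. (poly P y)\<^sup>2)"
  have b: "h * (poly P y)\<^sup>2 \<le> C * ?I" if "y \<in> {X (i - 1)..X i}" for y
    using C P X_less[OF i] that X_diff[OF i] unfolding inverse_const_def by metis
  have "\<bar>\<Sum>j\<le>r. \<omega> j * (poly P (nd i j))\<^sup>2\<bar> \<le> h * (C * ?I / h)"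
  proof (rule weighted_sum_bound)
    fix j assume "j \<le> r"
    then show "\<bar>(poly P (nd i j))\<^sup>2\<bar> \<le> C * ?I / h" using b[OF nd_in[OF i]] h_pos by (simp add: pos_le_divide_eq mult.commute)
  qed
  then show ?thesis unfolding cell_N2_def using h_pos by simp
qed

lemma integral_square_add:
  assumes "f \<in> L2_space c d" "g \<in> L2_space c d"
  shows "integral {c..d} (\<lambda>y. (f y + g y)\<^sup>2) \<le> 2 * integral {c..d} (\<lambda>y. (f y)\<^sup>2) + 2 * integral {c..d} (\<lambda>y. (g y)\<^sup>2)"
proof -
  have i: "(\<lambda>y. (f y)\<^sup>2) integrable_on {c..d}" if "f \<in> L2_space c d" for f
    using L2_space_integrable_on[OF that that] by (simp add: power2_eq_square)
  have "integral {c..d} (\<lambda>y. (f y + g y)\<^sup>2) \<le> integral {c..d} (\<lambda>y. 2 * (f y)\<^sup>2 + 2 * (g y)\<^sup>2)"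
    by (intro integral_le i L2_space_add assms integrable_add integrable_on_mult_right square_sum_le)
  also have "\<dots> = 2 * integral {c..d} (\<lambda>y. (f y)\<^sup>2) + 2 * integral {c..d} (\<lambda>y. (g y)\<^sup>2)"
    using i[OF assms(1)] i[OF assms(2)] by (simp add: Henstock_Kurzweil_Integration.integral_add integrable_on_mult_right)
  finally show ?thesis .
qed

lemma integral_square_bound:
  assumes "i \<in> {1..M}" "f \<in> L2_space (X (i - 1)) (X i)" "\<And>y. y \<in> {X (i - 1)..X i} \<Longrightarrow> \<bar>f y\<bar> \<le> K"
  shows "integral {X (i - 1)..X i} (\<lambda>y. (f y)\<^sup>2) \<le> h * K\<^sup>2"
proof -
  have "(L2_norm (X (i - 1)) (X i) f)\<^sup>2 \<le> (X i - X (i - 1)) * K\<^sup>2"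
    by (rule L2_norm_le_sup[OF cell_le[OF assms(1)] assms(2,3)])
  then show ?thesis unfolding L2_norm_sq_integral[OF assms(2)] X_diff[OF assms(1)] .
qed

text \<open>The two norms are equivalent on polynomials of degree at most \<open>r\<close>, but
  \<open>g\<close> is not one. On each cell \<open>g\<close> is replaced by a Taylor polynomial; in
  either norm this costs \<open>h ^ (r + 1)\<close> times the norm of the weak derivative of order
  \<open>r + 1\<close>.\<close>

lemma norm_comparison:
  assumes C: "inverse_const r C" and g: "continuous_on {a..b} g" "g \<in> H_space a b (r + 1)" and v: "v \<in> V"
  defines "W \<equiv> L2_norm a b (weak_deriv a b (r + 1) g)"
  shows "N2 (\<lambda>y. g y - v y) \<le> (4 * C + 2) * ((L2_norm a b (\<lambda>y. g y - v y))\<^sup>2 + (h ^ (r + 1) * W)\<^sup>2)"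
    and "(L2_norm a b (\<lambda>y. g y - v y))\<^sup>2 \<le> 6 * (N2 (\<lambda>y. g y - v y) + (h ^ (r + 1) * W)\<^sup>2)"
proof -
  define e where "e = (\<lambda>y. g y - v y)"
  define w where "w = weak_deriv a b (r + 1) g"
  have C0: "C \<ge> 0" using C by (simp add: inverse_const_def)
  obtain P where P: "pieces v P" using V_pieces[OF v] by blast
  have ec: "continuous_on {a..b} e" unfolding e_def by (intro continuous_intros g pieces_continuous[OF P])
  have eL: "e \<in> L2_space a b" using ec by auto
  have wL: "w \<in> L2_space a b" unfolding w_def by (rule has_weak_derivD(2)[OF H_space_weak_deriv[OF g(2)]]) simp
  obtain D where D: "taylor_reps a b (r + 1) g D" using taylor_reps_exist[OF g ab] by blast
  note D0 = taylor_repsD(1)[OF D]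
  \<comment> \<open>Sup bound of the Taylor error on a cell; integrating its square over length
    \<open>h\<close> restores the full power (\<open>hR\<close>).\<close>
  define R where "R i = h ^ r * (sqrt h * L2_norm (X (i - 1)) (X i) w)" for i
  have hR: "h * (R i)\<^sup>2 = (h ^ (r + 1) * L2_norm (X (i - 1)) (X i) w)\<^sup>2" for i
    using h_pos by (simp add: R_def power_mult_distrib algebra_simps power2_eq_square)
  have both: "cell_N2 i e \<le> (4 * C + 2) * (integral {X (i - 1)..X i} (\<lambda>y. (e y)\<^sup>2) + h * (R i)\<^sup>2) \<and>
      integral {X (i - 1)..X i} (\<lambda>y. (e y)\<^sup>2) \<le> 6 * (cell_N2 i e + h * (R i)\<^sup>2)" if i: "i \<in> {1..M}" for i
  proof -
    let ?c = "X (i - 1)" and ?d = "X i"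
    obtain S where "degree S < r + 1" and S': "\<And>j y. j < r + 1 \<Longrightarrow> y \<in> {?c..?d} \<Longrightarrow> \<bar>D j y - poly ((pderiv ^^ j) S) y\<bar>
          \<le> (?d - ?c) ^ (r + 1 - 1 - j) * (sqrt (?d - ?c) * L2_norm ?c ?d (weak_deriv a b (r + 1) g))"
      by (rule taylor_reps_poly[OF D _ order.refl cell_bounds(1)[OF i] X_less[OF i] cell_bounds(2)[OF i]]) auto
    note S = this(1)
    have S2: "\<bar>g y - poly S y\<bar> \<le> R i" if "y \<in> {?c..?d}" for y
      using S'[OF _ that, of 0] X_diff[OF i] D0 unfolding R_def w_def by simp
    define Q where "Q = S - P i"
    have dQ: "degree Q \<le> r" unfolding Q_def using S piecesD(1)[OF P i] by (intro degree_diff_le) auto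
    have pv: "v y = poly (P i) y" if "y \<in> {?c..?d}" for y using piecesD(2)[OF P i that] .
    have rho: "\<bar>e y - poly Q y\<bar> \<le> R i" if "y \<in> {?c..?d}" for y
      using S2[OF that] pv[OF that] by (simp add: e_def Q_def)
    have rho': "\<bar>poly Q y - e y\<bar> \<le> R i" if "y \<in> {?c..?d}" for y using rho[OF that] by (simp add: abs_minus_commute)
    have L: "e \<in> L2_space ?c ?d" "poly Q \<in> L2_space ?c ?d" using L2_space_subinterval[OF eL cell_subset[OF i]] by auto
    let ?I = "\<lambda>f. integral {?c..?d} (\<lambda>y. (f y)\<^sup>2)"
    have I1: "?I (poly Q) \<le> 2 * ?I e + 2 * (h * (R i)\<^sup>2)"
      using integral_square_add[OF L(1) L2_space_diff[OF L(2,1)]] integral_square_bound[OF i L2_space_diff[OF L(2,1)] rho'] by simp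
    have I2: "?I e \<le> 2 * ?I (poly Q) + 2 * (h * (R i)\<^sup>2)"
      using integral_square_add[OF L(2) L2_space_diff[OF L(1,2)]] integral_square_bound[OF i L2_space_diff[OF L(1,2)] rho] by simp
    have N1: "cell_N2 i (poly Q) \<le> 2 * cell_N2 i e + 2 * (h * (R i)\<^sup>2)"
      using cell_N2_add[of i e "\<lambda>y. poly Q y - e y"] cell_N2_bound[OF i, of "\<lambda>y. poly Q y - e y" "R i", OF rho'] by simp
    have N2': "cell_N2 i e \<le> 2 * cell_N2 i (poly Q) + 2 * (h * (R i)\<^sup>2)"
      using cell_N2_add[of i "poly Q" "\<lambda>y. e y - poly Q y"] cell_N2_bound[OF i, of "\<lambda>y. e y - poly Q y" "R i", OF rho] by simp
    have p0: "0 \<le> h * (R i)\<^sup>2" using h_pos by simp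
    have "cell_N2 i (poly Q) \<le> C * (2 * ?I e + 2 * (h * (R i)\<^sup>2))"
      using cell_N2_le_poly_L2[OF C i dQ] mult_left_mono[OF I1 C0] by linarith
    moreover have "(4 * C + 2) * (?I e + h * (R i)\<^sup>2) = 2 * (C * (2 * ?I e + 2 * (h * (R i)\<^sup>2))) + 2 * ?I e + 2 * (h * (R i)\<^sup>2)"
      by (simp add: algebra_simps)
    moreover have "0 \<le> ?I e" using L2_norm_sq_integral[OF L(1)] by (metis zero_le_power2)
    moreover have "n \<le> Z \<and> I \<le> 6 * (n + p)"
      if "q \<le> Y" "Z = 2 * Y + 2 * I + 2 * p" "0 \<le> I" "n \<le> 2 * q + 2 * p" "I \<le> 2 * J + 2 * p" "J \<le> q"
        "q \<le> 2 * n + 2 * p" "0 \<le> p" "0 \<le> n" for n Z I p q Y J :: real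
    proof
      show "n \<le> Z" using that by linarith
      have "I \<le> 2 * q + 2 * p" using that(5,6) by linarith
      then have "I \<le> 4 * n + 6 * p" using that(7) by linarith
      then show "I \<le> 6 * (n + p)" using that(8,9) by (simp add: distrib_left)
    qed
    ultimately show ?thesis using N2' I2 poly_L2_le_cell_N2[OF i dQ] N1 p0 cell_N2_nonneg[of i e] by blast
  qed
  have sum_lin: "(\<Sum>i\<in>I. k * (f i + g i)) = k * ((\<Sum>i\<in>I. f i) + (\<Sum>i\<in>I. g i))"
    for I :: "nat set" and k :: real and f g
    by (simp only: sum.distrib[symmetric] sum_distrib_left)
  have Rsum: "(\<Sum>i=1..M. h * (R i)\<^sup>2) = (h ^ (r + 1) * W)\<^sup>2"
    unfolding hR power_mult_distrib sum_distrib_left[symmetric] W_def w_def[symmetric] L2_norm_cells[OF wL] ..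
  have esum: "(\<Sum>i=1..M. integral {X (i - 1)..X i} (\<lambda>y. (e y)\<^sup>2)) = (L2_norm a b e)\<^sup>2"
    unfolding L2_norm_sq_integral[OF eL]
    by (rule integral_cells[symmetric]) (use L2_space_integrable_on[OF eL eL] in \<open>simp add: power2_eq_square\<close>)
  have "N2 e \<le> (\<Sum>i=1..M. (4 * C + 2) * (integral {X (i - 1)..X i} (\<lambda>y. (e y)\<^sup>2) + h * (R i)\<^sup>2))"
    unfolding N2_cells using both by (intro sum_mono) blast
  also have "\<dots> = (4 * C + 2) * ((L2_norm a b e)\<^sup>2 + (h ^ (r + 1) * W)\<^sup>2)"
    unfolding sum_lin esum Rsum ..
  finally show "N2 (\<lambda>y. g y - v y) \<le> (4 * C + 2) * ((L2_norm a b (\<lambda>y. g y - v y))\<^sup>2 + (h ^ (r + 1) * W)\<^sup>2)"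
    unfolding e_def .
  have "(L2_norm a b e)\<^sup>2 \<le> (\<Sum>i=1..M. 6 * (cell_N2 i e + h * (R i)\<^sup>2))"
    unfolding esum[symmetric] using both by (intro sum_mono) blast
  also have "\<dots> = 6 * (N2 e + (h ^ (r + 1) * W)\<^sup>2)"
    unfolding sum_lin Rsum N2_cells ..
  finally show "(L2_norm a b (\<lambda>y. g y - v y))\<^sup>2 \<le> 6 * (N2 (\<lambda>y. g y - v y) + (h ^ (r + 1) * W)\<^sup>2)"
    unfolding e_def .
qed

section \<open>Energy of interpolants\<close>

lemma poly_deriv_nodes_bound:
  assumes C: "inverse_const r C" and i: "i \<in> {1..M}" and P: "degree P \<le> r"
    and K: "\<And>j. j \<le> r \<Longrightarrow> \<bar>poly P (nd i j)\<bar> \<le> K"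
  shows "integral {X (i - 1)..X i} (\<lambda>y. (poly (pderiv P) y)\<^sup>2) \<le> C * K\<^sup>2 / h"
proof -
  let ?I = "integral {X (i - 1)..X i} (\<lambda>y. (poly P y)\<^sup>2)"
  have "?I \<le> \<bar>\<Sum>j\<le>r. \<omega> j * (poly P (nd i j))\<^sup>2\<bar>" using poly_L2_le_cell_N2[OF i P] by (simp add: cell_N2_def)
  also have "\<dots> \<le> h * K\<^sup>2"
    by (rule weighted_sum_bound) (use K in \<open>auto simp: abs_le_square_iff[symmetric] intro: order.trans[OF _ abs_ge_self]\<close>)
  finally have I: "C * ?I \<le> C * (h * K\<^sup>2)" using C by (intro mult_left_mono) (auto simp: inverse_const_def)
  have sup: "(poly (pderiv P) y)\<^sup>2 \<le> C * K\<^sup>2 / h\<^sup>2" if "y \<in> {X (i - 1)..X i}" for y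
  proof -
    have "h ^ 3 * (poly (pderiv P) y)\<^sup>2 \<le> C * ?I"
      using C P X_less[OF i] that X_diff[OF i] unfolding inverse_const_def by metis
    then have "h * (h\<^sup>2 * (poly (pderiv P) y)\<^sup>2) \<le> h * (C * K\<^sup>2)"
      using I by (simp add: power3_eq_cube power2_eq_square algebra_simps)
    then have "h\<^sup>2 * (poly (pderiv P) y)\<^sup>2 \<le> C * K\<^sup>2" using h_pos by (simp add: mult_le_cancel_left)
    then show ?thesis using h_pos by (simp add: pos_le_divide_eq mult.commute)
  qed
  have "integral {X (i - 1)..X i} (\<lambda>y. (poly (pderiv P) y)\<^sup>2) \<le> integral {X (i - 1)..X i} (\<lambda>y. C * K\<^sup>2 / h\<^sup>2)"
    by (intro integral_le sup integrable_continuous_real continuous_intros)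
  also have "\<dots> = h * (C * K\<^sup>2 / h\<^sup>2)" using X_diff[OF i] X_less[OF i] by simp
  also have "\<dots> = C * K\<^sup>2 / h" using h_pos by (simp add: power2_eq_square)
  finally show ?thesis .
qed

text \<open>Subtracting the value at the left end of each cell makes all nodal values at most
  \<open>L * h\<close>, which compensates the loss in the inverse inequality. Lipschitz continuity
  therefore suffices for a bound independent of the mesh.\<close>

lemma E_interp_Lipschitz:
  assumes C: "inverse_const r C"
    and L: "\<And>y z. y \<in> {a..b} \<Longrightarrow> z \<in> {a..b} \<Longrightarrow> \<bar>g y - g z\<bar> \<le> L * \<bar>y - z\<bar>" and "L \<ge> 0"
  shows "E (interp g) (interp g) \<le> C * L\<^sup>2 * (b - a)"
proof -
  obtain P where P: "pieces (interp g) P" using V_pieces[OF interp(1)] by blast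
  have "integral {X (i - 1)..X i} (\<lambda>y. poly (pderiv (P i)) y * poly (pderiv (P i)) y) \<le> C * L\<^sup>2 * h" if i: "i \<in> {1..M}" for i
  proof -
    define Q where "Q = P i - [:g (X (i - 1)):]"
    have dQ: "degree Q \<le> r" unfolding Q_def using piecesD(1)[OF P i] by (intro degree_diff_le) auto
    have "integral {X (i - 1)..X i} (\<lambda>y. (poly (pderiv Q) y)\<^sup>2) \<le> C * (L * h)\<^sup>2 / h"
    proof (rule poly_deriv_nodes_bound[OF C i dQ])
      fix j assume j: "j \<le> r"
      have n: "nd i j \<in> {X (i - 1)..X i}" by (rule nd_in[OF i j])
      have "poly Q (nd i j) = g (nd i j) - g (X (i - 1))"
        using pieces_nd[OF P i j] interp(2)[OF node_index[OF i j], of g] by (simp add: Q_def nd_def)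
      also have "\<bar>\<dots>\<bar> \<le> L * \<bar>nd i j - X (i - 1)\<bar>"
        by (rule L) (use n cell_subset[OF i] cell_bounds[OF i] X_less[OF i] in auto)
      also have "\<dots> \<le> L * h" using n X_diff[OF i] \<open>L \<ge> 0\<close> by (intro mult_left_mono) auto
      finally show "\<bar>poly Q (nd i j)\<bar> \<le> L * h" .
    qed
    moreover have "C * (L * h)\<^sup>2 / h = C * L\<^sup>2 * h" using h_pos by (simp add: power2_eq_square)
    moreover have "pderiv Q = pderiv (P i)" by (simp add: Q_def pderiv_diff)
    ultimately show ?thesis by (simp add: power2_eq_square)
  qed
  then have "E (interp g) (interp g) \<le> (\<Sum>i=1..M. C * L\<^sup>2 * h)" unfolding E_cells[OF P P] by (intro sum_mono)
  also have "\<dots> = C * L\<^sup>2 * (b - a)" by (simp add: Mh[symmetric])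
  finally show ?thesis .
qed

text \<open>
  The consistency error on one cell vanishes for polynomials of degree \<open>r + 1\<close>, which handles test
  functions vanishing at the left end point; for constants it is the quadrature error of the second
  derivative.
\<close>

lemma cell_consistency:
  assumes C: "inverse_const r C" and i: "i \<in> {1..M}"
    and P: "degree P \<le> r" "\<And>j. j \<le> r \<Longrightarrow> poly P (nd i j) = g (nd i j)" and Q: "degree Q \<le> r"
    and S: "degree S \<le> r + 1" and R: "degree R \<le> 2 * r + 1" and eta: "\<eta> \<ge> 0" and zeta: "\<zeta> \<ge> 0"
    and S0: "\<And>y. y \<in> {X (i - 1)..X i} \<Longrightarrow> \<bar>g y - poly S y\<bar> \<le> h ^ (r + 1) * (sqrt h * \<eta>)"
    and S1: "\<And>y. y \<in> {X (i - 1)..X i} \<Longrightarrow> \<bar>g1 y - poly (pderiv S) y\<bar> \<le> h ^ r * (sqrt h * \<eta>)"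
    and S2: "\<And>y. y \<in> {X (i - 1)..X i} \<Longrightarrow> \<bar>g2 y - poly (pderiv (pderiv S)) y\<bar> \<le> h ^ (r - 1) * (sqrt h * \<eta>)"
    and R1: "\<And>y. y \<in> {X (i - 1)..X i} \<Longrightarrow> \<bar>g1 y - poly (pderiv R) y\<bar> \<le> h ^ (2 * r) * (sqrt h * \<zeta>)"
    and R2: "\<And>y. y \<in> {X (i - 1)..X i} \<Longrightarrow> \<bar>g2 y - poly (pderiv (pderiv R)) y\<bar> \<le> h ^ (2 * r - 1) * (sqrt h * \<zeta>)"
  shows "\<bar>integral {X (i - 1)..X i} (\<lambda>y. poly (pderiv P) y * poly (pderiv Q) y) + (\<Sum>j\<le>r. \<omega> j * (g2 (nd i j) * poly Q (nd i j)))
      - (g1 (X i) * poly Q (X i) - g1 (X (i - 1)) * poly Q (X (i - 1)))\<bar>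
    \<le> (sqrt C + 2) * h ^ (r + 1) * (\<eta> * sqrt (integral {X (i - 1)..X i} (\<lambda>y. (poly (pderiv Q) y)\<^sup>2)))
      + 3 * sqrt C * h ^ (2 * r) * (\<zeta> * sqrt (cell_N2 i (poly Q)))"
proof -
  let ?c = "X (i - 1)" and ?d = "X i"
  note cd = X_less[OF i] and le = cell_le[OF i] and xd = X_diff[OF i]
  have C0: "C \<ge> 0" using C by (simp add: inverse_const_def)
  note exact = gauss_lobatto_exact[OF gl_cell[OF i] r]
  have ends: "?c \<in> {?c..?d}" "?d \<in> {?c..?d}" using le by auto
  \<comment> \<open>The test function is split into its value at the left end and \<open>q\<close>,
    which is controlled by its derivative alone (\<open>qb\<close>).\<close>
  define qc where "qc = poly Q ?c"
  define q where "q = Q - [:qc:]"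
  have dq: "degree q \<le> r" unfolding q_def using Q by (intro degree_diff_le) auto
  have q': "pderiv q = pderiv Q" by (simp add: q_def pderiv_diff)
  have pq: "poly q y = poly Q y - qc" for y by (simp add: q_def)
  have qc0: "poly q ?c = 0" by (simp add: pq qc_def)
  define nq where "nq = L2_norm ?c ?d (poly (pderiv Q))"
  have nq: "nq = sqrt (integral {?c..?d} (\<lambda>y. (poly (pderiv Q) y)\<^sup>2))"
    unfolding nq_def using L2_norm_sq_integral[OF poly_L2_space, of ?c ?d "pderiv Q"] L2_norm_nonneg by (metis real_sqrt_unique)
  have nq0: "nq \<ge> 0" by (simp add: nq_def)
  have qb: "\<bar>poly q y\<bar> \<le> sqrt h * nq" if y: "y \<in> {?c..?d}" for y
  proof -
    have "poly q y = integral {?c..y} (poly (pderiv Q))"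
      using poly_integral_deriv[of ?c y q] y qc0 q' by simp
    then show ?thesis unfolding nq_def using L2_integral_bound[OF poly_L2_space, of ?c ?c y ?d "pderiv Q"] y xd by simp
  qed
  \<comment> \<open>\<open>S\<close> may have degree \<open>r + 1\<close>, one too many to be
    reproduced by interpolation; the next fact says that its interpolant still has the same energy
    product with \<open>Q\<close>.\<close>
  obtain S' where S': "degree S' \<le> r" "\<And>j. j \<le> r \<Longrightarrow> poly S' (nd i j) = poly S (nd i j)"
    using poly_interpolation_exists[OF nd_inj[OF i], of "\<lambda>j. poly S (nd i j)"] by blast
  have S'S: "integral {?c..?d} (\<lambda>y. poly (pderiv (S' - S)) y * poly (pderiv Q) y) = 0"
  proof -
    have z: "poly (S' - S) (nd i j) = 0" if "j \<le> r" for j using S'(2)[OF that] by simp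
    have e: "poly (S' - S) ?c = 0" "poly (S' - S) ?d = 0" using z[of 0] z[of r] nd_ends i by auto
    have "integral {?c..?d} (\<lambda>y. poly (pderiv (S' - S)) y * poly (pderiv Q) y) = - integral {?c..?d} (poly ((S' - S) * pderiv (pderiv Q)))"
    proof -
      have "poly ((S' - S) * pderiv (pderiv Q)) = (\<lambda>x. poly (S' - S) x * poly (pderiv (pderiv Q)) x)" by (simp add: fun_eq_iff)
      then show ?thesis using poly_integral_by_parts[OF le, of "S' - S" "pderiv Q"] e by (simp only: mult_zero_left diff_zero diff_0_right)
    qed
    also have "integral {?c..?d} (poly ((S' - S) * pderiv (pderiv Q))) = (\<Sum>j\<le>r. \<omega> j * poly ((S' - S) * pderiv (pderiv Q)) (nd i j))"
    proof (cases "pderiv (pderiv Q) = 0")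
      case False
      \<comment> \<open>The product has degree at most \<open>(r + 1) + (r - 2)\<close>, the degree
        of exactness, and all its nodal values vanish.\<close>
      have "degree (pderiv (pderiv Q)) + 2 \<le> r"
      proof -
        have "degree (pderiv Q) \<noteq> 0" using False pderiv_eq_0_iff by blast
        then show ?thesis using Q by (simp add: degree_pderiv)
      qed
      moreover have "degree (S' - S) \<le> r + 1" using S'(1) S by (intro degree_diff_le) auto
      ultimately have "degree ((S' - S) * pderiv (pderiv Q)) \<le> 2 * r - 1"
        using degree_mult_le[of "S' - S" "pderiv (pderiv Q)"] by linarith
      then show ?thesis by (rule exact)
    next
      case True
      then have "poly ((S' - S) * pderiv (pderiv Q)) = (\<lambda>x. 0)" by (simp add: fun_eq_iff)
      then show ?thesis by simp
    qed
    also have "\<dots> = 0" using z by (intro sum.neutral) auto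
    finally show ?thesis by simp
  qed
  \<comment> \<open>Again degree \<open>2 * r - 1\<close>: at most \<open>r - 1\<close> from the
    second derivative of \<open>S\<close> and \<open>r\<close> from \<open>q\<close>. The boundary
    term on the left drops out since \<open>q\<close> vanishes there.\<close>
  have quadS: "(\<Sum>j\<le>r. \<omega> j * (poly (pderiv (pderiv S)) (nd i j) * poly q (nd i j))) = poly (pderiv S) ?d * poly q ?d - integral {?c..?d} (\<lambda>y. poly (pderiv S) y * poly (pderiv Q) y)"
  proof -
    have "degree (pderiv (pderiv S) * q) \<le> 2 * r - 1"
      using degree_mult_le[of "pderiv (pderiv S)" q] S dq r by (simp add: degree_pderiv)
    from exact[OF this] have "(\<Sum>j\<le>r. \<omega> j * (poly (pderiv (pderiv S)) (nd i j) * poly q (nd i j))) = integral {?c..?d} (\<lambda>y. poly (pderiv (pderiv S)) y * poly q y)"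
      by (simp add: poly_mult[abs_def])
    then show ?thesis using poly_integral_by_parts[OF le, of "pderiv S" q] qc0 q' by simp
  qed
  \<comment> \<open>At the nodes \<delta> equals \<open>g - S\<close>, so the inverse inequality
    applies with the Taylor error as nodal bound.\<close>
  define \<delta> where "\<delta> = P - S'"
  have d\<delta>: "degree \<delta> \<le> r" unfolding \<delta>_def using P(1) S'(1) by (intro degree_diff_le) auto
  have ii: "(\<lambda>y. poly p1 y * poly p2 y) integrable_on {?c..?d}" for p1 p2 :: "real poly"
    by (intro integrable_continuous_real continuous_intros)
  have split1: "integral {?c..?d} (\<lambda>y. poly (pderiv P) y * poly (pderiv Q) y) =
      integral {?c..?d} (\<lambda>y. poly (pderiv \<delta>) y * poly (pderiv Q) y) + integral {?c..?d} (\<lambda>y. poly (pderiv S) y * poly (pderiv Q) y)"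
  proof -
    have "integral {?c..?d} (\<lambda>y. poly (pderiv P) y * poly (pderiv Q) y) =
      integral {?c..?d} (\<lambda>y. poly (pderiv \<delta>) y * poly (pderiv Q) y + poly (pderiv (S' - S)) y * poly (pderiv Q) y + poly (pderiv S) y * poly (pderiv Q) y)"
      by (intro Henstock_Kurzweil_Integration.integral_cong) (simp add: \<delta>_def pderiv_diff algebra_simps)
    also have "\<dots> = integral {?c..?d} (\<lambda>y. poly (pderiv \<delta>) y * poly (pderiv Q) y) + integral {?c..?d} (\<lambda>y. poly (pderiv (S' - S)) y * poly (pderiv Q) y) + integral {?c..?d} (\<lambda>y. poly (pderiv S) y * poly (pderiv Q) y)"
      by (simp only: Henstock_Kurzweil_Integration.integral_add ii integrable_add)
    finally show ?thesis using S'S by simp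
  qed
  have hh: "sqrt h * sqrt h = h" using h_pos by simp
  have b1: "\<bar>integral {?c..?d} (\<lambda>y. poly (pderiv \<delta>) y * poly (pderiv Q) y)\<bar> \<le> sqrt C * h ^ (r + 1) * (\<eta> * nq)"
  proof -
    define K where "K = h ^ (r + 1) * (sqrt h * \<eta>)"
    have "(L2_norm ?c ?d (poly (pderiv \<delta>)))\<^sup>2 \<le> C * K\<^sup>2 / h"
      unfolding L2_norm_sq_integral[OF poly_L2_space]
    proof (rule poly_deriv_nodes_bound[OF C i d\<delta>])
      fix j assume "j \<le> r"
      then show "\<bar>poly \<delta> (nd i j)\<bar> \<le> K" using S0[OF nd_in[OF i]] P(2) S'(2) by (simp add: \<delta>_def K_def)
    qed
    also have "C * K\<^sup>2 / h = (sqrt C * (h ^ (r + 1) * \<eta>))\<^sup>2"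
      using h_pos C0 by (simp add: K_def power_mult_distrib)
    finally have "L2_norm ?c ?d (poly (pderiv \<delta>)) \<le> sqrt C * (h ^ (r + 1) * \<eta>)"
      by (rule power2_le_imp_le) (use h_pos eta C0 in auto)
    then have "L2_norm ?c ?d (poly (pderiv \<delta>)) * nq \<le> sqrt C * (h ^ (r + 1) * \<eta>) * nq" using nq0 by (rule mult_right_mono)
    moreover have "\<bar>integral {?c..?d} (\<lambda>y. poly (pderiv \<delta>) y * poly (pderiv Q) y)\<bar> \<le> L2_norm ?c ?d (poly (pderiv \<delta>)) * nq"
      unfolding nq_def using L2_Cauchy_Schwarz[OF poly_L2_space poly_L2_space] L2_inner_integral[OF poly_L2_space poly_L2_space] by metis
    ultimately show ?thesis by (simp add: mult.assoc)
  qed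
  have b2: "\<bar>\<Sum>j\<le>r. \<omega> j * ((g2 (nd i j) - poly (pderiv (pderiv S)) (nd i j)) * poly q (nd i j))\<bar> \<le> h ^ (r + 1) * (\<eta> * nq)"
  proof -
    have "\<bar>\<Sum>j\<le>r. \<omega> j * ((g2 (nd i j) - poly (pderiv (pderiv S)) (nd i j)) * poly q (nd i j))\<bar>
        \<le> h * ((h ^ (r - 1) * (sqrt h * \<eta>)) * (sqrt h * nq))"
    proof (rule weighted_sum_bound)
      fix j assume "j \<le> r"
      then have n: "nd i j \<in> {?c..?d}" by (rule nd_in[OF i])
      show "\<bar>(g2 (nd i j) - poly (pderiv (pderiv S)) (nd i j)) * poly q (nd i j)\<bar> \<le> (h ^ (r - 1) * (sqrt h * \<eta>)) * (sqrt h * nq)"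
        unfolding abs_mult using h_pos eta by (intro mult_mono S2[OF n] qb[OF n]) auto
    qed
    also have "\<dots> = (h * (h ^ (r - 1) * (sqrt h * sqrt h))) * (\<eta> * nq)" by (simp add: algebra_simps)
    also have "h * (h ^ (r - 1) * (sqrt h * sqrt h)) = h ^ (r + 1)" unfolding hh using r by (cases r) auto
    finally show ?thesis .
  qed
  have b3: "\<bar>(g1 ?d - poly (pderiv S) ?d) * poly q ?d\<bar> \<le> h ^ (r + 1) * (\<eta> * nq)"
  proof -
    have "\<bar>(g1 ?d - poly (pderiv S) ?d) * poly q ?d\<bar> \<le> (h ^ r * (sqrt h * \<eta>)) * (sqrt h * nq)"
      unfolding abs_mult using h_pos eta by (intro mult_mono S1[OF ends(2)] qb[OF ends(2)]) auto
    also have "\<dots> = (h ^ r * (sqrt h * sqrt h)) * (\<eta> * nq)" by (simp add: algebra_simps)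
    finally show ?thesis unfolding hh by (simp add: mult.commute)
  qed
  \<comment> \<open>For the constant part of the test function only the quadrature error of
    \<open>g2\<close> remains. \<open>R\<close> has degree at most \<open>2 * r + 1\<close>, so its
    second derivative is integrated exactly; the factor 3 counts the quadrature sum and the two end
    values.\<close>
  have b4: "\<bar>qc * ((\<Sum>j\<le>r. \<omega> j * g2 (nd i j)) - (g1 ?d - g1 ?c))\<bar> \<le> 3 * sqrt C * h ^ (2 * r) * (\<zeta> * sqrt (cell_N2 i (poly Q)))"
  proof -
    define Z where "Z = sqrt h * \<zeta>"
    have "degree (pderiv (pderiv R)) \<le> 2 * r - 1" using R by (simp add: degree_pderiv)
    from exact[OF this] have eR: "(\<Sum>j\<le>r. \<omega> j * poly (pderiv (pderiv R)) (nd i j)) = poly (pderiv R) ?d - poly (pderiv R) ?c"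
      using poly_integral_deriv[OF le, of "pderiv R"] by simp
    have "\<bar>\<Sum>j\<le>r. \<omega> j * (g2 (nd i j) - poly (pderiv (pderiv R)) (nd i j))\<bar> \<le> h * (h ^ (2 * r - 1) * Z)"
      unfolding Z_def by (intro weighted_sum_bound R2 nd_in[OF i])
    also have "h * (h ^ (2 * r - 1) * Z) = h ^ (2 * r) * Z" using r by (cases r) auto
    finally have "\<bar>(\<Sum>j\<le>r. \<omega> j * g2 (nd i j)) - (poly (pderiv R) ?d - poly (pderiv R) ?c)\<bar> \<le> h ^ (2 * r) * Z"
      unfolding eR[symmetric] by (simp add: right_diff_distrib sum_subtractf)
    then have m: "\<bar>(\<Sum>j\<le>r. \<omega> j * g2 (nd i j)) - (g1 ?d - g1 ?c)\<bar> \<le> 3 * (h ^ (2 * r) * Z)"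
      using R1[OF ends(1)] R1[OF ends(2)] unfolding Z_def by linarith
    have "h * qc\<^sup>2 \<le> C * integral {?c..?d} (\<lambda>y. (poly Q y)\<^sup>2)"
      using C Q cd ends xd unfolding inverse_const_def qc_def by metis
    also have "\<dots> \<le> C * cell_N2 i (poly Q)" by (rule mult_left_mono[OF poly_L2_le_cell_N2[OF i Q] C0])
    finally have "sqrt (h * qc\<^sup>2) \<le> sqrt (C * cell_N2 i (poly Q))" by (rule real_sqrt_le_mono)
    then have qcb: "sqrt h * \<bar>qc\<bar> \<le> sqrt C * sqrt (cell_N2 i (poly Q))" by (simp add: real_sqrt_mult)
    have "\<bar>qc * ((\<Sum>j\<le>r. \<omega> j * g2 (nd i j)) - (g1 ?d - g1 ?c))\<bar> \<le> \<bar>qc\<bar> * (3 * (h ^ (2 * r) * Z))"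
      unfolding abs_mult by (intro mult_left_mono m) auto
    also have "\<dots> = (3 * h ^ (2 * r) * \<zeta>) * (sqrt h * \<bar>qc\<bar>)" by (simp add: Z_def algebra_simps)
    also have "\<dots> \<le> (3 * h ^ (2 * r) * \<zeta>) * (sqrt C * sqrt (cell_N2 i (poly Q)))"
      using zeta h_pos by (intro mult_left_mono qcb) auto
    finally show ?thesis by (simp add: algebra_simps)
  qed
  have "integral {?c..?d} (\<lambda>y. poly (pderiv P) y * poly (pderiv Q) y) + (\<Sum>j\<le>r. \<omega> j * (g2 (nd i j) * poly Q (nd i j)))
      - (g1 ?d * poly Q ?d - g1 ?c * poly Q ?c) =
      integral {?c..?d} (\<lambda>y. poly (pderiv \<delta>) y * poly (pderiv Q) y)
      + (\<Sum>j\<le>r. \<omega> j * ((g2 (nd i j) - poly (pderiv (pderiv S)) (nd i j)) * poly q (nd i j)))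
      - (g1 ?d - poly (pderiv S) ?d) * poly q ?d
      + qc * ((\<Sum>j\<le>r. \<omega> j * g2 (nd i j)) - (g1 ?d - g1 ?c))"
  proof -
    have sQ: "(\<Sum>j\<le>r. \<omega> j * (g2 (nd i j) * poly Q (nd i j))) = (\<Sum>j\<le>r. \<omega> j * ((g2 (nd i j) - poly (pderiv (pderiv S)) (nd i j)) * poly q (nd i j)))
        + (\<Sum>j\<le>r. \<omega> j * (poly (pderiv (pderiv S)) (nd i j) * poly q (nd i j))) + qc * (\<Sum>j\<le>r. \<omega> j * g2 (nd i j))"
      unfolding pq sum_distrib_left sum.distrib[symmetric] by (intro sum.cong refl) (simp add: algebra_simps)
    have e1: "poly Q ?c = qc" by (simp add: qc_def)
    have "A1 + IS + (s1 + s2 + qc * s3) - (gd * Qd - gc * Qc) = A1 + s1 - (gd - Sd) * qd + qc * (s3 - (gd - gc))"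
      if "s2 = Sd * qd - IS" "Qc = qc" "qd = Qd - qc" for A1 IS s1 s2 s3 gd gc Qd Qc Sd qd :: real
      by (simp add: that algebra_simps)
    from this[OF quadS e1 pq] show ?thesis unfolding split1 sQ .
  qed
  moreover have "(sqrt C + 2) * h ^ (r + 1) * (\<eta> * nq) = sqrt C * h ^ (r + 1) * (\<eta> * nq) + h ^ (r + 1) * (\<eta> * nq) + h ^ (r + 1) * (\<eta> * nq)"
    by (simp add: algebra_simps)
  ultimately show ?thesis using b1 b2 b3 b4 unfolding nq[symmetric] by linarith
qed

text \<open>The cell bounds are added: boundary terms telescope, the outer ones vanish by the
  Neumann condition, and Cauchy-Schwarz over the cells assembles global norms. That condition is a
  premise inside the conclusion because \<open>g1\<close> is only obtained here.\<close>

lemma consistency: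
  assumes C: "inverse_const r C" and g: "continuous_on {a..b} g" "g \<in> H_space a b (2 * r + 2)"
  obtains g1 g2 where "continuous_on {a..b} g2"
    "\<And>y. y \<in> {a..b} \<Longrightarrow> (g has_real_derivative g1 y) (at y within {a..b})"
    "\<And>y. y \<in> {a..b} \<Longrightarrow> (g1 has_real_derivative g2 y) (at y within {a..b})"
    "\<And>w. g1 a = 0 \<Longrightarrow> g1 b = 0 \<Longrightarrow> w \<in> V \<Longrightarrow>
       \<bar>E (interp g) w + ip g2 w\<bar> \<le>
         (sqrt C + 2) * h ^ (r + 1) * (L2_norm a b (weak_deriv a b (r + 2) g) * sqrt (E w w))
         + 3 * sqrt C * h ^ (2 * r) * (L2_norm a b (weak_deriv a b (2 * r + 2) g) * sqrt (N2 w))"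
proof -
  obtain D where TD: "taylor_reps a b (2 * r + 2) g D" using taylor_reps_exist[OF g ab] by blast
  note D = taylor_repsD[OF TD]
  have main: "\<bar>E (interp g) w + ip (D 2) w\<bar> \<le>
         (sqrt C + 2) * h ^ (r + 1) * (L2_norm a b (weak_deriv a b (r + 2) g) * sqrt (E w w))
         + 3 * sqrt C * h ^ (2 * r) * (L2_norm a b (weak_deriv a b (2 * r + 2) g) * sqrt (N2 w))"
    if z: "D 1 a = 0" "D 1 b = 0" and w: "w \<in> V" for w
  proof -
    have C0: "C \<ge> 0" using C by (simp add: inverse_const_def)
    obtain P where P: "pieces (interp g) P" using V_pieces[OF interp(1)] by blast
    obtain Q where Q: "pieces w Q" using V_pieces[OF w] by blast
    define \<eta> where "\<eta> i = L2_norm (X (i - 1)) (X i) (weak_deriv a b (r + 2) g)" for i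
    define \<zeta> where "\<zeta> i = L2_norm (X (i - 1)) (X i) (weak_deriv a b (2 * r + 2) g)" for i
    define t where "t i = integral {X (i - 1)..X i} (\<lambda>y. poly (pderiv (P i)) y * poly (pderiv (Q i)) y) + (\<Sum>j\<le>r. \<omega> j * (D 2 (nd i j) * poly (Q i) (nd i j)))
      - (D 1 (X i) * poly (Q i) (X i) - D 1 (X (i - 1)) * poly (Q i) (X (i - 1)))" for i
    define n1 where "n1 i = sqrt (integral {X (i - 1)..X i} (\<lambda>y. (poly (pderiv (Q i)) y)\<^sup>2))" for i
    define n2 where "n2 i = sqrt (cell_N2 i w)" for i
    have ti: "\<bar>t i\<bar> \<le> (sqrt C + 2) * h ^ (r + 1) * (\<eta> i * n1 i) + 3 * sqrt C * h ^ (2 * r) * (\<zeta> i * n2 i)" if i: "i \<in> {1..M}" for i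
    proof -
      note cell = cell_bounds(1)[OF i] X_less[OF i] cell_bounds(2)[OF i]
      obtain S where S: "degree S < r + 2" "\<And>j y. j < r + 2 \<Longrightarrow> y \<in> {X (i - 1)..X i} \<Longrightarrow> \<bar>D j y - poly ((pderiv ^^ j) S) y\<bar>
          \<le> (X i - X (i - 1)) ^ (r + 2 - 1 - j) * (sqrt (X i - X (i - 1)) * L2_norm (X (i - 1)) (X i) (weak_deriv a b (r + 2) g))"
        by (rule taylor_reps_poly[OF TD _ _ cell, of "r + 2"]) auto
      obtain R where R: "degree R < 2 * r + 2" "\<And>j y. j < 2 * r + 2 \<Longrightarrow> y \<in> {X (i - 1)..X i} \<Longrightarrow> \<bar>D j y - poly ((pderiv ^^ j) R) y\<bar>
          \<le> (X i - X (i - 1)) ^ (2 * r + 2 - 1 - j) * (sqrt (X i - X (i - 1)) * L2_norm (X (i - 1)) (X i) (weak_deriv a b (2 * r + 2) g))"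
        by (rule taylor_reps_poly[OF TD _ _ cell, of "2 * r + 2"]) auto
      note S2 = S(2)[folded \<eta>_def, unfolded X_diff[OF i]] and R2 = R(2)[folded \<zeta>_def, unfolded X_diff[OF i]]
      have cw: "cell_N2 i (poly (Q i)) = cell_N2 i w"
        unfolding cell_N2_def by (intro sum.cong refl) (simp add: pieces_nd[OF Q i])
      have PP: "poly (P i) (nd i j) = g (nd i j)" if "j \<le> r" for j
        using pieces_nd[OF P i that] interp(2)[OF node_index[OF i that], of g] by (simp add: nd_def)
      show ?thesis unfolding t_def n1_def n2_def cw[symmetric]
      proof (rule cell_consistency[OF C i piecesD(1)[OF P i] PP piecesD(1)[OF Q i]])
        show "degree S \<le> r + 1" "degree R \<le> 2 * r + 1" using S(1) R(1) by auto
        fix y assume y: "y \<in> {X (i - 1)..X i}"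
        show "\<bar>g y - poly S y\<bar> \<le> h ^ (r + 1) * (sqrt h * \<eta> i)" using S2[OF _ y, of 0] D(1) by simp
        show "\<bar>D 1 y - poly (pderiv S) y\<bar> \<le> h ^ r * (sqrt h * \<eta> i)" using S2[OF _ y, of 1] by simp
        show "\<bar>D 2 y - poly (pderiv (pderiv S)) y\<bar> \<le> h ^ (r - 1) * (sqrt h * \<eta> i)" using S2[OF _ y, of 2] r by (simp add: numeral_2_eq_2)
        show "\<bar>D 1 y - poly (pderiv R) y\<bar> \<le> h ^ (2 * r) * (sqrt h * \<zeta> i)" using R2[OF _ y, of 1] by simp
        show "\<bar>D 2 y - poly (pderiv (pderiv R)) y\<bar> \<le> h ^ (2 * r - 1) * (sqrt h * \<zeta> i)" using R2[OF _ y, of 2] r by (simp add: numeral_2_eq_2)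
      qed (simp_all add: \<eta>_def \<zeta>_def)
    qed
    \<comment> \<open>Telescoping uses that both neighbouring polynomials take the value of
      \<open>w\<close> at a common mesh point.\<close>
    have bracket: "(\<Sum>i=1..m. D 1 (X i) * poly (Q i) (X i) - D 1 (X (i - 1)) * poly (Q i) (X (i - 1))) = D 1 (X m) * w (X m) - D 1 (X 0) * w (X 0)" if "m \<le> M" for m
      using that
    proof (induction m)
      case (Suc m)
      have i: "Suc m \<in> {1..M}" using Suc.prems by auto
      show ?case using Suc piecesD(2)[OF Q i, of "X (Suc m)"] piecesD(2)[OF Q i, of "X m"] X_less[OF i] by simp
    qed simp
    have tsum: "E (interp g) w + ip (D 2) w = (\<Sum>i=1..M. t i)"
    proof -
      have "ip (D 2) w = (\<Sum>i=1..M. \<Sum>j\<le>r. \<omega> j * (D 2 (nd i j) * poly (Q i) (nd i j)))"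
        unfolding ip_nd by (intro sum.cong refl) (use pieces_nd[OF Q] in auto)
      then show ?thesis
        unfolding t_def sum_subtractf[of _ "\<lambda>i. D 1 (X i) * poly (Q i) (X i) - D 1 (X (i - 1)) * poly (Q i) (X (i - 1))"] sum.distrib bracket[OF order.refl] E_cells[OF P Q]
        using z X_ends by simp
    qed
    have wd: "weak_deriv a b n g \<in> L2_space a b" if "n \<le> 2 * r + 2" for n
      by (rule has_weak_derivD(2)[OF H_space_weak_deriv[OF g(2) that]])
    have c1: "(\<Sum>i=1..M. \<eta> i * n1 i) \<le> L2_norm a b (weak_deriv a b (r + 2) g) * sqrt (E w w)"
    proof -
      have "(\<Sum>i=1..M. (\<eta> i)\<^sup>2) = (L2_norm a b (weak_deriv a b (r + 2) g))\<^sup>2"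
        unfolding \<eta>_def by (rule L2_norm_cells[OF wd]) simp
      moreover have "(\<Sum>i=1..M. (n1 i)\<^sup>2) = E w w"
        unfolding E_cells[OF Q Q] n1_def
        by (intro sum.cong refl) (simp add: power2_eq_square[symmetric] Henstock_Kurzweil_Integration.integral_nonneg integrable_continuous_real continuous_intros)
      ultimately show ?thesis using sum_Cauchy_Schwarz[of \<eta> n1 "{1..M}"] by simp
    qed
    have c2: "(\<Sum>i=1..M. \<zeta> i * n2 i) \<le> L2_norm a b (weak_deriv a b (2 * r + 2) g) * sqrt (N2 w)"
    proof -
      have "(\<Sum>i=1..M. (\<zeta> i)\<^sup>2) = (L2_norm a b (weak_deriv a b (2 * r + 2) g))\<^sup>2"
        unfolding \<zeta>_def by (rule L2_norm_cells[OF wd]) simp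
      moreover have "(\<Sum>i=1..M. (n2 i)\<^sup>2) = N2 w"
        unfolding N2_cells n2_def by (intro sum.cong refl) (simp add: cell_N2_nonneg)
      ultimately show ?thesis using sum_Cauchy_Schwarz[of \<zeta> n2 "{1..M}"] by simp
    qed
    have "\<bar>\<Sum>i=1..M. t i\<bar> \<le> (\<Sum>i=1..M. \<bar>t i\<bar>)" by (rule sum_abs)
    also have "\<dots> \<le> (\<Sum>i=1..M. (sqrt C + 2) * h ^ (r + 1) * (\<eta> i * n1 i) + 3 * sqrt C * h ^ (2 * r) * (\<zeta> i * n2 i))"
      by (intro sum_mono ti)
    also have "\<dots> = (sqrt C + 2) * h ^ (r + 1) * (\<Sum>i=1..M. \<eta> i * n1 i) + 3 * sqrt C * h ^ (2 * r) * (\<Sum>i=1..M. \<zeta> i * n2 i)"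
      by (simp only: sum.distrib sum_distrib_left)
    also have "\<dots> \<le> (sqrt C + 2) * h ^ (r + 1) * (L2_norm a b (weak_deriv a b (r + 2) g) * sqrt (E w w))
         + 3 * sqrt C * h ^ (2 * r) * (L2_norm a b (weak_deriv a b (2 * r + 2) g) * sqrt (N2 w))"
      using h_pos C0 by (intro add_mono mult_left_mono c1 c2) auto
    finally show ?thesis unfolding tsum .
  qed
  show ?thesis
  proof (rule that[of "D 2" "D 1"])
    show "continuous_on {a..b} (D 2)" by (rule D(2)) (use r in auto)
    show "(g has_real_derivative D 1 y) (at y within {a..b})" if "y \<in> {a..b}" for y
      using D(3)[of 0 y] that D(1) by simp
    show "(D 1 has_real_derivative D 2 y) (at y within {a..b})" if "y \<in> {a..b}" for y
      using D(3)[of 1 y] that r by (simp add: numeral_2_eq_2)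
  qed (rule main)
qed

end

subsection \<open>One step of the scheme in spectral coordinates\<close>

lemma stable_schemeD:
  assumes "stable_scheme k m c s q c0 B"
  shows "c0 > 0" "B \<ge> 0" "l \<ge> 0 \<Longrightarrow> (s l)\<^sup>2 \<le> 1 - c0 * min l 1"
    "i \<in> {1..m} \<Longrightarrow> l \<ge> 0 \<Longrightarrow> \<bar>q i l\<bar> \<le> B" "i \<in> {1..m} \<Longrightarrow> l \<ge> 0 \<Longrightarrow> \<bar>l * q i l\<bar> \<le> B"
    "j < k \<Longrightarrow> l \<ge> 0 \<Longrightarrow> defect s q m c j l = 0" "l \<ge> 0 \<Longrightarrow> \<bar>defect s q m c k l\<bar> \<le> B * min l 1"
  using assms unfolding stable_scheme_def by blast+

lemma sum_plus_squared_le: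
  fixes f :: "nat \<Rightarrow> real"
  shows "(z + (\<Sum>i=1..m. f i))\<^sup>2 \<le> (real m + 1) * (z\<^sup>2 + (\<Sum>i=1..m. (f i)\<^sup>2))"
proof -
  define g where "g i = (if i = 0 then z else f i)" for i
  have s: "(\<Sum>i\<in>{0..m}. F (g i)) = F z + (\<Sum>i=1..m. F (f i))" for F :: "real \<Rightarrow> real"
  proof -
    have "(\<Sum>i\<in>{0..m}. F (g i)) = F (g 0) + (\<Sum>i\<in>{0<..m}. F (g i))" by (rule sum.head) simp
    moreover have "{0<..m} = {1..m}" by auto
    moreover have "(\<Sum>i=1..m. F (g i)) = (\<Sum>i=1..m. F (f i))" by (intro sum.cong) (auto simp: g_def)
    ultimately show ?thesis by (simp only:) (simp add: g_def)
  qed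
  have "(\<Sum>i\<in>{0..m}. g i)\<^sup>2 \<le> (\<Sum>i\<in>{0..m}. (g i)\<^sup>2) * card {0..m}"
    by (rule sum_squared_le_sum_of_squares)
  then show ?thesis using s[of "\<lambda>x. x"] s[of "\<lambda>x. x\<^sup>2"] by (simp add: mult.commute add.commute)
qed

text \<open>Young's inequality, used with \<open>t = \<tau>\<close>: the main part grows only by
  \<open>1 + \<tau>\<close>, and the remainder is small enough to afford
  \<open>1 + 1 / \<tau>\<close>.\<close>

lemma square_add_weighted:
  fixes x y t :: real
  assumes "t > 0"
  shows "(x + y)\<^sup>2 \<le> (1 + t) * x\<^sup>2 + (1 + 1 / t) * y\<^sup>2"
proof -
  have "0 \<le> (sqrt t * x - y / sqrt t)\<^sup>2" by simp
  also have "\<dots> = t * x\<^sup>2 - 2 * x * y + y\<^sup>2 / t"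
    using assms by (simp add: power2_diff power_mult_distrib power_divide)
  finally show ?thesis by (simp add: power2_sum algebra_simps)
qed

text \<open>The gap \<open>1 + t - s\<^sup>2\<close> absorbs the mixed term.\<close>

lemma square_add_contraction:
  fixes s e X t g :: real
  assumes "t > 0" "g \<ge> 0" "s\<^sup>2 \<le> 1 - g"
  shows "(s * e + X)\<^sup>2 \<le> (1 + t) * e\<^sup>2 + (1 + t) * X\<^sup>2 / (t + g)"
proof -
  define p where "p = 1 + t - s\<^sup>2"
  have p: "p > 0" "t + g \<le> p" using assms by (auto simp: p_def)
  have "0 \<le> (sqrt p * e - s * X / sqrt p)\<^sup>2" by simp
  also have "\<dots> = p * e\<^sup>2 - 2 * e * s * X + s\<^sup>2 * X\<^sup>2 / p"
    using p(1) by (simp add: power2_diff power_mult_distrib power_divide)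
  finally have 1: "(s * e + X)\<^sup>2 \<le> (1 + t) * e\<^sup>2 + (X\<^sup>2 + s\<^sup>2 * X\<^sup>2 / p)"
    by (simp add: p_def power2_sum power_mult_distrib algebra_simps)
  have 2: "X\<^sup>2 + s\<^sup>2 * X\<^sup>2 / p = (1 + t) * X\<^sup>2 / p"
  proof -
    have "X\<^sup>2 + s\<^sup>2 * X\<^sup>2 / p = (p + s\<^sup>2) * X\<^sup>2 / p" 
      using p(1) by (simp add: distrib_right add_divide_distrib)
    moreover have "p + s\<^sup>2 = 1 + t" by (simp add: p_def)
    ultimately show ?thesis by (simp only:)
  qed
  have "(1 + t) * X\<^sup>2 / p \<le> (1 + t) * X\<^sup>2 / (t + g)"
    using p assms by (intro divide_left_mono mult_nonneg_nonneg mult_pos_pos) auto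
  then show ?thesis using 1 unfolding 2 by linarith
qed

text \<open>The summands come from the defect of order \<open>k\<close>, the spatial residuals, the
  remainder \<open>R0\<close> and the three remainders per stage, in this order;
  \<open>(1 + T)\<^sup>2\<close> bounds the factors \<open>1 + \<tau>\<close>.\<close>

definition step_const :: "nat \<Rightarrow> real \<Rightarrow> real \<Rightarrow> real \<Rightarrow> real" where
  "step_const m T c0 B = (1 + T)\<^sup>2 * (real m + 1) * (B\<^sup>2 / c0 + real m * (B\<^sup>2 * (1 + T) / c0) + 1 + 9 * real m * B\<^sup>2)"

text \<open>The step error of one mode is split into \<open>X\<close>, which is too large and must
  be absorbed by the damping, and \<open>Z\<close>, whose summands will carry enough powers of
  \<tau>. Only the square of \<open>X\<close> is divided by the gap
  \<open>\<tau> + g\<close>.\<close>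

lemma step_estimate_mode:
  fixes y e R0 :: real and D G R R' :: "nat \<Rightarrow> real"
  assumes st: "stable_scheme k m c s q c0 B" and \<tau>: "0 < \<tau>" "\<tau> \<le> T" and l: "l \<ge> 0"
  shows "(s l * e + (\<tau> ^ k * defect s q m c k l * y + (\<Sum>i=1..m. \<tau> * q i l * D i))
      + (R0 + (\<Sum>i=1..m. \<tau> * q i l * G i - \<tau> * q i l * R' i - l * q i l * R i)))\<^sup>2
    \<le> (1 + \<tau>)\<^sup>2 * e\<^sup>2
      + (1 + T)\<^sup>2 * (real m + 1) * (B\<^sup>2 / c0 * \<tau> ^ (2 * k) * (l * y\<^sup>2) + (\<Sum>i=1..m. B\<^sup>2 * (1 + T) / c0 * \<tau> * ((D i)\<^sup>2 / (1 + l / \<tau>))))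
      + (1 + 1 / \<tau>) * (real m + 1) * (R0\<^sup>2 + (\<Sum>i=1..m. 3 * B\<^sup>2 * (\<tau>\<^sup>2 * (G i)\<^sup>2 + \<tau>\<^sup>2 * (R' i)\<^sup>2 + (R i)\<^sup>2)))"
proof -
  have c0: "c0 > 0" and B0: "B \<ge> 0" and sq: "(s l)\<^sup>2 \<le> 1 - c0 * min l 1"
    and q1: "\<And>i. i \<in> {1..m} \<Longrightarrow> \<bar>q i l\<bar> \<le> B" and q2: "\<And>i. i \<in> {1..m} \<Longrightarrow> \<bar>l * q i l\<bar> \<le> B"
    and dk: "\<bar>defect s q m c k l\<bar> \<le> B * min l 1"
    using stable_schemeD[OF st] l by blast+
  \<comment> \<open>The decay estimate at \<open>l = 1\<close> yields
    \<open>c0 \<le> 1\<close>.\<close>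
  have "(s 1)\<^sup>2 \<le> 1 - c0" using stable_schemeD(3)[OF st, of 1] by simp
  moreover have "0 \<le> (s 1)\<^sup>2" by (rule zero_le_power2)
  ultimately have c01: "c0 \<le> 1" by linarith
  have T0: "T > 0" using \<tau> by simp
  define g where "g = c0 * min l 1"
  have g0: "g \<ge> 0" using c0 l by (simp add: g_def)
  have tg: "\<tau> + g > 0" using \<tau> g0 by simp
  define X where "X = \<tau> ^ k * defect s q m c k l * y + (\<Sum>i=1..m. \<tau> * q i l * D i)"
  define Z where "Z = R0 + (\<Sum>i=1..m. \<tau> * q i l * G i - \<tau> * q i l * R' i - l * q i l * R i)"
  \<comment> \<open>The defect is at most \<open>B * min l 1\<close>; dividing its square by
    \<open>c0 * min l 1\<close> leaves one factor \<open>min l 1\<close>, which is at most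
    \<open>l\<close>.\<close>
  have gap1: "(defect s q m c k l)\<^sup>2 / (\<tau> + g) \<le> B\<^sup>2 / c0 * l"
  proof (cases "l = 0")
    case True
    then show ?thesis using dk by simp
  next
    case False
    then have mp: "min l 1 > 0" using l by auto
    have "(defect s q m c k l)\<^sup>2 \<le> (B * min l 1)\<^sup>2" using dk by (metis abs_ge_zero power2_abs power_mono)
    then have "(defect s q m c k l)\<^sup>2 / (\<tau> + g) \<le> (B * min l 1)\<^sup>2 / g"
      using mp c0 \<tau> by (intro frac_le) (auto simp: g_def)
    also have "\<dots> = B\<^sup>2 / c0 * min l 1" using mp c0 by (simp add: g_def power2_eq_square)
    also have "\<dots> \<le> B\<^sup>2 / c0 * l" using c0 by (intro mult_left_mono) auto
    finally show ?thesis .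
  qed
  \<comment> \<open>For \<open>l \<le> 1\<close> the gap is comparable to \<open>\<tau> + l\<close>
    and boundedness of \<open>q\<close> suffices; for larger \<open>l\<close> the gap is merely
    bounded below, and the bound on \<open>l * q\<close> supplies the decay.\<close>
  have gap2: "(q i l)\<^sup>2 / (\<tau> + g) \<le> B\<^sup>2 * (1 + T) / c0 / (\<tau> + l)" if i: "i \<in> {1..m}" for i
  proof -
    have qq: "(q i l)\<^sup>2 \<le> B\<^sup>2" using q1[OF i] by (metis abs_ge_zero power2_abs power_mono)
    have "c0 * ((q i l)\<^sup>2 * (\<tau> + l)) \<le> B\<^sup>2 * (1 + T) * (\<tau> + g)"
    proof (cases "l \<le> 1")
      case True
      have "c0 * (\<tau> + l) \<le> \<tau> + g"
      proof -
        have "c0 * \<tau> \<le> 1 * \<tau>" using c01 \<tau> by (intro mult_right_mono) auto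
        then show ?thesis using True l by (simp add: g_def distrib_left)
      qed
      then have "(q i l)\<^sup>2 * (c0 * (\<tau> + l)) \<le> B\<^sup>2 * (\<tau> + g)" using qq \<tau> l c0 by (intro mult_mono) auto
      also have "\<dots> \<le> B\<^sup>2 * (1 + T) * (\<tau> + g)"
      proof -
        have "0 \<le> T * (B\<^sup>2 * (\<tau> + g))" using T0 tg by simp
        moreover have "B\<^sup>2 * (1 + T) * (\<tau> + g) = B\<^sup>2 * (\<tau> + g) + T * (B\<^sup>2 * (\<tau> + g))" by (simp add: algebra_simps)
        ultimately show ?thesis by linarith
      qed
      finally show ?thesis by (simp add: mult.left_commute)
    next
      case False
      have "(l * q i l)\<^sup>2 \<le> B\<^sup>2" using q2[OF i] by (metis abs_ge_zero power2_abs power_mono)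
      moreover have "\<tau> + l \<le> (1 + T) * l\<^sup>2"
      proof -
        have "l \<le> l\<^sup>2" using False by (simp add: power2_eq_square)
        moreover have "\<tau> \<le> T * l\<^sup>2" using \<tau> False mult_mono[of \<tau> T 1 "l\<^sup>2"] by simp
        ultimately show ?thesis by (simp add: distrib_right)
      qed
      then have "(q i l)\<^sup>2 * (\<tau> + l) \<le> (q i l)\<^sup>2 * ((1 + T) * l\<^sup>2)" by (intro mult_left_mono) auto
      then have "(q i l)\<^sup>2 * (\<tau> + l) \<le> (1 + T) * (l * q i l)\<^sup>2" by (simp add: power_mult_distrib algebra_simps)
      ultimately have "(q i l)\<^sup>2 * (\<tau> + l) \<le> (1 + T) * B\<^sup>2" using T0 by (smt (verit) mult_left_mono)
      then have f1: "(q i l)\<^sup>2 * (\<tau> + l) \<le> (1 + T) * B\<^sup>2" .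
      have f2: "c0 \<le> \<tau> + g" using False \<tau> by (simp add: g_def)
      have f3: "0 \<le> (q i l)\<^sup>2 * (\<tau> + l)" and f4: "0 \<le> \<tau> + g" using \<tau> l tg by auto
      have "c0 * ((q i l)\<^sup>2 * (\<tau> + l)) \<le> (\<tau> + g) * ((1 + T) * B\<^sup>2)"
        by (rule mult_mono[OF f2 f1 f4 f3])
      then show ?thesis by (simp add: algebra_simps)
    qed
    then have "(q i l)\<^sup>2 * (c0 * (\<tau> + l)) \<le> B\<^sup>2 * (1 + T) * (\<tau> + g)" by (simp add: mult.left_commute)
    moreover have "c0 * (\<tau> + l) > 0" using \<tau> l c0 by simp
    ultimately show ?thesis
      unfolding divide_divide_eq_left by (simp only: pos_le_divide_eq times_divide_eq_left pos_divide_le_eq[OF tg])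
  qed
  have X2: "(1 + \<tau>) * X\<^sup>2 / (\<tau> + g) \<le> (1 + T) * (real m + 1) *
      (B\<^sup>2 / c0 * \<tau> ^ (2 * k) * (l * y\<^sup>2) + (\<Sum>i=1..m. B\<^sup>2 * (1 + T) / c0 * \<tau> * ((D i)\<^sup>2 / (1 + l / \<tau>))))" (is "_ \<le> _ * ?S")
  proof -
    have "X\<^sup>2 / (\<tau> + g) \<le> (real m + 1) * ((\<tau> ^ k * defect s q m c k l * y)\<^sup>2 + (\<Sum>i=1..m. (\<tau> * q i l * D i)\<^sup>2)) / (\<tau> + g)"
      unfolding X_def using tg by (intro divide_right_mono sum_plus_squared_le) auto
    also have "\<dots> = (real m + 1) * ((\<tau> ^ k * defect s q m c k l * y)\<^sup>2 / (\<tau> + g) + (\<Sum>i=1..m. (\<tau> * q i l * D i)\<^sup>2 / (\<tau> + g)))"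
      by (simp only: sum_divide_distrib add_divide_distrib times_divide_eq_right[symmetric])
    also have "\<dots> \<le> (real m + 1) * ?S"
    proof (intro mult_left_mono add_mono sum_mono)
      have "(\<tau> ^ k * defect s q m c k l * y)\<^sup>2 / (\<tau> + g) = \<tau> ^ (2 * k) * y\<^sup>2 * ((defect s q m c k l)\<^sup>2 / (\<tau> + g))"
        by (simp add: power_mult_distrib power_mult mult.commute)
      also have "\<dots> \<le> \<tau> ^ (2 * k) * y\<^sup>2 * (B\<^sup>2 / c0 * l)" using \<tau> by (intro mult_left_mono gap1) auto
      finally show "(\<tau> ^ k * defect s q m c k l * y)\<^sup>2 / (\<tau> + g) \<le> B\<^sup>2 / c0 * \<tau> ^ (2 * k) * (l * y\<^sup>2)" by (simp add: algebra_simps)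
      fix i assume i: "i \<in> {1..m}"
      have "(\<tau> * q i l * D i)\<^sup>2 / (\<tau> + g) = \<tau>\<^sup>2 * (D i)\<^sup>2 * ((q i l)\<^sup>2 / (\<tau> + g))"
        by (simp add: power_mult_distrib)
      also have "\<dots> \<le> \<tau>\<^sup>2 * (D i)\<^sup>2 * (B\<^sup>2 * (1 + T) / c0 / (\<tau> + l))" by (intro mult_left_mono gap2[OF i]) auto
      also have "\<dots> = B\<^sup>2 * (1 + T) / c0 * \<tau> * ((D i)\<^sup>2 / (1 + l / \<tau>))"
      proof -
        have "(D i)\<^sup>2 / (1 + l / \<tau>) = \<tau> * (D i)\<^sup>2 / (\<tau> + l)" using \<tau> by (simp add: field_simps)
        then show ?thesis by (simp add: power2_eq_square)
      qed
      finally show "(\<tau> * q i l * D i)\<^sup>2 / (\<tau> + g) \<le> B\<^sup>2 * (1 + T) / c0 * \<tau> * ((D i)\<^sup>2 / (1 + l / \<tau>))" .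
    qed auto
    finally have "(1 + \<tau>) * (X\<^sup>2 / (\<tau> + g)) \<le> (1 + T) * ((real m + 1) * ?S)"
      using \<tau> tg by (intro mult_mono) auto
    then show ?thesis by (simp add: mult.assoc)
  qed
  have Z2: "Z\<^sup>2 \<le> (real m + 1) * (R0\<^sup>2 + (\<Sum>i=1..m. 3 * B\<^sup>2 * (\<tau>\<^sup>2 * (G i)\<^sup>2 + \<tau>\<^sup>2 * (R' i)\<^sup>2 + (R i)\<^sup>2)))"
  proof -
    have three: "(u - v - w)\<^sup>2 \<le> 3 * (u\<^sup>2 + v\<^sup>2 + w\<^sup>2)" for u v w :: real
    proof -
      have "0 \<le> (u + v)\<^sup>2 + (u + w)\<^sup>2 + (v - w)\<^sup>2" by simp
      then show ?thesis by (simp add: power2_eq_square algebra_simps)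
    qed
    have "(\<tau> * q i l * G i - \<tau> * q i l * R' i - l * q i l * R i)\<^sup>2 \<le> 3 * B\<^sup>2 * (\<tau>\<^sup>2 * (G i)\<^sup>2 + \<tau>\<^sup>2 * (R' i)\<^sup>2 + (R i)\<^sup>2)" if i: "i \<in> {1..m}" for i
    proof -
      have qq: "(q i l)\<^sup>2 \<le> B\<^sup>2" "(l * q i l)\<^sup>2 \<le> B\<^sup>2" using q1[OF i] q2[OF i] by (metis abs_ge_zero power2_abs power_mono)+
      have "(\<tau> * q i l * G i - \<tau> * q i l * R' i - l * q i l * R i)\<^sup>2 \<le> 3 * ((\<tau> * q i l * G i)\<^sup>2 + (\<tau> * q i l * R' i)\<^sup>2 + (l * q i l * R i)\<^sup>2)"
        by (rule three)
      also have "\<dots> = 3 * ((q i l)\<^sup>2 * (\<tau>\<^sup>2 * (G i)\<^sup>2) + (q i l)\<^sup>2 * (\<tau>\<^sup>2 * (R' i)\<^sup>2) + (l * q i l)\<^sup>2 * (R i)\<^sup>2)"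
        by (simp add: power_mult_distrib algebra_simps)
      also have "\<dots> \<le> 3 * (B\<^sup>2 * (\<tau>\<^sup>2 * (G i)\<^sup>2) + B\<^sup>2 * (\<tau>\<^sup>2 * (R' i)\<^sup>2) + B\<^sup>2 * (R i)\<^sup>2)"
        by (intro mult_left_mono add_mono mult_right_mono qq) auto
      finally show ?thesis by (simp add: algebra_simps)
    qed
    then have "(\<Sum>i=1..m. (\<tau> * q i l * G i - \<tau> * q i l * R' i - l * q i l * R i)\<^sup>2) \<le> (\<Sum>i=1..m. 3 * B\<^sup>2 * (\<tau>\<^sup>2 * (G i)\<^sup>2 + \<tau>\<^sup>2 * (R' i)\<^sup>2 + (R i)\<^sup>2))"
      by (rule sum_mono)
    then have "(real m + 1) * (R0\<^sup>2 + (\<Sum>i=1..m. (\<tau> * q i l * G i - \<tau> * q i l * R' i - l * q i l * R i)\<^sup>2)) \<le> (real m + 1) * (R0\<^sup>2 + (\<Sum>i=1..m. 3 * B\<^sup>2 * (\<tau>\<^sup>2 * (G i)\<^sup>2 + \<tau>\<^sup>2 * (R' i)\<^sup>2 + (R i)\<^sup>2)))"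
      by (intro mult_left_mono add_left_mono) auto
    then show ?thesis unfolding Z_def by (rule order.trans[OF sum_plus_squared_le])
  qed
  have gen: "z \<le> p\<^sup>2 * e2 + q\<^sup>2 * mm * S + w * mm * Zs"
    if "z \<le> p * x + w * z2" "p * x \<le> p * (p * e2 + Y)" "p * Y \<le> q * (q * mm * S)" "w * z2 \<le> w * (mm * Zs)"
    for z p x w z2 e2 Y q mm S Zs :: real
  proof -
    have "p * (p * e2 + Y) = p\<^sup>2 * e2 + p * Y" "q * (q * mm * S) = q\<^sup>2 * mm * S" "w * (mm * Zs) = w * mm * Zs"
      by (simp_all add: power2_eq_square algebra_simps)
    then show ?thesis using that by linarith
  qed
  have f1: "(s l * e + X + Z)\<^sup>2 \<le> (1 + \<tau>) * (s l * e + X)\<^sup>2 + (1 + 1 / \<tau>) * Z\<^sup>2"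
    by (rule square_add_weighted[OF \<tau>(1)])
  have f2: "(1 + \<tau>) * (s l * e + X)\<^sup>2 \<le> (1 + \<tau>) * ((1 + \<tau>) * e\<^sup>2 + (1 + \<tau>) * X\<^sup>2 / (\<tau> + g))"
    using \<tau> by (intro mult_left_mono square_add_contraction g0) (use sq in \<open>auto simp: g_def\<close>)
  have f3: "(1 + \<tau>) * ((1 + \<tau>) * X\<^sup>2 / (\<tau> + g)) \<le> (1 + T) * ((1 + T) * (real m + 1) *
      (B\<^sup>2 / c0 * \<tau> ^ (2 * k) * (l * y\<^sup>2) + (\<Sum>i=1..m. B\<^sup>2 * (1 + T) / c0 * \<tau> * ((D i)\<^sup>2 / (1 + l / \<tau>)))))"
    using \<tau> tg by (intro mult_mono X2) auto
  have f4: "(1 + 1 / \<tau>) * Z\<^sup>2 \<le> (1 + 1 / \<tau>) * ((real m + 1) * (R0\<^sup>2 + (\<Sum>i=1..m. 3 * B\<^sup>2 * (\<tau>\<^sup>2 * (G i)\<^sup>2 + \<tau>\<^sup>2 * (R' i)\<^sup>2 + (R i)\<^sup>2))))"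
    using \<tau> by (intro mult_left_mono Z2) auto
  show ?thesis unfolding X_def[symmetric] Z_def[symmetric] by (rule gen[OF f1 f2 f3 f4])
qed

text \<open>Sums the modes. Every contribution ends up with a factor \<tau>: from the energy in
  \<open>bY\<close>, from the weight in \<open>bD\<close>, and from
  \<open>(1 + 1 / \<tau>) * \<tau>\<^sup>2\<close> for the remainders.\<close>

lemma step_estimate:
  fixes l e y R0 eh :: "nat \<Rightarrow> real" and D G R R' :: "nat \<Rightarrow> nat \<Rightarrow> real"
  assumes st: "stable_scheme k m c s q c0 B" and \<tau>: "0 < \<tau>" "\<tau> \<le> T" and l: "\<And>\<nu>. \<nu> < n \<Longrightarrow> l \<nu> \<ge> 0"
    and eh: "\<And>\<nu>. \<nu> < n \<Longrightarrow> eh \<nu> = s (l \<nu>) * e \<nu> + (\<tau> ^ k * defect s q m c k (l \<nu>) * y \<nu> + (\<Sum>i=1..m. \<tau> * q i (l \<nu>) * D i \<nu>))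
      + (R0 \<nu> + (\<Sum>i=1..m. \<tau> * q i (l \<nu>) * G i \<nu> - \<tau> * q i (l \<nu>) * R' i \<nu> - l \<nu> * q i (l \<nu>) * R i \<nu>))"
    and bY: "(\<Sum>\<nu><n. l \<nu> * (y \<nu>)\<^sup>2) \<le> \<tau> * \<rho>"
    and bD: "\<And>i. i \<in> {1..m} \<Longrightarrow> (\<Sum>\<nu><n. (D i \<nu>)\<^sup>2 / (1 + l \<nu> / \<tau>)) \<le> \<epsilon>"
    and bR0: "(\<Sum>\<nu><n. (R0 \<nu>)\<^sup>2) \<le> \<rho> * \<tau> ^ (2 * k + 2)"
    and bR: "\<And>i. i \<in> {1..m} \<Longrightarrow> (\<Sum>\<nu><n. (R i \<nu>)\<^sup>2) \<le> \<rho> * \<tau> ^ (2 * k + 2)"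
    and bR': "\<And>i. i \<in> {1..m} \<Longrightarrow> (\<Sum>\<nu><n. (R' i \<nu>)\<^sup>2) \<le> \<rho> * \<tau> ^ (2 * k)"
    and bG: "\<And>i. i \<in> {1..m} \<Longrightarrow> (\<Sum>\<nu><n. (G i \<nu>)\<^sup>2) \<le> \<gamma>"
    and nn: "\<rho> \<ge> 0" "\<epsilon> \<ge> 0" "\<gamma> \<ge> 0"
  shows "(\<Sum>\<nu><n. (eh \<nu>)\<^sup>2) \<le> (1 + \<tau>)\<^sup>2 * (\<Sum>\<nu><n. (e \<nu>)\<^sup>2) + step_const m T c0 B * \<tau> * (\<rho> * \<tau> ^ (2 * k) + \<epsilon> + \<gamma>)"
proof -
  note c0 = stable_schemeD(1)[OF st] and B0 = stable_schemeD(2)[OF st]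
  have T0: "T > 0" using \<tau> by simp
  let ?mm = "real m + 1" and ?Kq = "B\<^sup>2 * (1 + T) / c0"
  have "(\<Sum>\<nu><n. (eh \<nu>)\<^sup>2) \<le> (\<Sum>\<nu><n. (1 + \<tau>)\<^sup>2 * (e \<nu>)\<^sup>2
      + (1 + T)\<^sup>2 * ?mm * (B\<^sup>2 / c0 * \<tau> ^ (2 * k) * (l \<nu> * (y \<nu>)\<^sup>2) + (\<Sum>i=1..m. ?Kq * \<tau> * ((D i \<nu>)\<^sup>2 / (1 + l \<nu> / \<tau>))))
      + (1 + 1 / \<tau>) * ?mm * ((R0 \<nu>)\<^sup>2 + (\<Sum>i=1..m. 3 * B\<^sup>2 * (\<tau>\<^sup>2 * (G i \<nu>)\<^sup>2 + \<tau>\<^sup>2 * (R' i \<nu>)\<^sup>2 + (R i \<nu>)\<^sup>2))))"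
    by (intro sum_mono) (use eh step_estimate_mode[OF st \<tau> l] in auto)
  also have "\<dots> = (1 + \<tau>)\<^sup>2 * (\<Sum>\<nu><n. (e \<nu>)\<^sup>2)
      + (1 + T)\<^sup>2 * ?mm * (B\<^sup>2 / c0 * \<tau> ^ (2 * k) * (\<Sum>\<nu><n. l \<nu> * (y \<nu>)\<^sup>2) + (\<Sum>i=1..m. ?Kq * \<tau> * (\<Sum>\<nu><n. (D i \<nu>)\<^sup>2 / (1 + l \<nu> / \<tau>))))
      + (1 + 1 / \<tau>) * ?mm * ((\<Sum>\<nu><n. (R0 \<nu>)\<^sup>2) + (\<Sum>i=1..m. 3 * B\<^sup>2 * (\<tau>\<^sup>2 * (\<Sum>\<nu><n. (G i \<nu>)\<^sup>2) + \<tau>\<^sup>2 * (\<Sum>\<nu><n. (R' i \<nu>)\<^sup>2) + (\<Sum>\<nu><n. (R i \<nu>)\<^sup>2))))"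
    by (simp only: sum.distrib sum_distrib_left[symmetric] sum.swap[of _ "{..<n}" "{1..m}"])
  also have "\<dots> \<le> (1 + \<tau>)\<^sup>2 * (\<Sum>\<nu><n. (e \<nu>)\<^sup>2)
      + (1 + T)\<^sup>2 * ?mm * (B\<^sup>2 / c0 * \<tau> ^ (2 * k) * (\<tau> * \<rho>) + (\<Sum>i=1..m. ?Kq * \<tau> * \<epsilon>))
      + (1 + 1 / \<tau>) * ?mm * (\<rho> * \<tau> ^ (2 * k + 2) + (\<Sum>i=1..m. 3 * B\<^sup>2 * (\<tau>\<^sup>2 * \<gamma> + \<tau>\<^sup>2 * (\<rho> * \<tau> ^ (2 * k)) + \<rho> * \<tau> ^ (2 * k + 2))))"
    using \<tau> T0 c0 by (intro add_mono mult_left_mono order.refl sum_mono bY bD bR0 bR bR' bG) auto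
  also have "\<dots> = (1 + \<tau>)\<^sup>2 * (\<Sum>\<nu><n. (e \<nu>)\<^sup>2) + \<tau> * (
      (1 + T)\<^sup>2 * ?mm * (B\<^sup>2 / c0 * (\<rho> * \<tau> ^ (2 * k)) + real m * ?Kq * \<epsilon>)
      + (1 + \<tau>) * ?mm * (\<rho> * \<tau> ^ (2 * k) + 3 * real m * B\<^sup>2 * (\<gamma> + 2 * (\<rho> * \<tau> ^ (2 * k)))))"
  proof -
    have "(1 + 1 / \<tau>) * \<tau>\<^sup>2 = \<tau> * (1 + \<tau>)" using \<tau> by (simp add: power2_eq_square field_simps)
    then have a: "(1 + 1 / \<tau>) * mm * (\<tau>\<^sup>2 * z) = \<tau> * ((1 + \<tau>) * mm * z)" for mm z by (metis mult.assoc mult.left_commute)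
    have e: "(\<rho> * \<tau> ^ (2 * k + 2) + (\<Sum>i=1..m. 3 * B\<^sup>2 * (\<tau>\<^sup>2 * \<gamma> + \<tau>\<^sup>2 * (\<rho> * \<tau> ^ (2 * k)) + \<rho> * \<tau> ^ (2 * k + 2))))
       = \<tau>\<^sup>2 * (\<rho> * \<tau> ^ (2 * k) + 3 * real m * B\<^sup>2 * (\<gamma> + 2 * (\<rho> * \<tau> ^ (2 * k))))"
      by (simp add: power_add power2_eq_square algebra_simps)
    have f: "B\<^sup>2 / c0 * \<tau> ^ (2 * k) * (\<tau> * \<rho>) + (\<Sum>i=1..m. ?Kq * \<tau> * \<epsilon>) = \<tau> * (B\<^sup>2 / c0 * (\<rho> * \<tau> ^ (2 * k)) + real m * ?Kq * \<epsilon>)"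
      by (simp add: algebra_simps)
    have "A + w * (\<tau> * u) + (1 + 1 / \<tau>) * mm * (\<tau>\<^sup>2 * z) = A + \<tau> * (w * u + (1 + \<tau>) * mm * z)" for A w u mm z
      unfolding a by (simp add: distrib_left mult.left_commute)
    then show ?thesis unfolding e f .
  qed
  also have "\<dots> \<le> (1 + \<tau>)\<^sup>2 * (\<Sum>\<nu><n. (e \<nu>)\<^sup>2) + \<tau> * (step_const m T c0 B * (\<rho> * \<tau> ^ (2 * k) + \<epsilon> + \<gamma>))"
  proof (intro add_left_mono mult_left_mono)
    define z where "z = \<rho> * \<tau> ^ (2 * k)"
    have z0: "z \<ge> 0" using nn \<tau> by (simp add: z_def)
    define K1 where "K1 = B\<^sup>2 / c0"
    define K2 where "K2 = real m * ?Kq"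
    define K3 where "K3 = real m * B\<^sup>2"
    have K: "K1 \<ge> 0" "K2 \<ge> 0" "K3 \<ge> 0" using c0 T0 by (auto simp: K1_def K2_def K3_def)
    have "(1 + \<tau>) \<le> (1 + T)\<^sup>2"
    proof -
      have "1 + \<tau> \<le> 1 + T" using \<tau> by simp
      also have "\<dots> \<le> (1 + T)\<^sup>2" using T0 by (simp add: power2_eq_square)
      finally show ?thesis .
    qed
    then have "(1 + \<tau>) * ?mm * (z + 3 * K3 * (\<gamma> + 2 * z)) \<le> (1 + T)\<^sup>2 * ?mm * (z + 3 * K3 * (\<gamma> + 2 * z))"
      using z0 nn K by (intro mult_right_mono) auto
    then have "(1 + T)\<^sup>2 * ?mm * (K1 * z + K2 * \<epsilon>) + (1 + \<tau>) * ?mm * (z + 3 * K3 * (\<gamma> + 2 * z)) \<le> (1 + T)\<^sup>2 * ?mm * ((K1 * z + K2 * \<epsilon>) + (z + 3 * K3 * (\<gamma> + 2 * z)))"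
      by (simp add: distrib_left)
    also have "\<dots> \<le> (1 + T)\<^sup>2 * ?mm * ((K1 + K2 + 1 + 9 * K3) * (z + \<epsilon> + \<gamma>))"
    proof (intro mult_left_mono)
      have "0 \<le> K1 * \<epsilon> + K1 * \<gamma> + K2 * z + K2 * \<gamma> + \<epsilon> + \<gamma> + 3 * (K3 * z) + 9 * (K3 * \<epsilon>) + 6 * (K3 * \<gamma>)"
        using K z0 nn by (intro add_nonneg_nonneg mult_nonneg_nonneg) auto
      then show "(K1 * z + K2 * \<epsilon>) + (z + 3 * K3 * (\<gamma> + 2 * z)) \<le> (K1 + K2 + 1 + 9 * K3) * (z + \<epsilon> + \<gamma>)"
        by (simp add: algebra_simps)
    qed auto
    finally show "(1 + T)\<^sup>2 * ?mm * (B\<^sup>2 / c0 * (\<rho> * \<tau> ^ (2 * k)) + real m * ?Kq * \<epsilon>)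
      + (1 + \<tau>) * ?mm * (\<rho> * \<tau> ^ (2 * k) + 3 * real m * B\<^sup>2 * (\<gamma> + 2 * (\<rho> * \<tau> ^ (2 * k))))
      \<le> step_const m T c0 B * (\<rho> * \<tau> ^ (2 * k) + \<epsilon> + \<gamma>)"
      by (simp add: step_const_def K1_def K2_def K3_def z_def mult.assoc)
  qed (use \<tau> in auto)
  finally show ?thesis by (simp add: mult.assoc mult.left_commute)
qed

text \<open>The majorant \<open>Q\<close> is increasing, so one value bounds the \<open>k\<close>
  previous terms together and the multistep recursion reduces to a one-step recursion.\<close>

lemma discrete_Gronwall:
  fixes a :: "nat \<Rightarrow> real"
  assumes \<tau>: "0 < \<tau>" "\<tau> \<le> T" "real N * \<tau> \<le> T" and nn: "K \<ge> 0" "\<delta> \<ge> 0" "\<And>n. a n \<ge> 0" and "k \<ge> 1"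
    and step: "\<And>n. k \<le> n \<Longrightarrow> n \<le> N \<Longrightarrow> a n \<le> (1 + \<tau>)\<^sup>2 * a (n - 1) + K * \<tau> * (\<delta> + (\<Sum>j=1..k. a (n - j)))"
    and n: "n \<le> N"
  defines "\<kappa> \<equiv> 2 + T + (1 + real k) * K"
  shows "a n \<le> exp (\<kappa> * T) * ((\<Sum>l<k. a l) + \<kappa> * T * \<delta>)"
proof -
  define S where "S = (\<Sum>l<k. a l)"
  \<comment> \<open>Starts at the sum of the \<open>k\<close> initial values, which bounds each of
    them, and accumulates the inhomogeneity.\<close>
  define Q where "Q n = (1 + \<kappa> * \<tau>) ^ n * (S + real n * \<tau> * \<kappa> * \<delta>)" for n
  have S0: "S \<ge> 0" using nn by (simp add: S_def sum_nonneg)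
  have \<kappa>: "\<kappa> \<ge> 0" using \<tau> nn by (simp add: \<kappa>_def)
  have Q0: "Q n \<ge> 0" for n unfolding Q_def using \<kappa> \<tau> S0 nn by (intro mult_nonneg_nonneg add_nonneg_nonneg zero_le_power) auto
  have Qstep: "(1 + \<kappa> * \<tau>) * Q n + \<kappa> * \<tau> * \<delta> \<le> Q (Suc n)" for n
  proof -
    have "1 * (\<kappa> * \<tau> * \<delta>) \<le> (1 + \<kappa> * \<tau>) ^ Suc n * (\<kappa> * \<tau> * \<delta>)"
      using \<kappa> \<tau> nn by (intro mult_right_mono one_le_power) auto
    then show ?thesis by (simp add: Q_def algebra_simps)
  qed
  have Qmono: "Q n \<le> Q (Suc n)" for n
  proof -
    have "Q n \<le> (1 + \<kappa> * \<tau>) * Q n + \<kappa> * \<tau> * \<delta>" using \<kappa> \<tau> nn Q0[of n] by (simp add: distrib_right)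
    then show ?thesis using Qstep[of n] by linarith
  qed
  have "\<forall>j\<le>n. a j \<le> Q n" if "n \<le> N" for n
    using that
  proof (induction n)
    case 0
    have "a 0 \<le> S" unfolding S_def using nn \<open>k \<ge> 1\<close> by (intro member_le_sum) auto
    then show ?case by (simp add: Q_def)
  next
    case (Suc n)
    then have IH: "\<And>j. j \<le> n \<Longrightarrow> a j \<le> Q n" by auto
    have "a (Suc n) \<le> Q (Suc n)"
    proof (cases "Suc n < k")
      case True
      have "a (Suc n) \<le> S" unfolding S_def using nn True by (intro member_le_sum) auto
      also have "\<dots> \<le> 1 * (S + real (Suc n) * \<tau> * \<kappa> * \<delta>)" using \<kappa> \<tau> nn by simp
      also have "\<dots> \<le> Q (Suc n)" unfolding Q_def using \<kappa> \<tau> nn S0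
        by (intro mult_right_mono one_le_power add_nonneg_nonneg mult_nonneg_nonneg) auto
      finally show ?thesis .
    next
      case False
      have "a (Suc n) \<le> (1 + \<tau>)\<^sup>2 * a (Suc n - 1) + K * \<tau> * (\<delta> + (\<Sum>j=1..k. a (Suc n - j)))"
        by (rule step) (use False Suc.prems in auto)
      also have "\<dots> \<le> (1 + \<tau>)\<^sup>2 * Q n + K * \<tau> * (\<delta> + (\<Sum>j=1..k. Q n))"
        using nn \<tau> by (intro add_mono mult_left_mono sum_mono IH order.refl) auto
      finally have 1: "a (Suc n) \<le> (1 + \<tau>)\<^sup>2 * Q n + K * \<tau> * (\<delta> + (\<Sum>j=1..k. Q n))" .
      \<comment> \<open>The part \<open>2 + T\<close> of \<kappa> comes from here; of the rest,
        \<open>real k * K\<close> covers the history and \<open>K\<close> the inhomogeneity.\<close>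
      have 2: "(1 + \<tau>)\<^sup>2 * Q n \<le> (1 + (2 + T) * \<tau>) * Q n"
      proof (rule mult_right_mono[OF _ Q0])
        have "\<tau> * \<tau> \<le> T * \<tau>" using \<tau> by (intro mult_right_mono) auto
        then show "(1 + \<tau>)\<^sup>2 \<le> 1 + (2 + T) * \<tau>" by (simp add: power2_eq_square algebra_simps)
      qed
      have 3: "(1 + (2 + T) * \<tau>) * Q n + K * \<tau> * (\<delta> + (\<Sum>j=1..k. Q n)) \<le> (1 + \<kappa> * \<tau>) * Q n + \<kappa> * \<tau> * \<delta>"
      proof -
        have "0 \<le> K * \<tau> * Q n" "0 \<le> (2 + T + real k * K) * \<tau> * \<delta>"
          using nn \<tau> Q0[of n] by (intro mult_nonneg_nonneg add_nonneg_nonneg; simp)+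
        then show ?thesis by (simp add: \<kappa>_def algebra_simps)
      qed
      show ?thesis using 1 2 3 Qstep[of n] by linarith
    qed
    then show ?case using IH Qmono[of n] by (metis le_Suc_eq order.trans)
  qed
  then have "a n \<le> Q n" using n by blast
  also have "\<dots> \<le> exp (\<kappa> * T) * (S + \<kappa> * T * \<delta>)"
    unfolding Q_def
  proof (rule mult_mono)
    have nT: "real n * \<tau> \<le> T" using \<tau> n by (meson order.trans mult_right_mono less_imp_le of_nat_mono)
    have "(1 + \<kappa> * \<tau>) ^ n \<le> exp (\<kappa> * \<tau>) ^ n" using \<kappa> \<tau> by (intro power_mono exp_ge_add_one_self) auto
    also have "\<dots> = exp (\<kappa> * (real n * \<tau>))" by (simp add: algebra_simps flip: exp_of_nat_mult)
    also have "\<dots> \<le> exp (\<kappa> * T)" using nT \<kappa> by (simp add: mult_left_mono)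
    finally show "(1 + \<kappa> * \<tau>) ^ n \<le> exp (\<kappa> * T)" .
    have "real n * \<tau> * (\<kappa> * \<delta>) \<le> T * (\<kappa> * \<delta>)" using nT \<kappa> nn by (intro mult_right_mono) auto
    then show "S + real n * \<tau> * \<kappa> * \<delta> \<le> S + \<kappa> * T * \<delta>" by (simp add: algebra_simps)
  qed (use S0 \<kappa> \<tau> nn in auto)
  finally show ?thesis by (simp add: S_def)
qed

subsection \<open>Interpolation in time\<close>

context
  fixes \<tau> :: real and k n :: nat
  assumes \<tau>: "\<tau> > 0" and k: "k \<ge> 1" "k \<le> n"
begin

lemma time_node_diff: "i \<in> {1..k} \<Longrightarrow> j \<in> {1..k} \<Longrightarrow> real (n - j) * \<tau> - real (n - i) * \<tau> = (real i - real j) * \<tau>"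
  using k by (simp add: of_nat_diff algebra_simps)

lemma time_lagrange_node:
  assumes "i \<in> {1..k}" "j \<in> {1..k}"
  shows "time_lagrange \<tau> k n j (real (n - i) * \<tau>) = (if i = j then 1 else 0)"
proof (cases "i = j")
  case True
  have "(real (n - i) * \<tau> - real (n - i') * \<tau>) / (real (n - j) * \<tau> - real (n - i') * \<tau>) = 1" if "i' \<in> {1..k} - {j}" for i'
    using that True time_node_diff[of i' j] assms \<tau> by auto
  then have "time_lagrange \<tau> k n j (real (n - i) * \<tau>) = 1"
    unfolding time_lagrange_def by (intro prod.neutral ballI)
  then show ?thesis using True by simp
next
  case False
  then show ?thesis unfolding time_lagrange_def using assms by (auto intro!: prod_zero bexI[of _ i])
qed

text \<open>Extrapolation by one step: in each factor the numerator is at most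
  \<open>real k * \<tau>\<close> and the distance of two nodes at least \<tau>.\<close>

lemma time_lagrange_bound:
  assumes j: "j \<in> {1..k}" and t: "t \<in> {real (n - 1) * \<tau>..real n * \<tau>}"
  shows "\<bar>time_lagrange \<tau> k n j t\<bar> \<le> real k ^ k"
proof -
  have "\<bar>time_lagrange \<tau> k n j t\<bar> \<le> (\<Prod>i\<in>{1..k} - {j}. real k)"
    unfolding time_lagrange_def abs_prod
  proof (rule prod_mono)
    fix i assume i: "i \<in> {1..k} - {j}"
    have "\<bar>t - real (n - i) * \<tau>\<bar> \<le> real k * \<tau>"
    proof -
      have "real (n - i) * \<tau> \<le> real (n - 1) * \<tau>" using i k \<tau> by (intro mult_right_mono) auto
      moreover have "real n * \<tau> - real (n - i) * \<tau> = real i * \<tau>" using i k by (simp add: of_nat_diff algebra_simps)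
      moreover have "real i * \<tau> \<le> real k * \<tau>" using i \<tau> by (intro mult_right_mono) auto
      ultimately show ?thesis using t by auto
    qed
    moreover have "\<tau> \<le> \<bar>real (n - j) * \<tau> - real (n - i) * \<tau>\<bar>"
    proof -
      have "1 \<le> \<bar>real i - real j\<bar>" using i by auto
      then have "1 * \<tau> \<le> \<bar>real i - real j\<bar> * \<tau>" using \<tau> by (intro mult_right_mono) auto
      then show ?thesis using time_node_diff[of i j] i j \<tau> by (simp add: abs_mult)
    qed
    ultimately have "\<bar>t - real (n - i) * \<tau>\<bar> / \<bar>real (n - j) * \<tau> - real (n - i) * \<tau>\<bar> \<le> (real k * \<tau>) / \<tau>"
      using \<tau> by (intro frac_le) auto
    then show "0 \<le> \<bar>(t - real (n - i) * \<tau>) / (real (n - j) * \<tau> - real (n - i) * \<tau>)\<bar> \<and>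
      \<bar>(t - real (n - i) * \<tau>) / (real (n - j) * \<tau> - real (n - i) * \<tau>)\<bar> \<le> real k"
      using \<tau> by (simp add: abs_divide)
  qed
  also have "\<dots> = real k ^ card ({1..k} - {j})" by simp
  also have "\<dots> \<le> real k ^ k" using k j by (intro power_increasing) auto
  finally show ?thesis .
qed

lemma time_lagrange_poly:
  assumes "degree p < k"
  shows "(\<Sum>j=1..k. time_lagrange \<tau> k n j t * poly p (real (n - j) * \<tau>)) = poly p t"
proof -
  define t' where "t' i = real (n - i) * \<tau>" for i
  define L where "L j = (\<Prod>i\<in>{1..k} - {j}. smult (1 / (t' j - t' i)) [:- t' i, 1:])" for j
  have pL: "poly (L j) s = time_lagrange \<tau> k n j s" for j s
  proof -
    have "poly (smult (1 / w) [:- v, 1:]) s = (s - v) / w" for v w :: real by (simp add: diff_divide_distrib)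
    then show ?thesis unfolding L_def poly_prod time_lagrange_def t'_def by (simp only:)
  qed
  have dL: "degree (L j) < k" if "j \<in> {1..k}" for j
  proof -
    have "degree (L j) \<le> (\<Sum>i\<in>{1..k} - {j}. degree (smult (1 / (t' j - t' i)) [:- t' i, 1:]))"
      unfolding L_def using degree_prod_sum_le[of "{1..k} - {j}" "\<lambda>i. smult (1 / (t' j - t' i)) [:- t' i, 1:]"] by (simp add: o_def)
    also have "\<dots> \<le> (\<Sum>i\<in>{1..k} - {j}. 1)" by (intro sum_mono) (auto intro: order.trans[OF degree_smult_le])
    also have "\<dots> = k - 1" using that by simp
    finally show ?thesis using k by linarith
  qed
  define Q where "Q = (\<Sum>j=1..k. smult (poly p (t' j)) (L j))"
  \<comment> \<open>Both have degree below \<open>k\<close> and agree at the \<open>k\<close>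
    distinct time nodes.\<close>
  have "Q = p"
  proof (rule poly_eqI_degree[of "t' ` {1..k}"])
    have inj: "inj_on t' {1..k}"
    proof (rule inj_onI)
      fix i j assume ij: "i \<in> {1..k}" "j \<in> {1..k}" "t' i = t' j"
      then have "n - i = n - j" using \<tau> by (simp add: t'_def)
      moreover have "i \<le> n" "j \<le> n" using ij k by auto
      ultimately show "i = j" by linarith
    qed
    have card: "card (t' ` {1..k}) = k" using inj by (simp add: card_image)
    show "degree p < card (t' ` {1..k})" using assms card by simp
    have "degree Q \<le> k - 1" unfolding Q_def
    proof (rule degree_sum_le)
      fix j assume "j \<in> {1..k}"
      then have "degree (L j) \<le> k - 1" using dL by fastforce
      then show "degree (smult (poly p (t' j)) (L j)) \<le> k - 1" by (rule order.trans[OF degree_smult_le])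
    qed simp
    then show "degree Q < card (t' ` {1..k})" using card k by simp
    fix s assume "s \<in> t' ` {1..k}"
    then obtain i where i: "i \<in> {1..k}" "s = t' i" by auto
    have "poly Q s = (\<Sum>j=1..k. poly p (t' j) * (if j = i then 1 else 0))"
      unfolding Q_def poly_sum poly_smult pL i(2) unfolding t'_def
      by (intro sum.cong refl) (use time_lagrange_node[OF i(1)] in auto)
    also have "\<dots> = poly p (t' i)" by (rule sum_mult_delta) (use i in auto)
    finally show "poly Q s = poly p s" using i by simp
  qed
  then have "poly p t = poly Q t" by simp
  also have "\<dots> = (\<Sum>j=1..k. time_lagrange \<tau> k n j t * poly p (t' j))" by (simp add: Q_def poly_sum pL mult.commute)
  finally show ?thesis by (simp add: t'_def)
qed

text \<open>The Taylor polynomial of degree \<open>k - 1\<close> at the latest node is reproduced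
  exactly, so only Taylor remainders at \<open>t\<close> and at the \<open>k\<close> nodes
  contribute; \<open>1 + real k * real k ^ k\<close> bounds the sum of their weights.\<close>

lemma time_interpolation_error:
  fixes G :: "nat \<Rightarrow> real \<Rightarrow> real"
  assumes d: "\<And>i s. i < k \<Longrightarrow> s \<in> {0..T} \<Longrightarrow> (G i has_real_derivative G (Suc i) s) (at s within {0..T})"
    and K: "\<And>s. s \<in> {0..T} \<Longrightarrow> \<bar>G k s\<bar> \<le> K" and nT: "real n * \<tau> \<le> T"
    and t: "t \<in> {real (n - 1) * \<tau>..real n * \<tau>}"
  shows "\<bar>G 0 t - (\<Sum>j=1..k. time_lagrange \<tau> k n j t * G 0 (real (n - j) * \<tau>))\<bar> \<le> (1 + real k * real k ^ k) * real k ^ k * \<tau> ^ k * K"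
proof -
  define t0 where "t0 = real (n - 1) * \<tau>"
  have node: "real (n - j) * \<tau> \<in> {0..T} \<and> \<bar>real (n - j) * \<tau> - t0\<bar> \<le> real k * \<tau>" if j: "j \<in> {1..k}" for j
  proof -
    have n1: "real (n - j) * \<tau> \<le> real n * \<tau>" using \<tau> by (intro mult_right_mono) auto
    have n2: "real (n - j) * \<tau> - t0 = (1 - real j) * \<tau>" using time_node_diff[of 1 j] j k by (simp add: t0_def)
    have n3: "\<bar>(1 - real j) * \<tau>\<bar> \<le> real k * \<tau>" unfolding abs_mult using j \<tau> by (intro mult_mono) auto
    have "0 \<le> real (n - j) * \<tau>" using \<tau> by simp
    moreover have "real (n - j) * \<tau> \<le> T" using n1 nT by linarith
    ultimately show ?thesis using n3 unfolding n2 by simp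
  qed
  have t0: "t0 \<in> {0..T}" using node[of 1] k by (simp add: t0_def)
  have "t0 \<le> t" "t \<le> t0 + \<tau>" using t k by (auto simp: t0_def of_nat_diff algebra_simps)
  moreover have "1 * \<tau> \<le> real k * \<tau>" using k \<tau> by (intro mult_right_mono) auto
  ultimately have tt: "t \<in> {0..T}" "\<bar>t - t0\<bar> \<le> real k * \<tau>" using t t0 nT by auto
  have K0: "K \<ge> 0" using K[OF t0] by linarith
  obtain k' where k': "k = Suc k'" using k by (cases k) auto
  define p where "p = (\<Sum>i\<le>k'. smult (G i t0 / fact i) ([:- t0, 1:] ^ i))"
  have dp: "degree p < k"
  proof -
    have "degree p \<le> k'" unfolding p_def
      by (rule degree_sum_le) (auto intro!: order.trans[OF degree_smult_le] order.trans[OF degree_power_le])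
    then show ?thesis by (simp add: k')
  qed
  have pp: "poly p s = (\<Sum>i\<le>k'. G i t0 * (s - t0) ^ i / fact i)" for s
    by (simp add: p_def poly_sum poly_power algebra_simps)
  have rem: "\<bar>G 0 s - poly p s\<bar> \<le> real k ^ k * \<tau> ^ k * K" if s: "s \<in> {0..T}" "\<bar>s - t0\<bar> \<le> real k * \<tau>" for s
  proof -
    have "norm (G 0 s - (\<Sum>i\<le>k'. G i t0 * (s - t0) ^ i / fact i)) \<le> K * norm (s - t0) ^ Suc k' / fact k'"
      by (rule field_Taylor[where S = "{0..T}"]) (use d K s t0 k' in auto)
    also have "\<dots> \<le> K * norm (s - t0) ^ Suc k' / 1" using K0 by (intro divide_left_mono fact_ge_1) auto
    also have "\<dots> \<le> K * (real k * \<tau>) ^ k" using s K0 unfolding k' by (simp del: power_Suc add: mult_left_mono power_mono)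
    finally show ?thesis unfolding pp by (simp add: power_mult_distrib algebra_simps)
  qed
  have "G 0 t - (\<Sum>j=1..k. time_lagrange \<tau> k n j t * G 0 (real (n - j) * \<tau>)) =
      (G 0 t - poly p t) - (\<Sum>j=1..k. time_lagrange \<tau> k n j t * (G 0 (real (n - j) * \<tau>) - poly p (real (n - j) * \<tau>)))"
    using time_lagrange_poly[OF dp, of t] by (simp add: right_diff_distrib sum_subtractf)
  moreover have "\<bar>\<Sum>j=1..k. time_lagrange \<tau> k n j t * (G 0 (real (n - j) * \<tau>) - poly p (real (n - j) * \<tau>))\<bar> \<le> (\<Sum>j=1..k. real k ^ k * (real k ^ k * \<tau> ^ k * K))"
  proof (rule order.trans[OF sum_abs sum_mono])
    fix j assume j: "j \<in> {1..k}"
    show "\<bar>time_lagrange \<tau> k n j t * (G 0 (real (n - j) * \<tau>) - poly p (real (n - j) * \<tau>))\<bar> \<le> real k ^ k * (real k ^ k * \<tau> ^ k * K)"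
      unfolding abs_mult using node[OF j] by (intro mult_mono time_lagrange_bound[OF j t] rem) auto
  qed
  moreover have "(\<Sum>j=1..k. real k ^ k * (real k ^ k * \<tau> ^ k * K)) = real k * real k ^ k * (real k ^ k * \<tau> ^ k * K)" by simp
  moreover have "(1 + real k * real k ^ k) * real k ^ k * \<tau> ^ k * K = real k ^ k * \<tau> ^ k * K + real k * real k ^ k * (real k ^ k * \<tau> ^ k * K)"
    by (simp add: algebra_simps)
  ultimately show ?thesis using rem[OF tt] by linarith
qed

end

subsection \<open>Functions of time with values in function spaces\<close>

text \<open>Compactness of the time interval. \<open>q\<close> may be any quantity whose increments
  are controlled by \<open>nrm\<close>, for instance the norm of a single weak derivative.\<close>

lemma C_time_bounded:
  fixes V :: "real \<Rightarrow> real \<Rightarrow> real" and q nrm :: "(real \<Rightarrow> real) \<Rightarrow> real"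
  assumes V: "\<And>t. t \<in> {0..T} \<Longrightarrow> V t \<in> S"
    "\<And>t. t \<in> {0..T} \<Longrightarrow> ((\<lambda>s. nrm (\<lambda>x. V s x - V t x)) \<longlongrightarrow> 0) (at t within {0..T})"
    and q: "\<And>v w. v \<in> S \<Longrightarrow> w \<in> S \<Longrightarrow> q v \<le> q w + nrm (\<lambda>x. v x - w x)"
  obtains K where "\<And>t. t \<in> {0..T} \<Longrightarrow> q (V t) \<le> K"
proof -
  have "\<exists>d>0. \<forall>s\<in>{0..T}. s \<in> ball t d \<longrightarrow> q (V s) \<le> q (V t) + 1" if t: "t \<in> {0..T}" for t
  proof -
    have "\<forall>\<^sub>F s in at t within {0..T}. nrm (\<lambda>x. V s x - V t x) < 1" using V(2)[OF t] by (rule order_tendstoD(2)) simp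
    then obtain d where d: "d > 0" "\<And>s. s \<in> {0..T} \<Longrightarrow> s \<noteq> t \<Longrightarrow> dist s t < d \<Longrightarrow> nrm (\<lambda>x. V s x - V t x) < 1"
      unfolding eventually_at by blast
    have "q (V s) \<le> q (V t) + 1" if s: "s \<in> {0..T}" "s \<in> ball t d" for s
      using q[OF V(1)[OF s(1)] V(1)[OF t]] d(2)[OF s(1)] s(2) by (cases "s = t") (auto simp: dist_commute)
    then show ?thesis using d(1) by blast
  qed
  then have "\<forall>t\<in>{0..T}. \<exists>d. d > 0 \<and> (\<forall>s\<in>{0..T}. s \<in> ball t d \<longrightarrow> q (V s) \<le> q (V t) + 1)" by blast
  from bchoice[OF this] obtain d where d: "\<forall>t\<in>{0..T}. d t > 0 \<and> (\<forall>s\<in>{0..T}. s \<in> ball t (d t) \<longrightarrow> q (V s) \<le> q (V t) + 1)"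
    by (elim exE)
  have cover: "{0..T} \<subseteq> (\<Union>t\<in>{0..T}. ball t (d t))"
  proof
    fix t assume "t \<in> {0..T}"
    then show "t \<in> (\<Union>t\<in>{0..T}. ball t (d t))" using d by (intro UN_I[of t]) auto
  qed
  obtain F where F: "F \<subseteq> {0..T}" "finite F" "{0..T} \<subseteq> (\<Union>t\<in>F. ball t (d t))"
    using compactE_image[OF compact_Icc _ cover] by auto
  show ?thesis
  proof (rule that[of "(\<Sum>t\<in>F. \<bar>q (V t)\<bar>) + 1"])
    fix s assume s: "s \<in> {0..T}"
    then obtain t where t: "t \<in> F" "s \<in> ball t (d t)" using F(3) by blast
    have "q (V s) \<le> q (V t) + 1" using d t s F(1) by blast
    moreover have "\<bar>q (V t)\<bar> \<le> (\<Sum>t\<in>F. \<bar>q (V t)\<bar>)" using t F(2) by (intro member_le_sum) auto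
    ultimately show "q (V s) \<le> (\<Sum>t\<in>F. \<bar>q (V t)\<bar>) + 1" by linarith
  qed
qed

lemma abs_le_C_norm:
  assumes "continuous_on {a..b} v" "y \<in> {a..b}"
  shows "\<bar>v y\<bar> \<le> C_norm a b v"
proof -
  have "compact ((\<lambda>x. \<bar>v x\<bar>) ` {a..b})" by (intro compact_continuous_image continuous_intros assms) auto
  then have "bdd_above ((\<lambda>x. \<bar>v x\<bar>) ` {a..b})" by (intro bounded_imp_bdd_above compact_imp_bounded)
  then show ?thesis unfolding C_norm_def using assms(2) by (rule cSUP_upper[rotated])
qed

lemma C_norm_triangle:
  assumes "continuous_on {a..b} v" "continuous_on {a..b} w" "a \<le> b"
  shows "C_norm a b v \<le> C_norm a b w + C_norm a b (\<lambda>x. v x - w x)"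
  unfolding C_norm_def[of a b v]
proof (rule cSUP_least)
  fix y assume y: "y \<in> {a..b}"
  show "\<bar>v y\<bar> \<le> C_norm a b w + C_norm a b (\<lambda>x. v x - w x)"
    using abs_le_C_norm[OF assms(2) y] abs_le_C_norm[OF continuous_on_diff[OF assms(1,2)] y] by linarith
qed (use assms in auto)

lemma weak_deriv_norm_triangle:
  assumes "has_weak_deriv a b n v v'" "has_weak_deriv a b n w w'"
  shows "L2_norm a b (weak_deriv a b n v) \<le> L2_norm a b (weak_deriv a b n w) + L2_norm a b (weak_deriv a b n (\<lambda>x. v x - w x))"
proof -
  note W = has_weak_deriv_weak_deriv[OF assms(1)] has_weak_deriv_weak_deriv[OF assms(2)]
    has_weak_deriv_weak_deriv[OF has_weak_deriv_diff[OF assms]]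
  note L = has_weak_derivD(2)[OF W(1)] has_weak_derivD(2)[OF W(2)] has_weak_derivD(2)[OF W(3)]
  have "AE x in lebesgue_on {a..b}. weak_deriv a b n v x = weak_deriv a b n w x + weak_deriv a b n (\<lambda>x. v x - w x) x"
    using has_weak_deriv_unique[OF W(1)] has_weak_deriv_add[OF W(2,3)] by simp
  then have "L2_norm a b (weak_deriv a b n v) = L2_norm a b (\<lambda>x. weak_deriv a b n w x + weak_deriv a b n (\<lambda>x. v x - w x) x)"
    by (rule L2_norm_AE_cong) (use L in auto)
  also have "\<dots> \<le> L2_norm a b (weak_deriv a b n w) + L2_norm a b (weak_deriv a b n (\<lambda>x. v x - w x))"
    by (rule L2_norm_triangle[OF L(2,3)])
  finally show ?thesis .
qed

lemma weak_deriv_le_H_norm: "i \<le> n \<Longrightarrow> L2_norm a b (weak_deriv a b i v) \<le> H_norm a b n v"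
proof -
  assume "i \<le> n"
  then have "(L2_norm a b (weak_deriv a b i v))\<^sup>2 \<le> (\<Sum>i\<le>n. (L2_norm a b (weak_deriv a b i v))\<^sup>2)"
    by (intro member_le_sum) auto
  then show ?thesis unfolding H_norm_def by (rule real_le_rsqrt)
qed

subsection \<open>The error recursion\<close>

text \<open>With the exact solution expanded at the old time level, the coefficient of
  \<open>y j * \<tau> ^ j\<close> in the step error is exactly the \<open>defect\<close> of order
  \<open>j\<close>, and those below \<open>k\<close> vanish. \<open>D i\<close> is the residual of
  the spatially discrete equation at stage \<open>i\<close>, with \<open>g i\<close> as the exact
  reaction term.\<close>

lemma step_identity:
  fixes y ui wi g F R R' D G :: "nat \<Rightarrow> real"
  assumes k: "k \<ge> 1" and df: "\<And>j. j < k \<Longrightarrow> defect s q m c j l = 0" and \<tau>: "\<tau> > 0"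
    and un: "un = R0 + (\<Sum>j\<le>k. y j * (\<tau> ^ j / fact j))"
    and ui: "\<And>i. i \<in> {1..m} \<Longrightarrow> ui i = R i + (\<Sum>j\<le>k. y j * ((c i * \<tau>) ^ j / fact j))"
    and wi: "\<And>i. i \<in> {1..m} \<Longrightarrow> wi i = R' i + (\<Sum>j<k. y (Suc j) * ((c i * \<tau>) ^ j / fact j))"
    and D: "\<And>i. i \<in> {1..m} \<Longrightarrow> D i = l / \<tau> * ui i + wi i - g i"
    and G: "\<And>i. i \<in> {1..m} \<Longrightarrow> G i = g i - F i"
  shows "un - (s l * U + \<tau> * (\<Sum>i=1..m. q i l * F i)) =
     s l * (y 0 - U) + (\<tau> ^ k * defect s q m c k l * y k + (\<Sum>i=1..m. \<tau> * q i l * D i))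
      + (R0 + (\<Sum>i=1..m. \<tau> * q i l * G i - \<tau> * q i l * R' i - l * q i l * R i))"
proof -
  define P1 where "P1 i = (\<Sum>j\<le>k. y j * ((c i * \<tau>) ^ j / fact j))" for i
  define P2 where "P2 i = (\<Sum>j<k. y (Suc j) * ((c i * \<tau>) ^ j / fact j))" for i
  have terms: "\<tau> * q i l * D i + (\<tau> * q i l * G i - \<tau> * q i l * R' i - l * q i l * R i) = l * q i l * P1 i + \<tau> * q i l * P2 i - \<tau> * (q i l * F i)"
    if i: "i \<in> {1..m}" for i
  proof -
    have "\<tau> * q i l * D i = l * q i l * ui i + \<tau> * q i l * (wi i - g i)"
      unfolding D[OF i] using \<tau> by (simp add: algebra_simps)
    then show ?thesis unfolding G[OF i] ui[OF i] wi[OF i] P1_def[symmetric] P2_def[symmetric] by (simp add: algebra_simps)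
  qed
  have sums: "(\<Sum>i=1..m. \<tau> * q i l * D i) + (\<Sum>i=1..m. \<tau> * q i l * G i - \<tau> * q i l * R' i - l * q i l * R i)
      = (\<Sum>i=1..m. l * q i l * P1 i) + (\<Sum>i=1..m. \<tau> * q i l * P2 i) - \<tau> * (\<Sum>i=1..m. q i l * F i)"
    unfolding sum_distrib_left[of \<tau>] sum.distrib[symmetric] sum_subtractf[symmetric] by (rule sum.cong[OF refl terms])
  define S where "S j = (\<Sum>i=1..m. q i l * c i ^ j)" for j
  have q1: "(\<Sum>i=1..m. l * q i l * P1 i) = (\<Sum>j\<le>k. y j * \<tau> ^ j * (l * S j / fact j))"
  proof -
    have "(\<Sum>i=1..m. l * q i l * P1 i) = (\<Sum>i=1..m. \<Sum>j\<le>k. l * q i l * (y j * ((c i * \<tau>) ^ j / fact j)))"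
      by (simp only: P1_def sum_distrib_left)
    also have "\<dots> = (\<Sum>j\<le>k. \<Sum>i=1..m. l * q i l * (y j * ((c i * \<tau>) ^ j / fact j)))" by (rule sum.swap)
    also have "\<dots> = (\<Sum>j\<le>k. y j * \<tau> ^ j * (l * S j / fact j))"
      unfolding S_def sum_distrib_left sum_divide_distrib
      by (intro sum.cong refl) (simp add: power_mult_distrib)
    finally show ?thesis .
  qed
  have q2: "(\<Sum>i=1..m. \<tau> * q i l * P2 i) = (\<Sum>j<k. y (Suc j) * \<tau> ^ Suc j * (S j / fact j))"
  proof -
    have "(\<Sum>i=1..m. \<tau> * q i l * P2 i) = (\<Sum>i=1..m. \<Sum>j<k. \<tau> * q i l * (y (Suc j) * ((c i * \<tau>) ^ j / fact j)))"
      by (simp only: P2_def sum_distrib_left)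
    also have "\<dots> = (\<Sum>j<k. \<Sum>i=1..m. \<tau> * q i l * (y (Suc j) * ((c i * \<tau>) ^ j / fact j)))" by (rule sum.swap)
    also have "\<dots> = (\<Sum>j<k. y (Suc j) * \<tau> ^ Suc j * (S j / fact j))"
      unfolding S_def sum_distrib_left sum_divide_distrib
      by (intro sum.cong refl) (simp add: power_mult_distrib)
    finally show ?thesis .
  qed
  have "(\<Sum>j\<le>k. y j * \<tau> ^ j * defect s q m c j l) = \<tau> ^ k * defect s q m c k l * y k"
  proof -
    have "(\<Sum>j\<le>k. y j * \<tau> ^ j * defect s q m c j l) = (\<Sum>j<k. y j * \<tau> ^ j * defect s q m c j l) + y k * \<tau> ^ k * defect s q m c k l"
      by (simp add: lessThan_Suc_atMost[symmetric])
    also have "(\<Sum>j<k. y j * \<tau> ^ j * defect s q m c j l) = 0" using df by (intro sum.neutral) auto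
    finally show ?thesis by simp
  qed
  moreover have "(\<Sum>j\<le>k. y j * \<tau> ^ j * defect s q m c j l) =
      (\<Sum>j\<le>k. y j * (\<tau> ^ j / fact j)) - (y 0 * s l + (\<Sum>j<k. y (Suc j) * \<tau> ^ Suc j * (S j / fact j))) - (\<Sum>j\<le>k. y j * \<tau> ^ j * (l * S j / fact j))"
  proof -
    \<comment> \<open>Merges the propagated old value, at \<open>j = 0\<close>, with the shifted
      stage sums belonging to the time derivative.\<close>
    define H where "H j = (if j = 0 then s l else S (j - 1) / fact (j - 1))" for j
    have "(\<Sum>j\<le>k. y j * \<tau> ^ j * defect s q m c j l) = (\<Sum>j\<le>k. y j * (\<tau> ^ j / fact j) - y j * \<tau> ^ j * H j - y j * \<tau> ^ j * (l * S j / fact j))"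
      by (intro sum.cong refl) (simp add: defect_def H_def S_def algebra_simps)
    also have "\<dots> = (\<Sum>j\<le>k. y j * (\<tau> ^ j / fact j)) - (\<Sum>j\<le>k. y j * \<tau> ^ j * H j) - (\<Sum>j\<le>k. y j * \<tau> ^ j * (l * S j / fact j))"
      by (simp only: sum_subtractf)
    also have "(\<Sum>j\<le>k. y j * \<tau> ^ j * H j) = y 0 * s l + (\<Sum>j<k. y (Suc j) * \<tau> ^ Suc j * (S j / fact j))"
    proof -
      obtain n where n: "k = Suc n" using k by (cases k) auto
      have "(\<Sum>j\<le>Suc n. y j * \<tau> ^ j * H j) = y 0 * \<tau> ^ 0 * H 0 + (\<Sum>j\<le>n. y (Suc j) * \<tau> ^ Suc j * H (Suc j))"
        by (rule sum.atMost_Suc_shift)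
      then show ?thesis unfolding n lessThan_Suc_atMost by (simp add: H_def)
    qed
    finally show ?thesis .
  qed
  ultimately have key: "\<tau> ^ k * defect s q m c k l * y k = (un - R0) - (y 0 * s l + (\<Sum>i=1..m. \<tau> * q i l * P2 i)) - (\<Sum>i=1..m. l * q i l * P1 i)"
    unfolding q1 q2 un by simp
  show ?thesis using sums key by (simp add: right_diff_distrib mult.commute)
qed

context mesh
begin

lemma spectral_basisD:
  assumes "spectral_basis \<tau> n e l"
  shows "\<nu> < n \<Longrightarrow> e \<nu> \<in> V" "\<nu> < n \<Longrightarrow> 0 \<le> l \<nu>" "N2 v = (\<Sum>\<nu><n. (ip v (e \<nu>))\<^sup>2)"
    "v \<in> V \<Longrightarrow> \<nu> < n \<Longrightarrow> \<tau> * E v (e \<nu>) = l \<nu> * ip v (e \<nu>)"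
    "v \<in> V \<Longrightarrow> \<tau> * E v v = (\<Sum>\<nu><n. l \<nu> * (ip v (e \<nu>))\<^sup>2)"
    "\<nu> < n \<Longrightarrow> ip (\<lambda>y. \<Sum>j<n. s j * e j y) (e \<nu>) = s \<nu>"
    "v \<in> V \<Longrightarrow> \<nu> < n \<Longrightarrow> ip (spectral_fun V ip (\<lambda>v y. \<tau> * A v y) g v) (e \<nu>) = g (l \<nu>) * ip v (e \<nu>)"
  using assms unfolding spectral_basis_def by blast+

lemma N2_add: "N2 (\<lambda>y. v y + w y) \<le> 2 * N2 v + 2 * N2 w"
proof -
  have "N2 (\<lambda>y. v y + w y) \<le> (\<Sum>i=1..M. 2 * cell_N2 i v + 2 * cell_N2 i w)"
    unfolding N2_cells by (intro sum_mono cell_N2_add)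
  then show ?thesis by (simp add: N2_cells sum.distrib sum_distrib_left)
qed

lemma N2_le_sum:
  assumes "\<And>J. J \<le> M * r \<Longrightarrow> (v (x J))\<^sup>2 \<le> K * (\<Sum>j=1..k. (d j (x J))\<^sup>2)"
  shows "N2 v \<le> K * (\<Sum>j=1..k. N2 (d j))"
proof -
  have "N2 v \<le> (\<Sum>i=1..M. \<Sum>j\<le>r. \<omega> j * (K * (\<Sum>j'=1..k. (d j' (nd i j))\<^sup>2)))"
    unfolding ip_nd
  proof (intro sum_mono mult_left_mono)
    fix i j assume "i \<in> {1..M}" "j \<in> {..r}"
    then show "v (nd i j) * v (nd i j) \<le> K * (\<Sum>j'=1..k. (d j' (nd i j))\<^sup>2)"
      using assms[OF node_index] by (simp add: nd_def power2_eq_square)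
  qed (use weight_pos in \<open>auto intro: less_imp_le\<close>)
  also have "\<dots> = K * (\<Sum>i=1..M. \<Sum>j\<le>r. \<Sum>j'=1..k. \<omega> j * (d j' (nd i j))\<^sup>2)"
    by (simp only: sum_distrib_left mult.left_commute)
  also have "(\<Sum>i=1..M. \<Sum>j\<le>r. \<Sum>j'=1..k. \<omega> j * (d j' (nd i j))\<^sup>2) = (\<Sum>j'=1..k. \<Sum>i=1..M. \<Sum>j\<le>r. \<omega> j * (d j' (nd i j))\<^sup>2)"
    by (simp only: sum.swap[of _ "{..r}" "{1..k}"] sum.swap[of _ "{1..M}" "{1..k}"])
  finally show ?thesis by (simp add: ip_nd power2_eq_square)
qed

text \<open>Duality in the norm of \<open>(1 + A)\<^sup>-\<^sup>1\<^sup>/\<^sup>2\<close>: the functional is tested with its own Riesz representative.\<close>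

lemma dual_norm_bound:
  assumes sb: "spectral_basis \<tau> n e l" and \<tau>: "\<tau> > 0" and vg: "v \<in> V" and K: "K \<ge> 0"
    and bound: "\<And>w. w \<in> V \<Longrightarrow> \<bar>E v w + ip g w\<bar> \<le> K * (sqrt (E w w) + sqrt (N2 w))"
  shows "(\<Sum>\<nu><n. (E v (e \<nu>) + ip g (e \<nu>))\<^sup>2 / (1 + l \<nu> / \<tau>)) \<le> 2 * K\<^sup>2"
proof -
  define D where "D \<nu> = E v (e \<nu>) + ip g (e \<nu>)" for \<nu>
  define s where "s \<nu> = D \<nu> / (1 + l \<nu> / \<tau>)" for \<nu>
  define w where "w = (\<lambda>y. \<Sum>\<nu><n. s \<nu> * e \<nu> y)"
  define S where "S = (\<Sum>\<nu><n. (D \<nu>)\<^sup>2 / (1 + l \<nu> / \<tau>))"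
  note sbD = spectral_basisD[OF sb]
  have pos: "1 + l \<nu> / \<tau> > 0" if "\<nu> < n" for \<nu> using sbD(2)[OF that] \<tau> by (simp add: add_pos_nonneg)
  have wV: "w \<in> V" unfolding w_def by (intro V_sum) (use sbD(1) in auto)
  have we: "ip w (e \<nu>) = s \<nu>" if "\<nu> < n" for \<nu> unfolding w_def by (rule sbD(6)[OF that])
  have S0: "S \<ge> 0" unfolding S_def using pos by (intro sum_nonneg) (auto intro!: divide_nonneg_pos)
  have "E v w + ip g w = (\<Sum>\<nu><n. s \<nu> * E v (e \<nu>)) + (\<Sum>\<nu><n. s \<nu> * ip g (e \<nu>))"
  proof -
    have "E v w = (\<Sum>\<nu><n. s \<nu> * E v (e \<nu>))"
      using E_sum[of "{..<n}" e v s] sbD(1) vg by (simp add: w_def E_sym[of v])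
    moreover have "ip g w = (\<Sum>\<nu><n. s \<nu> * ip g (e \<nu>))"
      unfolding w_def ip_sym[of g] ip_sum ..
    ultimately show ?thesis by simp
  qed
  also have "\<dots> = (\<Sum>\<nu><n. s \<nu> * D \<nu>)" by (simp add: D_def distrib_left sum.distrib)
  also have "\<dots> = S" by (simp add: S_def s_def power2_eq_square)
  finally have Sw: "S = E v w + ip g w" by simp
  have en: "E w w + N2 w = S"
  proof -
    have "\<tau> * E w w = (\<Sum>\<nu><n. l \<nu> * (s \<nu>)\<^sup>2)" using sbD(5)[OF wV] we by simp
    then have "E w w = (\<Sum>\<nu><n. l \<nu> * (s \<nu>)\<^sup>2) / \<tau>" using \<tau> by (simp add: field_simps)
    then have "E w w = (\<Sum>\<nu><n. l \<nu> / \<tau> * (s \<nu>)\<^sup>2)" by (simp add: sum_divide_distrib)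
    moreover have "N2 w = (\<Sum>\<nu><n. (s \<nu>)\<^sup>2)" using sbD(3)[of w] we by simp
    ultimately have "E w w + N2 w = (\<Sum>\<nu><n. (1 + l \<nu> / \<tau>) * (s \<nu>)\<^sup>2)" by (simp add: sum.distrib distrib_right)
    also have "\<dots> = S" unfolding S_def
    proof (intro sum.cong refl)
      fix \<nu> assume "\<nu> \<in> {..<n}"
      then show "(1 + l \<nu> / \<tau>) * (s \<nu>)\<^sup>2 = (D \<nu>)\<^sup>2 / (1 + l \<nu> / \<tau>)"
        using pos[of \<nu>] by (simp add: s_def power_divide power2_eq_square)
    qed
    finally show ?thesis .
  qed
  have "S \<le> K * (sqrt (E w w) + sqrt (N2 w))" using bound[OF wV] Sw by linarith
  then have "S\<^sup>2 \<le> (K * (sqrt (E w w) + sqrt (N2 w)))\<^sup>2" using S0 by (rule power_mono)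
  also have "\<dots> = K\<^sup>2 * (sqrt (E w w) + sqrt (N2 w))\<^sup>2" by (simp add: power_mult_distrib)
  also have "\<dots> \<le> K\<^sup>2 * (2 * (sqrt (E w w))\<^sup>2 + 2 * (sqrt (N2 w))\<^sup>2)" by (intro mult_left_mono square_sum_le) auto
  also have "\<dots> = 2 * K\<^sup>2 * S" using en E_nonneg[of w] N2_nonneg[of w] by (simp add: distrib_left[symmetric])
  finally have "S * S \<le> 2 * K\<^sup>2 * S" by (simp add: power2_eq_square)
  then have "S \<le> 2 * K\<^sup>2" using S0 by (cases "S = 0") auto
  then show ?thesis by (simp add: S_def D_def)
qed

text \<open>The data enter through pointwise, energy and quadrature-norm bounds only, so the
  analysis in function spaces stays separate. The resulting constant involves neither \<tau> nor
  \<open>h\<close>, as the Gronwall argument requires.\<close>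

lemma error_recursion:
  fixes u :: "real \<Rightarrow> real \<Rightarrow> real" and W :: "nat \<Rightarrow> real \<Rightarrow> real \<Rightarrow> real" and U :: "nat \<Rightarrow> real \<Rightarrow> real"
  assumes C: "inverse_const r C" and st: "stable_scheme k m c s q c0 B"
    and k: "k \<ge> 1" and c01: "\<And>i. i \<in> {1..m} \<Longrightarrow> c i \<in> {0..1}"
    and \<tau>: "0 < \<tau>" "\<tau> \<le> T" and N: "real N * \<tau> \<le> T"
    and W0: "W 0 = u"
    and dW: "\<And>i t y. i \<le> k \<Longrightarrow> t \<in> {0..T} \<Longrightarrow> y \<in> {a..b} \<Longrightarrow> ((\<lambda>s. W i s y) has_real_derivative W (Suc i) t y) (at t within {0..T})"
    and bW: "\<And>t y. t \<in> {0..T} \<Longrightarrow> y \<in> {a..b} \<Longrightarrow> \<bar>W (Suc k) t y\<bar> \<le> K0"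
    and lW: "L \<ge> 0" "\<And>t y z. t \<in> {0..T} \<Longrightarrow> y \<in> {a..b} \<Longrightarrow> z \<in> {a..b} \<Longrightarrow> \<bar>W k t y - W k t z\<bar> \<le> L * \<bar>y - z\<bar>"
    and cons: "KD \<ge> 0" "\<And>t w. t \<in> {0..T} \<Longrightarrow> w \<in> V \<Longrightarrow>
       \<bar>E (interp (u t)) w + ip (\<lambda>y. W 1 t y - f (u t y)) w\<bar> \<le> KD * h ^ (r + 1) * (sqrt (E w w) + sqrt (N2 w))"
    and ua: "\<And>t y. t \<in> {0..T} \<Longrightarrow> y \<in> {a..b} \<Longrightarrow> \<bar>u t y\<bar> \<le> \<alpha>"
    and Lf: "Lf \<ge> 0" "\<And>y z. \<bar>y\<bar> \<le> \<alpha> \<Longrightarrow> \<bar>z\<bar> \<le> \<alpha> \<Longrightarrow> \<bar>f y - f z\<bar> \<le> Lf * \<bar>y - z\<bar>"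
    and KG: "KG \<ge> 0" "\<And>n t. k \<le> n \<Longrightarrow> n \<le> N \<Longrightarrow> t \<in> {real (n - 1) * \<tau>..real n * \<tau>} \<Longrightarrow>
       N2 (\<lambda>y. f (u t y) - (\<Sum>j=1..k. time_lagrange \<tau> k n j t * f (u (real (n - j) * \<tau>) y))) \<le> KG * (\<tau> ^ (2 * k) + h ^ (2 * r + 2))"
    and UV: "\<And>l. l \<le> N \<Longrightarrow> U l \<in> V" and Ua: "\<And>l J. l \<le> N \<Longrightarrow> J \<le> M * r \<Longrightarrow> \<bar>U l (x J)\<bar> \<le> \<alpha>"
    and cut: "cutoff_solution a b M r x \<omega> f \<alpha> \<tau> N k m s q c U"
    and n: "k \<le> n" "n \<le> N"
  defines "err \<equiv> \<lambda>n. N2 (\<lambda>y. u (real n * \<tau>) y - U n y)"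
  shows "err n \<le> (1 + \<tau>)\<^sup>2 * err (n - 1)
    + step_const m T c0 B * ((b - a) * K0\<^sup>2 + C * L\<^sup>2 * (b - a) + 2 * KD\<^sup>2 + 2 * KG + 2 * real k * (real k ^ k * Lf)\<^sup>2) * \<tau>
      * (\<tau> ^ (2 * k) + h ^ (2 * r + 2) + (\<Sum>j=1..k. err (n - j)))"
proof -
  obtain d e l where sb: "spectral_basis \<tau> d e l" using spectral_basis_exists[OF \<tau>(1)] by blast
  note sbD = spectral_basisD[OF sb]
  \<comment> \<open>Base point of all Taylor expansions in this step.\<close>
  define t where "t = real (n - 1) * \<tau>"
  define tn where "tn = real n * \<tau>"
  define ti where "ti i = real (n - 1) * \<tau> + c i * \<tau>" for i
  have tn: "tn = t + \<tau>" using n k by (simp add: tn_def t_def of_nat_diff algebra_simps)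
  have tnT: "tn \<le> T" using N n \<tau> unfolding tn_def by (meson order.trans mult_right_mono less_imp_le of_nat_mono)
  have t0: "0 \<le> t" using \<tau> by (simp add: t_def)
  have tT: "t \<in> {0..T}" "tn \<in> {0..T}" using t0 tn tnT \<tau> by auto
  have cit: "0 \<le> c i * \<tau>" "c i * \<tau> \<le> \<tau>" if "i \<in> {1..m}" for i
    using c01[OF that] \<tau> mult_right_mono[of "c i" 1 \<tau>] by auto
  have tiT: "ti i \<in> {0..T}" "ti i \<in> {real (n - 1) * \<tau>..real n * \<tau>}" "\<bar>ti i - t\<bar> \<le> \<tau>" "ti i - t = c i * \<tau>" if "i \<in> {1..m}" for i
    using cit[OF that] tT tn unfolding ti_def t_def[symmetric] tn_def[symmetric] by auto
  have nodeT: "real (n - j) * \<tau> \<in> {0..T}" for j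
  proof -
    have "real (n - j) * \<tau> \<le> real n * \<tau>" using \<tau> by (intro mult_right_mono) auto
    moreover have "real n * \<tau> \<le> T" using tnT by (simp add: tn_def)
    ultimately have "real (n - j) * \<tau> \<le> T" by (rule order.trans)
    then show ?thesis using \<tau> by simp
  qed
  define Uh where "Uh = provisional_step a b M r x \<omega> f \<tau> k m s q c U n"
  define F where "F i = (\<lambda>z. \<Sum>j=1..k. time_lagrange \<tau> k n j (ti i) * interp (\<lambda>w. f (U (n - j) w)) z)" for i
  have FV: "F i \<in> V" for i unfolding F_def by (intro V_sum interp)
  have UnV: "U (n - 1) \<in> V" by (rule UV) (use n in simp)
  define sf where "sf = spectral_fun V ip (\<lambda>v y. \<tau> * A v y)"
  have Uh: "Uh = (\<lambda>y. sf s (U (n - 1)) y + \<tau> * (\<Sum>i=1..m. 1 * sf (q i) (F i) y))"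
    unfolding Uh_def provisional_step_def Let_def sf_def A_def F_def interp_def ti_def by simp
  have hUh: "ip Uh (e \<nu>) = s (l \<nu>) * ip (U (n - 1)) (e \<nu>) + \<tau> * (\<Sum>i=1..m. q i (l \<nu>) * ip (F i) (e \<nu>))" if \<nu>: "\<nu> < d" for \<nu>
    unfolding Uh ip_add ip_scale ip_sum unfolding sf_def
    using sbD(7)[OF UnV \<nu>] sbD(7)[OF FV \<nu>] by simp
  define R0 where "R0 y = u tn y - (\<Sum>j\<le>k. (\<tau> ^ j / fact j) * W j t y)" for y
  define R where "R i y = u (ti i) y - (\<Sum>j\<le>k. ((c i * \<tau>) ^ j / fact j) * W j t y)" for i y
  define R' where "R' i y = W 1 (ti i) y - (\<Sum>j<k. ((c i * \<tau>) ^ j / fact j) * W (Suc j) t y)" for i y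
  define G where "G i y = f (u (ti i) y) - F i y" for i y
  \<comment> \<open>Order \<open>k + 1\<close> for the solution, but only \<open>k\<close> for its
    time derivative in \<open>taylor'\<close>, which enters the step with an additional factor
    \<tau>.\<close>
  have taylor: "\<bar>u t' y - (\<Sum>j\<le>k. ((t' - t) ^ j / fact j) * W j t y)\<bar> \<le> K0 * \<tau> ^ (k + 1)"
    if t': "t' \<in> {0..T}" "\<bar>t' - t\<bar> \<le> \<tau>" and y: "y \<in> {a..b}" for t' y
  proof -
    have K00: "K0 \<ge> 0" using bW[OF tT(1) y] by linarith
    have "norm (W 0 t' y - (\<Sum>i\<le>k. W i t y * (t' - t) ^ i / fact i)) \<le> K0 * norm (t' - t) ^ Suc k / fact k"
      by (rule field_Taylor[where S = "{0..T}" and f = "\<lambda>i t. W i t y"]) (use dW bW y tT t' in auto)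
    also have "\<dots> \<le> K0 * norm (t' - t) ^ Suc k / 1" using K00 by (intro divide_left_mono fact_ge_1) auto
    also have "\<dots> \<le> K0 * \<tau> ^ (k + 1)" using t'(2) K00 by (simp del: power_Suc add: mult_left_mono power_mono)
    finally show ?thesis by (simp add: W0 mult.commute)
  qed
  have taylor': "\<bar>W 1 t' y - (\<Sum>j<k. ((t' - t) ^ j / fact j) * W (Suc j) t y)\<bar> \<le> K0 * \<tau> ^ k"
    if t': "t' \<in> {0..T}" "\<bar>t' - t\<bar> \<le> \<tau>" and y: "y \<in> {a..b}" for t' y
  proof -
    obtain k' where k': "k = Suc k'" using k by (cases k) auto
    have K00: "K0 \<ge> 0" using bW[OF tT(1) y] by linarith
    have "norm (W (Suc 0) t' y - (\<Sum>i\<le>k'. W (Suc i) t y * (t' - t) ^ i / fact i)) \<le> K0 * norm (t' - t) ^ Suc k' / fact k'"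
      by (rule field_Taylor[where S = "{0..T}" and f = "\<lambda>i t. W (Suc i) t y"]) (use dW bW y tT t' k' in auto)
    also have "\<dots> \<le> K0 * norm (t' - t) ^ Suc k' / 1" using K00 by (intro divide_left_mono fact_ge_1) auto
    also have "\<dots> \<le> K0 * \<tau> ^ k" using t'(2) K00 by (simp del: power_Suc add: mult_left_mono power_mono k')
    finally show ?thesis by (simp add: k' lessThan_Suc_atMost mult.commute)
  qed
  have sq: "(b - a) * (K0 * \<tau> ^ j)\<^sup>2 = (b - a) * K0\<^sup>2 * \<tau> ^ (2 * j)" for j
    by (simp add: power_mult_distrib power_mult mult.commute)
  have nR0: "N2 R0 \<le> (b - a) * K0\<^sup>2 * \<tau> ^ (2 * k + 2)"
  proof -
    have "N2 R0 \<le> (b - a) * (K0 * \<tau> ^ (k + 1))\<^sup>2"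
      by (rule N2_bound) (use taylor[OF tT(2)] tn \<tau> node_in in \<open>auto simp: R0_def\<close>)
    then show ?thesis unfolding sq by (simp add: algebra_simps)
  qed
  have nR: "N2 (R i) \<le> (b - a) * K0\<^sup>2 * \<tau> ^ (2 * k + 2)" if i: "i \<in> {1..m}" for i
  proof -
    have "N2 (R i) \<le> (b - a) * (K0 * \<tau> ^ (k + 1))\<^sup>2"
      by (rule N2_bound) (use taylor[OF tiT(1,3)[OF i]] tiT(4)[OF i] node_in in \<open>auto simp: R_def\<close>)
    then show ?thesis unfolding sq by (simp add: algebra_simps)
  qed
  have nR': "N2 (R' i) \<le> (b - a) * K0\<^sup>2 * \<tau> ^ (2 * k)" if i: "i \<in> {1..m}" for i
    unfolding sq[symmetric]
    by (rule N2_bound) (use taylor'[OF tiT(1,3)[OF i]] tiT(4)[OF i] node_in in \<open>auto simp: R'_def\<close>)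
  define errs where "errs = (\<Sum>j=1..k. err (n - j))"
  have err0: "err n \<ge> 0" for n unfolding err_def by (rule N2_nonneg)
  have errs0: "errs \<ge> 0" unfolding errs_def by (intro sum_nonneg err0)
  have nG: "N2 (G i) \<le> 2 * KG * (\<tau> ^ (2 * k) + h ^ (2 * r + 2)) + 2 * real k * (real k ^ k * Lf)\<^sup>2 * errs" if i: "i \<in> {1..m}" for i
  proof -
    \<comment> \<open>The reaction error splits into the error of interpolating
      \<open>f (u t)\<close> in time and the difference between exact and numerical arguments at the
      old time levels.\<close>
    define G1 where "G1 y = f (u (ti i) y) - (\<Sum>j=1..k. time_lagrange \<tau> k n j (ti i) * f (u (real (n - j) * \<tau>) y))" for y
    define G2 where "G2 y = (\<Sum>j=1..k. time_lagrange \<tau> k n j (ti i) * (f (u (real (n - j) * \<tau>) y) - f (U (n - j) y)))" for y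
    have "N2 (G i) = N2 (\<lambda>y. G1 y + G2 y)"
      by (rule ip_cong) (auto simp: G_def G1_def G2_def F_def interp(2) right_diff_distrib sum_subtractf)
    moreover have "N2 G1 \<le> KG * (\<tau> ^ (2 * k) + h ^ (2 * r + 2))"
      unfolding G1_def by (rule KG(2)[OF n tiT(2)[OF i]])
    moreover have "N2 G2 \<le> real k * (real k ^ k * Lf)\<^sup>2 * errs"
      unfolding errs_def err_def
    proof (rule N2_le_sum)
      fix J assume J: "J \<le> M * r"
      let ?e = "\<lambda>j. u (real (n - j) * \<tau>) (x J) - U (n - j) (x J)"
      have "(G2 (x J))\<^sup>2 \<le> (\<Sum>j=1..k. (time_lagrange \<tau> k n j (ti i) * (f (u (real (n - j) * \<tau>) (x J)) - f (U (n - j) (x J))))\<^sup>2) * card {1..k}"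
        unfolding G2_def by (rule sum_squared_le_sum_of_squares)
      also have "\<dots> \<le> (\<Sum>j=1..k. (real k ^ k * Lf)\<^sup>2 * (?e j)\<^sup>2) * card {1..k}"
      proof (intro mult_right_mono sum_mono)
        fix j assume j: "j \<in> {1..k}"
        have "\<bar>time_lagrange \<tau> k n j (ti i) * (f (u (real (n - j) * \<tau>) (x J)) - f (U (n - j) (x J)))\<bar> \<le> real k ^ k * (Lf * \<bar>?e j\<bar>)"
          unfolding abs_mult
        proof (intro mult_mono)
          show "\<bar>time_lagrange \<tau> k n j (ti i)\<bar> \<le> real k ^ k" by (rule time_lagrange_bound[OF \<tau>(1) k n(1) j tiT(2)[OF i]])
          \<comment> \<open>Both arguments lie between \<open>- \<alpha>\<close> and \<alpha>, by
            \<open>ua\<close> and \<open>Ua\<close>, so a Lipschitz bound on that interval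
            suffices.\<close>
          show "\<bar>f (u (real (n - j) * \<tau>) (x J)) - f (U (n - j) (x J))\<bar> \<le> Lf * \<bar>?e j\<bar>"
            by (rule Lf(2)) (use ua[OF nodeT node_in[OF J]] Ua[of "n - j", OF _ J] n in auto)
        qed auto
        then have "(time_lagrange \<tau> k n j (ti i) * (f (u (real (n - j) * \<tau>) (x J)) - f (U (n - j) (x J))))\<^sup>2 \<le> (real k ^ k * (Lf * \<bar>?e j\<bar>))\<^sup>2"
          by (metis abs_ge_zero power2_abs power_mono)
        then show "(time_lagrange \<tau> k n j (ti i) * (f (u (real (n - j) * \<tau>) (x J)) - f (U (n - j) (x J))))\<^sup>2 \<le> (real k ^ k * Lf)\<^sup>2 * (?e j)\<^sup>2"
          by (simp add: power_mult_distrib)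
      qed auto
      also have "\<dots> = real k * (real k ^ k * Lf)\<^sup>2 * (\<Sum>j=1..k. (?e j)\<^sup>2)" by (simp add: sum_distrib_left[symmetric])
      finally show "(G2 (x J))\<^sup>2 \<le> real k * (real k ^ k * Lf)\<^sup>2 * (\<Sum>j=1..k. (?e j)\<^sup>2)" .
    qed
    ultimately show ?thesis using N2_add[of G1 G2] by linarith
  qed
  define y where "y j \<nu> = ip (W j t) (e \<nu>)" for j \<nu>
  have hat_un: "ip (u tn) (e \<nu>) = ip R0 (e \<nu>) + (\<Sum>j\<le>k. y j \<nu> * (\<tau> ^ j / fact j))" for \<nu>
    unfolding R0_def ip_diff ip_sum y_def by (simp add: mult.commute)
  have hat_ui: "ip (u (ti i)) (e \<nu>) = ip (R i) (e \<nu>) + (\<Sum>j\<le>k. y j \<nu> * ((c i * \<tau>) ^ j / fact j))" for i \<nu>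
    unfolding R_def ip_diff ip_sum y_def by (simp add: mult.commute)
  have hat_wi: "ip (W 1 (ti i)) (e \<nu>) = ip (R' i) (e \<nu>) + (\<Sum>j<k. y (Suc j) \<nu> * ((c i * \<tau>) ^ j / fact j))" for i \<nu>
    unfolding R'_def ip_diff ip_sum y_def by (simp add: mult.commute)
  define D where "D i \<nu> = E (interp (u (ti i))) (e \<nu>) + ip (\<lambda>y. W 1 (ti i) y - f (u (ti i) y)) (e \<nu>)" for i \<nu>
  \<comment> \<open>The energy product with an eigenfunction reads off
    \<open>l \<nu> / \<tau>\<close>, which brings the residual into the form required by
    \<open>step_identity\<close>.\<close>
  have hat_D: "D i \<nu> = l \<nu> / \<tau> * ip (u (ti i)) (e \<nu>) + ip (W 1 (ti i)) (e \<nu>) - ip (\<lambda>y. f (u (ti i) y)) (e \<nu>)" if \<nu>: "\<nu> < d" for i \<nu>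
  proof -
    have "\<tau> * E (interp (u (ti i))) (e \<nu>) = l \<nu> * ip (u (ti i)) (e \<nu>)"
      using sbD(4)[OF interp(1) \<nu>] by (simp add: ip_interp)
    then have "E (interp (u (ti i))) (e \<nu>) = l \<nu> / \<tau> * ip (u (ti i)) (e \<nu>)" using \<tau> by (simp add: field_simps)
    then show ?thesis unfolding D_def ip_diff by simp
  qed
  define err_h where "err_h \<nu> = ip (\<lambda>y. u tn y - Uh y) (e \<nu>)" for \<nu>
  define eo where "eo \<nu> = ip (\<lambda>y. u t y - U (n - 1) y) (e \<nu>)" for \<nu>
  \<comment> \<open>A single value of \<rho> in \<open>step_estimate\<close> serves both the Taylor
    remainders, through \<open>K0\<close>, and the energy of the \<open>k\<close>-th time
    derivative, through \<open>L\<close>.\<close>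
  have main: "(\<Sum>\<nu><d. (err_h \<nu>)\<^sup>2) \<le> (1 + \<tau>)\<^sup>2 * (\<Sum>\<nu><d. (eo \<nu>)\<^sup>2)
     + step_const m T c0 B * \<tau> * (((b - a) * K0\<^sup>2 + C * L\<^sup>2 * (b - a)) * \<tau> ^ (2 * k) + 2 * (KD * h ^ (r + 1))\<^sup>2 +
         (2 * KG * (\<tau> ^ (2 * k) + h ^ (2 * r + 2)) + 2 * real k * (real k ^ k * Lf)\<^sup>2 * errs))"
  proof (rule step_estimate[OF st \<tau>, where l = l and y = "y k" and D = D and ?R0.0 = "\<lambda>\<nu>. ip R0 (e \<nu>)" and G = "\<lambda>i \<nu>. ip (G i) (e \<nu>)"
        and R = "\<lambda>i \<nu>. ip (R i) (e \<nu>)" and R' = "\<lambda>i \<nu>. ip (R' i) (e \<nu>)"])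
    fix \<nu> assume \<nu>: "\<nu> < d"
    show "l \<nu> \<ge> 0" by (rule sbD(2)[OF \<nu>])
    have "ip (u tn) (e \<nu>) - (s (l \<nu>) * ip (U (n - 1)) (e \<nu>) + \<tau> * (\<Sum>i=1..m. q i (l \<nu>) * ip (F i) (e \<nu>))) =
      s (l \<nu>) * (y 0 \<nu> - ip (U (n - 1)) (e \<nu>)) + (\<tau> ^ k * defect s q m c k (l \<nu>) * y k \<nu> + (\<Sum>i=1..m. \<tau> * q i (l \<nu>) * D i \<nu>))
      + (ip R0 (e \<nu>) + (\<Sum>i=1..m. \<tau> * q i (l \<nu>) * ip (G i) (e \<nu>) - \<tau> * q i (l \<nu>) * ip (R' i) (e \<nu>) - l \<nu> * q i (l \<nu>) * ip (R i) (e \<nu>)))"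
    proof (rule step_identity[where y = "\<lambda>j. y j \<nu>" and ui = "\<lambda>i. ip (u (ti i)) (e \<nu>)" and wi = "\<lambda>i. ip (W 1 (ti i)) (e \<nu>)" and g = "\<lambda>i. ip (\<lambda>y. f (u (ti i) y)) (e \<nu>)"])
      show "defect s q m c j (l \<nu>) = 0" if "j < k" for j using stable_schemeD(6)[OF st that sbD(2)[OF \<nu>]] .
      show "ip (G i) (e \<nu>) = ip (\<lambda>y. f (u (ti i) y)) (e \<nu>) - ip (F i) (e \<nu>)" for i
        unfolding G_def by (rule ip_diff)
    qed (use k \<tau> hat_un hat_ui hat_wi hat_D[OF \<nu>] in auto)
    then show "err_h \<nu> = s (l \<nu>) * eo \<nu> + (\<tau> ^ k * defect s q m c k (l \<nu>) * y k \<nu> + (\<Sum>i=1..m. \<tau> * q i (l \<nu>) * D i \<nu>))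
      + (ip R0 (e \<nu>) + (\<Sum>i=1..m. \<tau> * q i (l \<nu>) * ip (G i) (e \<nu>) - \<tau> * q i (l \<nu>) * ip (R' i) (e \<nu>) - l \<nu> * q i (l \<nu>) * ip (R i) (e \<nu>)))"
      unfolding err_h_def eo_def ip_diff hUh[OF \<nu>] y_def W0 .
  next
    \<comment> \<open>The coordinates of \<open>W k t\<close> are those of its interpolant, whose
      energy times \<tau> is the weighted sum.\<close>
    have yk0: "\<tau> * E (interp (W k t)) (interp (W k t)) = (\<Sum>\<nu><d. l \<nu> * (y k \<nu>)\<^sup>2)"
      using sbD(5)[OF interp(1)] by (simp add: ip_interp y_def)
    have "E (interp (W k t)) (interp (W k t)) \<le> C * L\<^sup>2 * (b - a)"
      by (rule E_interp_Lipschitz[OF C lW(2)[OF tT(1)] lW(1)])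
    moreover have "0 \<le> (b - a) * K0\<^sup>2" using ab by simp
    ultimately have "E (interp (W k t)) (interp (W k t)) \<le> (b - a) * K0\<^sup>2 + C * L\<^sup>2 * (b - a)" by linarith
    then have yk: "\<tau> * E (interp (W k t)) (interp (W k t)) \<le> \<tau> * ((b - a) * K0\<^sup>2 + C * L\<^sup>2 * (b - a))"
      using \<tau> by (intro mult_left_mono) auto
    show "(\<Sum>\<nu><d. l \<nu> * (y k \<nu>)\<^sup>2) \<le> \<tau> * ((b - a) * K0\<^sup>2 + C * L\<^sup>2 * (b - a))" using yk unfolding yk0 .
  next
    fix i assume i: "i \<in> {1..m}"
    show "(\<Sum>\<nu><d. (D i \<nu>)\<^sup>2 / (1 + l \<nu> / \<tau>)) \<le> 2 * (KD * h ^ (r + 1))\<^sup>2"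
      unfolding D_def
      by (rule dual_norm_bound[OF sb \<tau>(1) interp(1) _ cons(2)[OF tiT(1)[OF i]]]) (use cons(1) h_pos in auto)
    have CL: "0 \<le> C * L\<^sup>2 * (b - a) * \<tau> ^ j" for j using C ab \<tau> by (auto simp: inverse_const_def)
    show "(\<Sum>\<nu><d. (ip (R i) (e \<nu>))\<^sup>2) \<le> ((b - a) * K0\<^sup>2 + C * L\<^sup>2 * (b - a)) * \<tau> ^ (2 * k + 2)"
      unfolding sbD(3)[symmetric] distrib_right using nR[OF i] CL[of "2 * k + 2"] by linarith
    show "(\<Sum>\<nu><d. (ip (R' i) (e \<nu>))\<^sup>2) \<le> ((b - a) * K0\<^sup>2 + C * L\<^sup>2 * (b - a)) * \<tau> ^ (2 * k)"
      unfolding sbD(3)[symmetric] distrib_right using nR'[OF i] CL[of "2 * k"] by linarith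
    show "(\<Sum>\<nu><d. (ip (G i) (e \<nu>))\<^sup>2) \<le> 2 * KG * (\<tau> ^ (2 * k) + h ^ (2 * r + 2)) + 2 * real k * (real k ^ k * Lf)\<^sup>2 * errs"
      unfolding sbD(3)[symmetric] by (rule nG[OF i])
  next
    have CL: "0 \<le> C * L\<^sup>2 * (b - a) * \<tau> ^ j" for j using C ab \<tau> by (auto simp: inverse_const_def)
    show "(\<Sum>\<nu><d. (ip R0 (e \<nu>))\<^sup>2) \<le> ((b - a) * K0\<^sup>2 + C * L\<^sup>2 * (b - a)) * \<tau> ^ (2 * k + 2)"
      unfolding sbD(3)[symmetric] distrib_right using nR0 CL[of "2 * k + 2"] by linarith
    show "0 \<le> (b - a) * K0\<^sup>2 + C * L\<^sup>2 * (b - a)" using C ab by (auto simp: inverse_const_def)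
    show "0 \<le> 2 * (KD * h ^ (r + 1))\<^sup>2" by simp
    show "0 \<le> 2 * KG * (\<tau> ^ (2 * k) + h ^ (2 * r + 2)) + 2 * real k * (real k ^ k * Lf)\<^sup>2 * errs"
      using KG(1) \<tau> h_pos errs0 by (intro add_nonneg_nonneg mult_nonneg_nonneg) auto
  qed
  have c1: "err n \<le> (\<Sum>\<nu><d. (err_h \<nu>)\<^sup>2)"
  proof -
    have "err n \<le> N2 (\<lambda>y. u tn y - Uh y)"
      unfolding err_def
    proof (rule N2_le_nodes)
      fix J assume J: "J \<le> M * r"
      have "U n (x J) = min (max (Uh (x J)) (- \<alpha>)) \<alpha>"
        using cut n J unfolding cutoff_solution_def Uh_def by auto
      moreover have "\<bar>u tn (x J)\<bar> \<le> \<alpha>" by (rule ua[OF tT(2) node_in[OF J]])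
      ultimately show "\<bar>u (real n * \<tau>) (x J) - U n (x J)\<bar> \<le> \<bar>u tn (x J) - Uh (x J)\<bar>"
        unfolding tn_def by (auto simp: min_def max_def abs_if split: if_splits)
    qed
    then show ?thesis unfolding sbD(3)[of "\<lambda>y. u tn y - Uh y"] err_h_def .
  qed
  have c2: "(\<Sum>\<nu><d. (eo \<nu>)\<^sup>2) = err (n - 1)"
    unfolding err_def eo_def sbD(3)[symmetric] t_def ..
  define Ks where "Ks = (b - a) * K0\<^sup>2 + C * L\<^sup>2 * (b - a)"
  define Kf where "Kf = real k * (real k ^ k * Lf)\<^sup>2"
  have Ks0: "Ks \<ge> 0" "Kf \<ge> 0" using C ab by (auto simp: Ks_def Kf_def inverse_const_def)
  define p1 where "p1 = \<tau> ^ (2 * k)"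
  define p2 where "p2 = h ^ (2 * r + 2)"
  have p0: "p1 \<ge> 0" "p2 \<ge> 0" using \<tau> h_pos by (auto simp: p1_def p2_def)
  have hp: "(KD * h ^ (r + 1))\<^sup>2 = KD\<^sup>2 * p2"
  proof -
    have "(h ^ (r + 1))\<^sup>2 = p2" unfolding p2_def power_mult[symmetric] by (simp add: mult.commute)
    then show ?thesis by (simp add: power_mult_distrib)
  qed
  have sc0: "step_const m T c0 B * \<tau> \<ge> 0"
    using stable_schemeD(1)[OF st] \<tau> unfolding step_const_def by (intro mult_nonneg_nonneg add_nonneg_nonneg divide_nonneg_pos) auto
  have "Ks * p1 + 2 * (KD\<^sup>2 * p2) + (2 * KG * (p1 + p2) + 2 * Kf * errs) \<le> (Ks + 2 * KD\<^sup>2 + 2 * KG + 2 * Kf) * (p1 + p2 + errs)"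
  proof -
    have "0 \<le> Ks * p2 + Ks * errs + 2 * KD\<^sup>2 * p1 + 2 * KD\<^sup>2 * errs + 2 * KG * errs + 2 * Kf * p1 + 2 * Kf * p2"
      using Ks0 p0 errs0 KG(1) by (intro add_nonneg_nonneg mult_nonneg_nonneg) auto
    then show ?thesis by (simp add: algebra_simps)
  qed
  then have "step_const m T c0 B * \<tau> * (Ks * p1 + 2 * (KD\<^sup>2 * p2) + (2 * KG * (p1 + p2) + 2 * Kf * errs))
      \<le> step_const m T c0 B * \<tau> * ((Ks + 2 * KD\<^sup>2 + 2 * KG + 2 * Kf) * (p1 + p2 + errs))"
    using sc0 by (rule mult_left_mono)
  then have c3: "err n \<le> (1 + \<tau>)\<^sup>2 * err (n - 1) + step_const m T c0 B * \<tau> * ((Ks + 2 * KD\<^sup>2 + 2 * KG + 2 * Kf) * (p1 + p2 + errs))"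
    using c1 main unfolding c2 hp Ks_def[symmetric] p1_def[symmetric] p2_def[symmetric] Kf_def by (simp add: mult.assoc)
  show ?thesis using c3 unfolding Ks_def Kf_def p1_def p2_def errs_def by (simp only: mult.assoc mult.commute[of \<tau>] mult.left_commute[of \<tau>])
qed

end

subsection \<open>Regularity of the exact solution\<close>

lemma Icc_at_within_nontrivial: "c < d \<Longrightarrow> t \<in> {c..d} \<Longrightarrow> at (t :: real) within {c..d} \<noteq> bot"
  using trivial_limit_within[of t "{c..d}"] by simp

lemma tendsto_0_within_le:
  fixes f g :: "real \<Rightarrow> real"
  assumes "(g \<longlongrightarrow> 0) (at t within S)" "\<And>s. s \<in> S \<Longrightarrow> s \<noteq> t \<Longrightarrow> \<bar>f s\<bar> \<le> g s"
  shows "(f \<longlongrightarrow> 0) (at t within S)"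
proof (rule Lim_null_comparison[OF _ assms(1)])
  show "\<forall>\<^sub>F s in at t within S. norm (f s) \<le> g s" using assms(2) by (simp add: eventually_at_filter)
qed

section \<open>Time derivatives in different spaces\<close>

lemma C_timeE:
  assumes "u \<in> C_time S nrm n T"
  obtains V where "V 0 = u" "\<And>i t. i \<le> n \<Longrightarrow> t \<in> {0..T} \<Longrightarrow> V i t \<in> S"
    "\<And>i t. i \<le> n \<Longrightarrow> t \<in> {0..T} \<Longrightarrow> ((\<lambda>s. nrm (\<lambda>x. V i s x - V i t x)) \<longlongrightarrow> 0) (at t within {0..T})"
    "\<And>i t. i < n \<Longrightarrow> t \<in> {0..T} \<Longrightarrow> ((\<lambda>s. nrm (\<lambda>x. (V i s x - V i t x) / (s - t) - V (Suc i) t x)) \<longlongrightarrow> 0) (at t within {0..T})"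
proof -
  obtain V where V: "V 0 = u"
    "\<forall>i\<le>n. \<forall>t\<in>{0..T}. V i t \<in> S \<and> ((\<lambda>s. nrm (\<lambda>x. V i s x - V i t x)) \<longlongrightarrow> 0) (at t within {0..T})"
    "\<forall>i<n. \<forall>t\<in>{0..T}. ((\<lambda>s. nrm (\<lambda>x. (V i s x - V i t x) / (s - t) - V (Suc i) t x)) \<longlongrightarrow> 0) (at t within {0..T})"
    using assms unfolding C_time_def mem_Collect_eq by (elim exE conjE)
  show ?thesis by (rule that[of V]) (use V in blast)+
qed

lemma C_norm_L2_norm:
  assumes "continuous_on {a..b} v" "a < b"
  shows "L2_norm a b v \<le> sqrt (b - a) * C_norm a b v"
proof (rule power2_le_imp_le)
  have "(L2_norm a b v)\<^sup>2 \<le> (b - a) * (C_norm a b v)\<^sup>2"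
    by (rule L2_norm_le_sup) (use assms abs_le_C_norm[OF assms(1)] in auto)
  then show "(L2_norm a b v)\<^sup>2 \<le> (sqrt (b - a) * C_norm a b v)\<^sup>2" using assms by (simp add: power_mult_distrib)
  have "0 \<le> C_norm a b v" using abs_le_C_norm[OF assms(1), of a] assms(2) by simp
  then show "0 \<le> sqrt (b - a) * C_norm a b v" using assms by simp
qed

lemma C_time_pointwise_deriv:
  assumes W: "\<And>t. t \<in> {0..T} \<Longrightarrow> continuous_on {a..b} (v t)" "continuous_on {a..b} w"
    and l: "((\<lambda>s. C_norm a b (\<lambda>x. (v s x - v t x) / (s - t) - w x)) \<longlongrightarrow> 0) (at t within {0..T})"
    and t: "t \<in> {0..T}" and y: "y \<in> {a..b}"
  shows "((\<lambda>s. v s y) has_real_derivative w y) (at t within {0..T})"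
  unfolding has_field_derivative_iff
proof (rule LIM_zero_cancel, rule tendsto_0_within_le[OF l])
  fix s assume "s \<in> {0..T}" "s \<noteq> t"
  then show "\<bar>(v s y - v t y) / (s - t) - w y\<bar> \<le> C_norm a b (\<lambda>x. (v s x - v t x) / (s - t) - w x)"
    by (intro abs_le_C_norm[where v = "\<lambda>x. (v s x - v t x) / (s - t) - w x"] y continuous_intros W t) auto
qed

text \<open>Regularity in time is assumed in several spaces, each with derivatives of its own. Two
  families that are both L2 derivatives of the same function agree almost everywhere, since limits
  of difference quotients are unique, so their properties can be combined.\<close>

lemma L2_time_derivs_unique:
  assumes T: "0 < T" and V0: "V 0 = W 0" and V: "\<And>i t. i \<le> n \<Longrightarrow> t \<in> {0..T} \<Longrightarrow> V i t \<in> L2_space a b"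
    and W: "\<And>i t. i \<le> n \<Longrightarrow> t \<in> {0..T} \<Longrightarrow> W i t \<in> L2_space a b"
    and dV: "\<And>i t. i < n \<Longrightarrow> t \<in> {0..T} \<Longrightarrow> ((\<lambda>s. L2_norm a b (\<lambda>x. (V i s x - V i t x) / (s - t) - V (Suc i) t x)) \<longlongrightarrow> 0) (at t within {0..T})"
    and dW: "\<And>i t. i < n \<Longrightarrow> t \<in> {0..T} \<Longrightarrow> ((\<lambda>s. L2_norm a b (\<lambda>x. (W i s x - W i t x) / (s - t) - W (Suc i) t x)) \<longlongrightarrow> 0) (at t within {0..T})"
    and i: "i \<le> n" and t: "t \<in> {0..T}"
  shows "AE x in lebesgue_on {a..b}. V i t x = W i t x"
  using i t
proof (induction i arbitrary: t)
  case 0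
  then show ?case by (simp add: V0)
next
  case (Suc i)
  define D where "D = (\<lambda>x. V (Suc i) t x - W (Suc i) t x)"
  define qV where "qV s x = (V i s x - V i t x) / (s - t) - V (Suc i) t x" for s x
  define qW where "qW s x = (W i s x - W i t x) / (s - t) - W (Suc i) t x" for s x
  have DL: "D \<in> L2_space a b" unfolding D_def using V[OF Suc.prems] W[OF Suc.prems] by (rule L2_space_diff)
  have div: "(\<lambda>x. (v x - w x) / c - z x) \<in> L2_space a b" if "v \<in> L2_space a b" "w \<in> L2_space a b" "z \<in> L2_space a b" for v w z :: "real \<Rightarrow> real" and c
  proof -
    have "(\<lambda>x. (1 / c) * (v x - w x) - z x) \<in> L2_space a b" by (intro L2_space_diff L2_space_scale that)
    then show ?thesis by simp
  qed
  have i: "i < n" "i \<le> n" using Suc.prems by auto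
  have bound: "L2_norm a b D \<le> L2_norm a b (qW s) + L2_norm a b (qV s)" if s: "s \<in> {0..T}" for s
  proof -
    have VL: "qV s \<in> L2_space a b" "qW s \<in> L2_space a b" unfolding qV_def qW_def
      by (intro div V W i s Suc.prems)+
    have "AE x in lebesgue_on {a..b}. D x = qW s x - qV s x"
      using Suc.IH[OF i(2) s] Suc.IH[OF i(2) Suc.prems(2)] by eventually_elim (simp add: D_def qV_def qW_def)
    then have "L2_norm a b D = L2_norm a b (\<lambda>x. qW s x - qV s x)"
      by (rule L2_norm_AE_cong) (use DL VL in auto)
    then show ?thesis using L2_norm_triangle_diff[OF VL(2,1)] by simp
  qed
  have "((\<lambda>s. L2_norm a b (qW s) + L2_norm a b (qV s)) \<longlongrightarrow> 0 + 0) (at t within {0..T})"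
    unfolding qV_def qW_def by (intro tendsto_add dV dW i Suc.prems)
  moreover have "\<forall>\<^sub>F s in at t within {0..T}. L2_norm a b D \<le> L2_norm a b (qW s) + L2_norm a b (qV s)"
    using bound by (simp add: eventually_at_filter)
  ultimately have "L2_norm a b D \<le> 0 + 0"
    using Icc_at_within_nontrivial[OF T Suc.prems(2)] by (rule tendsto_lowerbound)
  then have "L2_norm a b D = 0" using L2_norm_nonneg[of a b D] by linarith
  from L2_norm_eq_0_AE[OF DL this] show ?case by eventually_elim (simp add: D_def)
qed

lemma continuous_AE_eq:
  fixes v w :: "real \<Rightarrow> real"
  assumes "continuous_on {a..b} v" "continuous_on {a..b} w" "a < b" "AE x in lebesgue_on {a..b}. v x = w x" "y \<in> {a..b}"
  shows "v y = w y"
proof -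
  have "v y - w y = 0"
    by (rule continuous_AE_zero[where g = "\<lambda>x. v x - w x"]) (use assms in \<open>auto intro!: continuous_intros\<close>)
  then show ?thesis by simp
qed

lemma continuous_weak_deriv_integral:
  assumes "has_weak_deriv a b 1 v w" "continuous_on {a..b} v'" "AE x in lebesgue_on {a..b}. v x = v' x" "a < b"
    and xy: "a \<le> x" "x \<le> y" "y \<le> b"
  shows "v' y - v' x = integral {x..y} w"
proof -
  obtain C where C: "AE x in lebesgue_on {a..b}. v x = C + integral {a..x} w"
    by (rule weak_deriv_imp_indefinite_integral[OF assms(1,4)])
  have wi: "w integrable_on {a..b}"
    using L2_space_integrable[OF has_weak_derivD(2)[OF assms(1)]] by (auto intro!: integrable_on_lebesgue_on)
  have AE: "AE x in lebesgue_on {a..b}. v' x = C + integral {a..x} w" using C assms(3) by eventually_elim simp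
  have e: "v' z = C + integral {a..z} w" if "z \<in> {a..b}" for z
    by (rule continuous_AE_eq[OF assms(2) _ assms(4) AE that]) (intro continuous_intros indefinite_integral_continuous_1 wi)
  have "integral {a..x} w + integral {x..y} w = integral {a..y} w"
    by (rule Henstock_Kurzweil_Integration.integral_combine) (use xy integrable_on_subinterval[OF wi] in auto)
  then show ?thesis using e[of x] e[of y] xy by simp
qed

text \<open>The derivative of a function in the domain vanishes at \<open>a\<close>, so it is bounded by the integral of
  the second derivative.\<close>

lemma Dom_Laplacian_Lipschitz:
  assumes v: "v \<in> Dom_Laplacian a b" and g: "continuous_on {a..b} g" "AE x in lebesgue_on {a..b}. v x = g x" and ab: "a < b"
    and y: "y \<in> {a..b}" "z \<in> {a..b}"
  shows "\<bar>g y - g z\<bar> \<le> sqrt (b - a) * L2_norm a b (weak_deriv a b 2 v) * \<bar>y - z\<bar>"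
proof -
  obtain w where w: "has_weak_deriv a b 1 v w" "continuous_on {a..b} w" "w a = 0"
    using v by (auto simp: Dom_Laplacian_def)
  define L where "L = sqrt (b - a) * L2_norm a b (weak_deriv a b 2 v)"
  have w2: "has_weak_deriv a b 2 v (weak_deriv a b 2 v)"
    using v by (auto simp: Dom_Laplacian_def intro: H_space_weak_deriv)
  have ww: "has_weak_deriv a b 1 w (weak_deriv a b 2 v)"
    by (rule has_weak_deriv_Suc[OF w(1)]) (use w2 in \<open>simp add: numeral_2_eq_2\<close>)
  have wL: "\<bar>w x\<bar> \<le> L" if x: "x \<in> {a..b}" for x
  proof -
    have "w x - w a = integral {a..x} (weak_deriv a b 2 v)"
      by (rule continuous_weak_deriv_integral[OF ww w(2) _ ab]) (use x in auto)
    then have "w x = integral {a..x} (weak_deriv a b 2 v)" using w(3) by simp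
    then show ?thesis unfolding L_def using L2_integral_bound[OF has_weak_derivD(2)[OF w2], of a x] x by simp
  qed
  have main: "\<bar>g q - g p\<bar> \<le> L * \<bar>q - p\<bar>" if pq: "a \<le> p" "p \<le> q" "q \<le> b" for p q
  proof -
    have "g q - g p = integral {p..q} w" by (rule continuous_weak_deriv_integral[OF w(1) g ab pq])
    moreover have "\<bar>integral {p..q} w\<bar> \<le> integral {p..q} (\<lambda>_. L)"
      by (rule integral_abs_bound) (use pq wL continuous_on_subset[OF w(2)] in \<open>auto intro!: integrable_continuous_interval\<close>)
    ultimately show ?thesis using pq by (simp add: mult.commute)
  qed
  show ?thesis
  proof (cases "y \<le> z")
    case True
    then show ?thesis using main[of y z] y unfolding L_def[symmetric] by (simp add: abs_minus_commute)
  next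
    case False
    then show ?thesis using main[of z y] y unfolding L_def[symmetric] by simp
  qed
qed

lemma H_space_time_bounded:
  assumes "v \<in> C_time (H_space a b n) (H_norm a b n) j T"
  obtains K where "K \<ge> 0" "\<And>t. t \<in> {0..T} \<Longrightarrow> v t \<in> H_space a b n"
    "\<And>i t. i \<le> n \<Longrightarrow> t \<in> {0..T} \<Longrightarrow> L2_norm a b (weak_deriv a b i (v t)) \<le> K"
proof -
  obtain V where V0: "V 0 = v" and V: "\<And>i t. i \<le> j \<Longrightarrow> t \<in> {0..T} \<Longrightarrow> V i t \<in> H_space a b n"
    "\<And>i t. i \<le> j \<Longrightarrow> t \<in> {0..T} \<Longrightarrow> ((\<lambda>s. H_norm a b n (\<lambda>x. V i s x - V i t x)) \<longlongrightarrow> 0) (at t within {0..T})"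
    using assms by (rule C_timeE) blast
  have vH: "v t \<in> H_space a b n" if "t \<in> {0..T}" for t using V(1)[of 0] that V0 by simp
  have "\<exists>K. \<forall>t\<in>{0..T}. L2_norm a b (weak_deriv a b i (v t)) \<le> K" if i: "i \<le> n" for i
  proof -
    obtain K where "\<And>t. t \<in> {0..T} \<Longrightarrow> L2_norm a b (weak_deriv a b i (v t)) \<le> K"
    proof (rule C_time_bounded[where V = v and S = "H_space a b n" and nrm = "H_norm a b n" and T = T and q = "\<lambda>v. L2_norm a b (weak_deriv a b i v)"])
      show "((\<lambda>s. H_norm a b n (\<lambda>x. v s x - v t x)) \<longlongrightarrow> 0) (at t within {0..T})" if "t \<in> {0..T}" for t
        using V(2)[of 0] that V0 by simp
      fix v w assume vw: "v \<in> H_space a b n" "w \<in> H_space a b n"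
      show "L2_norm a b (weak_deriv a b i v) \<le> L2_norm a b (weak_deriv a b i w) + H_norm a b n (\<lambda>x. v x - w x)"
        using weak_deriv_norm_triangle[OF H_space_weak_deriv[OF vw(1) i] H_space_weak_deriv[OF vw(2) i]]
          weak_deriv_le_H_norm[OF i, of a b "\<lambda>x. v x - w x"] by linarith
    qed (use vH in auto)
    then show ?thesis by blast
  qed
  then have "\<forall>i\<in>{..n}. \<exists>K. \<forall>t\<in>{0..T}. L2_norm a b (weak_deriv a b i (v t)) \<le> K" by simp
  from bchoice[OF this] obtain K where K: "\<forall>i\<in>{..n}. \<forall>t\<in>{0..T}. L2_norm a b (weak_deriv a b i (v t)) \<le> K i" by (elim exE)
  show ?thesis
  proof (rule that[of "\<Sum>i\<le>n. \<bar>K i\<bar>"])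
    fix i t assume it: "i \<le> n" "t \<in> {0..T}"
    have "L2_norm a b (weak_deriv a b i (v t)) \<le> K i" using K it by auto
    also have "K i \<le> \<bar>K i\<bar>" by simp
    also have "\<bar>K i\<bar> \<le> (\<Sum>i\<le>n. \<bar>K i\<bar>)" using it by (intro member_le_sum[of i "{..n}" "\<lambda>i. \<bar>K i\<bar>"]) auto
    finally show "L2_norm a b (weak_deriv a b i (v t)) \<le> (\<Sum>i\<le>n. \<bar>K i\<bar>)" .
  qed (use vH in auto)
qed

section \<open>Local Lipschitz continuity of the nonlinearity\<close>

lemma locally_Lipschitz_on_Icc:
  fixes f :: "real \<Rightarrow> real"
  assumes loc: "\<forall>y. \<exists>e>0. \<exists>L. L-lipschitz_on (ball y e) f"
  shows "\<exists>L\<ge>0. \<forall>y z. \<bar>y\<bar> \<le> \<alpha> \<longrightarrow> \<bar>z\<bar> \<le> \<alpha> \<longrightarrow> \<bar>f y - f z\<bar> \<le> L * \<bar>y - z\<bar>"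
proof -
  have "local_lipschitz {0::real} {- \<alpha>..\<alpha>} (\<lambda>_. f)"
  proof (rule local_lipschitzI)
    fix t y :: real
    obtain e L where e: "e > 0" "L-lipschitz_on (ball y e) f" using loc by blast
    have "L-lipschitz_on (cball y (e / 2) \<inter> {- \<alpha>..\<alpha>}) f"
      by (rule lipschitz_on_subset[OF e(2)]) (use e(1) in auto)
    then show "\<exists>u>0. \<exists>L. \<forall>t\<in>cball t u \<inter> {0}. L-lipschitz_on (cball y u \<inter> {- \<alpha>..\<alpha>}) f"
      using e(1) by (intro exI[of _ "e / 2"]) auto
  qed
  then obtain L where L': "L-lipschitz_on {- \<alpha>..\<alpha>} f"
    using local_lipschitz_compact_implies_lipschitz[of "{0::real}" "{- \<alpha>..\<alpha>}" "\<lambda>_. f"] by auto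
  show ?thesis
  proof (intro exI[of _ L] conjI allI impI)
    show "0 \<le> L" using L' by (rule lipschitz_on_nonneg)
    fix y z :: real assume "\<bar>y\<bar> \<le> \<alpha>" "\<bar>z\<bar> \<le> \<alpha>"
    then show "\<bar>f y - f z\<bar> \<le> L * \<bar>y - z\<bar>" using lipschitz_onD[OF L', of y z] by (simp add: dist_real_def abs_le_iff minus_le_iff)
  qed
qed

lemma locally_Lipschitz_continuous:
  fixes f :: "real \<Rightarrow> real"
  assumes loc: "\<forall>y. \<exists>e>0. \<exists>L. L-lipschitz_on (ball y e) f"
  shows "continuous_on S f"
proof (rule continuous_at_imp_continuous_on, intro ballI)
  fix y
  obtain e L where e: "e > 0" "L-lipschitz_on (ball y e) f" using loc by blast
  then show "isCont f y" using continuous_on_interior[OF lipschitz_on_continuous_on[OF e(2)], of y] by simp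
qed

lemma L2_norm_sum:
  assumes "\<And>i. i \<in> I \<Longrightarrow> v i \<in> L2_space a b" "finite I"
  shows "L2_norm a b (\<lambda>x. \<Sum>i\<in>I. v i x) \<le> (\<Sum>i\<in>I. L2_norm a b (v i))"
  using assms(2,1)
proof (induction I rule: finite_induct)
  case empty
  then show ?case by (simp add: L2_norm_def L2_inner_def)
next
  case (insert i I)
  have "L2_norm a b (\<lambda>x. v i x + (\<Sum>i\<in>I. v i x)) \<le> L2_norm a b (v i) + L2_norm a b (\<lambda>x. \<Sum>i\<in>I. v i x)"
    by (rule L2_norm_triangle) (use insert.prems in auto)
  then show ?case using insert.IH insert.prems insert.hyps by simp
qed

section \<open>Consistency and interpolation bounds for the exact solution\<close>

context mesh
begin

text \<open>The equation is assumed at interior points and times. There it identifies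
  \<open>g2\<close> with \<open>w t y - f (u t y)\<close>; continuity in space extends this to the
  end points, and continuity in time extends the estimate to times 0 and \<open>T\<close>.\<close>

lemma consistency_bound:
  assumes C: "inverse_const r C" and T: "0 < T" and sol: "solves_Allen_Cahn a b T f u0 u"
    and f: "continuous_on UNIV f"
    and uc: "\<And>t. t \<in> {0..T} \<Longrightarrow> continuous_on {a..b} (u t)"
    and wc: "\<And>t. t \<in> {0..T} \<Longrightarrow> continuous_on {a..b} (w t)"
    and ud: "\<And>t y. t \<in> {0..T} \<Longrightarrow> y \<in> {a..b} \<Longrightarrow> ((\<lambda>s. u s y) has_real_derivative w t y) (at t within {0..T})"
    and wt: "\<And>y. y \<in> {a..b} \<Longrightarrow> continuous_on {0..T} (\<lambda>s. w s y)"
    and uH: "\<And>t. t \<in> {0..T} \<Longrightarrow> u t \<in> H_space a b (2 * r + 2)"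
    and K: "K \<ge> 0" "\<And>i t. i \<le> 2 * r + 2 \<Longrightarrow> t \<in> {0..T} \<Longrightarrow> L2_norm a b (weak_deriv a b i (u t)) \<le> K"
    and t: "t \<in> {0..T}" and v: "v \<in> V"
  shows "\<bar>E (interp (u t)) v + ip (\<lambda>y. w t y - f (u t y)) v\<bar>
    \<le> ((sqrt C + 2) * K + 3 * sqrt C * (b - a) ^ (r - 1) * K) * h ^ (r + 1) * (sqrt (E v v) + sqrt (N2 v))"
proof -
  define \<phi> where "\<phi> t = E (interp (u t)) v + ip (\<lambda>y. w t y - f (u t y)) v" for t
  define Q where "Q = ((sqrt C + 2) * K + 3 * sqrt C * (b - a) ^ (r - 1) * K) * h ^ (r + 1) * (sqrt (E v v) + sqrt (N2 v))"
  have C0: "C \<ge> 0" using C by (simp add: inverse_const_def)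
  have interior: "\<bar>\<phi> t\<bar> \<le> Q" if t: "t \<in> {0<..<T}" for t
  proof -
    have tT: "t \<in> {0..T}" using t by auto
    obtain g1 g2 where g2c: "continuous_on {a..b} g2"
      and d1: "\<And>y. y \<in> {a..b} \<Longrightarrow> (u t has_real_derivative g1 y) (at y within {a..b})"
      and d2: "\<And>y. y \<in> {a..b} \<Longrightarrow> (g1 has_real_derivative g2 y) (at y within {a..b})"
      and cb: "\<And>w. g1 a = 0 \<Longrightarrow> g1 b = 0 \<Longrightarrow> w \<in> V \<Longrightarrow> \<bar>E (interp (u t)) w + ip g2 w\<bar> \<le>
         (sqrt C + 2) * h ^ (r + 1) * (L2_norm a b (weak_deriv a b (r + 2) (u t)) * sqrt (E w w))
         + 3 * sqrt C * h ^ (2 * r) * (L2_norm a b (weak_deriv a b (2 * r + 2) (u t)) * sqrt (N2 w))"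
      by (rule consistency[OF C uc[OF tT] uH[OF tT]]) blast
    obtain ux where ux: "\<forall>y\<in>{a<..<b}. (u t has_real_derivative ux y) (at y) \<and>
        (\<exists>uxx. (ux has_real_derivative uxx) (at y) \<and> ((\<lambda>s. u s y) has_real_derivative uxx + f (u t y)) (at t))"
      and ua: "(u t has_real_derivative 0) (at a within {a..b})" and ub: "(u t has_real_derivative 0) (at b within {a..b})"
      using sol t unfolding solves_Allen_Cahn_def by blast
    \<comment> \<open>One-sided derivatives at \<open>a\<close> and \<open>b\<close> are unique,
      which transfers the Neumann condition to the representative \<open>g1\<close>.\<close>
    have uniq: "D = D'" if "(u t has_real_derivative D) (at y within {a..b})" "(u t has_real_derivative D') (at y within {a..b})" "y \<in> {a..b}" for D D' y
      using that(1,2) Icc_at_within_nontrivial[OF ab that(3)] unfolding has_field_derivative_iff by (intro tendsto_unique)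
    have g1a: "g1 a = 0" by (rule uniq[OF d1 ua]) (use ab in auto)
    have g1b: "g1 b = 0" by (rule uniq[OF d1 ub]) (use ab in auto)
    have eq0: "g2 y - (w t y - f (u t y)) = 0" if y: "y \<in> {a<..<b}" for y
    proof -
      have g1ux: "ux z = g1 z" if z: "z \<in> {a<..<b}" for z
      proof (rule DERIV_unique)
        show "(u t has_real_derivative ux z) (at z)" using ux z by blast
        show "(u t has_real_derivative g1 z) (at z)" using d1[of z] z by (simp add: at_within_Icc_at)
      qed
      obtain uxx where uxx: "(ux has_real_derivative uxx) (at y)" "((\<lambda>s. u s y) has_real_derivative uxx + f (u t y)) (at t)"
        using ux y by blast
      have "(g1 has_real_derivative uxx) (at y)"
        by (rule has_field_derivative_transform_within_open[OF uxx(1), of "{a<..<b}"]) (use y g1ux in auto)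
      moreover have "(g1 has_real_derivative g2 y) (at y)" using d2[of y] y by (simp add: at_within_Icc_at)
      ultimately have g2: "g2 y = uxx" by (rule DERIV_unique[rotated])
      have "((\<lambda>s. u s y) has_real_derivative w t y) (at t)" using ud[OF tT, of y] y t by (simp add: at_within_Icc_at)
      then have "w t y = uxx + f (u t y)" using uxx(2) by (rule DERIV_unique)
      then show ?thesis using g2 by simp
    qed
    have cl: "closure {a<..<b} = {a..b}" using ab by (rule closure_greaterThanLessThan)
    have fu: "continuous_on {a..b} (\<lambda>y. f (u t y))" by (rule continuous_on_compose2[OF f uc[OF tT]]) auto
    have eq: "g2 y = w t y - f (u t y)" if y: "y \<in> {a..b}" for y
    proof -
      have "g2 y - (w t y - f (u t y)) = 0"
        by (rule continuous_constant_on_closure[where S = "{a<..<b}" and f = "\<lambda>y. g2 y - (w t y - f (u t y))"])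
          (use y eq0 in \<open>auto simp: cl intro!: continuous_intros g2c wc[OF tT] fu\<close>)
      then show ?thesis by simp
    qed
    \<comment> \<open>Excess powers of \<open>h\<close> are traded for powers of the interval
      length; this uses \<open>r \<ge> 1\<close>.\<close>
    have hh: "h ^ (2 * r) \<le> (b - a) ^ (r - 1) * h ^ (r + 1)"
    proof -
      have "2 * r = (r - 1) + (r + 1)" using r by simp
      then have "h ^ (2 * r) = h ^ (r - 1) * h ^ (r + 1)" by (simp only: power_add)
      also have "\<dots> \<le> (b - a) ^ (r - 1) * h ^ (r + 1)"
        using h_pos h_le by (intro mult_right_mono power_mono) auto
      finally show ?thesis .
    qed
    have "ip g2 v = ip (\<lambda>y. w t y - f (u t y)) v" by (rule ip_cong) (use eq node_in in auto)
    then have "\<bar>\<phi> t\<bar> \<le> (sqrt C + 2) * h ^ (r + 1) * (L2_norm a b (weak_deriv a b (r + 2) (u t)) * sqrt (E v v))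
         + 3 * sqrt C * h ^ (2 * r) * (L2_norm a b (weak_deriv a b (2 * r + 2) (u t)) * sqrt (N2 v))"
      using cb[OF g1a g1b v] by (simp add: \<phi>_def)
    moreover have "(sqrt C + 2) * h ^ (r + 1) * (L2_norm a b (weak_deriv a b (r + 2) (u t)) * sqrt (E v v)) \<le> (sqrt C + 2) * h ^ (r + 1) * (K * sqrt (E v v))"
      using C0 h_pos K(2)[OF _ tT, of "r + 2"] E_nonneg[of v] by (intro mult_left_mono mult_right_mono) auto
    moreover have "3 * sqrt C * h ^ (2 * r) * (L2_norm a b (weak_deriv a b (2 * r + 2) (u t)) * sqrt (N2 v)) \<le> 3 * sqrt C * ((b - a) ^ (r - 1) * h ^ (r + 1)) * (K * sqrt (N2 v))"
      using C0 h_pos ab hh K N2_nonneg[of v] K(2)[OF _ tT, of "2 * r + 2"] by (intro mult_mono mult_left_mono) auto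
    moreover have "(sqrt C + 2) * h ^ (r + 1) * (K * sqrt (E v v)) + 3 * sqrt C * ((b - a) ^ (r - 1) * h ^ (r + 1)) * (K * sqrt (N2 v)) \<le> Q"
    proof -
      have "0 \<le> (sqrt C + 2) * h ^ (r + 1) * (K * sqrt (N2 v)) + 3 * sqrt C * ((b - a) ^ (r - 1) * h ^ (r + 1)) * (K * sqrt (E v v))"
        using C0 h_pos ab K(1) E_nonneg[of v] N2_nonneg[of v] by (intro add_nonneg_nonneg mult_nonneg_nonneg) auto
      moreover have "Q = (sqrt C + 2) * h ^ (r + 1) * (K * sqrt (E v v)) + 3 * sqrt C * ((b - a) ^ (r - 1) * h ^ (r + 1)) * (K * sqrt (N2 v))
        + ((sqrt C + 2) * h ^ (r + 1) * (K * sqrt (N2 v)) + 3 * sqrt C * ((b - a) ^ (r - 1) * h ^ (r + 1)) * (K * sqrt (E v v)))"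
        unfolding Q_def by (simp add: algebra_simps)
      ultimately show ?thesis by linarith
    qed
    ultimately show ?thesis by linarith
  qed
  have "continuous_on {0..T} \<phi>"
  proof -
    have u': "continuous_on {0..T} (\<lambda>t. u t y)" if "y \<in> {a..b}" for y
      using ud[OF _ that] by (rule DERIV_continuous_on)
    have fu: "continuous_on {0..T} (\<lambda>t. f (u t y))" if "y \<in> {a..b}" for y
      by (rule continuous_on_compose2[OF f u'[OF that]]) auto
    have nd: "nd i j \<in> {a..b}" if "i \<in> {1..M}" "j \<in> {..r}" for i j
      using node_in[OF node_index[OF that(1)]] that(2) by (simp add: nd_def)
    \<comment> \<open>Moving the operator to \<open>v\<close> exhibits the energy term as a finite
      combination of nodal values of \<open>u t\<close>, which are continuous in time.\<close>
    have "E (interp (u t)) v = ip (A v) (u t)" for t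
      by (simp only: E_sym[of _ v] A(2)[OF v interp(1), symmetric] ip_interp)
    then show ?thesis
      unfolding \<phi>_def ip_nd by (auto intro!: continuous_intros u' wt fu nd)
  qed
  moreover have cl: "closure {0<..<T} = {0..T}" using T by (rule closure_greaterThanLessThan)
  ultimately have "norm (\<phi> t) \<le> Q"
    using interior t by (intro continuous_on_closure_norm_le[of "{0<..<T}" \<phi>]) auto
  then show ?thesis by (simp add: \<phi>_def Q_def)
qed

text \<open>The time derivatives of \<open>F\<close> exist only in the L2 sense, so nodal values
  cannot be expanded in time. The scalar estimate is applied to inner products with the error
  itself, which bounds its L2 norm; spatial regularity then gives the quadrature norm through
  \<open>norm_comparison\<close>.\<close>

lemma time_interpolation_N2:
  assumes C: "inverse_const r C" and k: "k \<ge> 1" "k \<le> n" and \<tau>: "\<tau> > 0" "real n * \<tau> \<le> T"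
    and G0: "G 0 = F" and GL: "\<And>i s. i \<le> k \<Longrightarrow> s \<in> {0..T} \<Longrightarrow> G i s \<in> L2_space a b"
    and dG: "\<And>i t. i < k \<Longrightarrow> t \<in> {0..T} \<Longrightarrow> ((\<lambda>s. L2_norm a b (\<lambda>x. (G i s x - G i t x) / (s - t) - G (Suc i) t x)) \<longlongrightarrow> 0) (at t within {0..T})"
    and Kf: "Kf \<ge> 0" "\<And>s. s \<in> {0..T} \<Longrightarrow> L2_norm a b (G k s) \<le> Kf"
    and Fc: "\<And>s. s \<in> {0..T} \<Longrightarrow> continuous_on {a..b} (F s)"
    and FH: "\<And>s. s \<in> {0..T} \<Longrightarrow> F s \<in> H_space a b (2 * r + 2)"
    and K: "K \<ge> 0" "\<And>i s. i \<le> 2 * r + 2 \<Longrightarrow> s \<in> {0..T} \<Longrightarrow> L2_norm a b (weak_deriv a b i (F s)) \<le> K"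
    and t: "t \<in> {real (n - 1) * \<tau>..real n * \<tau>}"
  shows "N2 (\<lambda>y. F t y - (\<Sum>j=1..k. time_lagrange \<tau> k n j t * F (real (n - j) * \<tau>) y))
    \<le> (4 * C + 2) * (((1 + real k * real k ^ k) * real k ^ k * Kf)\<^sup>2 + ((1 + real k * real k ^ k) * K)\<^sup>2) * (\<tau> ^ (2 * k) + h ^ (2 * r + 2))"
proof -
  define p where "p j = time_lagrange \<tau> k n j t" for j
  define s where "s j = real (n - j) * \<tau>" for j
  define e where "e = (\<lambda>y. F t y - (\<Sum>j=1..k. p j * F (s j) y))"
  have sT: "s j \<in> {0..T}" for j
  proof -
    have "s j \<le> real n * \<tau>" unfolding s_def using \<tau> by (intro mult_right_mono) auto
    then have "s j \<le> T" using \<tau>(2) by (rule order.trans)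
    then show ?thesis using \<tau> by (simp add: s_def)
  qed
  have "0 \<le> real (n - 1) * \<tau>" using \<tau> by simp
  then have tT: "t \<in> {0..T}" using t \<tau>(2) by auto
  have pb: "\<bar>p j\<bar> \<le> real k ^ k" if "j \<in> {1..k}" for j
    unfolding p_def by (rule time_lagrange_bound[OF \<tau>(1) k that t])
  have FL: "F s \<in> L2_space a b" if "s \<in> {0..T}" for s using FH[OF that] by (simp add: H_space_def)
  have eL: "e \<in> L2_space a b" unfolding e_def by (intro L2_space_diff L2_space_sum L2_space_scale FL tT sT)
  have ec: "continuous_on {a..b} e" unfolding e_def by (intro continuous_intros Fc tT sT)
  have ew: "has_weak_deriv a b i e (\<lambda>y. weak_deriv a b i (F t) y - (\<Sum>j=1..k. p j * weak_deriv a b i (F (s j)) y))"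
    if i: "i \<le> 2 * r + 2" for i
    unfolding e_def by (intro has_weak_deriv_diff has_weak_deriv_sum has_weak_deriv_scale H_space_weak_deriv[OF FH] tT sT i)
  have eH: "e \<in> H_space a b (r + 1)"
    unfolding H_space_def mem_Collect_eq
  proof (intro conjI eL allI impI)
    fix i assume "i \<le> r + 1"
    then show "\<exists>w. has_weak_deriv a b i e w" using ew[of i] by (intro exI) simp
  qed
  have wb: "L2_norm a b (weak_deriv a b (r + 1) e) \<le> (1 + real k * real k ^ k) * K"
  proof -
    let ?w = "\<lambda>s. weak_deriv a b (r + 1) (F s)"
    have wL: "?w s \<in> L2_space a b" if "s \<in> {0..T}" for s
      using has_weak_derivD(2)[OF H_space_weak_deriv[OF FH[OF that]]] by simp
    have e1: "has_weak_deriv a b (r + 1) e (\<lambda>y. ?w t y - (\<Sum>j=1..k. p j * ?w (s j) y))" by (rule ew) simp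
    have "AE y in lebesgue_on {a..b}. weak_deriv a b (r + 1) e y = ?w t y - (\<Sum>j=1..k. p j * ?w (s j) y)"
      by (rule has_weak_deriv_unique[OF has_weak_deriv_weak_deriv[OF e1] e1])
    then have "L2_norm a b (weak_deriv a b (r + 1) e) = L2_norm a b (\<lambda>y. ?w t y - (\<Sum>j=1..k. p j * ?w (s j) y))"
      by (rule L2_norm_AE_cong) (use has_weak_derivD(2)[OF e1] has_weak_derivD(2)[OF has_weak_deriv_weak_deriv[OF e1]] in auto)
    also have "\<dots> \<le> L2_norm a b (?w t) + L2_norm a b (\<lambda>y. \<Sum>j=1..k. p j * ?w (s j) y)"
      by (intro L2_norm_triangle_diff L2_space_sum L2_space_scale wL tT sT)
    also have "L2_norm a b (\<lambda>y. \<Sum>j=1..k. p j * ?w (s j) y) \<le> (\<Sum>j=1..k. L2_norm a b (\<lambda>y. p j * ?w (s j) y))"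
      by (intro L2_norm_sum L2_space_scale wL sT) auto
    also have "\<dots> \<le> (\<Sum>j=1..k. real k ^ k * K)"
    proof (rule sum_mono)
      fix j assume j: "j \<in> {1..k}"
      show "L2_norm a b (\<lambda>y. p j * ?w (s j) y) \<le> real k ^ k * K"
        unfolding L2_norm_scale by (intro mult_mono pb[OF j] K(2) sT) auto
    qed
    also have "\<dots> = real k * real k ^ k * K" by simp
    also have "L2_norm a b (?w t) \<le> K" by (rule K(2)[OF _ tT]) simp
    finally show ?thesis by (simp add: distrib_right)
  qed
  define c where "c = (1 + real k * real k ^ k) * real k ^ k"
  have eb: "L2_norm a b e \<le> c * Kf * \<tau> ^ k"
  proof -
    \<comment> \<open>Testing with the error itself: its interpolation error at order 0 is the
      square of the L2 norm to be bounded.\<close>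
    define g where "g i s = L2_inner a b (G i s) e" for i s
    have "\<bar>g 0 t - (\<Sum>j=1..k. time_lagrange \<tau> k n j t * g 0 (real (n - j) * \<tau>))\<bar> \<le> (1 + real k * real k ^ k) * real k ^ k * \<tau> ^ k * (Kf * L2_norm a b e)"
    proof (rule time_interpolation_error[OF \<tau>(1) k _ _ \<tau>(2) t])
      fix i t assume i: "i < k" and t: "t \<in> {0..T}"
      show "(g i has_real_derivative g (Suc i) t) (at t within {0..T})"
        unfolding has_field_derivative_iff
      proof (rule LIM_zero_cancel, rule tendsto_0_within_le)
        show "((\<lambda>s. L2_norm a b (\<lambda>x. (G i s x - G i t x) / (s - t) - G (Suc i) t x) * L2_norm a b e) \<longlongrightarrow> 0) (at t within {0..T})"
          by (rule tendsto_mult_left_zero[OF dG[OF i t]])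
        fix s assume s: "s \<in> {0..T}" "s \<noteq> t"
        let ?q = "\<lambda>x. (1 / (s - t)) * (G i s x - G i t x) - G (Suc i) t x"
        have L: "G i s \<in> L2_space a b" "G i t \<in> L2_space a b" "G (Suc i) t \<in> L2_space a b" using GL i s t by auto
        have q: "?q \<in> L2_space a b" by (intro L2_space_diff L2_space_scale L)
        have "L2_inner a b ?q e = (1 / (s - t)) * (g i s - g i t) - g (Suc i) t"
          unfolding g_def by (simp only: L2_inner_diff[OF L2_space_scale[OF L2_space_diff[OF L(1,2)]] L(3) eL] L2_inner_scale L2_inner_diff[OF L(1,2) eL])
        then show "\<bar>(g i s - g i t) / (s - t) - g (Suc i) t\<bar> \<le> L2_norm a b (\<lambda>x. (G i s x - G i t x) / (s - t) - G (Suc i) t x) * L2_norm a b e"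
          using L2_Cauchy_Schwarz[OF q eL] by simp
      qed
    next
      fix s assume s: "s \<in> {0..T}"
      have "\<bar>g k s\<bar> \<le> L2_norm a b (G k s) * L2_norm a b e" unfolding g_def by (rule L2_Cauchy_Schwarz[OF GL[OF _ s] eL]) simp
      also have "\<dots> \<le> Kf * L2_norm a b e" by (intro mult_right_mono Kf(2) s) auto
      finally show "\<bar>g k s\<bar> \<le> Kf * L2_norm a b e" .
    qed
    moreover have "g 0 t - (\<Sum>j=1..k. time_lagrange \<tau> k n j t * g 0 (real (n - j) * \<tau>)) = (L2_norm a b e)\<^sup>2"
    proof -
      have "L2_inner a b e e = L2_inner a b (F t) e - L2_inner a b (\<lambda>y. \<Sum>j=1..k. p j * F (s j) y) e"
        by (subst (1) e_def, rule L2_inner_diff) (intro L2_space_sum L2_space_scale FL tT sT eL)+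
      also have "L2_inner a b (\<lambda>y. \<Sum>j=1..k. p j * F (s j) y) e = (\<Sum>j=1..k. p j * L2_inner a b (F (s j)) e)"
        by (simp only: L2_inner_sum[OF L2_space_scale[OF FL[OF sT]] eL] L2_inner_scale)
      finally show ?thesis by (simp add: L2_norm_sq g_def G0 p_def s_def)
    qed
    ultimately have "L2_norm a b e * L2_norm a b e \<le> (c * Kf * \<tau> ^ k) * L2_norm a b e"
      by (simp add: c_def power2_eq_square ac_simps)
    moreover have "0 \<le> c * Kf * \<tau> ^ k" using Kf(1) \<tau> by (simp add: c_def)
    ultimately show ?thesis using L2_norm_nonneg[of a b e] by (cases "L2_norm a b e = 0") auto
  qed
  \<comment> \<open>The comparison is applied with the zero element of \<open>V\<close>.\<close>
  have "N2 (\<lambda>y. e y - 0) \<le> (4 * C + 2) * ((L2_norm a b (\<lambda>y. e y - 0))\<^sup>2 + (h ^ (r + 1) * L2_norm a b (weak_deriv a b (r + 1) e))\<^sup>2)"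
    by (rule norm_comparison(1)[OF C ec eH V_zero])
  also have "\<dots> \<le> (4 * C + 2) * ((c * Kf * \<tau> ^ k)\<^sup>2 + (h ^ (r + 1) * ((1 + real k * real k ^ k) * K))\<^sup>2)"
    using C h_pos eb wb by (intro mult_left_mono add_mono power_mono) (auto simp: inverse_const_def)
  also have "\<dots> \<le> (4 * C + 2) * (((c * Kf)\<^sup>2 + ((1 + real k * real k ^ k) * K)\<^sup>2) * (\<tau> ^ (2 * k) + h ^ (2 * r + 2)))"
  proof (intro mult_left_mono)
    have e1: "(c * Kf * \<tau> ^ k)\<^sup>2 = (c * Kf)\<^sup>2 * \<tau> ^ (2 * k)" by (simp add: power_mult_distrib power_mult[symmetric] mult.commute)
    have e2: "(h ^ (r + 1) * ((1 + real k * real k ^ k) * K))\<^sup>2 = ((1 + real k * real k ^ k) * K)\<^sup>2 * h ^ (2 * r + 2)"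
    proof -
      have "(h ^ (r + 1))\<^sup>2 = h ^ (2 * r + 2)" unfolding power_mult[symmetric] by (simp add: mult.commute)
      then show ?thesis by (simp only: power_mult_distrib mult.commute)
    qed
    have gen: "x * p + y * q \<le> (x + y) * (p + q)" if "x \<ge> 0" "y \<ge> 0" "p \<ge> 0" "q \<ge> 0" for x y p q :: real
      using mult_nonneg_nonneg[OF that(1,4)] mult_nonneg_nonneg[OF that(2,3)] by (simp add: algebra_simps)
    show "(c * Kf * \<tau> ^ k)\<^sup>2 + (h ^ (r + 1) * ((1 + real k * real k ^ k) * K))\<^sup>2 \<le> ((c * Kf)\<^sup>2 + ((1 + real k * real k ^ k) * K)\<^sup>2) * (\<tau> ^ (2 * k) + h ^ (2 * r + 2))"
      unfolding e1 e2 by (rule gen) (use h_pos \<tau> in auto)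
    show "0 \<le> 4 * C + 2" using C by (simp add: inverse_const_def)
  qed
  finally show ?thesis by (simp add: e_def p_def s_def c_def mult.assoc)
qed

end

text \<open>Gronwall runs in the quadrature norm; \<open>norm_comparison\<close> converts the
  starting errors into it and the final error back, each conversion costing
  \<open>K * h ^ (r + 1)\<close> up to constants. \<open>R\<close> adds the two resulting factors so
  that one value multiplies all terms.\<close>

lemma (in mesh) error_bound:
  fixes u U :: "_ \<Rightarrow> real \<Rightarrow> real"
  assumes C: "inverse_const r C" and \<tau>: "0 < \<tau>" "\<tau> \<le> T" "real N * \<tau> \<le> T" and k: "k \<ge> 1" and Kt: "Kt \<ge> 0"
    and step: "\<And>n. k \<le> n \<Longrightarrow> n \<le> N \<Longrightarrow> N2 (\<lambda>y. u (real n * \<tau>) y - U n y) \<le>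
       (1 + \<tau>)\<^sup>2 * N2 (\<lambda>y. u (real (n - 1) * \<tau>) y - U (n - 1) y)
       + Kt * \<tau> * (\<tau> ^ (2 * k) + h ^ (2 * r + 2) + (\<Sum>j=1..k. N2 (\<lambda>y. u (real (n - j) * \<tau>) y - U (n - j) y)))"
    and uc: "\<And>t. t \<in> {0..T} \<Longrightarrow> continuous_on {a..b} (u t)"
    and uH: "\<And>t. t \<in> {0..T} \<Longrightarrow> u t \<in> H_space a b (r + 1)"
    and K: "\<And>t. t \<in> {0..T} \<Longrightarrow> L2_norm a b (weak_deriv a b (r + 1) (u t)) \<le> K"
    and UV: "\<And>l. l \<le> N \<Longrightarrow> U l \<in> V" and n: "k \<le> n" "n \<le> N"
  defines "\<kappa> \<equiv> 2 + T + (1 + real k) * Kt"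
  defines "R \<equiv> 6 * (exp (\<kappa> * T) * (4 * C + 2) + exp (\<kappa> * T) * (real k * ((4 * C + 2) * K\<^sup>2) + \<kappa> * T) + K\<^sup>2)"
  shows "L2_norm a b (\<lambda>y. u (real n * \<tau>) y - U n y)
    \<le> sqrt R * (\<tau> ^ k + h ^ (r + 1)) + sqrt R * (\<Sum>l<k. L2_norm a b (\<lambda>y. u (real l * \<tau>) y - U l y))"
proof -
  define e where "e l = L2_norm a b (\<lambda>y. u (real l * \<tau>) y - U l y)" for l
  define err where "err l = N2 (\<lambda>y. u (real l * \<tau>) y - U l y)" for l
  define \<delta> where "\<delta> = \<tau> ^ (2 * k) + h ^ (2 * r + 2)"
  define G where "G = exp (\<kappa> * T)"
  define S where "S = (\<Sum>l<k. (e l)\<^sup>2)"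
  have e0: "e l \<ge> 0" for l by (simp add: e_def)
  have S0: "S \<ge> 0" unfolding S_def by (intro sum_nonneg) auto
  have C0: "C \<ge> 0" using C by (simp add: inverse_const_def)
  have \<kappa>0: "\<kappa> \<ge> 0" unfolding \<kappa>_def using \<tau> Kt by (intro add_nonneg_nonneg mult_nonneg_nonneg) auto
  have T0: "T \<ge> 0" using \<tau> by simp
  have \<delta>0: "\<delta> \<ge> 0" using \<tau> h_pos by (simp add: \<delta>_def)
  have G0: "G \<ge> 0" by (simp add: G_def)
  have tl: "real l * \<tau> \<in> {0..T}" if "l \<le> N" for l
  proof -
    have "real l * \<tau> \<le> real N * \<tau>" using that \<tau> by (intro mult_right_mono) auto
    then have "real l * \<tau> \<le> T" using \<tau>(3) by (rule order.trans)
    then show ?thesis using \<tau> by simp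
  qed
  have hK: "(h ^ (r + 1) * L2_norm a b (weak_deriv a b (r + 1) (u (real l * \<tau>))))\<^sup>2 \<le> K\<^sup>2 * \<delta>" if l: "l \<le> N" for l
  proof -
    have "(h ^ (r + 1) * L2_norm a b (weak_deriv a b (r + 1) (u (real l * \<tau>))))\<^sup>2 \<le> (h ^ (r + 1) * K)\<^sup>2"
      using h_pos K[OF tl[OF l]] by (intro power_mono mult_left_mono) auto
    also have "\<dots> = K\<^sup>2 * h ^ (2 * r + 2)"
    proof -
      have "(h ^ (r + 1))\<^sup>2 = h ^ (2 * r + 2)" unfolding power_mult[symmetric] by (simp add: mult.commute)
      then show ?thesis by (simp only: power_mult_distrib mult.commute)
    qed
    also have "\<dots> \<le> K\<^sup>2 * \<delta>" using \<tau> by (intro mult_left_mono) (auto simp: \<delta>_def)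
    finally show ?thesis .
  qed
  have nc1: "err l \<le> (4 * C + 2) * ((e l)\<^sup>2 + K\<^sup>2 * \<delta>)" if l: "l \<le> N" for l
  proof -
    have "err l \<le> (4 * C + 2) * ((e l)\<^sup>2 + (h ^ (r + 1) * L2_norm a b (weak_deriv a b (r + 1) (u (real l * \<tau>))))\<^sup>2)"
      unfolding err_def e_def by (rule norm_comparison(1)[OF C uc[OF tl[OF l]] uH[OF tl[OF l]] UV[OF l]])
    also have "\<dots> \<le> (4 * C + 2) * ((e l)\<^sup>2 + K\<^sup>2 * \<delta>)" using C0 by (intro mult_left_mono add_left_mono hK l) auto
    finally show ?thesis .
  qed
  have nc2: "(e n)\<^sup>2 \<le> 6 * (err n + K\<^sup>2 * \<delta>)"
  proof -
    have "(e n)\<^sup>2 \<le> 6 * (err n + (h ^ (r + 1) * L2_norm a b (weak_deriv a b (r + 1) (u (real n * \<tau>))))\<^sup>2)"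
      unfolding err_def e_def by (rule norm_comparison(2)[OF C uc[OF tl[OF n(2)]] uH[OF tl[OF n(2)]] UV[OF n(2)]])
    also have "\<dots> \<le> 6 * (err n + K\<^sup>2 * \<delta>)" by (intro mult_left_mono add_left_mono hK n) auto
    finally show ?thesis .
  qed
  have gr: "err n \<le> G * ((\<Sum>l<k. err l) + \<kappa> * T * \<delta>)"
    unfolding \<kappa>_def G_def
    by (rule discrete_Gronwall[OF \<tau> Kt \<delta>0 _ k _ n(2)])
      (use step in \<open>auto simp only: err_def \<delta>_def N2_nonneg\<close>)
  have "(\<Sum>l<k. err l) \<le> (\<Sum>l<k. (4 * C + 2) * ((e l)\<^sup>2 + K\<^sup>2 * \<delta>))" by (intro sum_mono nc1) (use n in auto)
  also have "\<dots> = (4 * C + 2) * S + real k * ((4 * C + 2) * K\<^sup>2) * \<delta>"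
    by (simp add: S_def sum_distrib_left[symmetric] sum.distrib distrib_left)
  finally have "(\<Sum>l<k. err l) + \<kappa> * T * \<delta> \<le> (4 * C + 2) * S + real k * ((4 * C + 2) * K\<^sup>2) * \<delta> + \<kappa> * T * \<delta>" by simp
  from mult_left_mono[OF this G0] have "err n \<le> G * ((4 * C + 2) * S + real k * ((4 * C + 2) * K\<^sup>2) * \<delta> + \<kappa> * T * \<delta>)"
    using gr by linarith
  then have "(e n)\<^sup>2 \<le> 6 * (G * ((4 * C + 2) * S + real k * ((4 * C + 2) * K\<^sup>2) * \<delta> + \<kappa> * T * \<delta>) + K\<^sup>2 * \<delta>)"
    by (intro order.trans[OF nc2] mult_left_mono add_right_mono) auto
  also have "\<dots> = 6 * (G * (4 * C + 2)) * S + 6 * (G * (real k * ((4 * C + 2) * K\<^sup>2) + \<kappa> * T) + K\<^sup>2) * \<delta>"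
    by (simp add: algebra_simps)
  also have "\<dots> \<le> R * S + R * \<delta>"
  proof (intro add_mono mult_right_mono S0 \<delta>0)
    have pos: "0 \<le> G * (4 * C + 2)" "0 \<le> G * (real k * ((4 * C + 2) * K\<^sup>2) + \<kappa> * T)" "0 \<le> K\<^sup>2"
      using G0 C0 \<kappa>0 T0 by auto
    show "6 * (G * (4 * C + 2)) \<le> R" unfolding R_def G_def[symmetric] using pos by (intro mult_left_mono) auto
    show "6 * (G * (real k * ((4 * C + 2) * K\<^sup>2) + \<kappa> * T) + K\<^sup>2) \<le> R"
      unfolding R_def G_def[symmetric] using pos by (intro mult_left_mono add_right_mono) auto
  qed
  also have "\<dots> \<le> R * ((\<tau> ^ k + h ^ (r + 1)) + (\<Sum>l<k. e l))\<^sup>2"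
  proof -
    define p q w where "p = \<tau> ^ k" and "q = h ^ (r + 1)" and "w = (\<Sum>l<k. e l)"
    have nn: "p \<ge> 0" "q \<ge> 0" "w \<ge> 0" using \<tau> h_pos e0 by (auto simp: p_def q_def w_def intro!: sum_nonneg)
    have "S \<le> w\<^sup>2"
    proof -
      have "S \<le> (\<Sum>l<k. e l * w)" unfolding S_def power2_eq_square
        by (intro sum_mono mult_left_mono) (use e0 in \<open>auto simp: w_def intro!: member_le_sum\<close>)
      also have "\<dots> = w * w" by (simp add: w_def sum_distrib_right[symmetric])
      finally show ?thesis by (simp add: power2_eq_square)
    qed
    moreover have "\<delta> = p\<^sup>2 + q\<^sup>2"
      unfolding \<delta>_def p_def q_def power_mult[symmetric] by (simp add: mult.commute)
    moreover have "w\<^sup>2 + (p\<^sup>2 + q\<^sup>2) \<le> ((p + q) + w)\<^sup>2"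
    proof -
      have "0 \<le> 2 * (p * q) + 2 * (p * w) + 2 * (q * w)" using nn by simp
      then show ?thesis by (simp add: power2_eq_square algebra_simps)
    qed
    ultimately have "S + \<delta> \<le> ((p + q) + w)\<^sup>2" by linarith
    moreover have "R \<ge> 0" unfolding R_def G_def[symmetric] using G0 C0 \<kappa>0 T0 by auto
    ultimately have "R * (S + \<delta>) \<le> R * ((p + q) + w)\<^sup>2" by (intro mult_left_mono)
    then show ?thesis by (simp add: p_def q_def w_def distrib_left)
  qed
  finally have "e n \<le> sqrt (R * ((\<tau> ^ k + h ^ (r + 1)) + (\<Sum>l<k. e l))\<^sup>2)" by (rule real_le_rsqrt)
  also have "\<dots> = sqrt R * ((\<tau> ^ k + h ^ (r + 1)) + (\<Sum>l<k. e l))"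
    using \<tau> h_pos e0 by (simp add: real_sqrt_mult add_nonneg_nonneg sum_nonneg)
  finally show ?thesis by (simp add: e_def distrib_left)
qed

theorem theorem2p5:
  fixes a b T \<alpha> :: real
    and F f u0 :: "real \<Rightarrow> real"
    and u :: "real \<Rightarrow> real \<Rightarrow> real"
    and k r m :: nat
    and \<sigma> :: "real poly fract"
    and p :: "nat \<Rightarrow> real poly fract"
    and c :: "nat \<Rightarrow> real"
  assumes "a < b" and "T > 0" and "\<alpha> > 0"
    and "double_well F \<alpha>"
    and "\<And>y. (F has_real_derivative - f y) (at y)"
    and "solves_Allen_Cahn a b T f u0 u"
    and "k \<ge> 1" and "r \<ge> 1"
    and "\<And>i. i \<in> {1..m} \<Longrightarrow> c i \<in> {0..1}" and "inj_on c {1..m}"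
    and cond_i:
      "\<And>l. l > 0 \<Longrightarrow> \<bar>rat_eval \<sigma> l\<bar> < 1"
      "\<exists>B. \<forall>i\<in>{1..m}. \<forall>l>0. \<bar>rat_eval (p i) l\<bar> \<le> B"
      "\<And>i. i \<in> {1..m} \<Longrightarrow> p i = 0 \<or> degree (rat_num (p i)) < degree (rat_den (p i))"
    and cond_ii:
      "(\<lambda>l. rat_eval \<sigma> l - exp (- l)) \<in> O[at 0](\<lambda>l. l ^ (k + 1))"
      "\<And>j. j \<le> k \<Longrightarrow>
         (\<lambda>l. (\<Sum>i=1..m. c i ^ j * rat_eval (p i) l) - order_quotient j l (exp (- l)))
           \<in> O[at 0](\<lambda>l. l ^ (k - j))"
    and cond_iii:
      "\<And>j l. j \<le> k - 1 \<Longrightarrow> l > 0 \<Longrightarrow>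
         (\<Sum>i=1..m. c i ^ j * rat_eval (p i) l) - order_quotient j l (rat_eval \<sigma> l) = 0"
    and cond_iv: "((\<lambda>l. \<bar>rat_eval \<sigma> l\<bar>) \<longlongrightarrow> 0) at_top"
    and "\<And>y. y \<in> {a..b} \<Longrightarrow> \<bar>u0 y\<bar> \<le> \<alpha>"
    and "\<And>t y. t \<in> {0<..T} \<Longrightarrow> y \<in> {a..b} \<Longrightarrow> \<bar>u t y\<bar> \<le> \<alpha>"
  shows "(\<forall>M N x \<omega> U.
            gl_mesh a b M r x \<omega> \<and> N > 0 \<and>
            (\<forall>l<k. U l \<in> fem_space a b M r x \<and> (\<forall>j\<le>M * r. \<bar>U l (x j)\<bar> \<le> \<alpha>)) \<and>
            cutoff_solution a b M r x \<omega> f \<alpha> (T / real N) N k m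
              (rat_eval \<sigma>) (\<lambda>i. rat_eval (p i)) c U \<longrightarrow>
            (\<forall>n\<in>{k..N}. \<forall>j\<le>M * r. \<bar>U n (x j)\<bar> \<le> \<alpha>)) \<and>
         (u \<in> C_time (C_space a b) (C_norm a b) (k + 1) T \<and>
          u \<in> C_time (Dom_Laplacian a b) (Dom_Laplacian_norm a b) k T \<and>
          u \<in> C_time (H_space a b (2 * r + 2)) (H_norm a b (2 * r + 2)) 1 T \<and>
          (\<forall>y. \<exists>e>0. \<exists>L. L-lipschitz_on (ball y e) f) \<and>
          (\<lambda>t y. f (u t y)) \<in> C_time (L2_space a b) (L2_norm a b) k T \<and>
          (\<lambda>t y. f (u t y)) \<in> C_time (H_space a b (2 * r + 2)) (H_norm a b (2 * r + 2)) 0 T \<longrightarrow>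
          (\<exists>C. \<forall>M N x \<omega> U.
            gl_mesh a b M r x \<omega> \<and> N > 0 \<and>
            (\<forall>l<k. U l \<in> fem_space a b M r x \<and> (\<forall>j\<le>M * r. \<bar>U l (x j)\<bar> \<le> \<alpha>)) \<and>
            cutoff_solution a b M r x \<omega> f \<alpha> (T / real N) N k m
              (rat_eval \<sigma>) (\<lambda>i. rat_eval (p i)) c U \<longrightarrow>
            (\<forall>n\<in>{k..N}.
               L2_norm a b (\<lambda>y. u (real n * (T / real N)) y - U n y)
                 \<le> C * ((T / real N) ^ k + ((b - a) / real M) ^ (r + 1)) +
                   C * (\<Sum>l<k. L2_norm a b (\<lambda>y. u (real l * (T / real N)) y - U l y)))))"
proof (intro conjI impI)
  \<comment> \<open>Immediate from the clamp in \<open>cutoff_solution\<close>, given a positive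
    \<alpha>.\<close>
  show "\<forall>M N x \<omega> U. gl_mesh a b M r x \<omega> \<and> N > 0 \<and> (\<forall>l<k. U l \<in> fem_space a b M r x \<and> (\<forall>j\<le>M * r. \<bar>U l (x j)\<bar> \<le> \<alpha>)) \<and>
      cutoff_solution a b M r x \<omega> f \<alpha> (T / real N) N k m (rat_eval \<sigma>) (\<lambda>i. rat_eval (p i)) c U \<longrightarrow>
      (\<forall>n\<in>{k..N}. \<forall>j\<le>M * r. \<bar>U n (x j)\<bar> \<le> \<alpha>)"
    using \<open>\<alpha> > 0\<close> by (auto simp: cutoff_solution_def)
next
  assume reg: "u \<in> C_time (C_space a b) (C_norm a b) (k + 1) T \<and>
      u \<in> C_time (Dom_Laplacian a b) (Dom_Laplacian_norm a b) k T \<and>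
      u \<in> C_time (H_space a b (2 * r + 2)) (H_norm a b (2 * r + 2)) 1 T \<and>
      (\<forall>y. \<exists>e>0. \<exists>L. L-lipschitz_on (ball y e) f) \<and>
      (\<lambda>t y. f (u t y)) \<in> C_time (L2_space a b) (L2_norm a b) k T \<and>
      (\<lambda>t y. f (u t y)) \<in> C_time (H_space a b (2 * r + 2)) (H_norm a b (2 * r + 2)) 0 T"
  note ab = \<open>a < b\<close> and T = \<open>T > 0\<close> and k = \<open>k \<ge> 1\<close> and r = \<open>r \<ge> 1\<close> and sol = \<open>solves_Allen_Cahn a b T f u0 u\<close>
  have loc: "\<forall>y. \<exists>e>0. \<exists>L. L-lipschitz_on (ball y e) f" using reg by blast
  have fc: "continuous_on S f" for S by (rule locally_Lipschitz_continuous[OF loc])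
  \<comment> \<open>\<open>assms(18)\<close> bounds \<open>u0\<close>, and \<open>assms(19)\<close>
    is the maximum principle, which covers positive times.\<close>
  have ua: "\<bar>u t y\<bar> \<le> \<alpha>" if "t \<in> {0..T}" "y \<in> {a..b}" for t y
  proof (cases "t = 0")
    case True
    then show ?thesis using sol that assms(18) by (simp add: solves_Allen_Cahn_def)
  next
    case False
    then show ?thesis using that assms(19) by simp
  qed
  \<comment> \<open>Time derivatives that are continuous in space: these have the point values
    needed at the nodes.\<close>
  obtain W where W0: "W 0 = u" and Wc': "\<And>i t. i \<le> k + 1 \<Longrightarrow> t \<in> {0..T} \<Longrightarrow> W i t \<in> C_space a b"
    and Wn: "\<And>i t. i \<le> k + 1 \<Longrightarrow> t \<in> {0..T} \<Longrightarrow> ((\<lambda>s. C_norm a b (\<lambda>x. W i s x - W i t x)) \<longlongrightarrow> 0) (at t within {0..T})"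
    and Wd: "\<And>i t. i < k + 1 \<Longrightarrow> t \<in> {0..T} \<Longrightarrow> ((\<lambda>s. C_norm a b (\<lambda>x. (W i s x - W i t x) / (s - t) - W (Suc i) t x)) \<longlongrightarrow> 0) (at t within {0..T})"
    using C_timeE[OF conjunct1[OF reg]] by blast
  have Wc: "continuous_on {a..b} (W i t)" if "i \<le> k + 1" "t \<in> {0..T}" for i t
    using Wc'[OF that] by (simp add: C_space_def)
  have dW: "((\<lambda>s. W i s y) has_real_derivative W (Suc i) t y) (at t within {0..T})"
    if "i \<le> k" "t \<in> {0..T}" "y \<in> {a..b}" for i t y
    by (rule C_time_pointwise_deriv[OF Wc Wc Wd]) (use that in auto)
  obtain K0 where K0: "\<And>t. t \<in> {0..T} \<Longrightarrow> C_norm a b (W (Suc k) t) \<le> K0"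
    by (rule C_time_bounded[where V = "W (Suc k)" and S = "C_space a b" and nrm = "C_norm a b" and q = "C_norm a b" and T = T])
      (use Wc' Wn ab in \<open>auto simp: C_space_def intro: C_norm_triangle\<close>)
  have bW: "\<bar>W (Suc k) t y\<bar> \<le> K0" if "t \<in> {0..T}" "y \<in> {a..b}" for t y
    using abs_le_C_norm[OF Wc[of "Suc k" t] that(2)] K0[OF that(1)] that by simp
  \<comment> \<open>A second family of time derivatives, in the domain of the Laplacian; its
    \<open>k\<close>-th member gives \<open>W k\<close> a Lipschitz bound in space.\<close>
  obtain D where D0: "D 0 = u" and DD: "\<And>i t. i \<le> k \<Longrightarrow> t \<in> {0..T} \<Longrightarrow> D i t \<in> Dom_Laplacian a b"
    and Dn: "\<And>i t. i \<le> k \<Longrightarrow> t \<in> {0..T} \<Longrightarrow> ((\<lambda>s. Dom_Laplacian_norm a b (\<lambda>x. D i s x - D i t x)) \<longlongrightarrow> 0) (at t within {0..T})"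
    and Dd: "\<And>i t. i < k \<Longrightarrow> t \<in> {0..T} \<Longrightarrow> ((\<lambda>s. Dom_Laplacian_norm a b (\<lambda>x. (D i s x - D i t x) / (s - t) - D (Suc i) t x)) \<longlongrightarrow> 0) (at t within {0..T})"
    using C_timeE[OF conjunct1[OF conjunct2[OF reg]]] by blast
  have Dw: "has_weak_deriv a b 2 v (weak_deriv a b 2 v)" "v \<in> L2_space a b" if "v \<in> Dom_Laplacian a b" for v
    using that by (auto simp: Dom_Laplacian_def H_space_def intro: has_weak_deriv_weak_deriv)
  have DW: "AE y in lebesgue_on {a..b}. D k t y = W k t y" if t: "t \<in> {0..T}" for t
  proof (rule L2_time_derivs_unique[OF T, where n = k])
    fix i t assume i: "i < k" and t: "t \<in> {0..T}"
    show "((\<lambda>s. L2_norm a b (\<lambda>x. (D i s x - D i t x) / (s - t) - D (Suc i) t x)) \<longlongrightarrow> 0) (at t within {0..T})"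
      by (rule tendsto_0_within_le[OF Dd[OF i t]]) (simp add: Dom_Laplacian_norm_def)
    show "((\<lambda>s. L2_norm a b (\<lambda>x. (W i s x - W i t x) / (s - t) - W (Suc i) t x)) \<longlongrightarrow> 0) (at t within {0..T})"
    proof (rule tendsto_0_within_le)
      show "((\<lambda>s. sqrt (b - a) * C_norm a b (\<lambda>x. (W i s x - W i t x) / (s - t) - W (Suc i) t x)) \<longlongrightarrow> 0) (at t within {0..T})"
        by (rule tendsto_mult_right_zero[OF Wd]) (use i t in auto)
      fix s assume s: "s \<in> {0..T}" "s \<noteq> t"
      have "continuous_on {a..b} (\<lambda>x. (W i s x - W i t x) / (s - t) - W (Suc i) t x)"
        by (intro continuous_intros Wc) (use i s t in auto)
      from C_norm_L2_norm[OF this ab]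
      show "\<bar>L2_norm a b (\<lambda>x. (W i s x - W i t x) / (s - t) - W (Suc i) t x)\<bar> \<le> sqrt (b - a) * C_norm a b (\<lambda>x. (W i s x - W i t x) / (s - t) - W (Suc i) t x)"
        by simp
    qed
  qed (use D0 W0 Dw(2)[OF DD] Wc t in auto)
  obtain K2 where K2: "\<And>t. t \<in> {0..T} \<Longrightarrow> L2_norm a b (weak_deriv a b 2 (D k t)) \<le> K2"
  proof (rule C_time_bounded[where V = "D k" and S = "Dom_Laplacian a b" and nrm = "Dom_Laplacian_norm a b" and q = "\<lambda>v. L2_norm a b (weak_deriv a b 2 v)" and T = T])
    fix v w assume "v \<in> Dom_Laplacian a b" "w \<in> Dom_Laplacian a b"
    from weak_deriv_norm_triangle[OF this[THEN Dw(1)]]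
    show "L2_norm a b (weak_deriv a b 2 v) \<le> L2_norm a b (weak_deriv a b 2 w) + Dom_Laplacian_norm a b (\<lambda>x. v x - w x)"
      unfolding Dom_Laplacian_norm_def by (smt (verit) L2_norm_nonneg)
  qed (use DD Dn in auto)
  define L where "L = sqrt (b - a) * K2"
  have lW: "\<bar>W k t y - W k t z\<bar> \<le> L * \<bar>y - z\<bar>" if t: "t \<in> {0..T}" and yz: "y \<in> {a..b}" "z \<in> {a..b}" for t y z
  proof -
    have "\<bar>W k t y - W k t z\<bar> \<le> sqrt (b - a) * L2_norm a b (weak_deriv a b 2 (D k t)) * \<bar>y - z\<bar>"
      by (rule Dom_Laplacian_Lipschitz[OF DD[OF order.refl t] Wc DW[OF t] ab yz]) (use t in auto)
    also have "\<dots> \<le> L * \<bar>y - z\<bar>" unfolding L_def using ab by (intro mult_right_mono mult_left_mono K2 t) auto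
    finally show ?thesis .
  qed
  have "K2 \<ge> 0" by (rule order.trans[OF L2_norm_nonneg K2[of 0]]) (use T in simp)
  then have L0: "L \<ge> 0" using ab by (simp add: L_def)
  obtain Ku where Ku: "Ku \<ge> 0" and uH: "\<And>t. t \<in> {0..T} \<Longrightarrow> u t \<in> H_space a b (2 * r + 2)"
    and uK: "\<And>i t. i \<le> 2 * r + 2 \<Longrightarrow> t \<in> {0..T} \<Longrightarrow> L2_norm a b (weak_deriv a b i (u t)) \<le> Ku"
    using H_space_time_bounded[OF conjunct1[OF conjunct2[OF conjunct2[OF reg]]]] by blast
  obtain Kv where Kv: "Kv \<ge> 0" and fH: "\<And>t. t \<in> {0..T} \<Longrightarrow> (\<lambda>y. f (u t y)) \<in> H_space a b (2 * r + 2)"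
    and fK: "\<And>i t. i \<le> 2 * r + 2 \<Longrightarrow> t \<in> {0..T} \<Longrightarrow> L2_norm a b (weak_deriv a b i (\<lambda>y. f (u t y))) \<le> Kv"
    using H_space_time_bounded[OF conjunct2[OF conjunct2[OF conjunct2[OF conjunct2[OF conjunct2[OF reg]]]]]] by blast
  obtain G where G0: "G 0 = (\<lambda>t y. f (u t y))" and GL: "\<And>i t. i \<le> k \<Longrightarrow> t \<in> {0..T} \<Longrightarrow> G i t \<in> L2_space a b"
    and Gn: "\<And>i t. i \<le> k \<Longrightarrow> t \<in> {0..T} \<Longrightarrow> ((\<lambda>s. L2_norm a b (\<lambda>x. G i s x - G i t x)) \<longlongrightarrow> 0) (at t within {0..T})"
    and Gd: "\<And>i t. i < k \<Longrightarrow> t \<in> {0..T} \<Longrightarrow> ((\<lambda>s. L2_norm a b (\<lambda>x. (G i s x - G i t x) / (s - t) - G (Suc i) t x)) \<longlongrightarrow> 0) (at t within {0..T})"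
    using C_timeE[OF conjunct1[OF conjunct2[OF conjunct2[OF conjunct2[OF conjunct2[OF reg]]]]]] by blast
  obtain Kf where Kf: "\<And>t. t \<in> {0..T} \<Longrightarrow> L2_norm a b (G k t) \<le> Kf"
  proof (rule C_time_bounded[where V = "G k" and S = "L2_space a b" and nrm = "L2_norm a b" and q = "L2_norm a b" and T = T])
    fix v w assume vw: "v \<in> L2_space a b" "w \<in> L2_space a b"
    show "L2_norm a b v \<le> L2_norm a b w + L2_norm a b (\<lambda>x. v x - w x)"
      using L2_norm_triangle[OF vw(2) L2_space_diff[OF vw]] by simp
  qed (use GL Gn in auto)
  have Kf0: "Kf \<ge> 0" by (rule order.trans[OF L2_norm_nonneg Kf[of 0]]) (use T in simp)
  obtain Lf where Lf: "Lf \<ge> 0" "\<And>y z. \<bar>y\<bar> \<le> \<alpha> \<Longrightarrow> \<bar>z\<bar> \<le> \<alpha> \<Longrightarrow> \<bar>f y - f z\<bar> \<le> Lf * \<bar>y - z\<bar>"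
    using locally_Lipschitz_on_Icc[OF loc] by blast
  \<comment> \<open>All constants, here as above and below, are fixed before mesh and step size are
    introduced, which is the uniformity claimed.\<close>
  obtain C where C: "inverse_const r C" using inverse_const_exists by blast
  then have C0: "C \<ge> 0" by (simp add: inverse_const_def)
  obtain c0 B where st: "stable_scheme k m c (rat_eval \<sigma>) (\<lambda>i. rat_eval (p i)) c0 B"
    by (rule stable_scheme_exists[OF k assms(9) cond_i cond_ii(1) cond_iii cond_iv])
  define KD where "KD = (sqrt C + 2) * Ku + 3 * sqrt C * (b - a) ^ (r - 1) * Ku"
  have KD0: "KD \<ge> 0" unfolding KD_def using C0 Ku ab by auto
  define KG where "KG = (4 * C + 2) * (((1 + real k * real k ^ k) * real k ^ k * Kf)\<^sup>2 + ((1 + real k * real k ^ k) * Kv)\<^sup>2)"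
  have KG0: "KG \<ge> 0" unfolding KG_def using C0 by (intro mult_nonneg_nonneg) auto
  define Kt where "Kt = step_const m T c0 B * ((b - a) * K0\<^sup>2 + C * L\<^sup>2 * (b - a) + 2 * KD\<^sup>2 + 2 * KG + 2 * real k * (real k ^ k * Lf)\<^sup>2)"
  have Kt0: "Kt \<ge> 0"
    unfolding Kt_def step_const_def using stable_schemeD(1)[OF st] T ab C0 KG0
    by (intro mult_nonneg_nonneg add_nonneg_nonneg divide_nonneg_pos) auto
  define \<kappa> where "\<kappa> = 2 + T + (1 + real k) * Kt"
  define R where "R = 6 * (exp (\<kappa> * T) * (4 * C + 2) + exp (\<kappa> * T) * (real k * ((4 * C + 2) * Ku\<^sup>2) + \<kappa> * T) + Ku\<^sup>2)"
  show "\<exists>C. \<forall>M N x \<omega> U. gl_mesh a b M r x \<omega> \<and> N > 0 \<and>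
      (\<forall>l<k. U l \<in> fem_space a b M r x \<and> (\<forall>j\<le>M * r. \<bar>U l (x j)\<bar> \<le> \<alpha>)) \<and>
      cutoff_solution a b M r x \<omega> f \<alpha> (T / real N) N k m (rat_eval \<sigma>) (\<lambda>i. rat_eval (p i)) c U \<longrightarrow>
      (\<forall>n\<in>{k..N}. L2_norm a b (\<lambda>y. u (real n * (T / real N)) y - U n y)
         \<le> C * ((T / real N) ^ k + ((b - a) / real M) ^ (r + 1)) +
           C * (\<Sum>l<k. L2_norm a b (\<lambda>y. u (real l * (T / real N)) y - U l y)))"
  proof (intro exI[of _ "sqrt R"] allI impI ballI, elim conjE)
    fix M N n :: nat and x \<omega> :: "nat \<Rightarrow> real" and U :: "nat \<Rightarrow> real \<Rightarrow> real"
    assume gl: "gl_mesh a b M r x \<omega>" and N: "N > 0" and U0: "\<forall>l<k. U l \<in> fem_space a b M r x \<and> (\<forall>j\<le>M * r. \<bar>U l (x j)\<bar> \<le> \<alpha>)"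
      and cut: "cutoff_solution a b M r x \<omega> f \<alpha> (T / real N) N k m (rat_eval \<sigma>) (\<lambda>i. rat_eval (p i)) c U"
      and n: "n \<in> {k..N}"
    interpret mesh a b M r x \<omega> by unfold_locales (fact ab r gl)+
    define \<tau> where "\<tau> = T / real N"
    have \<tau>: "0 < \<tau>" "\<tau> \<le> T" "real N * \<tau> \<le> T"
    proof -
      have "T / real N \<le> T / 1" using N T by (intro divide_left_mono) auto
      then show "\<tau> \<le> T" by (simp add: \<tau>_def)
    qed (use N T in \<open>auto simp: \<tau>_def\<close>)
    \<comment> \<open>Below level \<open>k\<close> this is the assumption on the starting values,
      from \<open>k\<close> on it is part of the scheme.\<close>
    have UV: "U l \<in> V" if "l \<le> N" for l
      using U0 cut that unfolding cutoff_solution_def by (cases "l < k") auto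
    have Ua: "\<bar>U l (x J)\<bar> \<le> \<alpha>" if "l \<le> N" "J \<le> M * r" for l J
    proof (cases "l < k")
      case False
      then have "U l (x J) = min (max (provisional_step a b M r x \<omega> f (T / real N) k m (rat_eval \<sigma>) (\<lambda>i. rat_eval (p i)) c U l (x J)) (- \<alpha>)) \<alpha>"
        using cut that unfolding cutoff_solution_def by auto
      then show ?thesis using \<open>\<alpha> > 0\<close> by auto
    qed (use U0 that in auto)
    have uc: "continuous_on {a..b} (u t)" if "t \<in> {0..T}" for t using Wc[of 0 t] that W0 by simp
    have W1c: "continuous_on {0..T} (\<lambda>s. W 1 s y)" if "y \<in> {a..b}" for y
      using dW[of 1 _ y, OF k _ that] by (intro DERIV_continuous_on) auto
    have cons: "\<bar>E (interp (u t)) v + ip (\<lambda>y. W 1 t y - f (u t y)) v\<bar> \<le> KD * h ^ (r + 1) * (sqrt (E v v) + sqrt (N2 v))"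
      if "t \<in> {0..T}" "v \<in> V" for t v
      unfolding KD_def
      by (rule consistency_bound[OF C T sol fc uc _ _ W1c uH Ku uK that]) (use Wc dW[of 0] W0 k in auto)
    have KGb: "N2 (\<lambda>y. f (u t y) - (\<Sum>j=1..k. time_lagrange \<tau> k n j t * f (u (real (n - j) * \<tau>) y))) \<le> KG * (\<tau> ^ (2 * k) + h ^ (2 * r + 2))"
      if n: "k \<le> n" "n \<le> N" and t: "t \<in> {real (n - 1) * \<tau>..real n * \<tau>}" for n t
    proof -
      have "real n * \<tau> \<le> real N * \<tau>" using n \<tau> by (intro mult_right_mono) auto
      then have nT: "real n * \<tau> \<le> T" using \<tau>(3) by (rule order.trans)
      have fuc: "continuous_on {a..b} (\<lambda>y. f (u t y))" if "t \<in> {0..T}" for t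
        by (rule continuous_on_compose2[OF fc[of UNIV] uc[OF that]]) auto
      show ?thesis unfolding KG_def
        by (rule time_interpolation_N2[OF C k n(1) \<tau>(1) nT G0 GL Gd Kf0 Kf fuc fH Kv fK t])
    qed
    have step: "N2 (\<lambda>y. u (real n * \<tau>) y - U n y) \<le>
       (1 + \<tau>)\<^sup>2 * N2 (\<lambda>y. u (real (n - 1) * \<tau>) y - U (n - 1) y)
       + Kt * \<tau> * (\<tau> ^ (2 * k) + h ^ (2 * r + 2) + (\<Sum>j=1..k. N2 (\<lambda>y. u (real (n - j) * \<tau>) y - U (n - j) y)))"
      if n: "k \<le> n" "n \<le> N" for n
      unfolding Kt_def
      by (rule error_recursion[OF C st k assms(9) \<tau> W0 dW bW L0 lW KD0 cons ua Lf KG0 KGb UV Ua cut[folded \<tau>_def] n])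
    have uH': "u t \<in> H_space a b (r + 1)" if "t \<in> {0..T}" for t
      using uH[OF that] by (simp add: H_space_def)
    have "L2_norm a b (\<lambda>y. u (real n * \<tau>) y - U n y)
      \<le> sqrt R * (\<tau> ^ k + h ^ (r + 1)) + sqrt R * (\<Sum>l<k. L2_norm a b (\<lambda>y. u (real l * \<tau>) y - U l y))"
      unfolding R_def \<kappa>_def
      by (rule error_bound[OF C \<tau> k Kt0 step uc uH' uK UV]) (use n in auto)
    then show "L2_norm a b (\<lambda>y. u (real n * (T / real N)) y - U n y)
         \<le> sqrt R * ((T / real N) ^ k + ((b - a) / real M) ^ (r + 1)) +
           sqrt R * (\<Sum>l<k. L2_norm a b (\<lambda>y. u (real l * (T / real N)) y - U l y))"
      unfolding \<tau>_def h_def .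
  qed
qed

end
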